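(* Let $\Omega\in\mathbb{R}$, $L>0$ and $x,y\in\mathbb{R}^2$. In the scintillation regime ($C\to\varepsilon C$, $r_0\to r_0/\varepsilon$, $\rho_0\to\rho_0/\varepsilon$, $L\to L/\varepsilon$) with frequencies $\omega=\omega_0+\varepsilon\Omega$ and $\tilde\omega=\omega_0-\varepsilon\Omega$, the second-order moment of the refocused field satisfies, as $\varepsilon\to0$, $$\begin{aligned} \mathbb{E}\Big[\big|&\hat u_{\rm tr}\big(\tfrac y\varepsilon+x;\tfrac y\varepsilon\big)\big|^2\Big]\longrightarrow\frac{K(L)^2}{(2\pi)^8}\int_{\mathbb{R}^2}\frac{r_0^2}{2\pi}\exp\Big(-\frac{r_0^2|\zeta|^2}2+2iy\cdot\zeta\Big)d\zeta\\ &+\frac{2K(L)}{(2\pi)^8}\,{\rm Re}\iint\frac{r_0^2}{4\pi}\exp\Big(-\frac{r_0^2|\zeta|^2}4+ix\cdot\xi+iy\cdot\zeta-\frac{|y|^2}{r_0^2}-i\frac{Lc_o}{\omega_0}\xi\cdot\zeta\Big)A(L,\xi,\zeta,\Omega)\,d\xi d\zeta\\ &+\frac{2K(L)}{(2\pi)^8}\,{\rm Re}\iint\frac{\rho_0^2r_0^2}{2\pi(\rho_0^2+r_0^2)}\exp\Big(-\frac{r_0^2\rho_0^2|\zeta|^2}{2(r_0^2+\rho_0^2)}+i\frac{2\rho_0^2}{r_0^2+\rho_0^2}y\cdot\zeta-\frac{2|y|^2}{r_0^2+\rho_0^2}-i\frac{Lc_o}{\omega_0}\xi\cdot\zeta\Big)A(L,\xi,\zeta,0)\,d\xi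 d\zeta\\ &+\Big|\frac1{(2\pi)^4}\iint\frac{r_0^2}{4\pi}\exp\Big(-\frac{r_0^2|\zeta|^2}4+ix\cdot\xi+iy\cdot\zeta-i\frac{Lc_o}{\omega_0}\xi\cdot\zeta\Big)A(L,\xi,\zeta,\Omega)\,d\xi d\zeta\Big|^2\\ &+\frac1{(2\pi)^8}\int_{(\mathbb{R}^2)^4}\frac{r_0^2\rho_0^2}{(4\pi)^2}\exp\Big(-\frac{r_0^2+\rho_0^2}8(|\zeta_a|^2+|\zeta_b|^2)+\frac{r_0^2-\rho_0^2}4\zeta_a\cdot\zeta_b\Big)\\ &\qquad\times\exp\Big(iy\cdot(\zeta_a-\zeta_b)-i\frac{Lc_o}{\omega_0}(\xi_a\cdot\zeta_a-\xi_b\cdot\zeta_b)\Big)A(L,\xi_a,\zeta_a,0)\overline{A(L,\xi_b,\zeta_b,0)}\,d\xi_ad\xi_bd\zeta_ad\zeta_b, \end{aligned}$$ where double integrals are over $\mathbb{R}^2\times\mathbb{R}^2$.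
   Context: Constants $c_o,\omega_0,r_0,\rho_0>0$. $C:\mathbb{R}^2\to\mathbb{R}$ is the covariance function of the medium: even, continuous, integrable, with Fourier transform $\hat C(k)=\int_{\mathbb{R}^2}C(x)e^{-ik\cdot x}dx$ nonnegative (Bochner) and in $L^1(\mathbb{R}^2)$, so $C(0)=(2\pi)^{-2}\int\hat C(k)dk$. Time-reversed (refocused) field: for frequencies $\omega,\tilde\omega$ and distance $L$, $$\hat u_{\rm tr}(x;y)=\iint_{\mathbb{R}^2\times\mathbb{R}^2}e^{-\frac{|x'|^2}{r_0^2}-\frac{|y'|^2}{4\rho_0^2}}\,\hat G\big(\omega,L,x,x'+\tfrac{y'}2\big)\overline{\hat G\big(\tilde\omega,L,y,x'-\tfrac{y'}2\big)}\,dx'dy',$$ where $\hat G$ is the Green's function of the Itô–Schrödinger equation $d\hat G=\frac{ic_o}{2\omega}\Delta_x\hat G\,dz+\frac{i\omega}{2c_o}\hat G\circ dB(z,x)$, $\hat G(\omega,0,x,y)=\delta(x-y)$ ($\circ$: Stratonovich; $B$ real Brownian field with $\mathbb{E}[B(z,x)B(z',x')]=\min\{z,z'\}C(x-x')$). Its second moment is $\mathbb{E}[|\hat u_{\rm tr}(x;y)|^2]=M_2(L,x_1=x,x_2=y,y_1=y,y_2=x)$, where $M_2(z,x_1,x_2,y_1,y_2)$, with $\omega_1=\tilde\omega_2=\omega$ and $\omega_2=\tilde\omega_1=\tilde\omega$, is characterized by (and may be defined through) $$\partial_zM_2=\frac{ic_o}2\Big(\frac1{\omega_1}\Delta_{x_1}+\frac1{\omega_2}\Delta_{x_2}-\frac1{\tilde\omega_1}\Delta_{y_1}-\frac1{\tilde\omega_2}\Delta_{y_2}\Big)M_2+\frac1{4c_o^2}U_2M_2,$$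 $$U_2=\omega_1\tilde\omega_1C(x_1-y_1)+\omega_1\tilde\omega_2C(x_1-y_2)+\omega_2\tilde\omega_1C(x_2-y_1)+\omega_2\tilde\omega_2C(x_2-y_2)-\omega_1\omega_2C(x_1-x_2)-\tilde\omega_1\tilde\omega_2C(y_1-y_2)-\tfrac{\omega_1^2+\omega_2^2+\tilde\omega_1^2+\tilde\omega_2^2}2C(0),$$ $M_2(0,x_1,x_2,y_1,y_2)=\exp\big(-\frac{|x_1+y_1|^2+|x_2+y_2|^2}{4r_0^2}-\frac{|x_1-y_1|^2+|x_2-y_2|^2}{4\rho_0^2}\big)$ (mild sense in Fourier space, Fourier transform in $L^1$). In the scintillation regime, $C,r_0,\rho_0,L$ are replaced in these definitions by $\varepsilon C,r_0/\varepsilon,\rho_0/\varepsilon,L/\varepsilon$. $K(z)=(2\pi)^4\exp\big(-\frac{\omega_0^2}{4c_o^2}C(0)z\big)$, and $A(z,\xi,\zeta,\Omega)$ is, for fixed $\zeta,\Omega$, the ($L^1(d\xi)$-valued, mild) solution of $$\partial_zA=\frac{ic_o\Omega}{\omega_0^2}|\xi|^2A+\frac{\omega_0^2}{4(2\pi)^2c_o^2}\int_{\mathbb{R}^2}\hat C(k)\big[A(\xi-k)e^{\frac{ic_oz}{\omega_0}k\cdot\zeta}-A(\xi)\big]dk+\frac{\omega_0^2}{4(2\pi)^2c_o^2}K(z)\hat C(\xi)e^{\frac{ic_oz}{\omega_0}\xi\cdot\zeta},\qquad A(z=0)=0.$$ *)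

theory Defs
  imports "HOL-Analysis.Analysis"
begin

type_synonym R2 = "real^2"

text \<open>Points \<open>(x1, x2, y1, y2)\<close> of \<open>(\<real>\<^sup>2)\<^sup>4\<close>, and also the corresponding dual variables.\<close>
type_synonym R2x4 = "R2 \<times> R2 \<times> R2 \<times> R2"

definition fourier :: "('a::euclidean_space \<Rightarrow> complex) \<Rightarrow> 'a \<Rightarrow> complex" where
  "fourier f k = (LINT x|lborel. f x * exp (- \<i> * complex_of_real (k \<bullet> x)))"

text \<open>\<open>f\<close> is a bounded continuous, not necessarily integrable, function with Fourier transform
  \<open>g\<close> in \<open>L\<^sup>1\<close>. The relation is expressed by the inversion formula, in the normalization of
  \<^const>\<open>fourier\<close>; it determines \<open>g\<close> almost everywhere.\<close>
definition has_L1_fourier ::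
    "('a::euclidean_space \<Rightarrow> complex) \<Rightarrow> ('a \<Rightarrow> complex) \<Rightarrow> bool" where
  "has_L1_fourier f g \<longleftrightarrow> integrable lborel g \<and>
     (\<forall>x. f x = (LINT k|lborel. g k * exp (\<i> * complex_of_real (k \<bullet> x)))
               / complex_of_real ((2 * pi) ^ DIM('a)))"

text \<open>Continuity of \<open>z \<mapsto> f z\<close> from \<open>[0,\<infinity>)\<close> to \<open>L\<^sup>1\<close>.\<close>
definition L1_continuous :: "(real \<Rightarrow> 'a::euclidean_space \<Rightarrow> complex) \<Rightarrow> bool" where
  "L1_continuous f \<longleftrightarrow> (\<forall>z\<ge>0. integrable lborel (f z)) \<and>
     (\<forall>z\<ge>0. ((\<lambda>s. LINT k|lborel. cmod (f s k - f z k)) \<longlongrightarrow> 0) (at z within {0..}))"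

text \<open>The potential \<open>U\<^sub>2\<close>; the frequencies \<open>v1, v2\<close> are those of the conjugated fields
  (\<open>\<omega>1, \<omega>2\<close> with tilde).\<close>
definition U2 ::
    "(R2 \<Rightarrow> real) \<Rightarrow> real \<Rightarrow> real \<Rightarrow> real \<Rightarrow> real \<Rightarrow> R2x4 \<Rightarrow> real" where
  "U2 C w1 w2 v1 v2 = (\<lambda>(x1, x2, y1, y2).
       w1 * v1 * C (x1 - y1) + w1 * v2 * C (x1 - y2)
     + w2 * v1 * C (x2 - y1) + w2 * v2 * C (x2 - y2)
     - w1 * w2 * C (x1 - x2) - v1 * v2 * C (y1 - y2)
     - (w1\<^sup>2 + w2\<^sup>2 + v1\<^sup>2 + v2\<^sup>2) / 2 * C 0)"

text \<open>\<open>- \<i> * free_symbol\<close> is the Fourier multiplier of the operator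
  \<open>\<i> c / 2 * (\<Delta>\<^sub>x\<^sub>1 / w1 + \<Delta>\<^sub>x\<^sub>2 / w2 - \<Delta>\<^sub>y\<^sub>1 / v1 - \<Delta>\<^sub>y\<^sub>2 / v2)\<close>.\<close>
definition free_symbol :: "real \<Rightarrow> real \<Rightarrow> real \<Rightarrow> real \<Rightarrow> real \<Rightarrow> R2x4 \<Rightarrow> real" where
  "free_symbol c w1 w2 v1 v2 = (\<lambda>(k1, k2, l1, l2).
     c / 2 * ((norm k1)\<^sup>2 / w1 + (norm k2)\<^sup>2 / w2 - (norm l1)\<^sup>2 / v1 - (norm l2)\<^sup>2 / v2))"

definition M2_initial :: "real \<Rightarrow> real \<Rightarrow> R2x4 \<Rightarrow> real" where
  "M2_initial r0 \<rho>0 = (\<lambda>(x1, x2, y1, y2).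
     exp (- ((norm (x1 + y1))\<^sup>2 + (norm (x2 + y2))\<^sup>2) / (4 * r0\<^sup>2)
          - ((norm (x1 - y1))\<^sup>2 + (norm (x2 - y2))\<^sup>2) / (4 * \<rho>0\<^sup>2)))"

text \<open>\<open>M\<close> is the mild solution, in Fourier space, of
  \<open>\<partial>\<^sub>z M = (\<i> c / 2) (\<Delta>\<^sub>x\<^sub>1 / w1 + \<Delta>\<^sub>x\<^sub>2 / w2 - \<Delta>\<^sub>y\<^sub>1 / v1 - \<Delta>\<^sub>y\<^sub>2 / v2) M + U\<^sub>2 M / (4 c\<^sup>2)\<close>.
  Here \<open>m z\<close> and \<open>n z\<close> are the Fourier transforms of \<open>M z\<close> and \<open>U\<^sub>2 * M z\<close>, and the last clause
  is Duhamel's formula. Joint measurability selects versions of the \<open>L\<^sup>1\<close>-valued functions for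
  which the integral over \<open>s\<close> can be taken pointwise.\<close>
definition M2_mild_solution ::
    "real \<Rightarrow> (R2 \<Rightarrow> real) \<Rightarrow> real \<Rightarrow> real \<Rightarrow> real \<Rightarrow> real \<Rightarrow> real \<Rightarrow> real
      \<Rightarrow> (real \<Rightarrow> R2x4 \<Rightarrow> complex) \<Rightarrow> bool" where
  "M2_mild_solution c C r0 \<rho>0 w1 w2 v1 v2 M \<longleftrightarrow>
     (\<forall>X. M 0 X = complex_of_real (M2_initial r0 \<rho>0 X)) \<and>
     (\<exists>m n :: real \<Rightarrow> R2x4 \<Rightarrow> complex.
        set_borel_measurable borel ({0..} \<times> UNIV) (\<lambda>(z, k). m z k) \<and>
        set_borel_measurable borel ({0..} \<times> UNIV) (\<lambda>(z, k). n z k) \<and>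
        L1_continuous m \<and>
        (\<forall>z\<ge>0. has_L1_fourier (M z) (m z)) \<and>
        (\<forall>z\<ge>0. has_L1_fourier (\<lambda>X. complex_of_real (U2 C w1 w2 v1 v2 X) * M z X) (n z)) \<and>
        (\<forall>z\<ge>0. AE k in lborel.
           m z k = exp (- \<i> * complex_of_real (z * free_symbol c w1 w2 v1 v2 k)) * m 0 k
             + 1 / complex_of_real (4 * c\<^sup>2)
               * (LINT s:{0..z}|lborel.
                    exp (- \<i> * complex_of_real ((z - s) * free_symbol c w1 w2 v1 v2 k)) * n s k)))"

text \<open>For frequencies \<open>\<omega>\<close> and \<open>\<omega>'\<close>, \<open>Etr2 L x y\<close> is the second moment
  \<open>\<bbbE>[|u\<^sub>t\<^sub>r(x; y)|\<^sup>2] = M\<^sub>2(L, x, y, y, x)\<close> of the refocused field at distance \<open>L\<close>, with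
  \<open>w1 = v2 = \<omega>\<close> and \<open>w2 = v1 = \<omega>'\<close>. It is defined through the moment equation (whose
  solution is unique), not through the random Green's function.\<close>
definition refocused_second_moment ::
    "real \<Rightarrow> (R2 \<Rightarrow> real) \<Rightarrow> real \<Rightarrow> real \<Rightarrow> real \<Rightarrow> real
      \<Rightarrow> (real \<Rightarrow> R2 \<Rightarrow> R2 \<Rightarrow> complex) \<Rightarrow> bool" where
  "refocused_second_moment c C r0 \<rho>0 \<omega> \<omega>' Etr2 \<longleftrightarrow>
     (\<exists>M. M2_mild_solution c C r0 \<rho>0 \<omega> \<omega>' \<omega>' \<omega> M \<and>
          (\<forall>L\<ge>0. \<forall>x y. Etr2 L x y = M L (x, y, y, x)))"

definition K_fun :: "real \<Rightarrow> (R2 \<Rightarrow> real) \<Rightarrow> real \<Rightarrow> real \<Rightarrow> real" where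
  "K_fun c C \<omega>0 z = (2 * pi) ^ 4 * exp (- \<omega>0\<^sup>2 / (4 * c\<^sup>2) * C 0 * z)"

text \<open>The right-hand side of the equation for \<open>a z \<xi> = A(z,\<xi>,\<zeta>,\<Omega>)\<close>, without the term
  \<open>\<i> c \<Omega> / \<omega>0\<^sup>2 * |\<xi>|\<^sup>2 * a z \<xi>\<close>.\<close>
definition A_scattering ::
    "real \<Rightarrow> (R2 \<Rightarrow> real) \<Rightarrow> real \<Rightarrow> R2 \<Rightarrow> (real \<Rightarrow> R2 \<Rightarrow> complex) \<Rightarrow> real \<Rightarrow> R2 \<Rightarrow> complex" where
  "A_scattering c C \<omega>0 \<zeta> a z \<xi> =
     complex_of_real (\<omega>0\<^sup>2 / (4 * (2 * pi)\<^sup>2 * c\<^sup>2))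
       * (LINT k|lborel. fourier C k
            * (a z (\<xi> - k) * exp (\<i> * complex_of_real (c * z / \<omega>0 * (k \<bullet> \<zeta>))) - a z \<xi>))
   + complex_of_real (\<omega>0\<^sup>2 / (4 * (2 * pi)\<^sup>2 * c\<^sup>2))
       * complex_of_real (K_fun c C \<omega>0 z) * fourier C \<xi>
       * exp (\<i> * complex_of_real (c * z / \<omega>0 * (\<xi> \<bullet> \<zeta>)))"

text \<open>Duhamel's formula with initial condition \<open>0\<close>. The equation is posed for fixed \<open>\<zeta>\<close> and
  \<open>\<Omega>\<close> and determines \<open>A z \<xi> \<zeta> \<Omega>\<close> for almost every \<open>\<xi>\<close> only; measurability in \<open>(z, \<xi>, \<zeta>)\<close>
  selects versions that can be integrated in \<open>s\<close> and jointly in \<open>(\<xi>, \<zeta>)\<close>.\<close>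
definition A_mild_solution ::
    "real \<Rightarrow> (R2 \<Rightarrow> real) \<Rightarrow> real \<Rightarrow> (real \<Rightarrow> R2 \<Rightarrow> R2 \<Rightarrow> real \<Rightarrow> complex) \<Rightarrow> bool" where
  "A_mild_solution c C \<omega>0 A \<longleftrightarrow> (\<forall>\<Omega>.
     set_borel_measurable borel ({0..} \<times> UNIV) (\<lambda>(z, \<xi>, \<zeta>). A z \<xi> \<zeta> \<Omega>) \<and>
     (\<forall>\<zeta>. L1_continuous (\<lambda>z \<xi>. A z \<xi> \<zeta> \<Omega>) \<and>
        (\<forall>z\<ge>0. AE \<xi> in lborel.
           A z \<xi> \<zeta> \<Omega> = (LINT s:{0..z}|lborel.
             exp (\<i> * complex_of_real (c * \<Omega> / \<omega>0\<^sup>2 * (norm \<xi>)\<^sup>2 * (z - s)))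
             * A_scattering c C \<omega>0 \<zeta> (\<lambda>z \<xi>. A z \<xi> \<zeta> \<Omega>) s \<xi>))))"

end

theory Submission
  imports Defs "HOL-Probability.Probability"
begin

text \<open>The moment equation is solved backwards: the fourth-order field is the integral of the Fourier
  transform of the initial condition against the solution of the dual (backward) jump equation, a
  Dyson series that is bounded uniformly in \<open>\<epsilon>\<close>. Testing the dual equation against products of two
  forward densities (one for each of the two fields paired by a jump) leaves, besides the terminal
  value, only terms that oscillate at rate \<open>1 / \<epsilon>\<close>; they vanish by the Riemann--Lebesgue lemma.
  There are two such pairings (ladders), and both contain the unscattered part, which is therefore
  subtracted once. The densities are \<open>A\<close> in the interaction picture, so the limit is an explicit
  Gaussian integral in which the square is completed.\<close>

text \<open>On the Fourier side the field is an L1 density whose initial value tends to a point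
  mass, so L1 limits are out of reach. Dual solutions are bounded functions, and the only value
  asked of them is the one at time 0 and at the point \<open>eps n *\<^sub>R \<eta>\<close>.
  Elsewhere they are never shown to converge: error terms use a uniform bound on them and on their
  derivative in \<open>s\<close>. A jump from \<open>p\<close> carries the phase
  \<open>S n (p + jump j k) - S n p\<close>, which is of order \<open>1 / eps n\<close> unless the
  limiting free symbol is conserved. The two jump types of a ladder act on disjoint pairs of
  arguments and conserve it; all others violate it for almost every \<open>k\<close>, provided that
  the two ladder variables differ. The obstacle is the point where both ladder variables vanish: it
  carries positive mass, and there the jumps of the other ladder do not oscillate. The identities
  for the first ladder, for the second ladder and for the atoms alone contain the same uncontrolled
  integrals, which cancel in the sum of the first two minus the third.\<close>

abbreviation cor :: "real => complex" where "cor \<equiv> complex_of_real"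

section \<open>Gaussians, Fourier uniqueness and Fourier inversion\<close>

lemma lborel_integral_affine:
 fixes f :: "'a::euclidean_space => 'b::{banach, second_countable_topology}"
 assumes c: "c \<noteq> 0"
 shows "integrable lborel (%x. f (t + c *\<^sub>R x)) \<longleftrightarrow> integrable lborel f"
  and "(LINT x|lborel. f x) = \<bar>c\<bar> ^ DIM('a) *\<^sub>R (LINT x|lborel. f (t + c *\<^sub>R x))"
proof -
 have I: "integrable lborel (%x. f (t + c *\<^sub>R x))" if f: "integrable lborel f" "c \<noteq> 0" for c and t :: 'a
  and f :: "'a => 'b"
 proof -
  have [measurable]: "f \<in> borel_measurable borel" using f by auto
  have "integrable (density (distr lborel borel (%x. t + c *\<^sub>R x)) (%_. ennreal (\<bar>c\<bar>^DIM('a)))) f"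
   using f lborel_affine[of c t] by simp
  then have "integrable (distr lborel borel (%x. t + c *\<^sub>R x)) (%x. (\<bar>c\<bar>^DIM('a)) *\<^sub>R f x)"
   by (subst (asm) integrable_density) auto
  then have "integrable lborel (%x. (\<bar>c\<bar>^DIM('a)) *\<^sub>R f (t + c *\<^sub>R x))"
   by (subst (asm) integrable_distr_eq) auto
  from integrable_scaleR_right[of "inverse (\<bar>c\<bar>^DIM('a))", OF this] show ?thesis using f(2) by simp
 qed
 show J: "integrable lborel (%x. f (t + c *\<^sub>R x)) \<longleftrightarrow> integrable lborel f"
 proof
  assume "integrable lborel (%x. f (t + c *\<^sub>R x))"
  from I[OF this, of "inverse c" "- (inverse c *\<^sub>R t)"] c show "integrable lborel f"
   by (simp add: scaleR_right_diff_distrib scaleR_right_distrib)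
 qed (rule I[OF _ c])
 show "(LINT x|lborel. f x) = \<bar>c\<bar> ^ DIM('a) *\<^sub>R (LINT x|lborel. f (t + c *\<^sub>R x))"
 proof (cases "integrable lborel f")
  case True
  then have [measurable]: "f \<in> borel_measurable borel" by auto
  have "(LINT x|lborel. f x) = integral\<^sup>L (density (distr lborel borel (%x. t + c *\<^sub>R x)) (%_. ennreal (\<bar>c\<bar>^DIM('a)))) f"
   using lborel_affine[OF c, of t] by simp
  also have "\<dots> = (LINT x|distr lborel borel (%x. t + c *\<^sub>R x). (\<bar>c\<bar>^DIM('a)) *\<^sub>R f x)"
   by (subst integral_density) auto
  also have "\<dots> = (LINT x|lborel. (\<bar>c\<bar>^DIM('a)) *\<^sub>R f (t + c *\<^sub>R x))"
   by (subst integral_distr) auto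
  finally show ?thesis by simp
 next
  case False
  with J show ?thesis by (simp add: not_integrable_integral_eq)
 qed
qed

lemma lborel_shift:
 fixes f :: "'a::euclidean_space => 'b::{banach, second_countable_topology}"
 shows "integrable lborel (%x. f (x + t)) \<longleftrightarrow> integrable lborel f"
  and "(LINT x|lborel. f (x + t)) = (LINT x|lborel. f x)"
 using lborel_integral_affine[of 1 f t] by (simp_all add: add.commute)

text \<open>\<open>lborel\<close> is the image of a product of one-dimensional Lebesgue measures
  under recombination of the coordinates. This carries Gaussian integrals from dimension one to any
  dimension.\<close>

lemma lborel_integral_prod_Basis:
 fixes f :: "'a::euclidean_space => real => complex"
 assumes f: "!!b. b \<in> Basis ==> integrable lborel (f b)"
 shows "integrable lborel (%x::'a. \<Prod>b\<in>Basis. f b (x \<bullet> b))"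
  and "(LINT x|lborel. (\<Prod>b\<in>Basis. f b (x \<bullet> b))) = (\<Prod>b\<in>Basis. integral\<^sup>L lborel (f b))"
proof -
 interpret product_sigma_finite "%_::'a. lborel::real measure" ..
 have [measurable]: "!!b. b \<in> Basis ==> f b \<in> borel_measurable borel" using f by auto
 have [measurable]: "(%x::'a. \<Prod>b\<in>Basis. f b (x \<bullet> b)) \<in> borel_measurable borel" by measurable
 have [measurable]: "(%g. \<Sum>b\<in>Basis. g b *\<^sub>R b) \<in> measurable (PiM (Basis::'a set) (%_. lborel)) borel"
  by measurable
 have eq: "(\<Prod>b\<in>Basis. f b ((\<Sum>b\<in>Basis. g b *\<^sub>R b) \<bullet> b)) = (\<Prod>b\<in>Basis. f b (g b))" for g :: "'a => real"
  by (intro prod.cong) (auto simp: inner_sum_left inner_Basis if_distrib cong: if_cong)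
 have "integrable (PiM (Basis::'a set) (%_. lborel)) (%g. \<Prod>b\<in>Basis. f b (g b))"
  by (rule product_integrable_prod) (use f in auto)
 then show "integrable lborel (%x::'a. \<Prod>b\<in>Basis. f b (x \<bullet> b))"
  by (subst lborel_eq, subst integrable_distr_eq) (auto simp: eq)
 have "(LINT x|lborel. (\<Prod>b\<in>Basis. f b (x \<bullet> b))) = (LINT g|PiM (Basis::'a set) (%_. lborel). (\<Prod>b\<in>Basis. f b (g b)))"
  by (subst lborel_eq, subst integral_distr) (auto simp: eq)
 also have "\<dots> = (\<Prod>b\<in>Basis. integral\<^sup>L lborel (f b))"
  by (rule product_integral_prod) (use f in auto)
 finally show "(LINT x|lborel. (\<Prod>b\<in>Basis. f b (x \<bullet> b))) = (\<Prod>b\<in>Basis. integral\<^sup>L lborel (f b))" .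
qed

text \<open>The centred normal density, parametrised by its precision \<open>al\<close>, the inverse
  of the variance. With precision \<open>r0\<^sup>2\<close> it is, up to normalisation, the Fourier
  transform of a Gaussian of width \<open>r0\<close>.\<close>

definition gaussian :: "real => 'a::euclidean_space => real" where
 "gaussian al u = sqrt (al / (2 * pi)) ^ DIM('a) * exp (- (al * (norm u)\<^sup>2 / 2))"

lemma gaussian_nonneg [simp]: "al > 0 ==> gaussian al u \<ge> 0"
 by (simp add: gaussian_def)

lemma borel_measurable_gaussian [measurable]: "gaussian al \<in> borel_measurable borel"
 unfolding gaussian_def by measurable

text \<open>The characteristic function of the standard normal distribution, rescaled by
  \<open>s = sqrt al\<close>.\<close>

lemma gaussian_1d:
 assumes "al > 0"
 shows "integrable lborel (%x::real. cor (gaussian al x) * iexp (t * x))"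
  and "(LINT x|lborel. cor (gaussian al x) * iexp (t * x)) = exp (- (t\<^sup>2 / (2 * al)))"
proof -
 define s where "s = sqrt al"
 have s: "s > 0" "s\<^sup>2 = al" using assms by (auto simp: s_def)
 define h where "h = (%x. cor (std_normal_density x) * iexp (t / s * x))"
 have "integrable lborel (%x. cor (std_normal_density x))"
  using integrable_normal_moment[of 1 0 0] by (simp add: integrable_of_real)
 then have h_int: "integrable lborel h" unfolding h_def
  by (rule Bochner_Integration.integrable_bound) (auto simp: norm_mult)
 have h_val: "integral\<^sup>L lborel h = exp (- (t / s)\<^sup>2 / 2)"
  using fun_cong[OF char_std_normal_distribution, of "t / s"] unfolding char_def h_def
  by (subst (asm) integral_density) (auto simp: scaleR_conv_of_real normal_density_nonneg)
 have g: "cor (gaussian al x) * iexp (t * x) = s *\<^sub>R h (0 + s *\<^sub>R x)" for x :: real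
 proof -
  have "sqrt (al / (2*pi)) = s / sqrt (2 * pi)" by (simp add: s_def real_sqrt_divide)
  moreover have "(s * x)\<^sup>2 = al * x\<^sup>2" using s(2) by (simp add: power_mult_distrib)
  ultimately have "gaussian al x = s * std_normal_density (s * x)"
   by (simp add: gaussian_def std_normal_density_def)
  moreover have "t / s * (0 + s *\<^sub>R x) = t * x" using s by simp
  ultimately show ?thesis unfolding h_def by (simp add: scaleR_conv_of_real)
 qed
 show "integrable lborel (%x::real. cor (gaussian al x) * iexp (t * x))"
  unfolding g using lborel_integral_affine(1)[of s h 0] s h_int by simp
 have "(LINT x|lborel. cor (gaussian al x) * iexp (t * x)) = integral\<^sup>L lborel h"
  unfolding g using lborel_integral_affine(2)[of s h 0] s by simp
 also have "\<dots> = exp (- (t\<^sup>2 / (2 * al)))"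
  unfolding h_val using s by (simp add: power_divide field_simps)
 finally show "(LINT x|lborel. cor (gaussian al x) * iexp (t * x)) = exp (- (t\<^sup>2 / (2 * al)))" .
qed

lemma gaussian_fourier:
 fixes b :: "'a::euclidean_space"
 assumes "al > 0"
 shows "integrable lborel (%u. cor (gaussian al u) * iexp (b \<bullet> u))"
  and "(LINT u|lborel. cor (gaussian al u) * iexp (b \<bullet> u)) = exp (- ((norm b)\<^sup>2 / (2 * al)))"
proof -
 have n2: "(norm u)\<^sup>2 = (\<Sum>i\<in>Basis. (u \<bullet> i)\<^sup>2)" for u :: 'a
  by (simp only: power2_norm_eq_inner) (subst euclidean_inner, simp add: power2_eq_square)
 have e: "cor (gaussian al u) * iexp (b \<bullet> u)
   = (\<Prod>i\<in>Basis. cor (gaussian al (u \<bullet> i)) * iexp ((b \<bullet> i) * (u \<bullet> i)))" for u :: 'a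
 proof -
  have "iexp (b \<bullet> u) = (\<Prod>i\<in>Basis. iexp ((b \<bullet> i) * (u \<bullet> i)))"
   by (subst euclidean_inner) (simp add: sum_distrib_left exp_sum)
  moreover have "gaussian al u = (\<Prod>i\<in>Basis. gaussian al (u \<bullet> i))"
   by (simp add: gaussian_def n2 prod.distrib exp_sum[symmetric] sum_distrib_left sum_divide_distrib sum_negf)
  ultimately show ?thesis by (simp add: prod.distrib)
 qed
 show "integrable lborel (%u. cor (gaussian al u) * iexp (b \<bullet> u))"
  unfolding e by (rule lborel_integral_prod_Basis) (rule gaussian_1d[OF assms])
 have "(LINT u|lborel. cor (gaussian al u) * iexp (b \<bullet> u))
  = (\<Prod>i\<in>Basis. exp (- ((b \<bullet> i)\<^sup>2 / (2 * al))))"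
  unfolding e by (subst lborel_integral_prod_Basis(2), rule gaussian_1d[OF assms], simp only: gaussian_1d(2)[OF assms] of_real_prod)
 also have "\<dots> = exp (- ((norm b)\<^sup>2 / (2 * al)))"
  by (simp add: n2 exp_sum[symmetric] sum_divide_distrib sum_negf)
 finally show "(LINT u|lborel. cor (gaussian al u) * iexp (b \<bullet> u)) = exp (- ((norm b)\<^sup>2 / (2 * al)))" .
qed

lemma gaussian_integral:
 assumes "al > 0"
 shows "integrable lborel (gaussian al :: 'a::euclidean_space => real)"
  and "(LINT u|lborel. gaussian al (u::'a)) = 1"
proof -
 have i: "integrable lborel (%u::'a. cor (gaussian al u))"
  using gaussian_fourier(1)[OF assms, of 0] by simp
 then show "integrable lborel (gaussian al :: 'a => real)"
  using integrable_Re by fastforce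
 have "(LINT u|lborel. cor (gaussian al (u::'a))) = 1"
  using gaussian_fourier(2)[OF assms, of "0::'a"] by simp
 then show "(LINT u|lborel. gaussian al (u::'a)) = 1"
  by (simp add: integral_complex_of_real)
qed

lemma integrable_tensor:
 fixes f g :: "_ => 'c::{real_normed_field, banach, second_countable_topology}"
 assumes "sigma_finite_measure M1" "sigma_finite_measure M2" and f: "integrable M1 f" and g: "integrable M2 g"
 shows "integrable (M1 \<Otimes>\<^sub>M M2) (%x. f (fst x) * g (snd x))"
proof -
 interpret pair_sigma_finite M1 M2 using assms by (simp add: pair_sigma_finite_def)
 have [measurable]: "f \<in> borel_measurable M1" "g \<in> borel_measurable M2" using f g by auto
 show ?thesis
  by (rule Fubini_integrable) (use f g in \<open>auto simp: norm_mult\<close>)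
qed

lemma gaussian_scale:
 assumes "N > 0"
 shows "gaussian N (u::'a::euclidean_space) = sqrt N ^ DIM('a) * gaussian 1 (sqrt N *\<^sub>R u)"
proof -
 have "(norm (sqrt N *\<^sub>R u))\<^sup>2 = N * (norm u)\<^sup>2" using assms by (simp add: power_mult_distrib)
 moreover have "sqrt (N / (2*pi)) = sqrt N * sqrt (1 / (2*pi))" by (simp add: real_sqrt_divide)
 ultimately show ?thesis using assms by (simp add: gaussian_def power_mult_distrib)
qed

text \<open>Substituting \<open>a = k - v / sqrt (Suc n)\<close> moves the dependence on
  \<open>n\<close> from the kernel into the argument of \<open>f\<close>, where continuity at
  \<open>k\<close> and dominated convergence apply.\<close>

lemma gaussian_mollify:
 fixes f :: "'a::euclidean_space => complex"
 assumes [measurable]: "f \<in> borel_measurable borel" and B: "!!x. cmod (f x) \<le> B" and cont: "isCont f k"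
 shows "(%n. LINT a|lborel. gaussian (real (Suc n)) (k - a) *\<^sub>R f a) \<longlonglongrightarrow> f k"
proof -
 have eq: "(LINT a|lborel. gaussian (real (Suc n)) (k - a) *\<^sub>R f a)
  = (LINT v|lborel. gaussian 1 v *\<^sub>R f (k - (1 / sqrt (real (Suc n))) *\<^sub>R v))" for n
 proof -
  define r where "r = sqrt (real (Suc n))"
  have r: "r > 0" "r = sqrt (real (Suc n))" by (auto simp: r_def)
  have "(LINT a|lborel. gaussian (real (Suc n)) (k - a) *\<^sub>R f a)
   = \<bar>- (1 / r)\<bar> ^ DIM('a) *\<^sub>R (LINT v|lborel. gaussian (real (Suc n)) (k - (k + (- (1 / r)) *\<^sub>R v)) *\<^sub>R f (k + (- (1 / r)) *\<^sub>R v))"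
   using r by (intro lborel_integral_affine(2)) simp
  also have "\<dots> = \<bar>- (1 / r)\<bar> ^ DIM('a) *\<^sub>R (LINT v|lborel. (r ^ DIM('a)) *\<^sub>R (gaussian 1 v *\<^sub>R f (k - (1 / r) *\<^sub>R v)))"
   using r by (subst gaussian_scale) (auto simp flip: r(2))
  also have "\<dots> = \<bar>- (1 / r)\<bar> ^ DIM('a) *\<^sub>R (r ^ DIM('a) *\<^sub>R (LINT v|lborel. gaussian 1 v *\<^sub>R f (k - (1 / r) *\<^sub>R v)))"
   by (simp only: integral_scaleR_right)
  also have "\<dots> = (LINT v|lborel. gaussian 1 v *\<^sub>R f (k - (1 / r) *\<^sub>R v))"
   using r(1) by (simp add: power_divide)
  finally show ?thesis by (simp add: r)
 qed
 have lim: "(%n. LINT v|lborel. gaussian 1 v *\<^sub>R f (k - (1 / sqrt (real (Suc n))) *\<^sub>R v))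
   \<longlonglongrightarrow> (LINT v|lborel. gaussian 1 (v::'a) *\<^sub>R f k)"
 proof (rule integral_dominated_convergence[where w="%v. B * gaussian 1 v"])
  show "integrable lborel (%v::'a. B * gaussian 1 v)"
   using gaussian_integral(1)[of 1, where 'a='a] by simp
  have "(%n. 1 / sqrt (real (Suc n))) \<longlonglongrightarrow> 0"
   using tendsto_inverse_0_at_top[OF filterlim_compose[OF sqrt_at_top filterlim_compose[OF filterlim_real_sequentially filterlim_Suc]]]
   by (simp add: inverse_eq_divide)
  then have z: "(%n. k - (1 / sqrt (real (Suc n))) *\<^sub>R v) \<longlonglongrightarrow> k" for v
   using tendsto_diff[OF tendsto_const[of k] tendsto_scaleR[OF _ tendsto_const[of v]]] by fastforce
  show "AE v in lborel. (%n. gaussian 1 v *\<^sub>R f (k - (1 / sqrt (real (Suc n))) *\<^sub>R v)) \<longlonglongrightarrow> gaussian 1 v *\<^sub>R f k"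
   by (intro AE_I2 tendsto_scaleR tendsto_const isCont_tendsto_compose[OF cont] z)
  show "AE v in lborel. norm (gaussian 1 v *\<^sub>R f (k - (1 / sqrt (real (Suc n))) *\<^sub>R v)) \<le> B * gaussian 1 v" for n
   by (intro AE_I2) (auto simp: mult.commute[of B] intro!: mult_left_mono B)
 qed simp_all
 show ?thesis unfolding eq using lim by (simp add: gaussian_integral)
qed

text \<open>Negligibility is a statement about the completed measure; Borel measurability of
  \<open>P\<close> brings the exceptional set back into the domain of \<open>lborel\<close>.\<close>

lemma AE_lborel_if_negligible:
 fixes S :: "'a::euclidean_space set"
 assumes "negligible S" "{x. \<not> P x} \<subseteq> S" "Measurable.pred borel P"
 shows "AE x in lborel. P x"
proof -
 have s: "{x. \<not> P x} \<in> sets borel" using assms(3) by simp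
 have "negligible {x. \<not> P x}" using assms(1,2) negligible_subset by blast
 then have "{x. \<not> P x} \<in> null_sets lebesgue" by (simp add: negligible_iff_null_sets)
 then have "{x. \<not> P x} \<in> null_sets lborel"
  using s by (simp add: null_sets_def emeasure_completion)
 then show ?thesis by (rule AE_I') auto
qed

text \<open>Writing a Gaussian bump as a Fourier integral and applying Fubini shows that all
  Gaussian averages of \<open>g\<close> vanish (\<open>G\<close>). Bumps averaged over a box tend to
  its indicator off the frontier, so the integrals of \<open>g\<close> over boxes vanish
  (\<open>box\<close>), and differentiation of integrals finishes.\<close>

lemma fourier_L1_unique:
 fixes g :: "'a::euclidean_space => complex"
 assumes g: "integrable lborel g" and z: "!!x. (LINT k|lborel. g k * iexp (k \<bullet> x)) = 0"
 shows "AE k in lborel. g k = 0"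
proof -
 have [measurable]: "g \<in> borel_measurable borel" using g by auto
 have G: "(LINT k|lborel. g k * gaussian N (k - a)) = 0" if "N > 0" for N a
 proof -
  define c where "c = sqrt (N / (2 * pi)) ^ DIM('a)"
  have ge: "cor (gaussian N (k - a))
   = c * (LINT u|lborel. cor (gaussian (1/N) u) * iexp ((k - a) \<bullet> u))" for k
   using that by (subst gaussian_fourier(2)) (auto simp: c_def gaussian_def mult.commute)
  have int: "integrable (lborel \<Otimes>\<^sub>M lborel) (%(k, u). g k * (cor (gaussian (1/N) u) * iexp ((k - a) \<bullet> u)))"
  proof (rule Bochner_Integration.integrable_bound)
   show "integrable (lborel \<Otimes>\<^sub>M lborel) (%x::'a\<times>'a. g (fst x) * cor (gaussian (1/N) (snd x)))"
    by (rule integrable_tensor) (use g that gaussian_integral(1)[of "1/N"] in \<open>auto intro: sigma_finite_lborel integrable_of_real\<close>)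
  qed (auto simp: norm_mult)
  have "(LINT k|lborel. g k * gaussian N (k - a))
   = c * (LINT k|lborel. (LINT u|lborel. g k * (cor (gaussian (1/N) u) * iexp ((k - a) \<bullet> u))))"
   unfolding ge by (simp add: mult.left_commute)
  also have "\<dots> = c * (LINT u|lborel. (LINT k|lborel. g k * (cor (gaussian (1/N) u) * iexp ((k - a) \<bullet> u))))"
   using lborel_pair.Fubini_integral[OF int] by simp
  also have "\<dots> = c * (LINT u|lborel. cor (gaussian (1/N) u) * iexp (- (a \<bullet> u)) * (LINT k|lborel. g k * iexp (k \<bullet> u)))"
   by (intro arg_cong2[where f="(*)"] refl Bochner_Integration.integral_cong)
    (auto simp: inner_diff_left algebra_simps simp flip: exp_add integral_mult_right_zero)
  finally show ?thesis by (simp add: z)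
 qed
 have box: "(LINT k|lborel. g k * indicator (cbox p q) k) = 0" for p q
 proof -
  let ?h = "%N k. LINT a|lborel. gaussian N (k - a) *\<^sub>R (indicator (cbox p q) a :: complex)"
  have "(LINT k|lborel. g k * ?h N k) = 0" if "N > 0" for N
  proof -
   have i: "integrable (lborel \<Otimes>\<^sub>M lborel) (%(k, a). g k * (gaussian N (k - a) *\<^sub>R (indicator (cbox p q) a :: complex)))"
   proof (rule Bochner_Integration.integrable_bound)
    show "integrable (lborel \<Otimes>\<^sub>M lborel) (%x::'a\<times>'a. g (fst x) * (cor (sqrt (N / (2 * pi)) ^ DIM('a)) * indicator (cbox p q) (snd x)))"
    proof (rule integrable_tensor)
     have "integrable lborel (%x. cor (indicator (cbox p q) x))"
      by (intro integrable_of_real integrable_real_indicator) (use emeasure_lborel_cbox_finite[of p q] in \<open>auto simp: less_top\<close>)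
     then show "integrable lborel (%x. cor (sqrt (N / (2 * pi)) ^ DIM('a)) * indicator (cbox p q) x)"
      by (intro integrable_mult_right) (simp add: of_real_indicator)
    qed (use g in \<open>auto intro: sigma_finite_lborel\<close>)
    show "AE x in lborel \<Otimes>\<^sub>M lborel. norm (case x of (k, a) => g k * (gaussian N (k - a) *\<^sub>R (indicator (cbox p q) a :: complex)))
     \<le> norm (g (fst x) * (cor (sqrt (N / (2 * pi)) ^ DIM('a)) * indicator (cbox p q) (snd x)))"
     using that by (intro AE_I2) (auto simp: norm_mult norm_power gaussian_def indicator_def abs_mult intro!: mult_left_mono mult_left_le mult_left_le_one_le)
   qed simp
   have "(LINT k|lborel. g k * ?h N k) = (LINT k|lborel. LINT a|lborel. g k * (gaussian N (k - a) *\<^sub>R indicator (cbox p q) a))"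
    by (simp only: integral_mult_right_zero)
   also have "\<dots> = (LINT a|lborel. LINT k|lborel. g k * (gaussian N (k - a) *\<^sub>R indicator (cbox p q) a))"
    using lborel_pair.Fubini_integral[OF i] by simp
   also have "\<dots> = (LINT a|lborel. indicator (cbox p q) a * (LINT k|lborel. g k * gaussian N (k - a)))"
    by (intro Bochner_Integration.integral_cong refl)
     (simp add: scaleR_conv_of_real mult_ac flip: integral_mult_right_zero)
   finally show ?thesis using G[OF that] by simp
  qed
  then have "(%n. LINT k|lborel. g k * ?h (real (Suc n)) k) = (%n. 0)" by auto
  moreover have "(%n. LINT k|lborel. g k * ?h (real (Suc n)) k) \<longlonglongrightarrow> (LINT k|lborel. g k * indicator (cbox p q) k)"
  proof (rule integral_dominated_convergence[where w="%k. cmod (g k)"])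
   have [measurable]: "frontier (cbox p q) \<in> sets borel" by (simp add: borel_closed)
   have "AE k in lborel. k \<notin> frontier (cbox p q)"
    by (rule AE_lborel_if_negligible[OF negligible_convex_frontier[of "cbox p q"]]) (simp, force, measurable)
   then show "AE k in lborel. (%n. g k * ?h (real (Suc n)) k) \<longlonglongrightarrow> g k * indicator (cbox p q) k"
   proof eventually_elim
    case (elim k)
    have "isCont (indicator (cbox p q) :: 'a => real) k" using elim by (simp add: isCont_indicator)
    then have "isCont (%a. cor (indicator (cbox p q) a)) k" by (rule isCont_o2) simp
    then have "isCont (indicator (cbox p q) :: 'a => complex) k" by (simp add: of_real_indicator)
    then show ?case
     by (intro tendsto_mult tendsto_const gaussian_mollify[where B=1]) (simp, simp add: indicator_def, assumption)
   qed
   show "AE k in lborel. norm (g k * ?h (real (Suc n)) k) \<le> cmod (g k)" for n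
   proof (intro AE_I2)
    fix k
    have i: "integrable lborel (%a::'a. gaussian (real (Suc n)) (k - a))"
     using lborel_integral_affine(1)[of "-1" "gaussian (real (Suc n))" k] gaussian_integral(1)[of "real (Suc n)"] by simp
    have "cmod (?h (real (Suc n)) k) \<le> (LINT a|lborel. gaussian (real (Suc n)) (k - a))"
     by (rule Bochner_Integration.integral_norm_bound[THEN order_trans], rule integral_mono')
      (use i in \<open>auto simp: indicator_def\<close>)
    also have "\<dots> = 1"
     using lborel_integral_affine(2)[of "-1" "gaussian (real (Suc n))" k] gaussian_integral(2)[of "real (Suc n)", where 'a='a] by simp
    finally show "norm (g k * ?h (real (Suc n)) k) \<le> cmod (g k)"
     by (simp add: norm_mult mult_left_le)
   qed
  qed (use g in auto)
  ultimately show ?thesis by (metis LIMSEQ_unique tendsto_const)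
 qed
 have gi: "set_integrable lebesgue S g" if "S \<in> sets borel" for S
  using g that by (simp add: set_integrable_def integrable_completion integrable_mult_indicator)
 have sb: "set_integrable lborel (cbox p q) g" for p q
  using g by (simp add: set_integrable_def integrable_mult_indicator)
 have gI: "g integrable_on cbox p q" "integral (cbox p q) g = 0" for p q
  using set_borel_integral_eq_integral[OF sb[of p q]] box[of p q]
  by (auto simp: set_lebesgue_integral_def scaleR_conv_of_real mult.commute of_real_indicator)
 \<comment> \<open>Lebesgue differentiation: off \<open>N\<close> the averages over shrinking boxes
   with corner \<open>x\<close> tend to \<open>g x\<close>, and all these averages are 0.\<close>
 obtain N where N: "negligible N" "!!x e. \<lbrakk>x \<notin> N; 0 < e\<rbrakk> \<Longrightarrow>
        \<exists>d>0. \<forall>h. 0 < h \<and> h < d \<longrightarrow>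
            norm(integral (cbox x (x + h *\<^sub>R One)) g /\<^sub>R h ^ DIM('a) - g x) < e"
  using integrable_ccontinuous_explicit[OF gI(1)] by blast
 have "g x = 0" if x: "x \<notin> N" for x
 proof (rule ccontr)
  assume "g x \<noteq> 0"
  then obtain d where d: "d > 0" "\<forall>h. 0 < h \<and> h < d \<longrightarrow>
            norm(integral (cbox x (x + h *\<^sub>R One)) g /\<^sub>R h ^ DIM('a) - g x) < cmod (g x)"
   using N(2)[OF x, of "cmod (g x)"] by auto
  from d(2)[rule_format, of "d/2"] d(1) show False by (simp add: gI(2))
 qed
 then show ?thesis by (intro AE_lborel_if_negligible[OF N(1)]) auto
qed

text \<open>An integrable continuous \<open>C\<close> may be unbounded, so
  \<open>gaussian_mollify\<close> is applied to its restriction to the unit ball around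
  \<open>k\<close>. Outside that ball the kernel is uniformly small and integrability of
  \<open>C\<close> suffices.\<close>

lemma gaussian_mollify_L1:
 fixes C :: "'a::euclidean_space => complex"
 assumes C: "integrable lborel C" and cont: "continuous_on UNIV C"
 shows "(%n. LINT a|lborel. gaussian (real (Suc n)) (k - a) *\<^sub>R C a) \<longlonglongrightarrow> C k"
proof -
 have [measurable]: "C \<in> borel_measurable borel" using C by auto
 define C1 where "C1 = (%a. indicator (cball k 1) a *\<^sub>R C a)"
 define C2 where "C2 = (%a. indicator (- cball k 1) a *\<^sub>R C a)"
 have [measurable]: "C1 \<in> borel_measurable borel" "C2 \<in> borel_measurable borel"
  unfolding C1_def C2_def by (intro borel_measurable_scaleR borel_measurable_indicator; simp)+
 have "compact (C ` cball k 1)"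
  by (intro compact_continuous_image continuous_on_subset[OF cont]) auto
 from compact_imp_bounded[OF this] obtain B where "\<forall>y\<in>C ` cball k 1. cmod y \<le> B"
  unfolding bounded_iff by auto
 then have B: "!!x. x \<in> cball k 1 ==> cmod (C x) \<le> B" by auto
 have "k \<in> cball k 1" by simp
 then have "B \<ge> 0" using B[of k] norm_ge_zero[of "C k"] by linarith
 have ev: "eventually (%x. C1 x = C x) (nhds k)"
 proof (rule eventually_nhds[THEN iffD2], intro exI[of _ "ball k 1"] conjI ballI)
  fix x assume "x \<in> ball k 1" then show "C1 x = C x" by (auto simp: C1_def)
 qed auto
 have "isCont C k" using cont by (simp add: continuous_on_eq_continuous_at)
 then have "isCont C1 k" using ev isCont_cong by blast
 then have l1: "(%n. LINT a|lborel. gaussian (real (Suc n)) (k - a) *\<^sub>R C1 a) \<longlonglongrightarrow> C1 k"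
  using B \<open>B \<ge> 0\<close> by (intro gaussian_mollify[where B=B]) (auto simp: C1_def indicator_def)
 \<comment> \<open>The value of the kernel at distance 1, hence its maximum outside the unit
   ball.\<close>
 define c where "c = (%N. sqrt (N / (2 * pi)) ^ DIM('a) * exp (- (N / 2)))"
 have "((%t::real. t ^ DIM('a) / exp t) \<longlongrightarrow> 0) at_top" by (rule tendsto_power_div_exp_0)
 moreover have "filterlim (%n. real (Suc n) * (1/2)) at_top sequentially"
  by (rule filterlim_at_top_mult_tendsto_pos[OF tendsto_const _ filterlim_compose[OF filterlim_real_sequentially filterlim_Suc]]) simp
 ultimately have "(%n. (real (Suc n) * (1/2)) ^ DIM('a) / exp (real (Suc n) * (1/2))) \<longlonglongrightarrow> 0"
  by (rule filterlim_compose)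
 from tendsto_mult[OF tendsto_const[of "2 ^ DIM('a)"] this]
 have e0: "(%n. 2 ^ DIM('a) * ((real (Suc n) * (1/2)) ^ DIM('a) / exp (real (Suc n) * (1/2)))) \<longlonglongrightarrow> 0" by simp
 have cb: "c (real (Suc n)) \<le> 2 ^ DIM('a) * ((real (Suc n) * (1/2)) ^ DIM('a) / exp (real (Suc n) * (1/2)))" for n
 proof -
  define N where "N = real (Suc n)"
  have N: "N \<ge> 1" by (simp add: N_def)
  have "N / (2 * pi) \<le> N * N"
  proof -
   have "N * 1 \<le> N * (N * (2 * pi))" using N pi_ge_two by (intro mult_left_mono mult_ge1_I) auto
   then show ?thesis by (simp add: field_simps)
  qed
  then have "sqrt (N / (2 * pi)) \<le> N" using N by (intro real_le_lsqrt) (auto simp: power2_eq_square)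
  then have "sqrt (N / (2 * pi)) ^ DIM('a) \<le> N ^ DIM('a)" using N by (intro power_mono) auto
  then show ?thesis unfolding c_def N_def[symmetric]
   by (simp add: power_divide exp_minus field_simps divide_right_mono)
 qed
 have cn: "c (real (Suc n)) \<ge> 0" for n by (simp add: c_def)
 have c0: "(%n. c (real (Suc n))) \<longlonglongrightarrow> 0"
  by (rule tendsto_sandwich[OF _ _ tendsto_const e0]) (use cb cn in auto)
 have gb: "gaussian (real (Suc n)) (k - a) * cmod (C2 a) \<le> c (real (Suc n)) * cmod (C a)" for n a
 proof (cases "a \<in> cball k 1")
  case False
  then have "1 \<le> norm (k - a)" by (simp add: dist_norm)
  then have "1 \<le> (norm (k - a))\<^sup>2" by (simp add: one_le_power)
  then have *: "real (Suc n) * 1 \<le> real (Suc n) * (norm (k - a))\<^sup>2" by (intro mult_left_mono) auto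
  then have "gaussian (real (Suc n)) (k - a) \<le> c (real (Suc n))"
   unfolding gaussian_def c_def
   by (intro mult_left_mono iffD2[OF exp_le_cancel_iff]) (use * in linarith, simp)
  then show ?thesis using False by (simp add: C2_def mult_right_mono)
 qed (simp add: C2_def cn del: of_nat_Suc)
 have l2: "(%n. LINT a|lborel. gaussian (real (Suc n)) (k - a) *\<^sub>R C2 a) \<longlonglongrightarrow> 0"
 proof (rule Lim_null_comparison[OF always_eventually])
  show "\<forall>n. norm (LINT a|lborel. gaussian (real (Suc n)) (k - a) *\<^sub>R C2 a) \<le> c (real (Suc n)) * (LINT a|lborel. cmod (C a))"
  proof
   fix n
   have "norm (LINT a|lborel. gaussian (real (Suc n)) (k - a) *\<^sub>R C2 a) \<le> (LINT a|lborel. c (real (Suc n)) * cmod (C a))"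
    by (rule Bochner_Integration.integral_norm_bound[THEN order_trans], rule integral_mono')
     (use C gb cn in auto)
   then show "norm (LINT a|lborel. gaussian (real (Suc n)) (k - a) *\<^sub>R C2 a) \<le> c (real (Suc n)) * (LINT a|lborel. cmod (C a))"
    by simp
  qed
  show "(%n. c (real (Suc n)) * (LINT a|lborel. cmod (C a))) \<longlonglongrightarrow> 0"
   using tendsto_mult[OF c0 tendsto_const] by simp
 qed
 have gm: "gaussian (real (Suc n)) u \<le> sqrt (real (Suc n) / (2 * pi)) ^ DIM('a)" for n and u :: 'a
  by (simp add: gaussian_def mult_left_le)
 have I: "integrable lborel (%a. gaussian (real (Suc n)) (k - a) *\<^sub>R C a)" for n
  by (rule Bochner_Integration.integrable_bound[of _ "%a. (sqrt (real (Suc n) / (2 * pi)) ^ DIM('a)) *\<^sub>R C a"])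
   (use C gm in \<open>auto simp: abs_mult intro!: mult_right_mono simp del: of_nat_Suc\<close>)
 have I1: "integrable lborel (%a. indicator (cball k 1) a *\<^sub>R (gaussian (real (Suc n)) (k - a) *\<^sub>R C a))" for n
  by (rule integrable_mult_indicator[OF _ I]) simp
 have I2: "integrable lborel (%a. indicator (- cball k 1) a *\<^sub>R (gaussian (real (Suc n)) (k - a) *\<^sub>R C a))" for n
  by (rule integrable_mult_indicator[OF _ I]) simp
 have "(LINT a|lborel. gaussian (real (Suc n)) (k - a) *\<^sub>R C a) =
  (LINT a|lborel. gaussian (real (Suc n)) (k - a) *\<^sub>R C1 a) + (LINT a|lborel. gaussian (real (Suc n)) (k - a) *\<^sub>R C2 a)" for n
 proof -
  have "gaussian (real (Suc n)) (k - a) *\<^sub>R C a = indicator (cball k 1) a *\<^sub>R (gaussian (real (Suc n)) (k - a) *\<^sub>R C a)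
   + indicator (- cball k 1) a *\<^sub>R (gaussian (real (Suc n)) (k - a) *\<^sub>R C a)" for a
   by (cases "a \<in> cball k 1") simp_all
  then have "(LINT a|lborel. gaussian (real (Suc n)) (k - a) *\<^sub>R C a) =
   (LINT a|lborel. indicator (cball k 1) a *\<^sub>R (gaussian (real (Suc n)) (k - a) *\<^sub>R C a)
   + indicator (- cball k 1) a *\<^sub>R (gaussian (real (Suc n)) (k - a) *\<^sub>R C a))" by presburger
  also have "\<dots> = (LINT a|lborel. indicator (cball k 1) a *\<^sub>R (gaussian (real (Suc n)) (k - a) *\<^sub>R C a))
   + (LINT a|lborel. indicator (- cball k 1) a *\<^sub>R (gaussian (real (Suc n)) (k - a) *\<^sub>R C a))"
   by (rule Bochner_Integration.integral_add[OF I1 I2])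
  finally show ?thesis by (simp only: C1_def C2_def scaleR_left_commute)
 qed
 then show ?thesis using tendsto_add[OF l1 l2] by (simp add: C1_def)
qed

text \<open>Gaussian summation. With a Gaussian factor of width \<open>sqrt N\<close> under the
  integral, Fubini is legitimate; the factor is then removed by \<open>gaussian_mollify_L1\<close>
  on the side of \<open>C\<close> and by dominated convergence on the side of
  \<open>fourier C\<close>.\<close>

lemma fourier_inversion:
 fixes C :: "'a::euclidean_space => complex"
 assumes C: "integrable lborel C" and cont: "continuous_on UNIV C" and F: "integrable lborel (fourier C)"
 shows "C x = (LINT k|lborel. fourier C k * iexp (k \<bullet> x)) / cor ((2 * pi) ^ DIM('a))"
proof -
 have [measurable]: "C \<in> borel_measurable borel" "fourier C \<in> borel_measurable borel" using C F by auto
 let ?s = "cor ((2 * pi) ^ DIM('a))"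
 have eq: "(LINT a|lborel. gaussian N (x - a) *\<^sub>R C a)
   = (LINT u|lborel. exp (- ((norm u)\<^sup>2 / (2 * N))) * (fourier C u * iexp (u \<bullet> x))) / ?s" if "N > 0" for N
 proof -
  define c where "c = cor (sqrt (N / (2 * pi)) ^ DIM('a))"
  have ge: "cor (gaussian N (x - a))
   = c * (LINT u|lborel. cor (gaussian (1/N) u) * iexp ((x - a) \<bullet> u))" for a
   using that by (subst gaussian_fourier(2)) (auto simp: c_def gaussian_def mult.commute)
  have int: "integrable (lborel \<Otimes>\<^sub>M lborel) (%(a, u). C a * (cor (gaussian (1/N) u) * iexp ((x - a) \<bullet> u)))"
  proof (rule Bochner_Integration.integrable_bound)
   show "integrable (lborel \<Otimes>\<^sub>M lborel) (%x::'a\<times>'a. C (fst x) * cor (gaussian (1/N) (snd x)))"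
    by (rule integrable_tensor) (use C that gaussian_integral(1)[of "1/N"] in \<open>auto intro: sigma_finite_lborel integrable_of_real\<close>)
  qed (auto simp: norm_mult)
  have "(LINT a|lborel. gaussian N (x - a) *\<^sub>R C a)
   = c * (LINT a|lborel. (LINT u|lborel. C a * (cor (gaussian (1/N) u) * iexp ((x - a) \<bullet> u))))"
   unfolding scaleR_conv_of_real ge by (simp add: mult_ac flip: integral_mult_right_zero)
  also have "\<dots> = c * (LINT u|lborel. (LINT a|lborel. C a * (cor (gaussian (1/N) u) * iexp ((x - a) \<bullet> u))))"
   using lborel_pair.Fubini_integral[OF int] by simp
  also have "\<dots> = c * (LINT u|lborel. cor (gaussian (1/N) u) * (fourier C u * iexp (u \<bullet> x)))"
   unfolding fourier_def
   by (intro arg_cong2[where f="(*)"] refl Bochner_Integration.integral_cong)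
    (auto simp: inner_diff_left algebra_simps inner_commute simp flip: exp_add integral_mult_right_zero integral_mult_left_zero)
  also have "\<dots> = (LINT u|lborel. exp (- ((norm u)\<^sup>2 / (2 * N))) * (fourier C u * iexp (u \<bullet> x))) / ?s"
  proof -
   have sq: "sqrt (N / (2 * pi)) * sqrt (1 / N / (2 * pi)) = 1 / (2 * pi)"
   proof -
    have "N / (2 * pi) * (1 / N / (2 * pi)) = (1 / (2 * pi))\<^sup>2" using that by (simp add: power2_eq_square)
    then show ?thesis by (simp only: real_sqrt_mult[symmetric] real_sqrt_abs) simp
   qed
   have "c * cor (gaussian (1/N) u) = cor (exp (- ((norm u)\<^sup>2 / (2 * N)))) / ?s" for u :: 'a
   proof -
    have "sqrt (N / (2 * pi)) ^ DIM('a) * gaussian (1/N) u = (sqrt (N / (2 * pi)) * sqrt (1 / N / (2 * pi))) ^ DIM('a) * exp (- ((norm u)\<^sup>2 / (2 * N)))"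
     by (simp add: gaussian_def power_mult_distrib field_simps)
    then have "sqrt (N / (2 * pi)) ^ DIM('a) * gaussian (1/N) u = exp (- ((norm u)\<^sup>2 / (2 * N))) / (2 * pi) ^ DIM('a)"
     unfolding sq by (simp add: power_divide)
    then show ?thesis unfolding c_def of_real_mult[symmetric] of_real_divide[symmetric] by simp
   qed
   then show ?thesis
    by (simp add: mult.assoc[symmetric] flip: integral_mult_right_zero integral_divide_zero)
  qed
  finally show ?thesis .
 qed
 have "(%n. (LINT u|lborel. exp (- ((norm u)\<^sup>2 / (2 * real (Suc n)))) * (fourier C u * iexp (u \<bullet> x))) / ?s)
   \<longlonglongrightarrow> (LINT u|lborel. fourier C u * iexp (u \<bullet> x)) / ?s"
 proof (intro tendsto_divide tendsto_const integral_dominated_convergence[where w="%u. cmod (fourier C u)"])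
  show "AE u in lborel. (%n. cor (exp (- ((norm u)\<^sup>2 / (2 * real (Suc n))))) * (fourier C u * iexp (u \<bullet> x))) \<longlonglongrightarrow> fourier C u * iexp (u \<bullet> x)"
  proof (intro AE_I2)
   fix u :: 'a
   have "(%n. (norm u)\<^sup>2 / 2 * inverse (real (Suc n))) \<longlonglongrightarrow> (norm u)\<^sup>2 / 2 * 0"
    by (intro tendsto_mult tendsto_const LIMSEQ_inverse_real_of_nat)
   then have "(%n. - ((norm u)\<^sup>2 / (2 * real (Suc n)))) \<longlonglongrightarrow> - 0"
    by (intro tendsto_minus) (simp add: field_simps)
   then have "(%n. cor (exp (- ((norm u)\<^sup>2 / (2 * real (Suc n)))))) \<longlonglongrightarrow> cor (exp (- 0))"
    by (intro tendsto_of_real tendsto_exp)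
   from tendsto_mult[OF this tendsto_const]
   show "(%n. cor (exp (- ((norm u)\<^sup>2 / (2 * real (Suc n))))) * (fourier C u * iexp (u \<bullet> x))) \<longlonglongrightarrow> fourier C u * iexp (u \<bullet> x)"
    by simp
  qed
 qed (use F in \<open>auto simp: norm_mult mult_left_le_one_le\<close>)
 moreover have "(%n. LINT a|lborel. gaussian (real (Suc n)) (x - a) *\<^sub>R C a) \<longlonglongrightarrow> C x"
  by (rule gaussian_mollify_L1[OF C cont])
 ultimately show ?thesis by (simp add: eq LIMSEQ_unique del: of_nat_Suc)
qed

section \<open>Integration by parts and Riemann-Lebesgue lemmas\<close>

lemma set_integral_restrict:
 fixes g :: "real => complex"
 assumes "t \<in> {a..b}"
 shows "(LINT r:{t..b}|lborel. g r) = (LINT r|lborel. indicator {t..} r *\<^sub>R (indicator {a..b} r *\<^sub>R g r))"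
  and "(LINT r:{a..t}|lborel. g r) = (LINT r|lborel. indicator {..t} r *\<^sub>R (indicator {a..b} r *\<^sub>R g r))"
 using assms unfolding set_lebesgue_integral_def
 by (intro Bochner_Integration.integral_cong refl; auto simp: indicator_def)+

text \<open>\<open>f\<close> is a primitive running forward from \<open>a\<close> and known almost
  everywhere only; \<open>g\<close> is one running backward from \<open>b\<close>. Hence the
  separate end value \<open>fb\<close>, which may differ from \<open>f b\<close>. No differentiation
  is involved: both double integrals extend over the triangle \<open>t \<le> r\<close>, and Fubini
  identifies them.\<close>

lemma integral_by_parts_AE:
 fixes f g f' g' :: "real => complex"
 assumes ab: "a \<le> b"
  and f': "set_integrable lborel {a..b} f'" and g': "set_integrable lborel {a..b} g'"
  and fm: "set_borel_measurable borel {a..b} f" and gm: "set_borel_measurable borel {a..b} g"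
  and f: "AE t in lborel. t \<in> {a..b} \<longrightarrow> f t = fa + (LINT r:{a..t}|lborel. f' r)"
  and g: "!!t. t \<in> {a..b} ==> g t = gb + (LINT r:{t..b}|lborel. g' r)"
  and fb: "fb = fa + (LINT r:{a..b}|lborel. f' r)"
 shows "(LINT t:{a..b}|lborel. f' t * g t - f t * g' t) = fb * gb - fa * g a"
proof -
 define f1 where "f1 = (%t. indicator {a..b} t *\<^sub>R f' t)"
 define g1 where "g1 = (%t. indicator {a..b} t *\<^sub>R g' t)"
 have f1: "integrable lborel f1" and g1: "integrable lborel g1"
  using f' g' by (simp_all add: set_integrable_def f1_def g1_def)
 have [measurable]: "f1 \<in> borel_measurable borel" "g1 \<in> borel_measurable borel" using f1 g1 by auto
 let ?D = "%t r. (if t \<le> r then 1 else 0) * (f1 t * g1 r)"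
 have D: "integrable (lborel \<Otimes>\<^sub>M lborel) (%(t, r). ?D t r)"
  by (rule Bochner_Integration.integrable_bound[OF integrable_tensor[OF _ _ f1 g1]])
   (auto simp: norm_mult intro: sigma_finite_lborel)
 have eq1: "f1 t * g t = f1 t * gb + (LINT r|lborel. ?D t r)" for t
 proof (cases "t \<in> {a..b}")
  case True
  have "(LINT r:{t..b}|lborel. g' r) = (LINT r|lborel. (if t \<le> r then 1 else 0) * g1 r)"
   unfolding set_integral_restrict(1)[OF True] g1_def
   by (intro Bochner_Integration.integral_cong) (auto simp: indicator_def)
  then show ?thesis
   by (simp add: g[OF True] distrib_left mult.left_commute flip: integral_mult_right_zero)
 qed (simp add: f1_def)
 have eq2: "AE t in lborel. f t * g1 t = fa * g1 t + (LINT r|lborel. ?D r t)"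
  using f
 proof eventually_elim
  case (elim t)
  show ?case
  proof (cases "t \<in> {a..b}")
   case True
   have "(LINT r:{a..t}|lborel. f' r) = (LINT r|lborel. (if r \<le> t then 1 else 0) * f1 r)"
    unfolding set_integral_restrict(2)[OF True] f1_def
    by (intro Bochner_Integration.integral_cong) (auto simp: indicator_def)
   moreover have "(LINT r|lborel. ?D r t) = (LINT r|lborel. (if r \<le> t then 1 else 0) * f1 r) * g1 t"
    by (simp only: mult.assoc integral_mult_left_zero flip: mult.assoc)
   ultimately show ?thesis using elim True by (simp add: distrib_right)
  qed (simp add: g1_def)
 qed
 have i1: "integrable lborel (%t. LINT r|lborel. ?D t r)" using lborel_pair.integrable_fst[OF D] by simp
 have i2: "integrable lborel (%t. LINT r|lborel. ?D r t)" using lborel_pair.integrable_snd[OF D] by simp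
 have m1: "(%t. f t * g1 t) \<in> borel_measurable borel"
 proof -
  have "(%t. f t * g1 t) = (%t. (indicator {a..b} t *\<^sub>R f t) * g1 t)" by (auto simp: g1_def indicator_def)
  moreover have [measurable]: "(%t. indicator {a..b} t *\<^sub>R f t) \<in> borel_measurable borel"
   using fm unfolding set_borel_measurable_def by simp
  have "(%t. (indicator {a..b} t *\<^sub>R f t) * g1 t) \<in> borel_measurable borel" by measurable
  ultimately show ?thesis by metis
 qed
 have F: "integrable lborel (%t. f1 t * g t)" unfolding eq1 using f1 i1 by simp
 have G: "integrable lborel (%t. f t * g1 t)"
  by (subst integrable_cong_AE[OF _ _ eq2]) (use g1 i2 m1 in auto)
 have "(LINT t:{a..b}|lborel. f' t * g t - f t * g' t) = (LINT t|lborel. f1 t * g t - f t * g1 t)"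
  unfolding set_lebesgue_integral_def f1_def g1_def by (intro Bochner_Integration.integral_cong) (auto simp: indicator_def)
 also have "\<dots> = (LINT t|lborel. f1 t * g t) - (LINT t|lborel. f t * g1 t)"
  using F G by simp
 also have "(LINT t|lborel. f1 t * g t) = integral\<^sup>L lborel f1 * gb + (LINT t|lborel. LINT r|lborel. ?D t r)"
  unfolding eq1 using f1 i1 by simp
 also have "(LINT t|lborel. f t * g1 t) = fa * integral\<^sup>L lborel g1 + (LINT t|lborel. LINT r|lborel. ?D r t)"
  by (subst integral_cong_AE[OF _ _ eq2]) (use g1 i2 m1 in auto)
 also have "(LINT t|lborel. LINT r|lborel. ?D r t) = (LINT t|lborel. LINT r|lborel. ?D t r)"
  using lborel_pair.Fubini_integral[OF D] by simp
 also have "integral\<^sup>L lborel f1 = fb - fa" by (simp add: fb set_lebesgue_integral_def f1_def)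
 also have "integral\<^sup>L lborel g1 = g a - gb" using g[of a] ab by (simp add: set_lebesgue_integral_def g1_def)
 finally show ?thesis by (simp add: algebra_simps)
qed

text \<open>A weak form of \<open>(F, G)' = (F', G) - (F, G')\<close> for a forward quantity \<open>F\<close>
 (with derivative \<open>F'\<close>) paired with a backward quantity \<open>G\<close> (with derivative \<open>- G'\<close>).\<close>
lemma pairing_identity:
 fixes F F' G G' :: "real => 'y => complex"
 assumes Y: "sigma_finite_measure Y" and ab: "a \<le> b"
  and [measurable]: "(%(t, y). F t y) \<in> borel_measurable (borel \<Otimes>\<^sub>M Y)"
   "(%(t, y). F' t y) \<in> borel_measurable (borel \<Otimes>\<^sub>M Y)"
   "(%(t, y). G t y) \<in> borel_measurable (borel \<Otimes>\<^sub>M Y)"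
   "(%(t, y). G' t y) \<in> borel_measurable (borel \<Otimes>\<^sub>M Y)"
  and iF: "integrable (lborel \<Otimes>\<^sub>M Y) (%(t, y). indicator {a..b} t *\<^sub>R F t y)"
  and iF': "integrable (lborel \<Otimes>\<^sub>M Y) (%(t, y). indicator {a..b} t *\<^sub>R F' t y)"
  and Fa: "integrable Y (F a)" and Fb: "integrable Y (F b)"
  and F: "!!t. t \<in> {a..b} ==> AE y in Y. F t y = F a y + (LINT r:{a..t}|lborel. F' r y)"
  and B: "!!t y. t \<in> {a..b} ==> y \<in> space Y ==> cmod (G t y) \<le> B" "!!t y. t \<in> {a..b} ==> y \<in> space Y ==> cmod (G' t y) \<le> B"
  and G: "!!t y. t \<in> {a..b} ==> y \<in> space Y ==> G t y = G b y + (LINT r:{t..b}|lborel. G' r y)"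
 shows "(LINT y|Y. F b y * G b y) - (LINT y|Y. F a y * G a y)
  = (LINT t:{a..b}|lborel. (LINT y|Y. F' t y * G t y - F t y * G' t y))"
proof -
 interpret Y: sigma_finite_measure Y by fact
 interpret P: pair_sigma_finite lborel Y by standard
 let ?H = "%(t, y). indicator {a..b} t *\<^sub>R (F' t y * G t y - F t y * G' t y)"
 have bd: "cmod (u * G t y) \<le> \<bar>B\<bar> * cmod u" "cmod (u * G' t y) \<le> \<bar>B\<bar> * cmod u"
  if "t \<in> {a..b}" "y \<in> space Y" for t y u
  using B[OF that] by (auto simp: norm_mult mult.commute[of "\<bar>B\<bar>"] intro!: mult_left_mono)
 have H1: "integrable (lborel \<Otimes>\<^sub>M Y) (%(t, y). indicator {a..b} t *\<^sub>R (F' t y * G t y))"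
  by (rule Bochner_Integration.integrable_bound[OF integrable_mult_right[OF iF', of B]], measurable)
   (auto simp: space_pair_measure norm_mult bd[unfolded norm_mult] split: split_indicator intro!: AE_I2)
 have H2: "integrable (lborel \<Otimes>\<^sub>M Y) (%(t, y). indicator {a..b} t *\<^sub>R (F t y * G' t y))"
  by (rule Bochner_Integration.integrable_bound[OF integrable_mult_right[OF iF, of B]], measurable)
   (auto simp: space_pair_measure norm_mult bd[unfolded norm_mult] split: split_indicator intro!: AE_I2)
 have H: "integrable (lborel \<Otimes>\<^sub>M Y) ?H"
  using Bochner_Integration.integrable_diff[OF H1 H2]
  by (rule Bochner_Integration.integrable_cong[THEN iffD1, rotated 2]) (auto simp: scaleR_diff_right)
 have iFb: "integrable Y (%y. F b y * G b y)"
  by (rule Bochner_Integration.integrable_bound[OF integrable_mult_right[OF Fb, of B]])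
   (use ab in \<open>auto intro!: AE_I2 simp: norm_mult bd[unfolded norm_mult]\<close>)
 have iFa: "integrable Y (%y. F a y * G a y)"
  by (rule Bochner_Integration.integrable_bound[OF integrable_mult_right[OF Fa, of B]])
   (use ab in \<open>auto intro!: AE_I2 simp: norm_mult bd[unfolded norm_mult]\<close>)
 \<comment> \<open>The forward equation holds for each \<open>t\<close> off a null set of
   \<open>y\<close> that may depend on \<open>t\<close>. Joint measurability allows the two
   almost-everywhere quantifiers to be exchanged, so that the one-dimensional formula applies for
   almost every fixed \<open>y\<close>.\<close>
 have ae1: "AE y in Y. AE t in lborel. t \<in> {a..b} \<longrightarrow> F t y = F a y + (LINT r:{a..t}|lborel. F' r y)"
 proof (subst P.AE_commute[symmetric])
  have [measurable]: "(%x. LINT r:{a..fst x}|lborel. F' r (snd x)) \<in> borel_measurable (borel \<Otimes>\<^sub>M Y)"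
  proof -
   have "(%x. LINT r:{a..fst x}|lborel. F' r (snd x)) = (%x. LINT r|lborel. (if a \<le> r \<and> r \<le> fst x then F' r (snd x) else 0))"
    unfolding set_lebesgue_integral_def by (intro ext Bochner_Integration.integral_cong) auto
   also have "\<dots> \<in> borel_measurable (borel \<Otimes>\<^sub>M Y)" by measurable
   finally show ?thesis .
  qed
  show "{x \<in> space (lborel \<Otimes>\<^sub>M Y). fst x \<in> {a..b} \<longrightarrow> F (fst x) (snd x) = F a (snd x) + (LINT r:{a..fst x}|lborel. F' r (snd x))} \<in> sets (lborel \<Otimes>\<^sub>M Y)"
   by measurable
  show "AE t in lborel. AE y in Y. t \<in> {a..b} \<longrightarrow> F t y = F a y + (LINT r:{a..t}|lborel. F' r y)"
   using F by auto
 qed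
 have Fb': "AE y in Y. F b y = F a y + (LINT r:{a..b}|lborel. F' r y)" using F[of b] ab by simp
 have ae2: "AE y in Y. integrable lborel (%t. indicator {a..b} t *\<^sub>R F' t y)"
  using P.AE_integrable_snd[OF iF'] by simp
 have "(LINT y|Y. F b y * G b y) - (LINT y|Y. F a y * G a y) = (LINT y|Y. F b y * G b y - F a y * G a y)"
  using iFa iFb by simp
 also have "\<dots> = (LINT y|Y. LINT t|lborel. ?H (t, y))"
 proof (rule integral_cong_AE)
  show "(%y. LINT t|lborel. ?H (t, y)) \<in> borel_measurable Y" by measurable
  show "AE y in Y. F b y * G b y - F a y * G a y = (LINT t|lborel. ?H (t, y))"
   using ae1 ae2 Fb' AE_space
  proof eventually_elim
   case (elim y)
   have "(LINT t:{a..b}|lborel. F' t y * G t y - F t y * G' t y) = F b y * G b y - F a y * G a y"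
   proof (rule integral_by_parts_AE[OF ab])
    show "set_integrable lborel {a..b} (%t. G' t y)"
     unfolding set_integrable_def
    proof (rule Bochner_Integration.integrable_bound[where f="%t. B * indicator {a..b} t"])
     show "AE x in lborel. norm (indicator {a..b} x *\<^sub>R G' x y) \<le> norm (B * indicator {a..b} x)"
      using order_trans[OF B(2) abs_ge_self, of _ y] elim(4) by (intro AE_I2) (auto split: split_indicator)
     show "integrable lborel (%t. B * indicator {a..b} t)"
      by (simp add: emeasure_lborel_Icc_eq)
     show "(%x. indicator {a..b} x *\<^sub>R G' x y) \<in> borel_measurable lborel"
      using elim(4) by measurable
    qed
    show "G t y = G b y + (LINT r:{t..b}|lborel. G' r y)" if "t \<in> {a..b}" for t
     using that elim(4) by (rule G)
    show "set_borel_measurable borel {a..b} (%t. F t y)" "set_borel_measurable borel {a..b} (%t. G t y)"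
     unfolding set_borel_measurable_def using elim(4) by measurable
   qed (use elim in \<open>auto simp: set_integrable_def\<close>)
   then show ?case by (simp add: set_lebesgue_integral_def)
  qed
 qed (use ab in measurable)
 also have "\<dots> = (LINT t|lborel. LINT y|Y. ?H (t, y))"
  using P.Fubini_integral[of "%t y. ?H (t, y)"] H by (simp add: case_prod_beta')
 also have "\<dots> = (LINT t:{a..b}|lborel. (LINT y|Y. F' t y * G t y - F t y * G' t y))"
  unfolding set_lebesgue_integral_def by (intro Bochner_Integration.integral_cong) (auto simp: indicator_def)
 finally show ?thesis .
qed

text \<open>Density in L1: half-lines are closed under intersection and generate the Borel sets,
  which settles indicators cut to \<open>{0..L}\<close>; linearity gives simple functions and
  approximation gives the rest.\<close>

lemma integrable_induct_L1:
 fixes f :: "real => complex"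
 assumes f: "integrable lborel f"
  and iv: "!!a. P (%s. indicator {..a} s *\<^sub>R (indicator {0..L} s :: complex))"
  and scale: "!!f c. integrable lborel f ==> P f ==> P (%s. c * f s)"
  and add: "!!f g. integrable lborel f ==> integrable lborel g ==> P f ==> P g ==> P (%s. f s + g s)"
  and lim: "!!f g. integrable lborel g ==> (!!i. integrable lborel (f i)) ==> (!!i. P (f i)) ==>
   (%i. LINT s|lborel. cmod (f i s - g s)) \<longlonglongrightarrow> 0 ==> P g"
 shows "P (%s. indicator {0..L} s *\<^sub>R f s)"
proof -
 have ii: "integrable lborel (%s. indicator A s *\<^sub>R (indicator {0..L} s :: complex))" if [measurable]: "A \<in> sets borel" for A
 proof -
  have "integrable lborel (%s. cor (indicator {0..L} s))"
   by (intro integrable_of_real integrable_real_indicator) (auto simp: emeasure_lborel_Icc_eq)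
  then have "integrable lborel (indicator {0..L} :: real => complex)"
   by (simp add: of_real_indicator)
  then show ?thesis by (intro integrable_mult_indicator) auto
 qed
 have set: "P (%s. indicator A s *\<^sub>R (indicator {0..L} s :: complex))" if "A \<in> sets borel" for A
 proof -
  have "Int_stable (range (%a::real. {..a}))" by (auto simp: Int_stable_def)
  moreover have "range (%a::real. {..a}) \<subseteq> Pow UNIV" by auto
  moreover have "A \<in> sigma_sets UNIV (range (%a::real. {..a}))"
   using that unfolding borel_eq_atMost by (simp add: sets_measure_of)
  ultimately show ?thesis
  proof (induct rule: sigma_sets_induct_disjoint)
   case (basic A) then show ?case using iv by auto
  next
   case empty
   show ?case using scale[OF ii[of "{..0}"] iv, where c=0] by simp
  next
   case (compl A)
   have [measurable]: "A \<in> sets borel" using compl(1) unfolding borel_eq_atMost by (simp add: sets_measure_of)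
   \<comment> \<open>After multiplication by the indicator of \<open>{0..L}\<close>, the half-line
     \<open>{..L}\<close> plays the part of the whole space, so the complement is a
     difference.\<close>
   have "P (%s. indicator {..L} s *\<^sub>R (indicator {0..L} s :: complex) + (- 1) * (indicator A s *\<^sub>R (indicator {0..L} s :: complex)))"
    by (intro add scale iv compl ii integrable_mult_right) auto
   also have "(%s. indicator {..L} s *\<^sub>R (indicator {0..L} s :: complex) + (- 1) * (indicator A s *\<^sub>R (indicator {0..L} s :: complex)))
    = (%s. indicator (UNIV - A) s *\<^sub>R (indicator {0..L} s :: complex))"
    by (auto split: split_indicator)
   finally show ?case .
  next
   case (union A)
   have [measurable]: "A i \<in> sets borel" for i using union(2) unfolding borel_eq_atMost by (auto simp: sets_measure_of)
   have fin: "P (%s. indicator (\<Union>i<n. A i) s *\<^sub>R (indicator {0..L} s :: complex))" for n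
   proof (induct n)
    case 0 show ?case using scale[OF ii[of "{..0}"] iv, where c=0] by simp
   next
    case (Suc n)
    have "indicator (\<Union>i<Suc n. A i) s *\<^sub>R (indicator {0..L} s :: complex) =
     indicator (\<Union>i<n. A i) s *\<^sub>R indicator {0..L} s + indicator (A n) s *\<^sub>R indicator {0..L} s" for s
    proof -
     have "s \<notin> A i" if "s \<in> A n" "i < n" for i
      using disjoint_family_onD[OF union(1), of i n] that by auto
     then show ?thesis by (auto simp: lessThan_Suc split: split_indicator)
    qed
    then show ?case using add[OF ii ii Suc union(3)[of n]] by simp
   qed
   show ?case
   proof (rule lim[OF ii _ fin])
    have "(%i. LINT s|lborel. cmod (indicator (\<Union>i<i. A i) s *\<^sub>R (indicator {0..L} s :: complex) - indicator (\<Union>(range A)) s *\<^sub>R indicator {0..L} s))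
     \<longlonglongrightarrow> (LINT s|(lborel::real measure). 0)"
    proof (rule integral_dominated_convergence[where w="indicator {0..L}"])
     show "AE s in lborel. (%i. cmod (indicator (\<Union>i<i. A i) s *\<^sub>R (indicator {0..L} s :: complex) - indicator (\<Union>(range A)) s *\<^sub>R indicator {0..L} s)) \<longlonglongrightarrow> 0"
     proof (intro AE_I2)
      fix s
      have "eventually (%i. cmod (indicator (\<Union>i<i. A i) s *\<^sub>R (indicator {0..L} s :: complex) - indicator (\<Union>(range A)) s *\<^sub>R indicator {0..L} s) = 0) sequentially"
      proof (cases "s \<in> \<Union>(range A)")
       case True
       then obtain j where "s \<in> A j" by auto
       then show ?thesis by (intro eventually_sequentiallyI[of "Suc j"]) (auto split: split_indicator)
      qed (auto intro!: always_eventually split: split_indicator)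
      then show "(%i. cmod (indicator (\<Union>i<i. A i) s *\<^sub>R (indicator {0..L} s :: complex) - indicator (\<Union>(range A)) s *\<^sub>R indicator {0..L} s)) \<longlonglongrightarrow> 0"
       by (rule tendsto_eventually)
     qed
    qed (auto simp: emeasure_lborel_Icc_eq split: split_indicator)
    then show "(%i. LINT s|lborel. cmod (indicator (\<Union>i<i. A i) s *\<^sub>R (indicator {0..L} s :: complex) - indicator (\<Union>(range A)) s *\<^sub>R indicator {0..L} s)) \<longlonglongrightarrow> 0"
     by simp
   qed (auto intro!: ii)
  qed
 qed
 show ?thesis
  using f
 proof (induct rule: integrable_induct)
  case (base A c)
  have "A \<in> sets borel" using base by simp
  from scale[OF ii[OF this] set[OF this], of c] show ?case
   by (rule back_subst[of P]) (auto split: split_indicator)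
 next
  case (add f g)
  have "P (%s. indicator {0..L} s *\<^sub>R f s + indicator {0..L} s *\<^sub>R g s)"
   using add by (intro assms(4) integrable_mult_indicator) auto
  then show ?case by (simp add: scaleR_add_right)
 next
  case (lim f s)
  show ?case
  proof (rule assms(5)[of _ "%i t. indicator {0..L} t *\<^sub>R s i t"])
   have "(%i. LINT t|lborel. cmod (indicator {0..L} t *\<^sub>R s i t - indicator {0..L} t *\<^sub>R f t)) \<longlonglongrightarrow> (LINT t|(lborel::real measure). 0)"
   proof (rule integral_dominated_convergence[where w="%t. 3 * cmod (f t)"])
    show "AE x in lborel. (%i. cmod (indicator {0..L} x *\<^sub>R s i x - indicator {0..L} x *\<^sub>R f x)) \<longlonglongrightarrow> 0"
    proof (intro AE_I2)
     fix x :: real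
     have "(%i. cmod (indicator {0..L} x *\<^sub>R s i x - indicator {0..L} x *\<^sub>R f x)) \<longlonglongrightarrow> cmod (indicator {0..L} x *\<^sub>R f x - indicator {0..L} x *\<^sub>R f x)"
      by (intro tendsto_norm tendsto_diff tendsto_scaleR tendsto_const lim(3)) simp
     then show "(%i. cmod (indicator {0..L} x *\<^sub>R s i x - indicator {0..L} x *\<^sub>R f x)) \<longlonglongrightarrow> 0" by simp
    qed
    show "AE x in lborel. norm (cmod (indicator {0..L} x *\<^sub>R s i x - indicator {0..L} x *\<^sub>R f x)) \<le> 3 * cmod (f x)" for i
    proof (intro AE_I2)
     fix x :: real
     have "cmod (s i x - f x) \<le> cmod (s i x) + cmod (f x)" by (rule norm_triangle_ineq4)
     then show "norm (cmod (indicator {0..L} x *\<^sub>R s i x - indicator {0..L} x *\<^sub>R f x)) \<le> 3 * cmod (f x)"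
      using lim(4)[of x i] by (auto split: split_indicator)
    qed
   qed (use lim in auto)
   then show "(%i. LINT t|lborel. cmod (indicator {0..L} t *\<^sub>R s i t - indicator {0..L} t *\<^sub>R f t)) \<longlonglongrightarrow> 0" by simp
  qed (use lim in \<open>auto intro!: integrable_mult_indicator\<close>)
 qed
qed

lemma iexp_integral_bound:
 assumes "\<theta> \<noteq> 0" "a \<le> b"
 shows "cmod (LINT s:{a..b}|lborel. iexp (s * \<theta>)) \<le> 2 / \<bar>\<theta>\<bar>"
proof -
 have "(LINT s|lborel. indicator {a..b} s *\<^sub>R iexp (s * \<theta>)) = iexp (b * \<theta>) / (\<i> * \<theta>) - iexp (a * \<theta>) / (\<i> * \<theta>)"
 proof (rule integral_FTC_atLeastAtMost[OF assms(2)])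
  show "((%s. iexp (s * \<theta>) / (\<i> * \<theta>)) has_vector_derivative iexp (x * \<theta>)) (at x within {a..b})" for x
  proof -
   have "((%z. exp (\<i> * (z * \<theta>)) / (\<i> * \<theta>)) has_field_derivative
    exp (\<i> * (cor x * \<theta>)) * (\<i> * \<theta>) / (\<i> * \<theta>)) (at (cor x))"
    by (rule DERIV_cdivide) (auto intro!: derivative_eq_intros)
   then have "((%z. exp (\<i> * (z * \<theta>)) / (\<i> * \<theta>)) has_field_derivative
    exp (\<i> * (cor x * \<theta>))) (at (cor x))"
    using assms(1) by simp
   from has_vector_derivative_real_field[OF this] show ?thesis by simp
  qed
  show "continuous_on {a..b} (%s. iexp (s * \<theta>))" by (intro continuous_intros)
 qed
 also have "cmod \<dots> \<le> cmod (iexp (b * \<theta>) / (\<i> * \<theta>)) + cmod (iexp (a * \<theta>) / (\<i> * \<theta>))"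
  by (rule norm_triangle_ineq4)
 also have "\<dots> = 2 / \<bar>\<theta>\<bar>" by (simp add: norm_divide norm_mult)
 finally show ?thesis by (simp add: set_lebesgue_integral_def)
qed

text \<open>The Riemann-Lebesgue lemma with an amplitude that changes with \<open>n\<close>: uniform
  bounds on \<open>\<phi> n\<close> and on its derivative \<open>- \<phi>' n\<close> replace
  convergence. For the indicator of a half-line one integration by parts gains the reciprocal of the
  frequency, and density in L1 does the rest.\<close>

lemma oscillatory_integral_tendsto_0:
 fixes f :: "real => complex" and \<phi> \<phi>' :: "nat => real => complex"
 assumes f: "set_integrable lborel {0..L} f" and L: "L \<ge> 0"
  and \<theta>: "filterlim (%n. \<bar>\<theta> n\<bar>) at_top sequentially"
  and [measurable]: "!!n. \<phi> n \<in> borel_measurable borel" "!!n. \<phi>' n \<in> borel_measurable borel"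
  and B: "!!n s. s \<in> {0..L} ==> cmod (\<phi> n s) \<le> B" "!!n s. s \<in> {0..L} ==> cmod (\<phi>' n s) \<le> B"
  and \<phi>: "!!n s. s \<in> {0..L} ==> \<phi> n s = \<phi> n L + (LINT r:{s..L}|lborel. \<phi>' n r)"
 shows "(%n. LINT s:{0..L}|lborel. f s * iexp (s * \<theta> n) * \<phi> n s) \<longlonglongrightarrow> 0"
proof -
 let ?I = "%f n. LINT s|lborel. f s * (indicator {0..L} s *\<^sub>R (iexp (s * \<theta> n) * \<phi> n s))"
 define P where "P = (%f. (%n. ?I f n) \<longlonglongrightarrow> 0)"
 have B0: "B \<ge> 0" using B(1)[of 0 0] L norm_ge_zero[of "\<phi> 0 0"] by (simp, linarith)
 have kb: "cmod (f * (indicator {0..L} s *\<^sub>R (iexp (s * \<theta> n) * \<phi> n s))) \<le> B * cmod f" for f :: complex and s n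
  using B(1)[of s n] B0 by (auto simp: norm_mult mult.commute[of B] split: split_indicator intro!: mult_left_mono)
 have ki: "integrable lborel (%s. f s * (indicator {0..L} s *\<^sub>R (iexp (s * \<theta> n) * \<phi> n s)))" if "integrable lborel f" for f n
  using that kb B0 by (intro Bochner_Integration.integrable_bound[OF integrable_mult_right[OF that, of "cor B"]])
   (auto intro!: AE_I2 simp: norm_mult[of "cor B"])
 have "P (%s. indicator {0..L} s *\<^sub>R (indicator {0..L} s *\<^sub>R f s))"
 proof (rule integrable_induct_L1)
  show "integrable lborel (%s. indicator {0..L} s *\<^sub>R f s)" using f by (simp add: set_integrable_def)
 next
  fix a
  have bound: "cmod (?I (%s. indicator {..a} s *\<^sub>R (indicator {0..L} s :: complex)) n) \<le> 2 / \<bar>\<theta> n\<bar> * (B + L * B)" if "\<theta> n \<noteq> 0" for n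
  proof -
   define g where "g = (%s. indicator {..a} s *\<^sub>R iexp (s * \<theta> n))"
   \<comment> \<open>A primitive of the truncated exponential. It stays below
     \<open>2 / \<bar>\<theta> n\<bar>\<close> at all times, so after integration by parts the large
     frequency sits in the denominator.\<close>
   define F where "F = (%t. LINT r:{0..t}|lborel. g r)"
   have [measurable]: "g \<in> borel_measurable borel" unfolding g_def by measurable
   have [measurable]: "F \<in> borel_measurable borel"
   proof -
    have "F = (%t. LINT r|lborel. (if 0 \<le> r \<and> r \<le> t then g r else 0))"
     unfolding F_def set_lebesgue_integral_def by (intro ext Bochner_Integration.integral_cong) auto
    also have "\<dots> \<in> borel_measurable borel" by measurable
    finally show ?thesis .
   qed
   have Fb: "cmod (F t) \<le> 2 / \<bar>\<theta> n\<bar>" for t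
   proof (cases "0 \<le> min t a")
    case True
    have "F t = (LINT s:{0..min t a}|lborel. iexp (s * \<theta> n))"
     unfolding F_def g_def set_lebesgue_integral_def by (intro Bochner_Integration.integral_cong) (auto split: split_indicator)
    then show ?thesis using iexp_integral_bound[OF that True] by simp
   next
    case False
    have "F t = (LINT s|(lborel::real measure). 0)"
     unfolding F_def g_def set_lebesgue_integral_def using False by (intro Bochner_Integration.integral_cong) (auto split: split_indicator)
    then show ?thesis by simp
   qed
   have *: "(LINT t:{0..L}|lborel. g t * \<phi> n t - F t * \<phi>' n t) = F L * \<phi> n L - 0 * \<phi> n 0"
   proof (rule integral_by_parts_AE[OF L])
    show "set_integrable lborel {0..L} g" unfolding set_integrable_def
     by (rule Bochner_Integration.integrable_bound[of _ "indicator {0..L} :: real => real"])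
      (auto simp: emeasure_lborel_Icc_eq g_def split: split_indicator)
    show "set_integrable lborel {0..L} (\<phi>' n)" unfolding set_integrable_def
     by (rule Bochner_Integration.integrable_bound[of _ "%s. B * indicator {0..L} s"])
      (use B B0 in \<open>auto simp: emeasure_lborel_Icc_eq split: split_indicator\<close>)
    show "set_borel_measurable borel {0..L} F" "set_borel_measurable borel {0..L} (\<phi> n)"
     unfolding set_borel_measurable_def by measurable
    show "\<phi> n t = \<phi> n L + (LINT r:{t..L}|lborel. \<phi>' n r)" if "t \<in> {0..L}" for t
     using that by (rule \<phi>)
   qed (simp_all add: F_def)
   have i1: "integrable lborel (%s. indicator {0..L} s *\<^sub>R (g s * \<phi> n s))"
    by (rule Bochner_Integration.integrable_bound[of _ "%s. B * indicator {0..L} s"])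
     (use B B0 in \<open>auto simp: emeasure_lborel_Icc_eq g_def norm_mult split: split_indicator\<close>)
   have i2b: "cmod (indicator {0..L} s *\<^sub>R (F s * \<phi>' n s)) \<le> 2 / \<bar>\<theta> n\<bar> * B * indicator {0..L} s" for s
    proof (cases "s \<in> {0..L}")
    case True
    then show ?thesis using mult_mono[OF Fb[of s] B(2)[of s n]] by (simp add: norm_mult)
   qed simp
   have i2: "integrable lborel (%s. indicator {0..L} s *\<^sub>R (F s * \<phi>' n s))"
    by (rule Bochner_Integration.integrable_bound[of _ "%s. 2 / \<bar>\<theta> n\<bar> * B * indicator {0..L} s"])
     (use order_trans[OF i2b abs_ge_self] in \<open>auto simp: emeasure_lborel_Icc_eq\<close>)
   have "?I (%s. indicator {..a} s *\<^sub>R (indicator {0..L} s :: complex)) n = (LINT s|lborel. indicator {0..L} s *\<^sub>R (g s * \<phi> n s))"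
    by (intro Bochner_Integration.integral_cong) (auto simp: g_def split: split_indicator)
   also have "\<dots> = F L * \<phi> n L + (LINT s|lborel. indicator {0..L} s *\<^sub>R (F s * \<phi>' n s))"
    using * i1 i2 by (simp add: set_lebesgue_integral_def scaleR_diff_right diff_eq_eq)
   also have "cmod \<dots> \<le> 2 / \<bar>\<theta> n\<bar> * B + 2 / \<bar>\<theta> n\<bar> * B * L"
   proof (rule norm_triangle_mono)
    show "cmod (F L * \<phi> n L) \<le> 2 / \<bar>\<theta> n\<bar> * B"
     unfolding norm_mult using Fb[of L] B(1)[of L n] L by (intro mult_mono) auto
    have "cmod (LINT s|lborel. indicator {0..L} s *\<^sub>R (F s * \<phi>' n s)) \<le> (LINT s|lborel. 2 / \<bar>\<theta> n\<bar> * B * indicator {0..L} s)"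
     by (rule Bochner_Integration.integral_norm_bound[THEN order_trans], rule integral_mono)
      (use integrable_norm[OF i2] i2b in \<open>auto simp: emeasure_lborel_Icc_eq simp del: norm_scaleR\<close>)
    then show "cmod (LINT s|lborel. indicator {0..L} s *\<^sub>R (F s * \<phi>' n s)) \<le> 2 / \<bar>\<theta> n\<bar> * B * L"
     using L by simp
   qed
   also have "2 / \<bar>\<theta> n\<bar> * B + 2 / \<bar>\<theta> n\<bar> * B * L = 2 / \<bar>\<theta> n\<bar> * (B + L * B)"
    by (simp add: distrib_left)
   finally show ?thesis .
  qed
  have "eventually (%n. \<bar>\<theta> n\<bar> > 0) sequentially" using \<theta> unfolding filterlim_at_top_dense by blast
  then have "eventually (%n. cmod (?I (%s. indicator {..a} s *\<^sub>R (indicator {0..L} s :: complex)) n) \<le> 2 / \<bar>\<theta> n\<bar> * (B + L * B)) sequentially"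
   by eventually_elim (rule bound, simp)
  moreover have "(%n. 2 / \<bar>\<theta> n\<bar> * (B + L * B)) \<longlonglongrightarrow> 0"
   using tendsto_divide_0[OF tendsto_const[of "2 * B + 2 * (L * B)"] filterlim_at_top_imp_at_infinity[OF \<theta>]]
   by (simp add: distrib_left add_divide_distrib)
  ultimately show "P (%s. indicator {..a} s *\<^sub>R (indicator {0..L} s :: complex))"
   unfolding P_def by (rule Lim_null_comparison)
 next
  fix f :: "real => complex" and c assume "integrable lborel f" "P f"
  moreover have "?I (%s. c * f s) n = c * ?I f n" for n by (simp only: mult.assoc integral_mult_right_zero)
  ultimately show "P (%s. c * f s)" unfolding P_def
   using tendsto_mult[OF tendsto_const[of c], of "%n. ?I f n" 0] by (simp only: mult_zero_right)
 next
  fix f g :: "real => complex" assume fg: "integrable lborel f" "integrable lborel g" "P f" "P g"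
  have "?I (%s. f s + g s) n = ?I f n + ?I g n" for n
   by (simp only: distrib_right Bochner_Integration.integral_add[OF ki[OF fg(1)] ki[OF fg(2)]])
  then show "P (%s. f s + g s)" using fg(3,4) unfolding P_def
   using tendsto_add[of "%n. ?I f n" 0 sequentially "%n. ?I g n" 0] by (simp only: add_0_left)
 next
  fix f and g :: "real => complex"
  assume g: "integrable lborel g" and f: "!!i. integrable lborel (f i)" and P: "!!i. P (f i)"
   and l: "(%i. LINT s|lborel. cmod (f i s - g s)) \<longlonglongrightarrow> (0::real)"
  \<comment> \<open>This error is bounded uniformly in \<open>n\<close>, which is what allows the
    limits in \<open>i\<close> and \<open>n\<close> to be exchanged.\<close>
  have d: "cmod (?I (f i) n - ?I g n) \<le> B * (LINT s|lborel. cmod (f i s - g s))" for i n :: nat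
  proof -
   have "?I (f i) n - ?I g n = ?I (%s. f i s - g s) n"
    by (simp only: left_diff_distrib Bochner_Integration.integral_diff[OF ki[OF f] ki[OF g]])
   also have "cmod \<dots> \<le> (LINT s|lborel. B * cmod (f i s - g s))"
    by (rule Bochner_Integration.integral_norm_bound[THEN order_trans], rule integral_mono)
     (use f g kb integrable_norm[OF ki[OF Bochner_Integration.integrable_diff[OF f g]]] in \<open>simp_all only: integrable_mult_right integrable_norm Bochner_Integration.integrable_diff kb\<close>)
   finally show ?thesis by simp
  qed
  show "P g" unfolding P_def
  proof (rule LIMSEQ_I)
   fix e :: real assume "e > 0"
   have "(%i. B * (LINT s|lborel. cmod (f i s - g s))) \<longlonglongrightarrow> B * 0" by (intro tendsto_mult tendsto_const l)
   then have "\<exists>i. \<forall>n\<ge>i. norm (B * (LINT s|lborel. cmod (f n s - g s)) - B * 0) < e / 2"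
    by (rule LIMSEQ_D) (use \<open>e > 0\<close> in simp)
   then obtain i where "\<forall>n\<ge>i. norm (B * (LINT s|lborel. cmod (f n s - g s)) - B * 0) < e / 2" by (rule exE)
   from this[rule_format, of i] have i: "B * (LINT s|lborel. cmod (f i s - g s)) < e / 2" by simp
   have "\<exists>N. \<forall>n\<ge>N. norm (?I (f i) n - 0) < e / 2"
    by (rule LIMSEQ_D[OF P[of i, unfolded P_def]]) (use \<open>e > 0\<close> in simp)
   then obtain N where "\<forall>n\<ge>N. norm (?I (f i) n - 0) < e / 2" by (rule exE)
   then have N: "cmod (?I (f i) n) < e / 2" if "n \<ge> N" for n using that by (simp only: diff_zero)
   show "\<exists>no. \<forall>n\<ge>no. norm (?I g n - 0) < e"
   proof (intro exI[of _ N] allI impI)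
    fix n assume "N \<le> n"
    have "cmod (?I g n) \<le> cmod (?I (f i) n) + cmod (?I (f i) n - ?I g n)"
     using norm_triangle_sub[of "?I g n" "?I (f i) n"] by (simp only: norm_minus_commute)
    then show "norm (?I g n - 0) < e" using N[OF \<open>N \<le> n\<close>] d[of i n] i unfolding diff_zero by linarith
   qed
  qed
 qed
 then show ?thesis unfolding P_def set_lebesgue_integral_def
  by (rule back_subst[of "%x. x \<longlonglongrightarrow> 0"])
   (intro ext Bochner_Integration.integral_cong refl, auto split: split_indicator)
qed

text \<open>The frequency depends on a parameter \<open>y\<close> and diverges for almost every
  \<open>y\<close>, without uniformity. Fubini moves the integral over \<open>s\<close> inside,
  where the previous lemma applies for fixed \<open>y\<close>; dominated convergence handles the
  integral over \<open>y\<close>.\<close>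

lemma oscillatory_integral_parametric:
 fixes F :: "real => 'y => complex" and \<Phi> \<Phi>' :: "nat => real => 'y => complex"
 assumes Y: "sigma_finite_measure Y" and L: "L \<ge> 0"
  and F: "integrable (lborel \<Otimes>\<^sub>M Y) (%(s, y). indicator {0..L} s *\<^sub>R F s y)"
  and [measurable]: "!!n. \<Theta> n \<in> borel_measurable Y"
   "!!n. (%(s, y). \<Phi> n s y) \<in> borel_measurable (borel \<Otimes>\<^sub>M Y)"
   "!!n. (%(s, y). \<Phi>' n s y) \<in> borel_measurable (borel \<Otimes>\<^sub>M Y)"
  and \<Theta>: "AE y in Y. filterlim (%n. \<bar>\<Theta> n y\<bar>) at_top sequentially"
  and B: "!!n s y. s \<in> {0..L} ==> y \<in> space Y ==> cmod (\<Phi> n s y) \<le> B"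
   "!!n s y. s \<in> {0..L} ==> y \<in> space Y ==> cmod (\<Phi>' n s y) \<le> B"
  and \<Phi>: "!!n s y. s \<in> {0..L} ==> y \<in> space Y ==> \<Phi> n s y = \<Phi> n L y + (LINT r:{s..L}|lborel. \<Phi>' n r y)"
 shows "(%n. LINT s:{0..L}|lborel. (LINT y|Y. F s y * iexp (s * \<Theta> n y) * \<Phi> n s y)) \<longlonglongrightarrow> 0"
proof -
 interpret Y: sigma_finite_measure Y by fact
 interpret P: pair_sigma_finite lborel Y by standard
 define F1 where "F1 = (%s y. indicator {0..L} s *\<^sub>R F s y)"
 have F: "integrable (lborel \<Otimes>\<^sub>M Y) (%(s, y). F1 s y)" using F by (simp add: F1_def)
 have [measurable]: "(%(s, y). F1 s y) \<in> borel_measurable (borel \<Otimes>\<^sub>M Y)"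
  using borel_measurable_integrable[OF F] by simp
 let ?H = "%n s y. F1 s y * (iexp (s * \<Theta> n y) * \<Phi> n s y)"
 have Hb: "cmod (?H n s y) \<le> \<bar>B\<bar> * cmod (F1 s y)" if "y \<in> space Y" for n s y
 proof (cases "s \<in> {0..L}")
  case True
  from B(1)[OF True that, of n] have "cmod (\<Phi> n s y) \<le> \<bar>B\<bar>" by linarith
  then show ?thesis by (simp add: norm_mult mult.commute[of "\<bar>B\<bar>"] mult_left_mono)
 qed (simp add: F1_def)
 have H: "integrable (lborel \<Otimes>\<^sub>M Y) (%(s, y). ?H n s y)" for n
  by (rule Bochner_Integration.integrable_bound[OF integrable_mult_right[OF F, of B]], measurable)
   (auto simp: space_pair_measure norm_mult[of "cor B"] intro!: AE_I2 Hb[unfolded of_real_mult])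
 have swap: "(LINT s:{0..L}|lborel. (LINT y|Y. F s y * iexp (s * \<Theta> n y) * \<Phi> n s y)) = (LINT y|Y. LINT s|lborel. ?H n s y)" for n
 proof -
  have "(LINT s:{0..L}|lborel. (LINT y|Y. F s y * iexp (s * \<Theta> n y) * \<Phi> n s y)) = (LINT s|lborel. LINT y|Y. ?H n s y)"
   unfolding set_lebesgue_integral_def
   by (intro Bochner_Integration.integral_cong) (auto simp: F1_def mult.assoc split: split_indicator)
  also have "\<dots> = (LINT y|Y. LINT s|lborel. ?H n s y)" using P.Fubini_integral[OF H] by simp
  finally show ?thesis .
 qed
 have "(%n. LINT y|Y. LINT s|lborel. ?H n s y) \<longlonglongrightarrow> (LINT y|Y. 0)"
 proof (rule integral_dominated_convergence[where w="%y. LINT s|lborel. \<bar>B\<bar> * cmod (F1 s y)"])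
  have Fn: "integrable (lborel \<Otimes>\<^sub>M Y) (%(s, y). \<bar>B\<bar> * cmod (F1 s y))"
   using integrable_mult_right[OF integrable_norm[OF F], of "\<bar>B\<bar>"] by (simp add: case_prod_beta')
  show "integrable Y (%y. LINT s|lborel. \<bar>B\<bar> * cmod (F1 s y))"
   using P.integrable_snd[OF Fn] .
  show "AE y in Y. norm (LINT s|lborel. ?H n s y) \<le> (LINT s|lborel. \<bar>B\<bar> * cmod (F1 s y))" for n
   using P.AE_integrable_snd[OF Fn] P.AE_integrable_snd[OF H, of n] AE_space
  proof eventually_elim
   case (elim y)
   show ?case
    by (rule Bochner_Integration.integral_norm_bound[THEN order_trans], rule integral_mono)
     (use elim in \<open>auto intro!: Hb[unfolded of_real_mult]\<close>)
  qed
  show "AE y in Y. (%n. LINT s|lborel. ?H n s y) \<longlonglongrightarrow> 0"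
   using P.AE_integrable_snd[OF F] \<Theta> AE_space
  proof eventually_elim
   case (elim y)
   have "(%n. LINT s:{0..L}|lborel. F s y * iexp (s * \<Theta> n y) * \<Phi> n s y) \<longlonglongrightarrow> 0"
   proof (rule oscillatory_integral_tendsto_0[OF _ L elim(2)])
    show "set_integrable lborel {0..L} (%s. F s y)" using elim(1) by (simp add: F1_def set_integrable_def)
    show "(%s. \<Phi> n s y) \<in> borel_measurable borel" "(%s. \<Phi>' n s y) \<in> borel_measurable borel" for n
     using elim(3) by measurable
    show "\<Phi> n s y = \<Phi> n L y + (LINT r:{s..L}|lborel. \<Phi>' n r y)" if "s \<in> {0..L}" for n s
     using that elim(3) by (rule \<Phi>)
   qed (use B elim(3) in auto)
   then show ?case unfolding set_lebesgue_integral_def by (simp add: F1_def mult.assoc)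
  qed
 qed measurable
 then show ?thesis unfolding swap by simp
qed

section \<open>The backward jump equation and its Dyson series\<close>

definition jump_op ::
  "('b::euclidean_space => complex) => ('a::euclidean_space => real) => ('b => 'a) => (real => 'a => complex) => real => 'a => complex" where
 "jump_op h S d \<phi> s p = (LINT k|lborel. h k * iexp (s * (S (p + d k) - S p)) * \<phi> s (p + d k))"

text \<open>The generator in the interaction picture: free propagation with symbol \<open>S\<close>
  has been conjugated away and survives as the phase difference across a jump, where the rapid
  oscillation will sit. \<open>d j\<close> embeds the transferred wave vector into the space of all
  dual variables.\<close>

definition jump_gen ::
  "nat set => (nat => complex) => (nat => 'b => 'a) => ('b::euclidean_space => complex) => ('a::euclidean_space => real)
   => (real => 'a => complex) => real => 'a => complex" where
 "jump_gen J \<sigma> d h S \<phi> s p = (\<Sum>j\<in>J. \<sigma> j * jump_op h S (d j) \<phi> s p)"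

lemma jump_op_measurable:
 assumes [measurable]: "h \<in> borel_measurable borel" "S \<in> borel_measurable borel" "d \<in> borel_measurable borel"
  "(%(s, p). \<phi> s p) \<in> borel_measurable (borel \<Otimes>\<^sub>M borel)"
 shows "(%(s, p). jump_op h S d \<phi> s p) \<in> borel_measurable (borel \<Otimes>\<^sub>M borel)"
 unfolding jump_op_def by measurable

lemma jump_gen_measurable:
 assumes "h \<in> borel_measurable borel" "S \<in> borel_measurable borel" "!!j. d j \<in> borel_measurable borel"
  "(%(s, p). \<phi> s p) \<in> borel_measurable (borel \<Otimes>\<^sub>M borel)"
 shows "(%(s, p). jump_gen J \<sigma> d h S \<phi> s p) \<in> borel_measurable (borel \<Otimes>\<^sub>M borel)"
proof -
 have [measurable]: "(%(s, p). jump_op h S (d j) \<phi> s p) \<in> borel_measurable (borel \<Otimes>\<^sub>M borel)" for j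
  by (rule jump_op_measurable) (use assms in auto)
 show ?thesis unfolding jump_gen_def by measurable
qed

lemma jump_op_integrable:
 assumes h: "integrable lborel h" and [measurable]: "S \<in> borel_measurable borel" "d \<in> borel_measurable borel"
  "\<phi> s \<in> borel_measurable borel"
  and b: "!!p. cmod (\<phi> s p) \<le> b"
 shows "integrable lborel (%k. h k * iexp (s * (S (p + d k) - S p)) * \<phi> s (p + d k))"
  and "cmod (jump_op h S d \<phi> s p) \<le> (LINT k|lborel. cmod (h k)) * b"
proof -
 have [measurable]: "h \<in> borel_measurable borel" using h by auto
 have le: "cmod (h k * iexp (s * (S (p + d k) - S p)) * \<phi> s (p + d k)) \<le> cmod (h k) * b" for k
  using b[of "p + d k"] by (auto simp: norm_mult intro!: mult_left_mono)
 show i: "integrable lborel (%k. h k * iexp (s * (S (p + d k) - S p)) * \<phi> s (p + d k))"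
  by (rule Bochner_Integration.integrable_bound[of _ "%k. cmod (h k) * b"])
   (use h order_trans[OF le abs_ge_self] in auto)
 show "cmod (jump_op h S d \<phi> s p) \<le> (LINT k|lborel. cmod (h k)) * b"
  unfolding jump_op_def integral_mult_left_zero[symmetric]
  by (rule Bochner_Integration.integral_norm_bound[THEN order_trans], rule integral_mono)
   (use h i le in auto)
qed

lemma jump_gen_bound:
 assumes "integrable lborel h" "S \<in> borel_measurable borel" "!!j. d j \<in> borel_measurable borel"
  "\<phi> s \<in> borel_measurable borel" and b: "!!p. cmod (\<phi> s p) \<le> b"
  and \<Lambda>: "(\<Sum>j\<in>J. cmod (\<sigma> j)) * (LINT k|lborel. cmod (h k)) \<le> \<Lambda>"
 shows "cmod (jump_gen J \<sigma> d h S \<phi> s p) \<le> \<Lambda> * b"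
proof -
 have b0: "b \<ge> 0" using b[of 0] norm_ge_zero[of "\<phi> s 0"] by linarith
 have "cmod (jump_gen J \<sigma> d h S \<phi> s p) \<le> (\<Sum>j\<in>J. cmod (\<sigma> j) * ((LINT k|lborel. cmod (h k)) * b))"
  unfolding jump_gen_def
  by (rule norm_sum[THEN order_trans], rule sum_mono)
   (auto simp: norm_mult intro!: mult_left_mono jump_op_integrable(2) assms)
 also have "\<dots> = ((\<Sum>j\<in>J. cmod (\<sigma> j)) * (LINT k|lborel. cmod (h k))) * b"
  by (simp add: sum_distrib_right mult.assoc)
 also have "\<dots> \<le> \<Lambda> * b" by (rule mult_right_mono[OF \<Lambda> b0])
 finally show ?thesis .
qed

text \<open>With the exponent \<open>2 * \<Lambda>\<close> in place of \<open>\<Lambda>\<close> each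
  time integration gains a factor 1/2, which becomes the ratio of the geometric series in
  \<open>dyson_series\<close>.\<close>

lemma exp_integral_bound:
 fixes \<Lambda> s L :: real
 assumes "\<Lambda> > 0" "s \<le> L"
 shows "integrable lborel (%t. indicator {s..L} t *\<^sub>R (\<Lambda> * exp (2 * \<Lambda> * (L - t))))"
  and "(LINT t|lborel. indicator {s..L} t *\<^sub>R (\<Lambda> * exp (2 * \<Lambda> * (L - t)))) \<le> exp (2 * \<Lambda> * (L - s)) / 2"
proof -
 show "integrable lborel (%t. indicator {s..L} t *\<^sub>R (\<Lambda> * exp (2 * \<Lambda> * (L - t))))"
 proof -
  have "continuous_on {s..L} (%t. \<Lambda> * exp (2 * \<Lambda> * (L - t)))" by (intro continuous_intros)
  from borel_integrable_atLeastAtMost'[OF this] show ?thesis by (simp only: set_integrable_def)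
 qed
 have "(LINT t|lborel. indicator {s..L} t *\<^sub>R (\<Lambda> * exp (2 * \<Lambda> * (L - t)))) = - exp (2 * \<Lambda> * (L - L)) / 2 - (- exp (2 * \<Lambda> * (L - s)) / 2)"
  using assms by (intro integral_FTC_atLeastAtMost)
   (auto intro!: continuous_intros derivative_eq_intros simp: has_real_derivative_iff_has_vector_derivative[symmetric])
 then show "(LINT t|lborel. indicator {s..L} t *\<^sub>R (\<Lambda> * exp (2 * \<Lambda> * (L - t)))) \<le> exp (2 * \<Lambda> * (L - s)) / 2"
  by simp
qed

primrec dyson_term ::
  "((real => 'a => complex) => real => 'a => complex) => real => ('a => complex) => nat => real => 'a => complex" where
 "dyson_term G L f 0 = (%s p. f p)"
| "dyson_term G L f (Suc n) = (%s p. LINT t:{s..L}|lborel. G (dyson_term G L f n) t p)"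

text \<open>Iteration of the integral equation, with \<open>exp (2 * \<Lambda> * (L - s))\<close> as
  weight: the term of index \<open>n\<close> is smaller by \<open>2 ^ n\<close>. Since
  \<open>S\<close> enters through phases of modulus one, the resulting bound depends on
  \<open>\<Lambda>\<close> and \<open>L\<close> alone and is therefore uniform in the scaling
  parameter.\<close>

lemma dyson_series:
 fixes h :: "'b::euclidean_space => complex" and f :: "'a::euclidean_space => complex"
 assumes h: "integrable lborel h" and S[measurable]: "S \<in> borel_measurable borel" and d[measurable]: "!!j. d j \<in> borel_measurable borel"
  and f[measurable]: "f \<in> borel_measurable borel" "!!p. cmod (f p) \<le> 1"
  and \<Lambda>: "(\<Sum>j\<in>J. cmod (\<sigma> j)) * (LINT k|lborel. cmod (h k)) \<le> \<Lambda>" "\<Lambda> > 0"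
 obtains ps where "(%(s, p). ps s p) \<in> borel_measurable (borel \<Otimes>\<^sub>M borel)"
  "!!s p. s \<in> {0..L} ==> cmod (ps s p) \<le> 2 * exp (2 * \<Lambda> * L)"
  "!!s p. s \<in> {0..L} ==> ps s p = f p + (LINT t:{s..L}|lborel. jump_gen J \<sigma> d h S ps t p)"
proof -
 have [measurable]: "h \<in> borel_measurable borel" using h by auto
 let ?G = "jump_gen J \<sigma> d h S"
 define \<phi> where "\<phi> = dyson_term ?G L f"
 have \<phi>m[measurable]: "(%(s, p). \<phi> n s p) \<in> borel_measurable (borel \<Otimes>\<^sub>M borel)" for n
 proof (induct n)
  case 0 then show ?case by (simp add: \<phi>_def)
 next
  case (Suc n)
  have [measurable]: "(%(s, p). ?G (\<phi> n) s p) \<in> borel_measurable (borel \<Otimes>\<^sub>M borel)"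
   by (rule jump_gen_measurable[OF _ _ _ Suc]) auto
  have "(%(s, p). \<phi> (Suc n) s p) = (%(s, p). LINT t|lborel. (if s \<le> t \<and> t \<le> L then ?G (\<phi> n) t p else 0))"
   unfolding \<phi>_def dyson_term.simps set_lebesgue_integral_def
   by (auto intro!: ext Bochner_Integration.integral_cong)
  also have "\<dots> \<in> borel_measurable (borel \<Otimes>\<^sub>M borel)" by measurable
  finally show ?case .
 qed
 have Gm[measurable]: "(%(s, p). ?G (\<phi> n) s p) \<in> borel_measurable (borel \<Otimes>\<^sub>M borel)" for n
  by (rule jump_gen_measurable[OF _ _ _ \<phi>m]) auto
 have \<phi>b: "cmod (\<phi> n s p) \<le> exp (2 * \<Lambda> * (L - s)) / 2 ^ n" if "s \<le> L" for n s p
  using that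
 proof (induct n arbitrary: s p)
  case 0
  have "1 \<le> exp (2 * \<Lambda> * (L - s))" using 0 \<Lambda>(2) by simp
  then show ?case using order_trans[OF f(2)[of p]] by (simp add: \<phi>_def)
 next
  case (Suc n)
  have Gb: "cmod (indicator {s..L} t *\<^sub>R ?G (\<phi> n) t p) \<le> (indicator {s..L} t *\<^sub>R (\<Lambda> * exp (2 * \<Lambda> * (L - t)))) / 2 ^ n" for t
  proof (cases "t \<in> {s..L}")
   case True
   then have "cmod (?G (\<phi> n) t p) \<le> \<Lambda> * (exp (2 * \<Lambda> * (L - t)) / 2 ^ n)"
    by (intro jump_gen_bound[OF h S d _ _ \<Lambda>(1)] Suc) auto
   then show ?thesis using True by simp
  qed simp
  have "cmod (\<phi> (Suc n) s p) \<le> (LINT t|lborel. (indicator {s..L} t *\<^sub>R (\<Lambda> * exp (2 * \<Lambda> * (L - t)))) / 2 ^ n)"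
   unfolding \<phi>_def dyson_term.simps set_lebesgue_integral_def
   by (rule Bochner_Integration.integral_norm_bound[THEN order_trans], rule integral_mono')
    (use Gb exp_integral_bound(1)[OF \<Lambda>(2) Suc(2)] \<Lambda>(2) in \<open>auto simp: \<phi>_def split: split_indicator\<close>)
  also have "\<dots> = (LINT t|lborel. indicator {s..L} t *\<^sub>R (\<Lambda> * exp (2 * \<Lambda> * (L - t)))) / 2 ^ n"
   by (simp only: integral_divide_zero)
  also have "\<dots> \<le> (exp (2 * \<Lambda> * (L - s)) / 2) / 2 ^ n"
   by (rule divide_right_mono[OF exp_integral_bound(2)[OF \<Lambda>(2) Suc(2)]]) simp
  finally show ?case by simp
 qed
 define ps where "ps = (%s p. \<Sum>n. \<phi> n s p)"
 have geo1: "(\<Sum>n. 1 / 2 ^ n) = (2::real)"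
  using suminf_geometric[of "1/2::real"] by (simp add: power_divide)
 have geo: "summable (%n. c / 2 ^ n)" "(\<Sum>n. c / 2 ^ n) = 2 * c" for c :: real
  using summable_mult[OF summable_geometric[of "1/2::real"], of c] suminf_mult[OF summable_geometric[of "1/2::real"], of c]
  by (simp_all add: geo1 power_divide)
 have sn: "summable (%n. cmod (\<phi> n s p))" if "s \<le> L" for s p
  by (rule summable_comparison_test'[OF geo(1), of 0]) (use \<phi>b[OF that] in auto)
 have psm[measurable]: "(%(s, p). ps s p) \<in> borel_measurable (borel \<Otimes>\<^sub>M borel)"
  unfolding ps_def by measurable
 have psb: "cmod (ps s p) \<le> 2 * exp (2 * \<Lambda> * (L - s))" if "s \<le> L" for s p
 proof -
  have "cmod (ps s p) \<le> (\<Sum>n. cmod (\<phi> n s p))" unfolding ps_def by (rule summable_norm[OF sn[OF that]])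
  also have "\<dots> \<le> (\<Sum>n. exp (2 * \<Lambda> * (L - s)) / 2 ^ n)"
   by (rule suminf_le) (use \<phi>b[OF that] sn[OF that] geo(1) in auto)
  finally show ?thesis by (simp add: geo(2))
 qed
 \<comment> \<open>Absolute convergence, uniform in \<open>p\<close>, lets the generator be applied
   term by term; \<open>pseq\<close> then does the same for the time integral.\<close>
 have opsum: "(%n. jump_op h S (d j) (\<phi> n) t p) sums jump_op h S (d j) ps t p" if t: "t \<le> L" for j t p
 proof -
  let ?e = "exp (2 * \<Lambda> * (L - t))"
  have nn: "cmod (h k * iexp (t * (S (p + d j k) - S p)) * \<phi> n t (p + d j k)) \<le> cmod (h k) * (?e / 2 ^ n)" for n k
   using mult_left_mono[OF \<phi>b[OF t, of n "p + d j k"], of "cmod (h k)"] by (simp add: norm_mult)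
  have i: "integrable lborel (%k. h k * iexp (t * (S (p + d j k) - S p)) * \<phi> n t (p + d j k))" for n
   by (rule jump_op_integrable(1)[where \<phi>="\<phi> n" and s=t, OF h S d _ \<phi>b[OF t]]) measurable
  have "(%n. LINT k|lborel. h k * iexp (t * (S (p + d j k) - S p)) * \<phi> n t (p + d j k)) sums
   (LINT k|lborel. (\<Sum>n. h k * iexp (t * (S (p + d j k) - S p)) * \<phi> n t (p + d j k)))"
  proof (rule sums_integral[OF i])
   show "AE k in lborel. summable (%n. cmod (h k * iexp (t * (S (p + d j k) - S p)) * \<phi> n t (p + d j k)))"
    using sn[OF t] by (simp add: norm_mult summable_mult)
   show "summable (%n. LINT k|lborel. cmod (h k * iexp (t * (S (p + d j k) - S p)) * \<phi> n t (p + d j k)))"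
   proof (rule summable_comparison_test'[OF geo(1)[of "(LINT k|lborel. cmod (h k)) * ?e"], of 0])
    fix n
    have "(LINT k|lborel. cmod (h k * iexp (t * (S (p + d j k) - S p)) * \<phi> n t (p + d j k))) \<le> (LINT k|lborel. cmod (h k) * (?e / 2 ^ n))"
     by (rule integral_mono) (use i h nn in auto)
    then show "norm (LINT k|lborel. cmod (h k * iexp (t * (S (p + d j k) - S p)) * \<phi> n t (p + d j k))) \<le> (LINT k|lborel. cmod (h k)) * ?e / 2 ^ n"
     by simp
   qed
  qed
  then show ?thesis unfolding jump_op_def ps_def
   by (simp add: suminf_mult[OF summable_norm_cancel[OF sn[OF t]]])
 qed
 have Gsum: "(%n. ?G (\<phi> n) t p) sums ?G ps t p" if "t \<le> L" for t p
  unfolding jump_gen_def by (intro sums_sum sums_mult opsum that)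
 have pseq: "ps s p = f p + (LINT t:{s..L}|lborel. ?G ps t p)" if s: "s \<le> L" for s p
 proof -
  let ?g = "%n t. indicator {s..L} t *\<^sub>R ?G (\<phi> n) t p"
  have nn: "cmod (?g n t) \<le> (indicator {s..L} t *\<^sub>R (\<Lambda> * exp (2 * \<Lambda> * (L - t)))) / 2 ^ n" for n t
  proof (cases "t \<in> {s..L}")
   case True
   then have "cmod (?G (\<phi> n) t p) \<le> \<Lambda> * (exp (2 * \<Lambda> * (L - t)) / 2 ^ n)"
    by (intro jump_gen_bound[OF h S d _ _ \<Lambda>(1)] \<phi>b) auto
   then show ?thesis using True by simp
  qed simp
  have i: "integrable lborel (?g n)" for n
   by (rule Bochner_Integration.integrable_bound[of _ "%t. (indicator {s..L} t *\<^sub>R (\<Lambda> * exp (2 * \<Lambda> * (L - t)))) / 2 ^ n"])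
    (use order_trans[OF nn abs_ge_self] exp_integral_bound(1)[OF \<Lambda>(2) s] in \<open>auto simp del: real_scaleR_def\<close>)
  have "(%n. LINT t|lborel. ?g n t) sums (LINT t|lborel. (\<Sum>n. ?g n t))"
  proof (rule sums_integral[OF i])
   show "AE t in lborel. summable (%n. cmod (?g n t))"
    by (intro AE_I2 summable_comparison_test'[OF geo(1), of 0]) (use nn in auto)
   show "summable (%n. LINT t|lborel. cmod (?g n t))"
   proof (rule summable_comparison_test'[OF geo(1)[of "LINT t|lborel. indicator {s..L} t *\<^sub>R (\<Lambda> * exp (2 * \<Lambda> * (L - t)))"], of 0])
    fix n
    have "(LINT t|lborel. cmod (?g n t)) \<le> (LINT t|lborel. (indicator {s..L} t *\<^sub>R (\<Lambda> * exp (2 * \<Lambda> * (L - t)))) / 2 ^ n)"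
     by (rule integral_mono) (use i nn exp_integral_bound(1)[OF \<Lambda>(2) s] in \<open>auto simp del: real_scaleR_def norm_scaleR\<close>)
    then show "norm (LINT t|lborel. cmod (?g n t)) \<le> (LINT t|lborel. indicator {s..L} t *\<^sub>R (\<Lambda> * exp (2 * \<Lambda> * (L - t)))) / 2 ^ n"
     by (simp del: real_scaleR_def norm_scaleR)
   qed
  qed
  moreover have "(\<Sum>n. ?g n t) = indicator {s..L} t *\<^sub>R ?G ps t p" for t
   using Gsum[of t p] by (auto simp: sums_iff split: split_indicator)
  ultimately have "(%n. \<phi> (Suc n) s p) sums (LINT t:{s..L}|lborel. ?G ps t p)"
   by (simp add: \<phi>_def set_lebesgue_integral_def)
  \<comment> \<open>The series from index 1 on is the integral term; the term of index 0 is the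
    terminal value \<open>f\<close>.\<close>
  from sums_unique[OF sums_Suc[OF this]]
  have "ps s p = \<phi> 0 s p + (LINT t:{s..L}|lborel. ?G ps t p)"
   unfolding ps_def by (simp only: add.commute)
  then show ?thesis by (simp add: \<phi>_def)
 qed
 show thesis
 proof (rule that[OF psm])
  show "cmod (ps s p) \<le> 2 * exp (2 * \<Lambda> * L)" if "s \<in> {0..L}" for s p
  proof -
   have "exp (2 * \<Lambda> * (L - s)) \<le> exp (2 * \<Lambda> * L)" using that \<Lambda>(2) by simp
   moreover have "cmod (ps s p) \<le> 2 * exp (2 * \<Lambda> * (L - s))" by (rule psb) (use that in simp)
   ultimately show ?thesis by linarith
  qed
 qed (use pseq in auto)
qed

section \<open>Duality of jumps, and the moment equation in Fourier space\<close>

lemma integrable_slices: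
 fixes F :: "real => 'y => complex"
 assumes Y: "sigma_finite_measure Y"
  and [measurable]: "(%(t, y). F t y) \<in> borel_measurable (borel \<Otimes>\<^sub>M Y)"
  and F: "!!t. t \<in> {a..b} ==> integrable Y (F t)" "!!t. t \<in> {a..b} ==> (LINT y|Y. cmod (F t y)) \<le> B"
 shows "integrable (lborel \<Otimes>\<^sub>M Y) (%(t, y). indicator {a..b} t *\<^sub>R F t y)"
proof -
 interpret Y: sigma_finite_measure Y by fact
 interpret P: pair_sigma_finite lborel Y by standard
 show ?thesis
 proof (rule P.Fubini_integrable)
  show "(%(t, y). indicator {a..b} t *\<^sub>R F t y) \<in> borel_measurable (lborel \<Otimes>\<^sub>M Y)" by measurable
  have eq: "(LINT y|Y. cmod (case (t, y) of (t, y) => indicator {a..b} t *\<^sub>R F t y)) = indicator {a..b} t * (LINT y|Y. cmod (F t y))" for t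
   by (simp add: abs_mult)
  have i: "integrable lborel (%t. \<bar>B\<bar> * indicator {a..b} t)" by (simp add: emeasure_lborel_Icc_eq)
  show "integrable lborel (%t. LINT y|Y. cmod (case (t, y) of (t, y) => indicator {a..b} t *\<^sub>R F t y))"
   unfolding eq
  proof (rule Bochner_Integration.integrable_bound[OF i])
   show "AE t in lborel. norm (indicator {a..b} t * (LINT y|Y. cmod (F t y))) \<le> norm (\<bar>B\<bar> * indicator {a..b} t)"
   proof (intro AE_I2)
    fix t
    have "0 \<le> (LINT y|Y. cmod (F t y))" by simp
    then show "norm (indicator {a..b} t * (LINT y|Y. cmod (F t y))) \<le> norm (\<bar>B\<bar> * indicator {a..b} t)"
     using F(2)[of t] by (auto split: split_indicator)
   qed
  qed measurable
  show "AE t in lborel. integrable Y (%y. case (t, y) of (t, y) => indicator {a..b} t *\<^sub>R F t y)"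
   using F(1) by (intro AE_I2) (auto split: split_indicator)
 qed
qed

text \<open>The norm depends continuously on \<open>z\<close> by the reverse triangle inequality,
  and so is bounded on a compact interval.\<close>

lemma L1_continuous_bounded:
 fixes f :: "real => 'a::euclidean_space => complex"
 assumes "L1_continuous f"
 obtains B where "!!z. z \<in> {0..T} ==> integrable lborel (f z)"
  "!!z. z \<in> {0..T} ==> (LINT k|lborel. cmod (f z k)) \<le> B"
  "continuous_on {0..} (%z. LINT k|lborel. cmod (f z k))"
proof -
 let ?a = "%z. LINT k|lborel. cmod (f z k)"
 have i: "integrable lborel (f z)" if "z \<ge> 0" for z using assms that by (auto simp: L1_continuous_def)
 have c: "continuous_on {0..} ?a"
  unfolding continuous_on_def
 proof
  fix z :: real assume z: "z \<in> {0..}"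
  show "(?a \<longlongrightarrow> ?a z) (at z within {0..})"
  proof (rule Lim_transform2[OF tendsto_const], rule Lim_null_comparison)
   show "((%s. LINT k|lborel. cmod (f s k - f z k)) \<longlongrightarrow> 0) (at z within {0..})"
    using assms z by (auto simp: L1_continuous_def)
   show "\<forall>\<^sub>F s in at z within {0..}. norm (?a z - ?a s) \<le> (LINT k|lborel. cmod (f s k - f z k))"
    unfolding eventually_at_filter
   proof (intro always_eventually allI impI)
    fix s :: real assume s: "s \<in> {0..}"
    have "?a z - ?a s = (LINT k|lborel. cmod (f z k) - cmod (f s k))"
     using i z s by (simp add: Bochner_Integration.integral_diff)
    also have "norm \<dots> \<le> (LINT k|lborel. cmod (f s k - f z k))"
    proof (rule Bochner_Integration.integral_norm_bound[THEN order_trans], rule integral_mono)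
     show "norm (cmod (f z k) - cmod (f s k)) \<le> cmod (f s k - f z k)" for k
      by (metis norm_minus_commute norm_triangle_ineq3 real_norm_def)
    qed (use i z s in \<open>auto intro!: integrable_norm\<close>)
    finally show "norm (?a z - ?a s) \<le> (LINT k|lborel. cmod (f s k - f z k))" .
   qed
  qed
 qed
 have "compact (?a ` {0..T})"
  by (rule compact_continuous_image[OF continuous_on_subset[OF c]]) auto
 from compact_imp_bounded[OF this] obtain B where "\<forall>y\<in>?a ` {0..T}. norm y \<le> B"
  unfolding bounded_iff by auto
 then have "?a z \<le> B" if "z \<in> {0..T}" for z using that by auto
 then show thesis using that[of B] i c by auto
qed

text \<open>For each \<open>k\<close> the translation by \<open>d k\<close> preserves
  \<open>lborel\<close> and moves a gain term of the forward equation onto the test function.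
  \<open>G\<close> may depend on \<open>k\<close> so that it can absorb the phases of the
  interaction picture.\<close>

lemma jump_duality:
 fixes h :: "'b::euclidean_space => complex" and m :: "'a::euclidean_space => complex" and G :: "'b => 'a => complex"
 assumes h: "integrable lborel h" and m: "integrable lborel m" and [measurable]: "d \<in> borel_measurable borel"
  "(%(k, p). G k p) \<in> borel_measurable (borel \<Otimes>\<^sub>M borel)"
  and b: "!!k p. cmod (G k p) \<le> b"
 shows "integrable lborel (%p. LINT k|lborel. h k * m (p - d k) * G k p)"
  and "integrable lborel (%p. LINT k|lborel. h k * m p * G k (p + d k))"
  and "(LINT p|lborel. (LINT k|lborel. h k * m (p - d k) * G k p)) = (LINT p|lborel. (LINT k|lborel. h k * m p * G k (p + d k)))"
  and "(LINT p|lborel. cmod (LINT k|lborel. h k * m (p - d k) * G k p)) \<le> (LINT k|lborel. cmod (h k)) * (LINT p|lborel. cmod (m p)) * b"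
proof -
 have [measurable]: "h \<in> borel_measurable borel" "m \<in> borel_measurable borel" using h m by auto
 have b0: "b \<ge> 0" using b[of 0 0] norm_ge_zero[of "G 0 0"] by linarith
 have sh: "integrable lborel (%p. m (p - d k))" "(LINT p|lborel. cmod (m (p - d k))) = (LINT p|lborel. cmod (m p))" for k
  using lborel_shift(1)[of m "- d k"] lborel_shift(2)[of "%p. cmod (m p)" "- d k"] m by simp_all
 have I0: "integrable (lborel \<Otimes>\<^sub>M lborel) (%(k, p). h k * m (p - d k))"
  by (rule lborel_pair.Fubini_integrable) (use h m sh in \<open>auto simp: norm_mult\<close>)
 have bb: "cmod (x * G k p) \<le> cmod x * b" for x k p
  using mult_left_mono[OF b, of "cmod x" k p] by (simp add: norm_mult)
 have I1: "integrable (lborel \<Otimes>\<^sub>M lborel) (%(k, p). h k * m (p - d k) * G k p)"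
 proof (rule Bochner_Integration.integrable_bound[OF integrable_mult_right[OF I0, of b]], measurable)
  show "AE x in lborel \<Otimes>\<^sub>M lborel. cmod (case x of (k, p) => h k * m (p - d k) * G k p) \<le> cmod (b * (case x of (k, p) => h k * m (p - d k)))"
   using bb[of "h (fst x) * m (snd x - d (fst x))" "fst x" "snd x" for x] b0
   by (intro AE_I2) (simp only: case_prod_beta' norm_mult[of "cor b"] norm_of_real abs_of_nonneg mult.commute[of b])
 qed
 have I2: "integrable (lborel \<Otimes>\<^sub>M lborel) (%(k, p). h k * m p * G k (p + d k))"
 proof (rule Bochner_Integration.integrable_bound[OF integrable_mult_right[OF integrable_tensor[OF _ _ h m], of b]])
  show "AE x in lborel \<Otimes>\<^sub>M lborel. cmod (case x of (k, p) => h k * m p * G k (p + d k)) \<le> cmod (b * (h (fst x) * m (snd x)))"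
   using bb[of "h (fst x) * m (snd x)" "fst x" "snd x + d (fst x)" for x] b0
   by (intro AE_I2) (simp only: case_prod_beta' norm_mult[of "cor b"] norm_of_real abs_of_nonneg mult.commute[of b])
 qed (auto intro: sigma_finite_lborel)
 show A1: "integrable lborel (%p. LINT k|lborel. h k * m (p - d k) * G k p)"
  using lborel_pair.integrable_snd[OF I1] .
 show "integrable lborel (%p. LINT k|lborel. h k * m p * G k (p + d k))"
  using lborel_pair.integrable_snd[OF I2] .
 have "(LINT p|lborel. (LINT k|lborel. h k * m (p - d k) * G k p)) = (LINT k|lborel. (LINT p|lborel. h k * m (p - d k) * G k p))"
  using lborel_pair.Fubini_integral[OF I1] .
 also have "\<dots> = (LINT k|lborel. (LINT p|lborel. h k * m p * G k (p + d k)))"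
 proof (rule Bochner_Integration.integral_cong[OF refl])
  fix k show "(LINT p|lborel. h k * m (p - d k) * G k p) = (LINT p|lborel. h k * m p * G k (p + d k))"
   using lborel_shift(2)[of "%p. h k * m (p - d k) * G k p" "d k"] by simp
 qed
 also have "\<dots> = (LINT p|lborel. (LINT k|lborel. h k * m p * G k (p + d k)))"
  using lborel_pair.Fubini_integral[OF I2] by simp
 finally show "(LINT p|lborel. (LINT k|lborel. h k * m (p - d k) * G k p)) = (LINT p|lborel. (LINT k|lborel. h k * m p * G k (p + d k)))" .
 have I3: "integrable (lborel \<Otimes>\<^sub>M lborel) (%(k, p). cmod (h k * m (p - d k)) * b)"
  using integrable_mult_left[OF integrable_norm[OF I0], of b] by (simp add: case_prod_beta')
 have "(LINT p|lborel. cmod (LINT k|lborel. h k * m (p - d k) * G k p)) \<le> (LINT p|lborel. LINT k|lborel. cmod (h k * m (p - d k)) * b)"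
 proof (rule integral_mono_AE)
  show "integrable lborel (%p. LINT k|lborel. cmod (h k * m (p - d k)) * b)" using lborel_pair.integrable_snd[OF I3] .
  show "AE p in lborel. cmod (LINT k|lborel. h k * m (p - d k) * G k p) \<le> (LINT k|lborel. cmod (h k * m (p - d k)) * b)"
   using lborel_pair.AE_integrable_snd[OF I1] lborel_pair.AE_integrable_snd[OF I3]
  proof eventually_elim
   case (elim p)
   show ?case by (rule Bochner_Integration.integral_norm_bound[THEN order_trans], rule integral_mono)
    (use elim bb in auto)
  qed
 qed (use A1 in auto)
 also have "\<dots> = (LINT k|lborel. LINT p|lborel. cmod (h k * m (p - d k)) * b)"
  using lborel_pair.Fubini_integral[OF I3] by simp
 also have "\<dots> = (LINT k|lborel. cmod (h k)) * (LINT p|lborel. cmod (m p)) * b"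
  by (simp add: norm_mult sh)
 finally show "(LINT p|lborel. cmod (LINT k|lborel. h k * m (p - d k) * G k p)) \<le> (LINT k|lborel. cmod (h k)) * (LINT p|lborel. cmod (m p)) * b" .
qed

text \<open>The six pairs of arguments of \<^const>\<open>U2\<close>, in the order
 \<open>(x1,y1), (x2,y2), (x1,y2), (x2,y1), (x1,x2), (y1,y2)\<close>, and the diagonal term.\<close>
definition jump :: "nat => R2 => R2x4" where
 "jump j k = (if j = 0 then (k, 0, -k, 0) else if j = 1 then (0, k, 0, -k) else if j = 2 then (k, 0, 0, -k)
  else if j = 3 then (0, k, -k, 0) else if j = 4 then (k, -k, 0, 0) else if j = 5 then (0, 0, k, -k) else 0)"

definition coupling :: "real => real => real => real => nat => real" where
 "coupling w1 w2 v1 v2 j = (if j = 0 then w1 * v1 else if j = 1 then w2 * v2 else if j = 2 then w1 * v2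
  else if j = 3 then w2 * v1 else if j = 4 then - (w1 * w2) else if j = 5 then - (v1 * v2)
  else - ((w1\<^sup>2 + w2\<^sup>2 + v1\<^sup>2 + v2\<^sup>2) / 2))"

lemma jump_measurable [measurable]: "jump j \<in> borel_measurable borel"
proof -
 have "continuous_on UNIV (jump j)" unfolding jump_def
  by (cases "j \<in> {0,1,2,3,4,5}") (auto intro!: continuous_intros)
 then show ?thesis by (rule borel_measurable_continuous_onI)
qed

text \<open>Each covariance term depends on the difference of two arguments, so its transform lives
  on the vectors \<open>jump j k\<close>. The constant term fits the same pattern with a jump of 0,
  which reproduces \<open>C 0\<close>.\<close>

lemma U2_fourier:
 assumes C: "!!x. cor (C x) = (LINT k|lborel. F k * iexp (k \<bullet> x)) / cor ((2 * pi) ^ DIM(R2))"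
 shows "cor (U2 C w1 w2 v1 v2 X)
  = (\<Sum>j<7. cor (coupling w1 w2 v1 v2 j / (2 * pi) ^ DIM(R2)) * (LINT k|lborel. F k * iexp (jump j k \<bullet> X)))"
proof -
 obtain x1 x2 y1 y2 where X: "X = (x1, x2, y1, y2)" by (cases X) auto
 have e: "jump 0 k \<bullet> X = k \<bullet> (x1 - y1)" "jump 1 k \<bullet> X = k \<bullet> (x2 - y2)" "jump 2 k \<bullet> X = k \<bullet> (x1 - y2)"
  "jump 3 k \<bullet> X = k \<bullet> (x2 - y1)" "jump 4 k \<bullet> X = k \<bullet> (x1 - x2)" "jump 5 k \<bullet> X = k \<bullet> (y1 - y2)" "jump 6 k \<bullet> X = k \<bullet> 0" "jump (Suc 0) k \<bullet> X = k \<bullet> (x2 - y2)" for k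
  by (simp_all add: jump_def X inner_diff_right)
 have D: "(LINT k|lborel. F k * iexp (k \<bullet> x)) = cor ((2 * pi) ^ DIM(R2)) * C x" for x
  using C[of x] by simp
 have r: "{..<7::nat} = {0,1,2,3,4,5,6}" by auto
 show ?thesis
  unfolding r by (simp add: e D del: inner_zero_right of_real_power) (simp add: X U2_def coupling_def)
qed

lemma has_L1_fourierD:
 fixes f :: "'a::euclidean_space => complex"
 assumes "has_L1_fourier f g"
 shows "integrable lborel g" "(LINT k|lborel. g k * iexp (k \<bullet> x)) = cor ((2 * pi) ^ DIM('a)) * f x"
proof -
 show "integrable lborel g" using assms unfolding has_L1_fourier_def by blast
 have "f x = (LINT k|lborel. g k * iexp (k \<bullet> x)) / cor ((2 * pi) ^ DIM('a))"
  using assms unfolding has_L1_fourier_def by blast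
 then show "(LINT k|lborel. g k * iexp (k \<bullet> x)) = cor ((2 * pi) ^ DIM('a)) * f x" by simp
qed

text \<open>A product has the convolution as its transform. As \<open>has_L1_fourier\<close> fixes a
  transform only through the inversion formula, the two candidates are compared by testing against
  all exponentials, and \<open>fourier_L1_unique\<close> concludes.\<close>

lemma potential_convolution:
 assumes F: "integrable lborel F"
  and C: "!!x. cor (C x) = (LINT k|lborel. F k * iexp (k \<bullet> x)) / cor ((2 * pi) ^ DIM(R2))"
  and M: "has_L1_fourier M m" and n: "has_L1_fourier (%X. cor (U2 C w1 w2 v1 v2 X) * M X) n"
 shows "AE p in lborel. n p = (\<Sum>j<7. cor (coupling w1 w2 v1 v2 j / (2 * pi) ^ DIM(R2)) * (LINT k|lborel. F k * m (p - jump j k)))"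
proof -
 let ?s = "%j. cor (coupling w1 w2 v1 v2 j / (2 * pi) ^ DIM(R2))"
 have m: "integrable lborel m" and ni: "integrable lborel n" using M n by (auto simp: has_L1_fourier_def)
 have mi: "(LINT p|lborel. m p * iexp (p \<bullet> X)) = cor ((2 * pi) ^ DIM(R2x4)) * M X" for X
  by (rule has_L1_fourierD(2)[OF M])
 have nX: "(LINT p|lborel. n p * iexp (p \<bullet> X)) = cor ((2 * pi) ^ DIM(R2x4)) * (U2 C w1 w2 v1 v2 X * M X)" for X
  by (rule has_L1_fourierD(2)[OF n])
 have ci: "integrable lborel (%p. LINT k|lborel. F k * m (p - jump j k))" for j
  using jump_duality(1)[OF F m jump_measurable[of j], of "%_ _. 1" 1] by simp
 define q where "q = (%p. \<Sum>j<7. ?s j * (LINT k|lborel. F k * m (p - jump j k)))"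
 have q: "integrable lborel q" unfolding q_def
  by (intro Bochner_Integration.integrable_sum integrable_mult_right ci)
 have "(LINT p|lborel. (n p - q p) * iexp (p \<bullet> X)) = 0" for X
 proof -
  have t: "(LINT p|lborel. (LINT k|lborel. F k * m (p - jump j k)) * iexp (p \<bullet> X)) = (LINT k|lborel. F k * iexp (jump j k \<bullet> X)) * (LINT p|lborel. m p * iexp (p \<bullet> X))"
   and ti: "integrable lborel (%p. (LINT k|lborel. F k * m (p - jump j k)) * iexp (p \<bullet> X))" for j
  proof -
   have e: "(LINT k|lborel. F k * m (p - jump j k)) * iexp (p \<bullet> X) = (LINT k|lborel. F k * m (p - jump j k) * iexp (p \<bullet> X))" for p
    by (simp only: integral_mult_left_zero)
   have b: "cmod (iexp (p \<bullet> X)) \<le> 1" for p by simp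
   note jd = jump_duality[OF F m jump_measurable[of j], of "%k p. iexp (p \<bullet> X)", OF _ b]
   show "integrable lborel (%p. (LINT k|lborel. F k * m (p - jump j k)) * iexp (p \<bullet> X))"
    unfolding e by (rule jd(1)) measurable
   have "(LINT p|lborel. (LINT k|lborel. F k * m (p - jump j k)) * iexp (p \<bullet> X)) = (LINT p|lborel. (LINT k|lborel. F k * m p * iexp ((p + jump j k) \<bullet> X)))"
    unfolding e by (rule jd(3)) measurable
   also have "\<dots> = (LINT p|lborel. m p * iexp (p \<bullet> X) * (LINT k|lborel. F k * iexp (jump j k \<bullet> X)))"
    unfolding integral_mult_right_zero[symmetric]
    by (intro Bochner_Integration.integral_cong refl) (simp add: inner_add_left distrib_left exp_add mult_ac)
   finally show "(LINT p|lborel. (LINT k|lborel. F k * m (p - jump j k)) * iexp (p \<bullet> X)) = (LINT k|lborel. F k * iexp (jump j k \<bullet> X)) * (LINT p|lborel. m p * iexp (p \<bullet> X))"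
    by simp
  qed
  have "(LINT p|lborel. q p * iexp (p \<bullet> X)) = (LINT p|lborel. (\<Sum>j<7. ?s j * ((LINT k|lborel. F k * m (p - jump j k)) * iexp (p \<bullet> X))))"
   unfolding q_def sum_distrib_right by (simp only: mult.assoc)
  also have "\<dots> = (\<Sum>j<7. ?s j * ((LINT k|lborel. F k * iexp (jump j k \<bullet> X)) * (LINT p|lborel. m p * iexp (p \<bullet> X))))"
   by (subst Bochner_Integration.integral_sum) (auto simp: t intro!: integrable_mult_right ti)
  also have "\<dots> = cor (U2 C w1 w2 v1 v2 X) * (LINT p|lborel. m p * iexp (p \<bullet> X))"
   unfolding U2_fourier[OF C] sum_distrib_right by (simp only: mult.assoc)
  finally have qX: "(LINT p|lborel. q p * iexp (p \<bullet> X)) = cor (U2 C w1 w2 v1 v2 X) * (LINT p|lborel. m p * iexp (p \<bullet> X))" .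
  have "integrable lborel (%p. n p * iexp (p \<bullet> X))" "integrable lborel (%p. q p * iexp (p \<bullet> X))"
   using ni q by (auto intro: Bochner_Integration.integrable_bound[OF ni] Bochner_Integration.integrable_bound[OF q] simp: norm_mult)
  then show ?thesis by (simp add: left_diff_distrib nX qX mi)
 qed
 from fourier_L1_unique[OF Bochner_Integration.integrable_diff[OF ni q] this]
 show ?thesis by eventually_elim (simp add: q_def)
qed

lemma set_borel_measurable_slices:
 fixes m :: "real => 'a::euclidean_space => complex"
 assumes "set_borel_measurable borel ({0..} \<times> UNIV) (%(z, k). m z k)"
 shows "(%(z, k). indicator {0..} z *\<^sub>R m z k) \<in> borel_measurable (borel \<Otimes>\<^sub>M borel)"
proof -
 have "(%(z, k). indicator {0..} z *\<^sub>R m z k) = (%x. indicator ({0..} \<times> UNIV) x *\<^sub>R (case x of (z, k) => m z k))"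
  by (auto split: split_indicator)
 then show ?thesis using assms unfolding set_borel_measurable_def borel_prod[symmetric] by simp
qed

lemma iexp_mult: "iexp a * iexp b = iexp (a + b)"
 by (simp add: distrib_left exp_add)

lemma exp_minus_iexp: "exp (- \<i> * cor a) = iexp (- a)"
 by simp

lemma measurable_slice:
 fixes \<phi> :: "real => 'y => complex"
 assumes "(%(s, p). \<phi> s p) \<in> borel_measurable (borel \<Otimes>\<^sub>M N)"
 shows "\<phi> s \<in> borel_measurable N"
proof -
 have "(%p. case (s, p) of (s, p) => \<phi> s p) \<in> borel_measurable N"
  by (rule measurable_compose[OF measurable_Pair1' assms]) simp
 then show ?thesis by simp
qed

text \<open>In the time \<open>s = eps * z\<close> the weak potential acts over the fixed interval
  \<open>{0..L}\<close>, its factor \<open>eps\<close> cancelled, while the free symbol is divided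
  by \<open>eps\<close>. The pairing of the interaction-picture transform with a backward solution
  is constant in \<open>s\<close>: at \<open>s = L\<close> the terminal value makes it Fourier
  inversion at \<open>X\<close>, and at \<open>s = 0\<close> it involves only the initial condition.
  Every mild solution therefore has this value, so uniqueness comes for free.\<close>

lemma M2_dual_representation:
 fixes M :: "real => R2x4 => complex"
 assumes c: "c > 0" and eps: "eps > 0" and L: "L > 0" and F: "integrable lborel F"
  and C: "!!x. cor (C x) = (LINT k|lborel. F k * iexp (k \<bullet> x)) / cor ((2 * pi) ^ DIM(R2))"
  and M: "M2_mild_solution c (%x. eps * C x) r \<rho> w1 w2 v1 v2 M"
  and S: "S = (%p. free_symbol c w1 w2 v1 v2 p / eps)"
  and \<sigma>: "\<sigma> = (%j. cor (coupling w1 w2 v1 v2 j / (4 * c\<^sup>2 * (2 * pi)\<^sup>2)))"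
  and psm[measurable]: "(%(s, p). ps s p) \<in> borel_measurable (borel \<Otimes>\<^sub>M borel)"
  and psb: "!!s p. s \<in> {0..L} ==> cmod (ps s p) \<le> B"
  and ps: "!!s p. s \<in> {0..L} ==> ps s p = iexp (p \<bullet> X) * iexp (- (L * S p)) + (LINT t:{s..L}|lborel. jump_gen {..<7} \<sigma> jump F S ps t p)"
  and g: "integrable lborel g" "!!X. cor (M2_initial r \<rho> X) = (LINT p|lborel. g p * iexp (p \<bullet> X))"
 shows "M (L / eps) X = (LINT p|lborel. g p * ps 0 p)"
proof -
 from M obtain m n where
  mm: "set_borel_measurable borel ({0..} \<times> UNIV) (%(z, k). m z k)"
  and nm: "set_borel_measurable borel ({0..} \<times> UNIV) (%(z, k). n z k)"
  and mc: "L1_continuous m"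
  and mf: "!!z. z \<ge> 0 ==> has_L1_fourier (M z) (m z)"
  and nf: "!!z. z \<ge> 0 ==> has_L1_fourier (%X. cor (U2 (%x. eps * C x) w1 w2 v1 v2 X) * M z X) (n z)"
  and duh: "!!z. z \<ge> 0 ==> AE k in lborel.
     m z k = exp (- \<i> * cor (z * free_symbol c w1 w2 v1 v2 k)) * m 0 k
      + 1 / cor (4 * c\<^sup>2)
       * (LINT s:{0..z}|lborel.
          exp (- \<i> * cor ((z - s) * free_symbol c w1 w2 v1 v2 k)) * n s k)"
  and M0: "!!X. M 0 X = cor (M2_initial r \<rho> X)"
  unfolding M2_mild_solution_def by blast
 let ?fs = "free_symbol c w1 w2 v1 v2"
 have Sfs: "S p = ?fs p / eps" for p by (simp add: S)
 have [measurable]: "?fs \<in> borel_measurable borel"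
  unfolding free_symbol_def borel_prod[symmetric] by measurable
 then have Sm[measurable]: "S \<in> borel_measurable borel" unfolding S by measurable
 have m1[measurable]: "(%(z, k). indicator {0..} z *\<^sub>R m z k) \<in> borel_measurable (borel \<Otimes>\<^sub>M borel)"
  and n1[measurable]: "(%(z, k). indicator {0..} z *\<^sub>R n z k) \<in> borel_measurable (borel \<Otimes>\<^sub>M borel)"
  by (rule set_borel_measurable_slices, fact)+
 \<comment> \<open>Extension by 0 to negative \<open>z\<close> gives versions that are measurable on
   the whole product space.\<close>
 define mt where "mt = (%z k. indicator {0..} z *\<^sub>R m z k)"
 define nt where "nt = (%z k. indicator {0..} z *\<^sub>R n z k)"
 have [measurable]: "(%(z, k). mt z k) \<in> borel_measurable (borel \<Otimes>\<^sub>M borel)" "(%(z, k). nt z k) \<in> borel_measurable (borel \<Otimes>\<^sub>M borel)"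
  using m1 n1 by (simp_all add: mt_def nt_def)
 have mt: "mt z = m z" "nt z = n z" if "z \<ge> 0" for z using that by (simp_all add: mt_def nt_def)
 define T where "T = L / eps"
 have T: "T \<ge> 0" "!!t. t \<in> {0..L} ==> t / eps \<in> {0..T}" using L eps by (auto simp: T_def divide_right_mono)
 obtain Bm where Bm: "!!z. z \<in> {0..T} ==> integrable lborel (m z)" "!!z. z \<in> {0..T} ==> (LINT k|lborel. cmod (m z k)) \<le> Bm"
  using L1_continuous_bounded[OF mc, of T] by blast
 have epsF: "integrable lborel (%k. cor eps * F k)" using F by simp
 have epsC: "cor (eps * C x) = (LINT k|lborel. (cor eps * F k) * iexp (k \<bullet> x)) / cor ((2 * pi) ^ DIM(R2))" for x
  unfolding of_real_mult C by (simp only: mult.assoc integral_mult_right_zero times_divide_eq_right)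
 have fac: "cor (coupling w1 w2 v1 v2 j / (2 * pi) ^ DIM(R2)) * (cor eps * z) = cor (4 * c\<^sup>2 * eps) * (\<sigma> j * z)" for j z
  using c by (simp add: \<sigma>)
 have nconv: "AE p in lborel. n z p = cor (4 * c\<^sup>2 * eps) * (\<Sum>j<7. \<sigma> j * (LINT k|lborel. F k * m z (p - jump j k)))"
  if "z \<ge> 0" for z
  using potential_convolution[OF epsF epsC mf[OF that] nf[OF that]]
  unfolding mult.assoc[of "cor eps"] integral_mult_right_zero fac sum_distrib_left .
 have ci: "integrable lborel (%p. LINT k|lborel. F k * m z (p - jump j k))"
  "(LINT p|lborel. cmod (LINT k|lborel. F k * m z (p - jump j k))) \<le> (LINT k|lborel. cmod (F k)) * Bm" if "z \<in> {0..T}" for z j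
 proof -
  show "integrable lborel (%p. LINT k|lborel. F k * m z (p - jump j k))"
   using jump_duality(1)[OF F Bm(1)[OF that] jump_measurable[of j], of "%_ _. 1" 1] by simp
  have "(LINT p|lborel. cmod (LINT k|lborel. F k * m z (p - jump j k))) \<le> (LINT k|lborel. cmod (F k)) * (LINT p|lborel. cmod (m z p))"
   using jump_duality(4)[OF F Bm(1)[OF that] jump_measurable[of j], of "%_ _. 1" 1] by simp
  also have "\<dots> \<le> (LINT k|lborel. cmod (F k)) * Bm" by (intro mult_left_mono Bm that) simp
  finally show "(LINT p|lborel. cmod (LINT k|lborel. F k * m z (p - jump j k))) \<le> (LINT k|lborel. cmod (F k)) * Bm" .
 qed
 have ni: "integrable lborel (n z)" if "z \<ge> 0" for z using has_L1_fourierD(1)[OF nf[OF that]] .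
 define Bn where "Bn = 4 * c\<^sup>2 * eps * ((\<Sum>j<7. cmod (\<sigma> j)) * ((LINT k|lborel. cmod (F k)) * Bm))"
 have Bn: "(LINT p|lborel. cmod (n z p)) \<le> Bn" if z: "z \<in> {0..T}" for z
 proof -
  have z0: "z \<ge> 0" using z by simp
  have si: "integrable lborel (%p. cor (4 * c\<^sup>2 * eps) * (\<Sum>j<7. \<sigma> j * (LINT k|lborel. F k * m z (p - jump j k))))"
   by (intro Bochner_Integration.integrable_sum integrable_mult_right ci z)
  have "(LINT p|lborel. cmod (n z p)) \<le> (LINT p|lborel. 4 * c\<^sup>2 * eps * (\<Sum>j<7. cmod (\<sigma> j) * cmod (LINT k|lborel. F k * m z (p - jump j k))))"
  proof (rule integral_mono_AE)
   show "integrable lborel (%p. 4 * c\<^sup>2 * eps * (\<Sum>j<7. cmod (\<sigma> j) * cmod (LINT k|lborel. F k * m z (p - jump j k))))"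
    by (intro Bochner_Integration.integrable_sum integrable_mult_right integrable_norm ci z)
   show "AE p in lborel. cmod (n z p) \<le> 4 * c\<^sup>2 * eps * (\<Sum>j<7. cmod (\<sigma> j) * cmod (LINT k|lborel. F k * m z (p - jump j k)))"
    using nconv[OF z0]
   proof eventually_elim
    case (elim p)
    have "cmod (\<Sum>j<7. \<sigma> j * (LINT k|lborel. F k * m z (p - jump j k))) \<le> (\<Sum>j<7. cmod (\<sigma> j) * cmod (LINT k|lborel. F k * m z (p - jump j k)))"
     by (rule order_trans[OF norm_sum]) (simp add: norm_mult)
    moreover have "\<bar>4 * c\<^sup>2 * eps\<bar> = 4 * c\<^sup>2 * eps" using c eps by simp
    ultimately show ?case unfolding elim norm_mult norm_of_real using c eps by (simp only:) (rule mult_left_mono, assumption, simp)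
   qed
  qed (use ni[OF z0] in auto)
  also have "\<dots> = 4 * c\<^sup>2 * eps * (\<Sum>j<7. cmod (\<sigma> j) * (LINT p|lborel. cmod (LINT k|lborel. F k * m z (p - jump j k))))"
   by (subst integral_mult_right_zero, subst Bochner_Integration.integral_sum)
    (auto intro!: integrable_mult_right integrable_norm ci z)
  also have "\<dots> \<le> Bn"
   unfolding Bn_def sum_distrib_right using c eps
   by (intro mult_left_mono sum_mono ci z) auto
  finally show ?thesis .
 qed
 \<comment> \<open>The interaction picture: free evolution is removed from the transform. By
   Duhamel's formula its derivative in the new time is \<open>f'\<close>, where the factor
   \<open>1 / eps\<close> comes from the change of time.\<close>
 define f where "f = (%s p. iexp (s * S p) * mt (s / eps) p)"
 define f' where "f' = (%s p. iexp (s * S p) * nt (s / eps) p / cor (4 * c\<^sup>2 * eps))"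
 let ?G = "jump_gen {..<7} \<sigma> jump F S ps"
 have [measurable]: "(%(s, p). f s p) \<in> borel_measurable (borel \<Otimes>\<^sub>M borel)" "(%(s, p). f' s p) \<in> borel_measurable (borel \<Otimes>\<^sub>M borel)"
  unfolding f_def f'_def by measurable
 have Fm: "F \<in> borel_measurable borel" using F by auto
 have Gm: "(%(s, p). ?G s p) \<in> borel_measurable (borel \<Otimes>\<^sub>M borel)"
  by (rule jump_gen_measurable[OF Fm Sm _ psm]) measurable
 have fi: "integrable lborel (f t)" "(LINT p|lborel. cmod (f t p)) \<le> Bm" if t: "t \<in> {0..L}" for t
 proof -
  have f: "f t = (%p. iexp (t * S p) * m (t / eps) p)" using t eps by (simp add: f_def mt)
  show "integrable lborel (f t)"
   by (rule Bochner_Integration.integrable_bound[OF Bm(1)[OF T(2)[OF t]]]) (measurable, simp add: f norm_mult)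
  show "(LINT p|lborel. cmod (f t p)) \<le> Bm" using Bm(2)[OF T(2)[OF t]] by (simp add: f norm_mult)
 qed
 have f'i: "integrable lborel (f' t)" "(LINT p|lborel. cmod (f' t p)) \<le> Bn / (4 * c\<^sup>2 * eps)" if t: "t \<in> {0..L}" for t
 proof -
  have f': "f' t = (%p. iexp (t * S p) * n (t / eps) p / cor (4 * c\<^sup>2 * eps))" using t eps by (simp add: f'_def mt)
  have c': "cmod (f' t p) = cmod (n (t / eps) p) / (4 * c\<^sup>2 * eps)" for p
   unfolding f' norm_divide norm_mult norm_of_real using c eps by simp
  have i: "integrable lborel (n (t / eps))" using ni t eps by simp
  show "integrable lborel (f' t)"
   by (rule Bochner_Integration.integrable_bound[OF integrable_divide_zero[OF integrable_norm[OF i], of "4 * c\<^sup>2 * eps"]])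
    (measurable, use c eps in \<open>simp add: c'\<close>)
  show "(LINT p|lborel. cmod (f' t p)) \<le> Bn / (4 * c\<^sup>2 * eps)"
   unfolding c' integral_divide_zero using c eps by (intro divide_right_mono Bn T t) simp
 qed
 have "(LINT y|lborel. f L y * ps L y) - (LINT y|lborel. f 0 y * ps 0 y)
  = (LINT t:{0..L}|lborel. (LINT y|lborel. f' t y * ps t y - f t y * ?G t y))"
 proof (rule pairing_identity[where B="max B ((\<Sum>j<7. cmod (\<sigma> j)) * (LINT k|lborel. cmod (F k)) * B)"])
  show "sigma_finite_measure (lborel :: R2x4 measure)" by (rule sigma_finite_lborel)
  show "0 \<le> L" using L by simp
  show "(%(t, y). ?G t y) \<in> borel_measurable (borel \<Otimes>\<^sub>M lborel)" using Gm by simp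
  show "integrable (lborel \<Otimes>\<^sub>M lborel) (%(t, y). indicator {0..L} t *\<^sub>R f t y)"
   by (rule integrable_slices[OF sigma_finite_lborel _ fi]) measurable
  show "integrable (lborel \<Otimes>\<^sub>M lborel) (%(t, y). indicator {0..L} t *\<^sub>R f' t y)"
   by (rule integrable_slices[OF sigma_finite_lborel _ f'i]) measurable
  show "integrable lborel (f 0)" "integrable lborel (f L)" using fi(1) L by auto
  show "cmod (ps t y) \<le> max B ((\<Sum>j<7. cmod (\<sigma> j)) * (LINT k|lborel. cmod (F k)) * B)" if "t \<in> {0..L}" for t y
   using psb[OF that] by (simp add: max.coboundedI1)
  show "cmod (?G t y) \<le> max B ((\<Sum>j<7. cmod (\<sigma> j)) * (LINT k|lborel. cmod (F k)) * B)" if "t \<in> {0..L}" for t y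
   by (rule max.coboundedI2, rule jump_gen_bound[where \<phi>=ps and s=t, OF F Sm jump_measurable measurable_slice[OF psm] psb[OF that]]) simp
  show "ps t y = ps L y + (LINT r:{t..L}|lborel. ?G r y)" if "t \<in> {0..L}" for t y
  proof -
   have "ps L y = iexp (y \<bullet> X) * iexp (- (L * S y)) + (LINT r:{L..L}|lborel. ?G r y)" by (rule ps) (use L in simp)
   moreover have "(LINT r:{L..L}|lborel. ?G r y) = 0"
    unfolding set_lebesgue_integral_def
    by (rule integral_eq_zero_AE, rule AE_mp[OF AE_lborel_singleton[of L]]) (auto split: split_indicator)
   ultimately show ?thesis using ps[OF that, of y] by (simp only: add_0_right)
  qed
  show "AE y in lborel. f t y = f 0 y + (LINT r:{0..t}|lborel. f' r y)" if t: "t \<in> {0..L}" for t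
  proof -
   have z: "t / eps \<ge> 0" using t eps by simp
   show ?thesis using duh[OF z]
   proof eventually_elim
    case (elim p)
    have e1: "iexp (t * S p) * exp (- \<i> * cor ((t / eps - s) * ?fs p)) = iexp (s * ?fs p)" for s
    proof -
     have "t * S p + - ((t / eps - s) * ?fs p) = s * ?fs p" by (simp add: Sfs left_diff_distrib)
     then show ?thesis
      unfolding exp_minus_iexp iexp_mult by (simp only:)
    qed
    have "f t p = iexp (t * S p) * m (t / eps) p" using z by (simp add: f_def mt)
    also have "\<dots> = iexp (t * S p) * exp (- \<i> * cor ((t / eps - 0) * ?fs p)) * m 0 p
     + 1 / cor (4 * c\<^sup>2) * (LINT s:{0..t/eps}|lborel. iexp (t * S p) * exp (- \<i> * cor ((t / eps - s) * ?fs p)) * n s p)"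
     unfolding elim set_integral_mult_right diff_zero mult.assoc by (simp only: distrib_left mult.left_commute)
    also have "\<dots> = m 0 p + 1 / cor (4 * c\<^sup>2) * (LINT s:{0..t/eps}|lborel. iexp (s * ?fs p) * n s p)"
     unfolding e1 by simp
    \<comment> \<open>Change of time in Duhamel's integral.\<close>
    also have "(LINT s:{0..t/eps}|lborel. iexp (s * ?fs p) * n s p) = \<bar>1/eps\<bar> *\<^sub>R (LINT s|lborel. indicator {0..t/eps} (0 + (1/eps) * s) *\<^sub>R (iexp ((0 + (1/eps) * s) * ?fs p) * n (0 + (1/eps) * s) p))"
     unfolding set_lebesgue_integral_def using eps by (intro lborel_integral_real_affine) simp
    also have "(LINT s|lborel. indicator {0..t/eps} (0 + (1/eps) * s) *\<^sub>R (iexp ((0 + (1/eps) * s) * ?fs p) * n (0 + (1/eps) * s) p))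
     = (LINT s|lborel. indicator {0..t} s *\<^sub>R (f' s p * cor (4 * c\<^sup>2 * eps)))"
    proof (intro Bochner_Integration.integral_cong refl)
     fix s
     have ii: "s / eps \<in> {0..t/eps} \<longleftrightarrow> s \<in> {0..t}" using eps by (auto simp: divide_le_cancel zero_le_divide_iff)
     moreover have "f' s p * cor (4 * c\<^sup>2 * eps) = iexp (s * S p) * n (s / eps) p" if "s \<in> {0..t}"
      using that c eps by (simp add: f'_def mt)
     moreover have "s / eps * ?fs p = s * S p" by (simp add: Sfs)
     ultimately show "indicator {0..t/eps} (0 + (1/eps) * s) *\<^sub>R (iexp ((0 + (1/eps) * s) * ?fs p) * n (0 + (1/eps) * s) p)
      = indicator {0..t} s *\<^sub>R (f' s p * cor (4 * c\<^sup>2 * eps))"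
     proof (cases "s \<in> {0..t}")
      case False
      then have "s / eps \<notin> {0..t/eps}" by (simp only: ii not_False_eq_True)
      with False show ?thesis
       by (simp only: add_0_left mult.commute[of "1/eps"] times_divide_eq_right mult_1_right indicator_simps(2) scaleR_zero_left not_False_eq_True)
     qed (simp_all only: add_0_left mult.commute[of "1/eps"] times_divide_eq_right mult_1_right indicator_simps scaleR_one scaleR_zero_left if_True if_False)
    qed
    also have "\<dots> = (LINT s:{0..t}|lborel. f' s p) * cor (4 * c\<^sup>2 * eps)"
     unfolding set_lebesgue_integral_def by (simp only: integral_mult_left_zero[symmetric] mult_scaleR_left)
    finally have "f t p = m 0 p + 1 / cor (4 * c\<^sup>2) * (\<bar>1/eps\<bar> *\<^sub>R ((LINT s:{0..t}|lborel. f' s p) * cor (4 * c\<^sup>2 * eps)))" .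
    also have "\<dots> = m 0 p + (LINT s:{0..t}|lborel. f' s p)" using c eps by (simp add: scaleR_conv_of_real)
    finally show ?case by (simp add: f_def mt)
   qed
  qed
 qed (measurable)
 also have "\<dots> = 0"
 proof -
  \<comment> \<open>By \<open>jump_duality\<close> the convolution acting on the transform is
    adjoint to the jumps acting on \<open>ps\<close>, so the integrand of the pairing identity
    vanishes at every time.\<close>
  have "(LINT y|lborel. f' t y * ps t y - f t y * ?G t y) = 0" if t: "t \<in> {0..L}" for t
  proof -
   have z: "t / eps \<ge> 0" "t / eps \<in> {0..T}" using t eps T by auto
   let ?m = "m (t / eps)"
   define A where "A = (%(k::R2) p. iexp (t * S p) * ps t p)"
   have [measurable]: "(%(k::R2, p). A k p) \<in> borel_measurable (borel \<Otimes>\<^sub>M borel)" unfolding A_def by measurable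
   have Ab: "cmod (A k p) \<le> B" for k :: R2 and p using psb[OF t, of p] by (simp add: A_def norm_mult)
   note jd = jump_duality[OF F Bm(1)[OF z(2)] jump_measurable _ Ab]
   have j1: "integrable lborel (%p. LINT k|lborel. F k * ?m (p - jump j k) * A k p)" for j by (rule jd(1)) measurable
   have j2: "integrable lborel (%p. LINT k|lborel. F k * ?m p * A k (p + jump j k))" for j by (rule jd(2)) measurable
   have j3: "(LINT p|lborel. LINT k|lborel. F k * ?m (p - jump j k) * A k p) = (LINT p|lborel. LINT k|lborel. F k * ?m p * A k (p + jump j k))" for j
    by (rule jd(3)) measurable
   have e1: "AE p in lborel. f' t p * ps t p = (\<Sum>j<7. \<sigma> j * (LINT k|lborel. F k * ?m (p - jump j k) * A k p))"
    using nconv[OF z(1)]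
   proof eventually_elim
    case (elim p)
    have "f' t p * ps t p = iexp (t * S p) * (\<Sum>j<7. \<sigma> j * (LINT k|lborel. F k * ?m (p - jump j k))) * ps t p"
     using c eps by (simp add: f'_def mt(2)[OF z(1)] elim)
    also have "\<dots> = (\<Sum>j<7. \<sigma> j * ((LINT k|lborel. F k * ?m (p - jump j k)) * (iexp (t * S p) * ps t p)))"
     unfolding sum_distrib_left sum_distrib_right by (simp only: mult_ac)
    finally show ?case by (simp only: A_def integral_mult_left_zero)
   qed
   have e2: "f t p * ?G t p = (\<Sum>j<7. \<sigma> j * (LINT k|lborel. F k * ?m p * A k (p + jump j k)))" for p
   proof -
    have "f t p * (\<sigma> j * jump_op F S (jump j) ps t p) = \<sigma> j * (LINT k|lborel. F k * ?m p * A k (p + jump j k))" for j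
    proof -
     have x: "iexp (t * S p) * iexp (t * (S (p + jump j k) - S p)) = iexp (t * S (p + jump j k))" for k
      unfolding iexp_mult by (simp only: right_diff_distrib add_diff_cancel_left' diff_add_cancel add_diff_eq)
     have "(LINT k|lborel. F k * ?m p * A k (p + jump j k)) = (LINT k|lborel. f t p * (F k * iexp (t * (S (p + jump j k) - S p)) * ps t (p + jump j k)))"
      by (intro Bochner_Integration.integral_cong refl) (simp only: A_def f_def mt(1)[OF z(1)] x[symmetric] mult_ac)
     then show ?thesis by (simp only: jump_op_def integral_mult_right_zero mult.left_commute)
    qed
    then show ?thesis unfolding jump_gen_def sum_distrib_left by (simp only:)
   qed
   have s1: "integrable lborel (%p. \<Sum>j<7. \<sigma> j * (LINT k|lborel. F k * ?m (p - jump j k) * A k p))"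
    by (intro Bochner_Integration.integrable_sum integrable_mult_right j1)
   have s2: "integrable lborel (%p. \<Sum>j<7. \<sigma> j * (LINT k|lborel. F k * ?m p * A k (p + jump j k)))"
    by (intro Bochner_Integration.integrable_sum integrable_mult_right j2)
   have "(LINT y|lborel. f' t y * ps t y - f t y * ?G t y) = (LINT p|lborel. (\<Sum>j<7. \<sigma> j * (LINT k|lborel. F k * ?m (p - jump j k) * A k p)) - (\<Sum>j<7. \<sigma> j * (LINT k|lborel. F k * ?m p * A k (p + jump j k))))"
    unfolding e2
   proof (rule integral_cong_AE)
    show "AE x in lborel. f' t x * ps t x - (\<Sum>j<7. \<sigma> j * (LINT k|lborel. F k * ?m x * A k (x + jump j k))) = (\<Sum>j<7. \<sigma> j * (LINT k|lborel. F k * ?m (x - jump j k) * A k x)) - (\<Sum>j<7. \<sigma> j * (LINT k|lborel. F k * ?m x * A k (x + jump j k)))"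
     using e1 by eventually_elim (simp only:)
    show "(%x. f' t x * ps t x - (\<Sum>j<7. \<sigma> j * (LINT k|lborel. F k * ?m x * A k (x + jump j k)))) \<in> borel_measurable lborel"
     by (rule borel_measurable_diff[OF _ borel_measurable_integrable[OF s2]]) measurable
   qed (use s1 s2 in auto)
   also have "\<dots> = (\<Sum>j<7. \<sigma> j * (LINT p|lborel. LINT k|lborel. F k * ?m (p - jump j k) * A k p)) - (\<Sum>j<7. \<sigma> j * (LINT p|lborel. LINT k|lborel. F k * ?m p * A k (p + jump j k)))"
    unfolding Bochner_Integration.integral_diff[OF s1 s2]
    by (subst (1 2) Bochner_Integration.integral_sum) (auto intro!: integrable_mult_right j1 j2)
   finally show ?thesis by (simp only: j3 diff_self)
  qed
  then have "(LINT t:{0..L}|lborel. (LINT y|lborel. f' t y * ps t y - f t y * ?G t y)) = (LINT t:{0..L}|lborel. 0)"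
   by (intro set_lebesgue_integral_cong) auto
  then show ?thesis by (simp add: set_lebesgue_integral_def)
 qed
 finally have main: "(LINT y|lborel. f L y * ps L y) = (LINT y|lborel. f 0 y * ps 0 y)" by simp
 let ?c8 = "cor ((2 * pi) ^ DIM(R2x4))"
 have "(LINT y|lborel. f L y * ps L y) = (LINT y|lborel. m (L / eps) y * iexp (y \<bullet> X))"
 proof (intro Bochner_Integration.integral_cong refl)
  fix y
  have "ps L y = iexp (y \<bullet> X) * iexp (- (L * S y)) + (LINT r:{L..L}|lborel. ?G r y)" by (rule ps) (use L in simp)
  moreover have "(LINT r:{L..L}|lborel. ?G r y) = 0"
   unfolding set_lebesgue_integral_def
   by (rule integral_eq_zero_AE, rule AE_mp[OF AE_lborel_singleton[of L]]) (auto split: split_indicator)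
  ultimately have "ps L y = iexp (y \<bullet> X) * iexp (- (L * S y))" by (simp only: add_0_right)
  moreover have "iexp (L * S y) * iexp (- (L * S y)) = 1" unfolding iexp_mult by simp
  ultimately show "f L y * ps L y = m (L / eps) y * iexp (y \<bullet> X)"
   using L eps by (simp add: f_def mt)
 qed
 also have "\<dots> = ?c8 * M (L / eps) X" by (rule has_L1_fourierD(2)[OF mf]) (use L eps in simp)
 finally have 1: "(LINT y|lborel. f L y * ps L y) = ?c8 * M (L / eps) X" .
 \<comment> \<open>\<open>m 0\<close> and \<open>?c8\<close> times \<open>g\<close> have the same
   inverse transform, the initial condition, and so agree almost everywhere.\<close>
 have m0: "integrable lborel (m 0)" using Bm(1)[of 0] T by simp
 have i0: "integrable lborel (%p. m 0 p - ?c8 * g p)" using m0 g(1) by simp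
 have "(LINT p|lborel. (m 0 p - ?c8 * g p) * iexp (p \<bullet> Y)) = 0" for Y
 proof -
  have "integrable lborel (%p. m 0 p * iexp (p \<bullet> Y))" "integrable lborel (%p. ?c8 * (g p * iexp (p \<bullet> Y)))"
   using m0 g(1) by (auto intro!: integrable_mult_right intro: Bochner_Integration.integrable_bound[OF m0] Bochner_Integration.integrable_bound[OF g(1)] simp: norm_mult simp del: of_real_power)
  then have "(LINT p|lborel. (m 0 p - ?c8 * g p) * iexp (p \<bullet> Y)) = (LINT p|lborel. m 0 p * iexp (p \<bullet> Y)) - ?c8 * (LINT p|lborel. g p * iexp (p \<bullet> Y))"
   by (simp only: left_diff_distrib mult.assoc Bochner_Integration.integral_diff integral_mult_right_zero)
  then show ?thesis
   using has_L1_fourierD(2)[OF mf[of 0], of Y] by (simp only: M0 g(2)[symmetric] order_refl) simp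
 qed
 from fourier_L1_unique[OF i0 this] have ae: "AE p in lborel. m 0 p - ?c8 * g p = 0" .
 have [measurable]: "g \<in> borel_measurable borel" using g(1) by auto
 have "(LINT y|lborel. f 0 y * ps 0 y) = (LINT y|lborel. ?c8 * (g y * ps 0 y))"
 proof (rule integral_cong_AE)
  show "AE y in lborel. f 0 y * ps 0 y = ?c8 * (g y * ps 0 y)"
   using ae
  proof eventually_elim
   case (elim p)
   have "f 0 p = m 0 p" by (simp add: f_def mt)
   moreover have "m 0 p = ?c8 * g p" using elim by (simp only: right_minus_eq)
   ultimately show ?case by (simp only: mult.assoc)
  qed
 qed measurable
 then have "?c8 * M (L / eps) X = ?c8 * (LINT y|lborel. g y * ps 0 y)"
  using main 1 by (simp only: integral_mult_right_zero)
 then show ?thesis by simp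
qed

section \<open>Forward densities with an atom, and their duality\<close>

text \<open>The action of the measure \<open>K \<delta>\<^sub>0 + a(\<xi>) d\<xi>\<close> on a function.\<close>
definition mu :: "complex => ('b::euclidean_space => complex) => ('b => complex) => complex" where
 "mu K a f = K * f 0 + (LINT \<xi>|lborel. a \<xi> * f \<xi>)"

lemma mult_bounded_integrable:
 fixes a f :: "'b => complex"
 assumes a: "integrable N a" and [measurable]: "f \<in> borel_measurable N" and b: "!!x. x \<in> space N ==> cmod (f x) \<le> B"
 shows "integrable N (%x. a x * f x)"
  and "cmod (LINT x|N. a x * f x) \<le> (LINT x|N. cmod (a x)) * B"
proof -
 have [measurable]: "a \<in> borel_measurable N" using a by auto
 have le: "cmod (a x * f x) \<le> cmod (a x) * B" if "x \<in> space N" for x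
  unfolding norm_mult by (rule mult_left_mono[OF b[OF that] norm_ge_zero])
 have i: "integrable N (%x. cmod (a x) * B)" using a by simp
 show j: "integrable N (%x. a x * f x)"
  by (rule Bochner_Integration.integrable_bound[OF i]) (measurable, rule AE_I2, rule order_trans[OF le], simp_all)
 have "cmod (LINT x|N. a x * f x) \<le> (LINT x|N. cmod (a x) * B)"
  by (rule Bochner_Integration.integral_norm_bound[THEN order_trans], rule integral_mono[OF integrable_norm[OF j] i le])
 then show "cmod (LINT x|N. a x * f x) \<le> (LINT x|N. cmod (a x)) * B" by simp
qed

lemma mu_bound:
 assumes "integrable lborel a" "f \<in> borel_measurable borel" "!!x. cmod (f x) \<le> B"
 shows "cmod (mu K a f) \<le> (cmod K + (LINT x|lborel. cmod (a x))) * B"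
proof -
 have "cmod (K * f 0) \<le> cmod K * B" unfolding norm_mult by (rule mult_left_mono[OF assms(3) norm_ge_zero])
 moreover have "cmod (LINT \<xi>|lborel. a \<xi> * f \<xi>) \<le> (LINT x|lborel. cmod (a x)) * B"
  by (rule mult_bounded_integrable(2)) (use assms in auto)
 ultimately show ?thesis unfolding mu_def distrib_right by (rule norm_triangle_mono)
qed

lemma mu_diff:
 assumes a: "integrable lborel a" and f: "f \<in> borel_measurable borel" "!!x. cmod (f x) \<le> B"
  and g: "g \<in> borel_measurable borel" "!!x. cmod (g x) \<le> D"
 shows "mu K a (%x. f x - g x) = mu K a f - mu K a g"
proof -
 have "integrable lborel (%x. a x * f x)" "integrable lborel (%x. a x * g x)"
  by (rule mult_bounded_integrable(1)[OF a]; use f g in auto)+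
 then show ?thesis unfolding mu_def right_diff_distrib by simp
qed

lemma mu_add:
 assumes a: "integrable lborel a" and f: "f \<in> borel_measurable borel" "!!x. cmod (f x) \<le> B"
  and g: "g \<in> borel_measurable borel" "!!x. cmod (g x) \<le> D"
 shows "mu K a (%x. f x + g x) = mu K a f + mu K a g"
proof -
 have "integrable lborel (%x. a x * f x)" "integrable lborel (%x. a x * g x)"
  by (rule mult_bounded_integrable(1)[OF a]; use f g in auto)+
 then show ?thesis unfolding mu_def distrib_left by simp
qed

lemma mu_cmult: "mu K a (%x. z * f x) = z * mu K a f"
 unfolding mu_def distrib_left integral_mult_right_zero[symmetric] by (simp add: mult.left_commute)

lemma mu_measurable:
 fixes a :: "real => 'b::euclidean_space => complex"
 assumes [measurable]: "(%(t, x). a t x) \<in> borel_measurable (borel \<Otimes>\<^sub>M borel)" "K \<in> borel_measurable borel"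
  "(%((t, z), x). f t z x) \<in> borel_measurable ((borel \<Otimes>\<^sub>M borel) \<Otimes>\<^sub>M borel)"
 shows "(%(t, z). mu (K t) (a t) (f t z)) \<in> borel_measurable (borel \<Otimes>\<^sub>M borel)"
proof -
 have [measurable]: "(%(t, z). f t z 0) \<in> borel_measurable (borel \<Otimes>\<^sub>M borel)"
 proof -
  have "(%y. (y, 0)) \<in> measurable (borel \<Otimes>\<^sub>M borel) ((borel \<Otimes>\<^sub>M borel) \<Otimes>\<^sub>M borel)" by measurable
  from measurable_compose[OF this assms(3)] show ?thesis by (simp add: case_prod_beta')
 qed
 have [measurable]: "(%x. f (fst (fst x)) (snd (fst x)) (snd x)) \<in> borel_measurable ((borel \<Otimes>\<^sub>M borel) \<Otimes>\<^sub>M borel)"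
  using assms(3) by (simp add: case_prod_beta')
 show ?thesis unfolding mu_def by measurable
qed

lemma mu_integral:
 fixes h :: "'c::euclidean_space => complex" and g :: "'c => 'b::euclidean_space => complex"
 assumes h: "integrable lborel h" and a: "integrable lborel a"
  and [measurable]: "(%(k, x). g k x) \<in> borel_measurable (borel \<Otimes>\<^sub>M borel)" and g: "!!k x. cmod (g k x) \<le> B"
 shows "mu K a (%x. LINT k|lborel. h k * g k x) = (LINT k|lborel. h k * mu K a (g k))"
proof -
 have [measurable]: "a \<in> borel_measurable borel" "h \<in> borel_measurable borel" using a h by auto
 have I: "integrable (lborel \<Otimes>\<^sub>M lborel) (%(k, x). (h k * a x) * g k x)"
  using mult_bounded_integrable(1)[OF integrable_tensor[OF sigma_finite_lborel sigma_finite_lborel h a], of "%(k, x). g k x" B] g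
  by (simp add: case_prod_beta')
 have i0: "integrable lborel (%k. h k * g k 0)"
  by (rule mult_bounded_integrable(1)[OF h]) (use g in auto)
 have i1: "integrable lborel (%k. LINT x|lborel. (h k * a x) * g k x)" using lborel_pair.integrable_fst[OF I] .
 have "(LINT x|lborel. a x * (LINT k|lborel. h k * g k x)) = (LINT x|lborel. LINT k|lborel. (h k * a x) * g k x)"
  unfolding integral_mult_right_zero[symmetric] by (simp add: mult_ac)
 also have "\<dots> = (LINT k|lborel. LINT x|lborel. (h k * a x) * g k x)"
  using lborel_pair.Fubini_integral[OF I] .
 finally have "mu K a (%x. LINT k|lborel. h k * g k x) = (LINT k|lborel. K * (h k * g k 0)) + (LINT k|lborel. LINT x|lborel. (h k * a x) * g k x)"
  unfolding mu_def by simp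
 also have "\<dots> = (LINT k|lborel. K * (h k * g k 0) + (LINT x|lborel. (h k * a x) * g k x))"
  using i0 i1 by simp
 also have "\<dots> = (LINT k|lborel. h k * mu K a (g k))"
  unfolding mu_def distrib_left integral_mult_right_zero[symmetric] by (simp add: mult_ac)
 finally show ?thesis .
qed

text \<open>The rate of change of the density \<open>a\<close> in the interaction picture for the phase \<open>P\<close>.\<close>
definition fwd_rate ::
  "complex => ('b::euclidean_space => complex) => (real => complex) => ('b => real) => (real => 'b => complex) => real => 'b => complex" where
 "fwd_rate ka F K P a s \<xi> = ka * (LINT k|lborel. F k * (a s (\<xi> - k) * iexp (s * (P \<xi> - P (\<xi> - k))) - a s \<xi>))
  + ka * K s * F \<xi> * iexp (s * (P \<xi> - P 0))"

text \<open>The unscattered mass. It decays at the rate \<open>ka\<close> times the integral of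
  \<open>F\<close> and nothing returns to it; what it loses feeds the density through the last term
  of \<open>fwd_rate\<close>.\<close>

definition fwd_atom :: "complex => ('b::euclidean_space => complex) => complex => real => complex" where
 "fwd_atom ka F K0 s = K0 * exp (- (ka * (LINT k|lborel. F k) * s))"

text \<open>The bound \<open>B\<close> is an explicit parameter so that a whole family of densities,
  indexed by the dual variable in the phase, can be required to share it; integration over that
  variable relies on this.\<close>

definition fwd_density ::
  "complex => ('b::euclidean_space => complex) => complex => ('b => real) => real => real => (real => 'b => complex) => bool" where
 "fwd_density ka F K0 P L B a \<longleftrightarrow>
  (%(s, \<xi>). a s \<xi>) \<in> borel_measurable (borel \<Otimes>\<^sub>M borel) \<and>
  (\<forall>s\<in>{0..L}. integrable lborel (a s) \<and> (LINT \<xi>|lborel. cmod (a s \<xi>)) \<le> B) \<and>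
  (\<forall>z\<in>{0..L}. AE \<xi> in lborel. a z \<xi> = (LINT s:{0..z}|lborel. fwd_rate ka F (fwd_atom ka F K0) P a s \<xi>))"

text \<open>The adjoint of gain and loss, acting on test functions. Evaluated at the atom, its jump
  from 0 is the adjoint of the source term of \<open>fwd_rate\<close>.\<close>

definition bwd_rate ::
  "complex => ('b::euclidean_space => complex) => ('b => real) => (real => 'b => complex) => real => 'b => complex" where
 "bwd_rate ka F P \<phi> s \<xi> = ka * (LINT k|lborel. F k * (iexp (s * (P (\<xi> + k) - P \<xi>)) * \<phi> s (\<xi> + k) - \<phi> s \<xi>))"

lemma fwd_rate_measurable:
 assumes [measurable]: "F \<in> borel_measurable borel" "K \<in> borel_measurable borel" "P \<in> borel_measurable borel"
  "(%(s, \<xi>). a s \<xi>) \<in> borel_measurable (borel \<Otimes>\<^sub>M borel)"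
 shows "(%(s, \<xi>). fwd_rate ka F K P a s \<xi>) \<in> borel_measurable (borel \<Otimes>\<^sub>M borel)"
 unfolding fwd_rate_def by measurable

lemma bwd_rate_measurable:
 assumes [measurable]: "F \<in> borel_measurable borel" "P \<in> borel_measurable borel"
  "(%(s, \<xi>). \<phi> s \<xi>) \<in> borel_measurable (borel \<Otimes>\<^sub>M borel)"
 shows "(%(s, \<xi>). bwd_rate ka F P \<phi> s \<xi>) \<in> borel_measurable (borel \<Otimes>\<^sub>M borel)"
 unfolding bwd_rate_def by measurable

lemma fwd_atom_measurable [measurable]: "fwd_atom ka F K0 \<in> borel_measurable borel"
 unfolding fwd_atom_def by measurable

text \<open>Gain and loss can be separated where the convolution converges absolutely, which is
  almost everywhere; elsewhere the integral in \<open>fwd_rate\<close> may be a default value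
  0.\<close>

lemma fwd_rate_AE:
 fixes F :: "'b::euclidean_space => complex"
 assumes F: "integrable lborel F" and [measurable]: "P \<in> borel_measurable borel" and a: "integrable lborel (a s)"
 shows "AE \<xi> in lborel. fwd_rate ka F K P a s \<xi> = ka * (LINT k|lborel. F k * a s (\<xi> - k) * iexp (s * (P \<xi> - P (\<xi> - k))))
   - ka * (LINT k|lborel. F k) * a s \<xi> + ka * K s * F \<xi> * iexp (s * (P \<xi> - P 0))"
proof -
 have [measurable]: "F \<in> borel_measurable borel" "a s \<in> borel_measurable borel" using F a by auto
 have sh: "integrable lborel (%p. a s (p - k))" "(LINT p|lborel. cmod (a s (p - k))) = (LINT p|lborel. cmod (a s p))" for k
  using lborel_shift(1)[of "a s" "- k"] lborel_shift(2)[of "%p. cmod (a s p)" "- k"] a by simp_all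
 have I: "integrable (lborel \<Otimes>\<^sub>M lborel) (%(k, p). F k * a s (p - k))"
  by (rule lborel_pair.Fubini_integrable) (use F a sh in \<open>auto simp: norm_mult\<close>)
 from lborel_pair.AE_integrable_snd[OF I] show ?thesis
 proof eventually_elim
  case (elim \<xi>)
  have i: "integrable lborel (%k. F k * a s (\<xi> - k) * iexp (s * (P \<xi> - P (\<xi> - k))))"
   by (rule mult_bounded_integrable(1)[OF elim, where B=1]) auto
  have "(LINT k|lborel. F k * (a s (\<xi> - k) * iexp (s * (P \<xi> - P (\<xi> - k))) - a s \<xi>))
   = (LINT k|lborel. F k * a s (\<xi> - k) * iexp (s * (P \<xi> - P (\<xi> - k))) - F k * a s \<xi>)"
   by (intro Bochner_Integration.integral_cong refl) (simp only: right_diff_distrib mult.assoc)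
  also have "\<dots> = (LINT k|lborel. F k * a s (\<xi> - k) * iexp (s * (P \<xi> - P (\<xi> - k)))) - (LINT k|lborel. F k) * a s \<xi>"
   using Bochner_Integration.integral_diff[OF i integrable_mult_left[OF F, of "a s \<xi>"]] by (simp only: integral_mult_left_zero)
  finally show ?case unfolding fwd_rate_def by (simp only: right_diff_distrib mult.assoc)
 qed
qed

text \<open>Gain and loss are each bounded by \<open>B\<close> times the total rate, whence the
  factor 2; the third contribution is the source from the atom.\<close>

lemma fwd_rate_integrable:
 fixes F :: "'b::euclidean_space => complex"
 assumes F: "integrable lborel F" and P[measurable]: "P \<in> borel_measurable borel" and a: "integrable lborel (a s)"
  and aB: "(LINT \<xi>|lborel. cmod (a s \<xi>)) \<le> B" and m: "fwd_rate ka F K P a s \<in> borel_measurable borel"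
 shows "integrable lborel (fwd_rate ka F K P a s)"
  and "(LINT \<xi>|lborel. cmod (fwd_rate ka F K P a s \<xi>)) \<le> cmod ka * (LINT k|lborel. cmod (F k)) * (2 * B + cmod (K s))"
proof -
 have [measurable]: "F \<in> borel_measurable borel" "a s \<in> borel_measurable borel" using F a by auto
 let ?N = "LINT k|lborel. cmod (F k)"
 define T1 where "T1 = (%\<xi>. LINT k|lborel. F k * a s (\<xi> - k) * iexp (s * (P \<xi> - P (\<xi> - k))))"
 have jd: "integrable lborel T1" "(LINT \<xi>|lborel. cmod (T1 \<xi>)) \<le> ?N * (LINT \<xi>|lborel. cmod (a s \<xi>)) * 1" unfolding T1_def
  by (rule jump_duality(1)[OF F a, where d="%k. k" and b=1 and G="%k \<xi>. iexp (s * (P \<xi> - P (\<xi> - k)))"]; simp)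
   (rule jump_duality(4)[OF F a, where d="%k. k" and b=1 and G="%k \<xi>. iexp (s * (P \<xi> - P (\<xi> - k)))"]; simp)
 have ib: "integrable lborel (%\<xi>. cmod ka * cmod (T1 \<xi>) + cmod ka * ?N * cmod (a s \<xi>) + cmod ka * cmod (K s) * cmod (F \<xi>))"
  using jd(1) a F by simp
 have ae: "AE \<xi> in lborel. cmod (fwd_rate ka F K P a s \<xi>) \<le> cmod ka * cmod (T1 \<xi>) + cmod ka * ?N * cmod (a s \<xi>) + cmod ka * cmod (K s) * cmod (F \<xi>)"
  using fwd_rate_AE[where a=a and s=s and ka=ka and K=K, OF F P a]
 proof eventually_elim
  case (elim \<xi>)
  have "cmod (ka * (LINT k|lborel. F k) * a s \<xi>) \<le> cmod ka * ?N * cmod (a s \<xi>)"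
   unfolding norm_mult by (intro mult_right_mono mult_left_mono Bochner_Integration.integral_norm_bound) auto
  moreover have "cmod (ka * T1 \<xi>) = cmod ka * cmod (T1 \<xi>)" by (rule norm_mult)
  moreover have "cmod (ka * K s * F \<xi> * iexp (s * (P \<xi> - P 0))) = cmod ka * cmod (K s) * cmod (F \<xi>)"
   by (simp add: norm_mult)
  moreover have e: "fwd_rate ka F K P a s \<xi> = ka * T1 \<xi> - ka * (LINT k|lborel. F k) * a s \<xi> + ka * K s * F \<xi> * iexp (s * (P \<xi> - P 0))"
   unfolding elim T1_def ..
  ultimately show ?case unfolding e
   using norm_triangle_ineq4[of "ka * T1 \<xi>" "ka * (LINT k|lborel. F k) * a s \<xi>"]
    norm_triangle_ineq[of "ka * T1 \<xi> - ka * (LINT k|lborel. F k) * a s \<xi>" "ka * K s * F \<xi> * iexp (s * (P \<xi> - P 0))"]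
   by linarith
 qed
 show i: "integrable lborel (fwd_rate ka F K P a s)"
 proof (rule Bochner_Integration.integrable_bound[OF ib])
  show "AE \<xi> in lborel. cmod (fwd_rate ka F K P a s \<xi>) \<le> norm (cmod ka * cmod (T1 \<xi>) + cmod ka * ?N * cmod (a s \<xi>) + cmod ka * cmod (K s) * cmod (F \<xi>))"
   using ae by eventually_elim (unfold real_norm_def, rule order_trans[OF _ abs_ge_self], assumption)
 qed (use m in simp)
 have "(LINT \<xi>|lborel. cmod (fwd_rate ka F K P a s \<xi>)) \<le> (LINT \<xi>|lborel. cmod ka * cmod (T1 \<xi>) + cmod ka * ?N * cmod (a s \<xi>) + cmod ka * cmod (K s) * cmod (F \<xi>))"
  by (rule integral_mono_AE[OF integrable_norm[OF i] ib ae])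
 also have "\<dots> = cmod ka * (LINT \<xi>|lborel. cmod (T1 \<xi>)) + cmod ka * ?N * (LINT \<xi>|lborel. cmod (a s \<xi>)) + cmod ka * cmod (K s) * ?N"
  using jd(1) a F by simp
 also have "\<dots> \<le> cmod ka * (?N * B) + cmod ka * ?N * B + cmod ka * cmod (K s) * ?N"
 proof (intro add_mono mult_left_mono order_refl aB)
  have "?N * (LINT \<xi>|lborel. cmod (a s \<xi>)) \<le> ?N * B" by (rule mult_left_mono[OF aB]) simp
  then show "(LINT \<xi>|lborel. cmod (T1 \<xi>)) \<le> ?N * B" using jd(2) by simp
 qed auto
 finally show "(LINT \<xi>|lborel. cmod (fwd_rate ka F K P a s \<xi>)) \<le> cmod ka * ?N * (2 * B + cmod (K s))"
  by (simp add: algebra_simps)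
qed

lemma set_integral_Icc_split:
 fixes f :: "real => complex"
 assumes f: "set_integrable lborel {a..c} f" and b: "b \<in> {a..c}"
 shows "(LINT r:{a..c}|lborel. f r) = (LINT r:{a..b}|lborel. f r) + (LINT r:{b..c}|lborel. f r)"
proof -
 have i1: "set_integrable lborel {a..b} f" and i2: "set_integrable lborel {b..c} f"
  using b by (auto intro!: set_integrable_subset[OF f])
 have "(LINT r|lborel. indicator {a..c} r *\<^sub>R f r) = (LINT r|lborel. indicator {a..b} r *\<^sub>R f r + indicator {b..c} r *\<^sub>R f r)"
 proof (rule integral_cong_AE)
  show "AE r in lborel. indicator {a..c} r *\<^sub>R f r = indicator {a..b} r *\<^sub>R f r + indicator {b..c} r *\<^sub>R f r"
   by (rule AE_mp[OF AE_lborel_singleton[of b]]) (use b in \<open>auto split: split_indicator\<close>)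
 qed (use f i1 i2 in \<open>auto simp: set_integrable_def intro!: borel_measurable_add\<close>)
 then show ?thesis using i1 i2 by (simp add: set_lebesgue_integral_def set_integrable_def)
qed

lemma fwd_atom_integral:
 assumes "s \<le> t"
 shows "fwd_atom ka F K0 t = fwd_atom ka F K0 s + (LINT r:{s..t}|lborel. - (ka * (LINT k|lborel. F k)) * fwd_atom ka F K0 r)"
proof -
 let ?c = "ka * (LINT k|lborel. F k)"
 have "(LINT r|lborel. indicator {s..t} r *\<^sub>R (- ?c * fwd_atom ka F K0 r)) = fwd_atom ka F K0 t - fwd_atom ka F K0 s"
 proof (rule integral_FTC_atLeastAtMost[OF assms])
  show "(fwd_atom ka F K0 has_vector_derivative - ?c * fwd_atom ka F K0 x) (at x within {s..t})" for x
  proof -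
   have "((%z. K0 * exp (- (?c * z))) has_field_derivative - ?c * (K0 * exp (- (?c * cor x)))) (at (cor x))"
    by (auto intro!: derivative_eq_intros)
   from has_vector_derivative_real_field[OF this] show ?thesis unfolding fwd_atom_def .
  qed
  show "continuous_on {s..t} (%r. - ?c * fwd_atom ka F K0 r)" unfolding fwd_atom_def by (intro continuous_intros)
 qed
 then show ?thesis by (simp add: set_lebesgue_integral_def)
qed

lemma fwd_atom_bounded:
 obtains D where "!!s. s \<in> {0..L} ==> cmod (fwd_atom ka F K0 s) \<le> D"
proof -
 have "continuous_on {0..L} (fwd_atom ka F K0)" unfolding fwd_atom_def by (intro continuous_intros)
 then have "compact (fwd_atom ka F K0 ` {0..L})" by (rule compact_continuous_image) simp
 from compact_imp_bounded[OF this] obtain D where "\<forall>y\<in>fwd_atom ka F K0 ` {0..L}. cmod y \<le> D"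
  unfolding bounded_iff by auto
 then show thesis by (intro that[of D]) auto
qed

text \<open>The density is paired with \<open>\<phi>\<close> by \<open>pairing_identity\<close>, the
  atom with \<open>\<phi>\<close> at 0 by integration by parts. Neither contribution closes by
  itself: the source term in the density is the jump part of \<open>bwd_rate\<close> at 0, weighted
  with the atom, and only the sum is \<open>mu\<close> of \<open>bwd_rate\<close>.\<close>

lemma forward_duality:
 fixes F :: "'b::euclidean_space => complex" and a :: "real => 'b => complex"
 assumes F: "integrable lborel F" and P[measurable]: "P \<in> borel_measurable borel"
  and a: "fwd_density ka F K0 P L B a" and s: "s \<in> {0..L}"
  and [measurable]: "(%(t, \<xi>). \<phi> t \<xi>) \<in> borel_measurable (borel \<Otimes>\<^sub>M borel)" "(%(t, \<xi>). \<phi>' t \<xi>) \<in> borel_measurable (borel \<Otimes>\<^sub>M borel)"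
  and D: "!!t \<xi>. t \<in> {0..L} ==> cmod (\<phi> t \<xi>) \<le> D" "!!t \<xi>. t \<in> {0..L} ==> cmod (\<phi>' t \<xi>) \<le> D"
  and \<phi>: "!!t \<xi>. t \<in> {0..L} ==> \<phi> t \<xi> = \<phi> L \<xi> + (LINT r:{t..L}|lborel. \<phi>' r \<xi>)"
 shows "mu (fwd_atom ka F K0 L) (a L) (\<phi> L) - mu (fwd_atom ka F K0 s) (a s) (\<phi> s)
  = (LINT r:{s..L}|lborel. mu (fwd_atom ka F K0 r) (a r) (bwd_rate ka F P \<phi> r) - mu (fwd_atom ka F K0 r) (a r) (\<phi>' r))"
proof -
 let ?K = "fwd_atom ka F K0" and ?R = "fwd_rate ka F (fwd_atom ka F K0) P a" and ?H = "LINT k|lborel. F k"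
 have am[measurable]: "(%(s, \<xi>). a s \<xi>) \<in> borel_measurable (borel \<Otimes>\<^sub>M borel)"
  and ai: "!!t. t \<in> {0..L} ==> integrable lborel (a t)" and aB: "!!t. t \<in> {0..L} ==> (LINT \<xi>|lborel. cmod (a t \<xi>)) \<le> B"
  and ae: "!!z. z \<in> {0..L} ==> AE \<xi> in lborel. a z \<xi> = (LINT s:{0..z}|lborel. ?R s \<xi>)"
  using a by (auto simp: fwd_density_def)
 have Fm[measurable]: "F \<in> borel_measurable borel" using F by auto
 have Rm[measurable]: "(%(s, \<xi>). ?R s \<xi>) \<in> borel_measurable (borel \<Otimes>\<^sub>M borel)"
  by (rule fwd_rate_measurable) measurable
 have sL: "s \<le> L" "0 \<le> s" using s by auto
 have sub: "t \<in> {0..L}" if "t \<in> {s..L}" for t using that sL by auto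
 obtain DK where DK: "!!t. t \<in> {0..L} ==> cmod (?K t) \<le> DK" using fwd_atom_bounded[of L ka F K0] by blast
 define BR where "BR = cmod ka * (LINT k|lborel. cmod (F k)) * (2 * B + DK)"
 have Ri: "integrable lborel (?R t)" "(LINT \<xi>|lborel. cmod (?R t \<xi>)) \<le> BR" if t: "t \<in> {0..L}" for t
 proof -
  note r = fwd_rate_integrable[where a=a and s=t and K="?K" and ka=ka, OF F P ai[OF t] aB[OF t] measurable_slice[OF Rm]]
  show "integrable lborel (?R t)" by (rule r(1))
  have "(LINT \<xi>|lborel. cmod (?R t \<xi>)) \<le> cmod ka * (LINT k|lborel. cmod (F k)) * (2 * B + cmod (?K t))" by (rule r(2))
  also have "\<dots> \<le> BR" unfolding BR_def by (intro mult_left_mono add_left_mono DK t) auto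
  finally show "(LINT \<xi>|lborel. cmod (?R t \<xi>)) \<le> BR" .
 qed
 have Ri2: "integrable (lborel \<Otimes>\<^sub>M lborel) (%(t, y). indicator {0..L} t *\<^sub>R ?R t y)"
  by (rule integrable_slices[OF sigma_finite_lborel _ Ri]) measurable
 have "(LINT y|lborel. a L y * \<phi> L y) - (LINT y|lborel. a s y * \<phi> s y)
  = (LINT t:{s..L}|lborel. (LINT y|lborel. ?R t y * \<phi> t y - a t y * \<phi>' t y))"
 proof (rule pairing_identity[where B=D])
  show "sigma_finite_measure (lborel :: 'b measure)" by (rule sigma_finite_lborel)
  show "integrable (lborel \<Otimes>\<^sub>M lborel) (%(t, y). indicator {s..L} t *\<^sub>R a t y)"
   by (rule integrable_slices[OF sigma_finite_lborel _ ai[OF sub] aB[OF sub]]) measurable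
  show "integrable (lborel \<Otimes>\<^sub>M lborel) (%(t, y). indicator {s..L} t *\<^sub>R ?R t y)"
   by (rule integrable_slices[OF sigma_finite_lborel _ Ri(1)[OF sub] Ri(2)[OF sub]]) measurable
  show "integrable lborel (a s)" "integrable lborel (a L)" using ai s sL by auto
  show "AE y in lborel. a t y = a s y + (LINT r:{s..t}|lborel. ?R r y)" if t: "t \<in> {s..L}" for t
   using ae[OF sub[OF t]] ae[OF s] lborel_pair.AE_integrable_snd[OF Ri2]
  proof eventually_elim
   case (elim y)
   have "set_integrable lborel {0..L} (%r. ?R r y)" using elim(3) by (simp add: set_integrable_def)
   then have "set_integrable lborel {0..t} (%r. ?R r y)" by (rule set_integrable_subset) (use t in auto)
   \<comment> \<open>The equation for the density starts at time 0; subtracting its instance at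
     \<open>s\<close> gives the increment from \<open>s\<close> on.\<close>
   from set_integral_Icc_split[OF this, of s] show ?case using elim(1,2) t sL by simp
  qed
  show "cmod (\<phi> t y) \<le> D" "cmod (\<phi>' t y) \<le> D" if "t \<in> {s..L}" for t y using D sub[OF that] by auto
  show "\<phi> t y = \<phi> L y + (LINT r:{t..L}|lborel. \<phi>' r y)" if "t \<in> {s..L}" for t y by (rule \<phi>[OF sub[OF that]])
 qed (use sL in measurable)
 moreover have "(LINT t:{s..L}|lborel. (- (ka * ?H) * ?K t) * \<phi> t 0 - ?K t * \<phi>' t 0) = ?K L * \<phi> L 0 - ?K s * \<phi> s 0"
 proof (rule integral_by_parts_AE[OF sL(1)])
  have c: "continuous_on {s..L} (%t. - (ka * ?H) * ?K t)" unfolding fwd_atom_def by (intro continuous_intros)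
  show "set_integrable lborel {s..L} (%t. - (ka * ?H) * ?K t)" by (rule borel_integrable_atLeastAtMost'[OF c])
  show "set_integrable lborel {s..L} (%t. \<phi>' t 0)" unfolding set_integrable_def
  proof (rule Bochner_Integration.integrable_bound[where f="%t. D * indicator {s..L} t"])
   show "AE x in lborel. norm (indicator {s..L} x *\<^sub>R \<phi>' x 0) \<le> norm (D * indicator {s..L} x)"
    using order_trans[OF D(2)[OF sub] abs_ge_self, of _ 0] by (intro AE_I2) (auto split: split_indicator)
  qed (simp_all add: emeasure_lborel_Icc_eq)
  show "AE t in lborel. t \<in> {s..L} \<longrightarrow> ?K t = ?K s + (LINT r:{s..t}|lborel. - (ka * ?H) * ?K r)"
   by (intro AE_I2 impI fwd_atom_integral) auto
  show "?K L = ?K s + (LINT r:{s..L}|lborel. - (ka * ?H) * ?K r)" by (rule fwd_atom_integral[OF sL(1)])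
  show "\<phi> t 0 = \<phi> L 0 + (LINT r:{t..L}|lborel. \<phi>' r 0)" if "t \<in> {s..L}" for t by (rule \<phi>[OF sub[OF that]])
  show "set_borel_measurable borel {s..L} ?K" "set_borel_measurable borel {s..L} (%t. \<phi> t 0)"
   unfolding set_borel_measurable_def by measurable
 qed
 ultimately have "mu (?K L) (a L) (\<phi> L) - mu (?K s) (a s) (\<phi> s)
  = (LINT t:{s..L}|lborel. (- (ka * ?H) * ?K t) * \<phi> t 0 - ?K t * \<phi>' t 0) + (LINT t:{s..L}|lborel. (LINT y|lborel. ?R t y * \<phi> t y - a t y * \<phi>' t y))"
  unfolding mu_def by simp
 also have "\<dots> = (LINT t:{s..L}|lborel. ((- (ka * ?H) * ?K t) * \<phi> t 0 - ?K t * \<phi>' t 0) + (LINT y|lborel. ?R t y * \<phi> t y - a t y * \<phi>' t y))"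
 proof (rule set_integral_add(2)[symmetric])
  have B1: "cmod ((- (ka * ?H) * ?K t) * \<phi> t 0 - ?K t * \<phi>' t 0) \<le> cmod (ka * ?H) * DK * D + DK * D" if t: "t \<in> {0..L}" for t
  proof -
   have "cmod (?K t) * cmod (\<phi> t 0) \<le> DK * D" "cmod (?K t) * cmod (\<phi>' t 0) \<le> DK * D"
    using DK[OF t] D(1)[OF t, of 0] D(2)[OF t, of 0] order_trans[OF norm_ge_zero DK[OF t]] by (auto intro!: mult_mono)
   then have "cmod ((- (ka * ?H) * ?K t) * \<phi> t 0) \<le> cmod (ka * ?H) * (DK * D)" "cmod (?K t * \<phi>' t 0) \<le> DK * D"
    unfolding norm_mult[of "- (ka * ?H) * ?K t"] norm_mult[of "- (ka * ?H)"] norm_mult[of "?K t"] norm_minus_cancel mult.assoc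
    by (auto intro!: mult_left_mono)
   then show ?thesis using norm_triangle_ineq4[of "(- (ka * ?H) * ?K t) * \<phi> t 0" "?K t * \<phi>' t 0"] unfolding mult.assoc[symmetric] by linarith
  qed
  show "set_integrable lborel {s..L} (%t. (- (ka * ?H) * ?K t) * \<phi> t 0 - ?K t * \<phi>' t 0)"
   unfolding set_integrable_def
  proof (rule Bochner_Integration.integrable_bound[where f="%t. (cmod (ka * ?H) * DK * D + DK * D) * indicator {s..L} t"])
   show "AE x in lborel. norm (indicator {s..L} x *\<^sub>R ((- (ka * ?H) * ?K x) * \<phi> x 0 - ?K x * \<phi>' x 0)) \<le> norm ((cmod (ka * ?H) * DK * D + DK * D) * indicator {s..L} x)"
   proof (intro AE_I2)
    fix x
    show "norm (indicator {s..L} x *\<^sub>R ((- (ka * ?H) * ?K x) * \<phi> x 0 - ?K x * \<phi>' x 0)) \<le> norm ((cmod (ka * ?H) * DK * D + DK * D) * indicator {s..L} x)"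
    proof (cases "x \<in> {s..L}")
     case True
     from order_trans[OF B1[OF sub[OF True]] abs_ge_self] True show ?thesis by (simp only: indicator_simps scaleR_one mult_1_right real_norm_def)
    qed simp
   qed
  qed (simp_all add: emeasure_lborel_Icc_eq)
  have H1: "integrable (lborel \<Otimes>\<^sub>M lborel) (%(t, y). indicator {s..L} t *\<^sub>R (?R t y * \<phi> t y - a t y * \<phi>' t y))"
  proof (rule integrable_slices[OF sigma_finite_lborel])
   show "integrable lborel (%y. ?R t y * \<phi> t y - a t y * \<phi>' t y)" if "t \<in> {s..L}" for t
    by (intro Bochner_Integration.integrable_diff mult_bounded_integrable(1)[OF Ri(1)[OF sub[OF that]], where B=D] mult_bounded_integrable(1)[OF ai[OF sub[OF that]], where B=D])
     (use D sub[OF that] in auto)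
   show "(LINT y|lborel. cmod (?R t y * \<phi> t y - a t y * \<phi>' t y)) \<le> \<bar>D\<bar> * (BR + B)" if t: "t \<in> {s..L}" for t
   proof -
    have "(LINT y|lborel. cmod (?R t y * \<phi> t y - a t y * \<phi>' t y)) \<le> (LINT y|lborel. \<bar>D\<bar> * (cmod (?R t y) + cmod (a t y)))"
    proof (rule integral_mono')
     fix y
     have "cmod (?R t y * \<phi> t y) \<le> cmod (?R t y) * \<bar>D\<bar>" "cmod (a t y * \<phi>' t y) \<le> cmod (a t y) * \<bar>D\<bar>"
      unfolding norm_mult by (intro mult_left_mono order_trans[OF D(1)[OF sub[OF t]]] order_trans[OF D(2)[OF sub[OF t]]]; simp)+
     then show "cmod (?R t y * \<phi> t y - a t y * \<phi>' t y) \<le> \<bar>D\<bar> * (cmod (?R t y) + cmod (a t y))"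
      using norm_triangle_ineq4[of "?R t y * \<phi> t y" "a t y * \<phi>' t y"] unfolding distrib_left mult.commute[of "\<bar>D\<bar>"] by linarith
    qed (use Ri(1)[OF sub[OF t]] ai[OF sub[OF t]] in auto)
    also have "\<dots> = \<bar>D\<bar> * ((LINT y|lborel. cmod (?R t y)) + (LINT y|lborel. cmod (a t y)))"
     using Ri(1)[OF sub[OF t]] ai[OF sub[OF t]] by simp
    also have "\<dots> \<le> \<bar>D\<bar> * (BR + B)" by (intro mult_left_mono add_mono Ri(2) aB sub t) simp
    finally show ?thesis .
   qed
  qed measurable
  show "set_integrable lborel {s..L} (%t. LINT y|lborel. ?R t y * \<phi> t y - a t y * \<phi>' t y)"
   unfolding set_integrable_def using lborel_pair.integrable_fst[OF H1] by (simp only: integral_scaleR_right)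
 qed
 also have "\<dots> = (LINT r:{s..L}|lborel. mu (?K r) (a r) (bwd_rate ka F P \<phi> r) - mu (?K r) (a r) (\<phi>' r))"
 proof (rule set_lebesgue_integral_cong)
  show "\<forall>t. t \<in> {s..L} \<longrightarrow> ((- (ka * ?H) * ?K t) * \<phi> t 0 - ?K t * \<phi>' t 0) + (LINT y|lborel. ?R t y * \<phi> t y - a t y * \<phi>' t y)
   = mu (?K t) (a t) (bwd_rate ka F P \<phi> t) - mu (?K t) (a t) (\<phi>' t)"
  proof (intro allI impI)
   fix t assume "t \<in> {s..L}" then have t: "t \<in> {0..L}" by (rule sub)
   have at: "integrable lborel (a t)" by (rule ai[OF t])
   have [measurable]: "a t \<in> borel_measurable borel" using at by auto
   have [measurable]: "\<phi> t \<in> borel_measurable borel" "\<phi>' t \<in> borel_measurable borel" by (rule measurable_slice, measurable)+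
   have iR: "integrable lborel (%y. ?R t y * \<phi> t y)" by (rule mult_bounded_integrable(1)[OF Ri(1)[OF t], where B=D]) (use D t in auto)
   have iA: "integrable lborel (%y. a t y * \<phi>' t y)" "integrable lborel (%y. a t y * \<phi> t y)"
    by (rule mult_bounded_integrable(1)[OF at, where B=D]; use D t in auto)+
   define G where "G = (%k p. iexp (t * (P p - P (p - k))) * \<phi> t p)"
   have Gm[measurable]: "(%(k, p). G k p) \<in> borel_measurable (borel \<Otimes>\<^sub>M borel)" unfolding G_def by measurable
   have Gb: "cmod (G k p) \<le> D" for k p using D(1)[OF t, of p] by (simp add: G_def norm_mult)
   note jd = jump_duality[OF F at, of "%k. k" G D, OF _ Gm Gb]
   have j1: "integrable lborel (%p. LINT k|lborel. F k * a t (p - k) * G k p)" by (rule jd(1)) measurable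
   have j2: "integrable lborel (%p. LINT k|lborel. F k * a t p * G k (p + k))" by (rule jd(2)) measurable
   have j3: "(LINT p|lborel. (LINT k|lborel. F k * a t (p - k) * G k p)) = (LINT p|lborel. (LINT k|lborel. F k * a t p * G k (p + k)))"
    by (rule jd(3)) measurable
   have iF: "integrable lborel (%k. F k * (iexp (t * (P k - P 0)) * \<phi> t k))"
    by (rule mult_bounded_integrable(1)[OF F, where B=D]) (use D t in \<open>auto simp: norm_mult\<close>)
   have iFb: "integrable lborel (%k. F k * (iexp (t * (P (p + k) - P p)) * \<phi> t (p + k)))" for p
    by (rule mult_bounded_integrable(1)[OF F, where B=D]) (use D t in \<open>auto simp: norm_mult\<close>)
   have bw: "bwd_rate ka F P \<phi> t p = ka * (LINT k|lborel. F k * (iexp (t * (P (p + k) - P p)) * \<phi> t (p + k))) - ka * ?H * \<phi> t p" for p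
   proof -
    have "(LINT k|lborel. F k * (iexp (t * (P (p + k) - P p)) * \<phi> t (p + k) - \<phi> t p))
     = (LINT k|lborel. F k * (iexp (t * (P (p + k) - P p)) * \<phi> t (p + k)) - F k * \<phi> t p)"
     by (intro Bochner_Integration.integral_cong refl) (simp only: right_diff_distrib)
    also have "\<dots> = (LINT k|lborel. F k * (iexp (t * (P (p + k) - P p)) * \<phi> t (p + k))) - ?H * \<phi> t p"
     using Bochner_Integration.integral_diff[OF iFb integrable_mult_left[OF F, of "\<phi> t p"]] by (simp only: integral_mult_left_zero)
    finally show ?thesis unfolding bwd_rate_def by (simp only: right_diff_distrib mult.assoc)
   qed
   have "(LINT y|lborel. ?R t y * \<phi> t y) = (LINT p|lborel. ka * (LINT k|lborel. F k * a t (p - k) * G k p) - ka * ?H * (a t p * \<phi> t p) + ka * ?K t * (F p * (iexp (t * (P p - P 0)) * \<phi> t p)))"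
   proof (rule integral_cong_AE)
    show "AE p in lborel. ?R t p * \<phi> t p = ka * (LINT k|lborel. F k * a t (p - k) * G k p) - ka * ?H * (a t p * \<phi> t p) + ka * ?K t * (F p * (iexp (t * (P p - P 0)) * \<phi> t p))"
     using fwd_rate_AE[where a=a and s=t and ka=ka and K="?K", OF F P at]
    proof eventually_elim
     case (elim p)
     have "(LINT k|lborel. F k * a t (p - k) * G k p) = (LINT k|lborel. F k * a t (p - k) * iexp (t * (P p - P (p - k)))) * \<phi> t p"
      unfolding integral_mult_left_zero[symmetric] G_def by (simp only: mult.assoc)
     then show ?case unfolding elim by (simp only: left_diff_distrib distrib_right mult.assoc)
    qed
    show "(%y. ?R t y * \<phi> t y) \<in> borel_measurable lborel" using iR by auto
    show "(%p. ka * (LINT k|lborel. F k * a t (p - k) * G k p) - ka * ?H * (a t p * \<phi> t p) + ka * ?K t * (F p * (iexp (t * (P p - P 0)) * \<phi> t p))) \<in> borel_measurable lborel"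
     by measurable
   qed
   also have "\<dots> = ka * (LINT p|lborel. (LINT k|lborel. F k * a t (p - k) * G k p)) - ka * ?H * (LINT p|lborel. a t p * \<phi> t p) + ka * ?K t * (LINT p|lborel. F p * (iexp (t * (P p - P 0)) * \<phi> t p))"
    using j1 iA(2) iF
    by (simp only: Bochner_Integration.integral_add Bochner_Integration.integral_diff integral_mult_right_zero Bochner_Integration.integrable_diff integrable_mult_right)
   finally have r1: "(LINT y|lborel. ?R t y * \<phi> t y) = ka * (LINT p|lborel. (LINT k|lborel. F k * a t p * G k (p + k))) - ka * ?H * (LINT p|lborel. a t p * \<phi> t p) + ka * ?K t * (LINT p|lborel. F p * (iexp (t * (P p - P 0)) * \<phi> t p))"
    unfolding j3 .
   have pt: "a t p * bwd_rate ka F P \<phi> t p = ka * (LINT k|lborel. F k * a t p * G k (p + k)) - ka * ?H * (a t p * \<phi> t p)" for p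
   proof -
    have "(LINT k|lborel. F k * a t p * G k (p + k)) = (LINT k|lborel. a t p * (F k * (iexp (t * (P (p + k) - P p)) * \<phi> t (p + k))))"
     unfolding G_def add_diff_cancel_right' by (intro Bochner_Integration.integral_cong refl) (simp only: mult_ac)
    then have e: "(LINT k|lborel. F k * a t p * G k (p + k)) = a t p * (LINT k|lborel. F k * (iexp (t * (P (p + k) - P p)) * \<phi> t (p + k)))"
     by (simp only: integral_mult_right_zero)
    show ?thesis unfolding bw e right_diff_distrib by (simp only: mult_ac)
   qed
   have A1: "(LINT p|lborel. a t p * bwd_rate ka F P \<phi> t p) = ka * (LINT p|lborel. (LINT k|lborel. F k * a t p * G k (p + k))) - ka * ?H * (LINT p|lborel. a t p * \<phi> t p)"
    unfolding pt using j2 iA(2) by (simp only: Bochner_Integration.integral_diff integral_mult_right_zero integrable_mult_right)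
   have A2: "?K t * bwd_rate ka F P \<phi> t 0 = ka * ?K t * (LINT p|lborel. F p * (iexp (t * (P p - P 0)) * \<phi> t p)) - ka * ?H * ?K t * \<phi> t 0"
    unfolding bw by (simp add: right_diff_distrib mult_ac)
   have A3: "(LINT y|lborel. ?R t y * \<phi> t y - a t y * \<phi>' t y) = (LINT y|lborel. ?R t y * \<phi> t y) - (LINT y|lborel. a t y * \<phi>' t y)"
    using iR iA(1) by (rule Bochner_Integration.integral_diff)
   \<comment> \<open>\<open>Z\<close> is the source term: on the left it belongs to the pairing of
     the density, on the right to the jump of the atom.\<close>
   have alg: "(- (kap * H) * K) * ph - K * php + (IR - W) = (KB + Abw) - (K * php + W)"
    if "Abw = kap * X - kap * H * Y" "KB = kap * K * Z - kap * H * K * ph" "IR = kap * X - kap * H * Y + kap * K * Z"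
    for kap H K ph php X Y Z Abw KB IR W :: complex
    unfolding that by (simp add: algebra_simps)
   show "((- (ka * ?H) * ?K t) * \<phi> t 0 - ?K t * \<phi>' t 0) + (LINT y|lborel. ?R t y * \<phi> t y - a t y * \<phi>' t y)
   = mu (?K t) (a t) (bwd_rate ka F P \<phi> t) - mu (?K t) (a t) (\<phi>' t)"
    unfolding mu_def A3 by (rule alg[OF A1 A2 r1])
  qed
 qed simp
 finally show ?thesis .
qed

lemma bwd_rate_bound:
 fixes F :: "'b::euclidean_space => complex"
 assumes F: "integrable lborel F" and [measurable]: "P \<in> borel_measurable borel" "\<phi> s \<in> borel_measurable borel"
  and b: "!!\<xi>. cmod (\<phi> s \<xi>) \<le> D"
 shows "cmod (bwd_rate ka F P \<phi> s \<xi>) \<le> cmod ka * (LINT k|lborel. cmod (F k)) * (2 * D)"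
proof -
 have "cmod (iexp (s * (P (\<xi> + k) - P \<xi>)) * \<phi> s (\<xi> + k) - \<phi> s \<xi>) \<le> 2 * D" for k
  using norm_triangle_ineq4[of "iexp (s * (P (\<xi> + k) - P \<xi>)) * \<phi> s (\<xi> + k)" "\<phi> s \<xi>"] b[of \<xi>] b[of "\<xi> + k"]
  unfolding norm_mult norm_exp_i_times by linarith
 then have "cmod (LINT k|lborel. F k * (iexp (s * (P (\<xi> + k) - P \<xi>)) * \<phi> s (\<xi> + k) - \<phi> s \<xi>)) \<le> (LINT k|lborel. cmod (F k)) * (2 * D)"
  by (intro mult_bounded_integrable(2)[OF F]) auto
 then show ?thesis unfolding bwd_rate_def norm_mult mult.assoc by (rule mult_left_mono) simp
qed

text \<open>Both factors share the atom \<open>K\<close>. The iterated form lets the one-variable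
  duality act on the outer variable while the inner one is integrated out.\<close>

definition mu2 :: "complex => ('b::euclidean_space => complex) => ('b => complex) => ('b => 'b => complex) => complex" where
 "mu2 K a b f = mu K a (%\<xi>. mu K b (f \<xi>))"

lemma measurable_triple:
 assumes "(%((t, \<xi>), \<eta>). f t \<xi> \<eta>) \<in> borel_measurable ((M1 \<Otimes>\<^sub>M M2) \<Otimes>\<^sub>M M3)"
  and [measurable]: "u \<in> measurable N M1" "v \<in> measurable N M2" "w \<in> measurable N M3"
 shows "(%x. f (u x) (v x) (w x)) \<in> borel_measurable N"
proof -
 have "(%x. ((u x, v x), w x)) \<in> measurable N ((M1 \<Otimes>\<^sub>M M2) \<Otimes>\<^sub>M M3)" by measurable
 from measurable_compose[OF this assms(1)] show ?thesis by simp
qed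

lemma measurable_triple_slices:
 fixes f :: "'p::topological_space => 'q::topological_space => 'r::topological_space => complex"
 assumes m: "(%((t, \<xi>), \<eta>). f t \<xi> \<eta>) \<in> borel_measurable ((borel \<Otimes>\<^sub>M borel) \<Otimes>\<^sub>M borel)"
 shows "f t \<xi> \<in> borel_measurable borel" "(%\<xi>. f t \<xi> \<eta>) \<in> borel_measurable borel"
proof -
 have "(%\<eta>. ((t, \<xi>), \<eta>)) \<in> measurable borel ((borel \<Otimes>\<^sub>M borel) \<Otimes>\<^sub>M borel)" by measurable
 from measurable_compose[OF this m] show "f t \<xi> \<in> borel_measurable borel" by simp
 have "(%\<xi>. ((t, \<xi>), \<eta>)) \<in> measurable borel ((borel \<Otimes>\<^sub>M borel) \<Otimes>\<^sub>M borel)" by measurable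
 from measurable_compose[OF this m] show "(%\<xi>. f t \<xi> \<eta>) \<in> borel_measurable borel" by simp
qed

lemma bwd_rate_measurable_triple:
 fixes F :: "'b::euclidean_space => complex" and ps :: "real => 'c::euclidean_space => 'b => complex"
 assumes [measurable]: "F \<in> borel_measurable borel" "P \<in> borel_measurable borel"
  and m: "(%((t, \<xi>), \<eta>). ps t \<xi> \<eta>) \<in> borel_measurable ((borel \<Otimes>\<^sub>M borel) \<Otimes>\<^sub>M borel)"
 shows "(%x. bwd_rate ka F P (%t. ps t (snd (fst x))) (fst (fst x)) (snd x)) \<in> borel_measurable ((borel \<Otimes>\<^sub>M borel) \<Otimes>\<^sub>M borel)"
proof -
 have [measurable]: "(%x. ps (fst (fst (fst x))) (snd (fst (fst x))) (snd (fst x) + snd x)) \<in> borel_measurable (((borel \<Otimes>\<^sub>M borel) \<Otimes>\<^sub>M borel) \<Otimes>\<^sub>M lborel)"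
  "(%x. ps (fst (fst (fst x))) (snd (fst (fst x))) (snd (fst x))) \<in> borel_measurable (((borel \<Otimes>\<^sub>M borel) \<Otimes>\<^sub>M borel) \<Otimes>\<^sub>M lborel)"
  by (rule measurable_triple[OF m]; measurable)+
 have "(%x. F (snd x) * (iexp (fst (fst (fst x)) * (P (snd (fst x) + snd x) - P (snd (fst x)))) * ps (fst (fst (fst x))) (snd (fst (fst x))) (snd (fst x) + snd x)
  - ps (fst (fst (fst x))) (snd (fst (fst x))) (snd (fst x)))) \<in> borel_measurable (((borel \<Otimes>\<^sub>M borel) \<Otimes>\<^sub>M borel) \<Otimes>\<^sub>M lborel)"
  by (intro borel_measurable_times borel_measurable_diff) measurable
 then show ?thesis unfolding bwd_rate_def
  by (intro borel_measurable_times borel_measurable_const lborel.borel_measurable_lebesgue_integral) (simp only: case_prod_beta')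
qed

text \<open>The one-variable duality, used twice. Once the second variable is integrated out,
  \<open>\<phi>\<close> is again a backward quantity, and its rate \<open>\<phi>'\<close> combines
  the rate of \<open>ps\<close> with \<open>bwd_rate\<close> in the second variable; this is the
  form that \<open>forward_duality\<close> accepts for the first variable.\<close>

lemma product_duality:
 fixes F :: "'b::euclidean_space => complex" and a1 a2 :: "real => 'b => complex" and ps ps' :: "real => 'b => 'b => complex"
 assumes F: "integrable lborel F" and P1[measurable]: "P1 \<in> borel_measurable borel" and P2[measurable]: "P2 \<in> borel_measurable borel"
  and a1: "fwd_density ka F K0 P1 L B a1" and a2: "fwd_density ka F K0 P2 L B a2" and L: "L \<ge> 0"
  and psm: "(%((t, \<xi>), \<eta>). ps t \<xi> \<eta>) \<in> borel_measurable ((borel \<Otimes>\<^sub>M borel) \<Otimes>\<^sub>M borel)"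
  and ps'm: "(%((t, \<xi>), \<eta>). ps' t \<xi> \<eta>) \<in> borel_measurable ((borel \<Otimes>\<^sub>M borel) \<Otimes>\<^sub>M borel)"
  and D: "!!t \<xi> \<eta>. t \<in> {0..L} ==> cmod (ps t \<xi> \<eta>) \<le> D" "!!t \<xi> \<eta>. t \<in> {0..L} ==> cmod (ps' t \<xi> \<eta>) \<le> D"
  and ps: "!!t \<xi> \<eta>. t \<in> {0..L} ==> ps t \<xi> \<eta> = ps L \<xi> \<eta> + (LINT r:{t..L}|lborel. ps' r \<xi> \<eta>)"
 shows "mu2 (fwd_atom ka F K0 L) (a1 L) (a2 L) (ps L) - K0 * K0 * ps 0 0 0
  = (LINT r:{0..L}|lborel. mu2 (fwd_atom ka F K0 r) (a1 r) (a2 r)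
    (%\<xi> \<eta>. bwd_rate ka F P1 (%t \<xi>. ps t \<xi> \<eta>) r \<xi> + bwd_rate ka F P2 (%t. ps t \<xi>) r \<eta> - ps' r \<xi> \<eta>))"
proof -
 let ?K = "fwd_atom ka F K0"
 have a1m[measurable]: "(%(s, \<xi>). a1 s \<xi>) \<in> borel_measurable (borel \<Otimes>\<^sub>M borel)" and a2m[measurable]: "(%(s, \<xi>). a2 s \<xi>) \<in> borel_measurable (borel \<Otimes>\<^sub>M borel)"
  and a1i: "!!t. t \<in> {0..L} ==> integrable lborel (a1 t)" and a2i: "!!t. t \<in> {0..L} ==> integrable lborel (a2 t)"
  and a2B: "!!t. t \<in> {0..L} ==> (LINT \<xi>|lborel. cmod (a2 t \<xi>)) \<le> B"
  using a1 a2 by (auto simp: fwd_density_def)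
 have Fm[measurable]: "F \<in> borel_measurable borel" using F by auto
 obtain DK where DK: "!!t. t \<in> {0..L} ==> cmod (?K t) \<le> DK" using fwd_atom_bounded[of L ka F K0] by blast
 have D0: "D \<ge> 0" using order_trans[OF norm_ge_zero D(1)[of 0 0 0]] L by simp
 note t1 = measurable_triple[OF psm] and t2 = measurable_triple[OF ps'm]
 define \<phi> where "\<phi> = (%t \<xi>. mu (?K t) (a2 t) (ps t \<xi>))"
 define \<phi>' where "\<phi>' = (%t \<xi>. mu (?K t) (a2 t) (ps' t \<xi>) - mu (?K t) (a2 t) (bwd_rate ka F P2 (%t. ps t \<xi>) t))"
 note bwm2' = bwd_rate_measurable_triple[OF Fm P2 psm, of ka]
 have bwm2: "(%((t, \<xi>), \<eta>). bwd_rate ka F P2 (%t. ps t \<xi>) t \<eta>) \<in> borel_measurable ((borel \<Otimes>\<^sub>M borel) \<Otimes>\<^sub>M borel)"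
  using bwm2' unfolding case_prod_beta' .
 have \<phi>m: "(%(t, \<xi>). \<phi> t \<xi>) \<in> borel_measurable (borel \<Otimes>\<^sub>M borel)" unfolding \<phi>_def
  by (rule mu_measurable[OF a2m fwd_atom_measurable psm])
 have \<phi>'m: "(%(t, \<xi>). \<phi>' t \<xi>) \<in> borel_measurable (borel \<Otimes>\<^sub>M borel)"
 proof -
  have 1: "(%(t, \<xi>). mu (?K t) (a2 t) (ps' t \<xi>)) \<in> borel_measurable (borel \<Otimes>\<^sub>M borel)"
   by (rule mu_measurable[OF a2m fwd_atom_measurable ps'm])
  have 2: "(%(t, \<xi>). mu (?K t) (a2 t) (bwd_rate ka F P2 (%t. ps t \<xi>) t)) \<in> borel_measurable (borel \<Otimes>\<^sub>M borel)"
   by (rule mu_measurable[where f="%t \<xi>. bwd_rate ka F P2 (%t. ps t \<xi>) t", OF a2m fwd_atom_measurable bwm2])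
  note b = borel_measurable_diff[OF 1[unfolded case_prod_beta'] 2[unfolded case_prod_beta']]
  have b4: "(%x. mu (?K (fst x)) (a2 (fst x)) (ps' (fst x) (snd x)) - mu (?K (fst x)) (a2 (fst x)) (bwd_rate ka F P2 (%t. ps t (snd x)) (fst x))) \<in> borel_measurable (borel \<Otimes>\<^sub>M borel)"
   by (rule b)
  show ?thesis unfolding \<phi>'_def using b4 unfolding case_prod_beta' .
 qed
 have pss: "ps t \<xi> \<in> borel_measurable borel" "ps' t \<xi> \<in> borel_measurable borel" "(%\<xi>. ps t \<xi> \<eta>) \<in> borel_measurable borel" for t \<xi> \<eta>
 proof -
  show "ps t \<xi> \<in> borel_measurable borel" by (rule measurable_triple_slices(1)[OF psm])
  show "ps' t \<xi> \<in> borel_measurable borel" by (rule measurable_triple_slices(1)[OF ps'm])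
  show "(%\<xi>. ps t \<xi> \<eta>) \<in> borel_measurable borel" by (rule measurable_triple_slices(2)[OF psm])
 qed
 let ?N = "LINT k|lborel. cmod (F k)"
 define E where "E = cmod ka * ?N * (2 * D)"
 have E0: "E \<ge> 0" using D0 by (simp add: E_def)
 have bw2m: "bwd_rate ka F P2 (%t. ps t \<xi>) t \<in> borel_measurable borel" for t \<xi>
 proof -
  have "(%\<eta>. ((t, \<xi>), \<eta>)) \<in> measurable borel ((borel \<Otimes>\<^sub>M borel) \<Otimes>\<^sub>M borel)" by measurable
  from measurable_compose[OF this bwm2] show ?thesis by simp
 qed
 have bw2b: "cmod (bwd_rate ka F P2 (%t. ps t \<xi>) t \<eta>) \<le> E" if "t \<in> {0..L}" for t \<xi> \<eta>
  unfolding E_def by (rule bwd_rate_bound[OF F P2]) (use pss D(1)[OF that] in auto)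
 have DKB: "cmod (?K t) + (LINT x|lborel. cmod (a2 t x)) \<le> DK + B" if "t \<in> {0..L}" for t
  using DK[OF that] a2B[OF that] by simp
 have \<phi>b: "cmod (\<phi> t \<xi>) \<le> (DK + B) * (D + E)" if t: "t \<in> {0..L}" for t \<xi>
 proof -
  have "cmod (\<phi> t \<xi>) \<le> (cmod (?K t) + (LINT x|lborel. cmod (a2 t x))) * D"
   unfolding \<phi>_def by (rule mu_bound[OF a2i[OF t] pss(1) D(1)[OF t]])
  also have "\<dots> \<le> (DK + B) * (D + E)" using D0 E0 order_trans[OF _ DKB[OF t]] by (intro mult_mono DKB t) auto
  finally show ?thesis .
 qed
 have \<phi>'b: "cmod (\<phi>' t \<xi>) \<le> (DK + B) * (D + E)" if t: "t \<in> {0..L}" for t \<xi>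
 proof -
  have "cmod (mu (?K t) (a2 t) (ps' t \<xi>)) \<le> (cmod (?K t) + (LINT x|lborel. cmod (a2 t x))) * D"
   by (rule mu_bound[OF a2i[OF t] pss(2) D(2)[OF t]])
  moreover have "cmod (mu (?K t) (a2 t) (bwd_rate ka F P2 (%t. ps t \<xi>) t)) \<le> (cmod (?K t) + (LINT x|lborel. cmod (a2 t x))) * E"
   by (rule mu_bound[OF a2i[OF t] bw2m bw2b[OF t]])
  ultimately have "cmod (\<phi>' t \<xi>) \<le> (cmod (?K t) + (LINT x|lborel. cmod (a2 t x))) * (D + E)"
   unfolding \<phi>'_def distrib_left[of _ D E] by (rule order_trans[OF norm_triangle_ineq4 add_mono])
  also have "\<dots> \<le> (DK + B) * (D + E)" using D0 E0 by (intro mult_right_mono DKB t) auto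
  finally show ?thesis .
 qed
 \<comment> \<open>\<open>forward_duality\<close> in the second variable with \<open>\<xi>\<close>
   frozen, read as a backward integral equation.\<close>
 have \<phi>: "\<phi> t \<xi> = \<phi> L \<xi> + (LINT r:{t..L}|lborel. \<phi>' r \<xi>)" if t: "t \<in> {0..L}" for t \<xi>
 proof -
  have m: "(%(t, \<eta>). ps t \<xi> \<eta>) \<in> borel_measurable (borel \<Otimes>\<^sub>M borel)" "(%(t, \<eta>). ps' t \<xi> \<eta>) \<in> borel_measurable (borel \<Otimes>\<^sub>M borel)"
   unfolding case_prod_beta' by (rule t1 t2; measurable)+
  have "\<phi> L \<xi> - \<phi> t \<xi> = (LINT r:{t..L}|lborel. mu (?K r) (a2 r) (bwd_rate ka F P2 (%t. ps t \<xi>) r) - mu (?K r) (a2 r) (ps' r \<xi>))"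
   unfolding \<phi>_def by (rule forward_duality[OF F P2 a2 t m D ps])
  also have "\<dots> = - (LINT r:{t..L}|lborel. \<phi>' r \<xi>)"
   unfolding set_lebesgue_integral_def \<phi>'_def
   by (subst Bochner_Integration.integral_minus[symmetric]) (intro Bochner_Integration.integral_cong refl, simp flip: scaleR_minus_right)
  finally show ?thesis by (simp add: algebra_simps)
 qed
 \<comment> \<open>\<open>bwd_rate\<close> acts in the first variable and \<open>mu\<close> in the
   second, so they commute by Fubini.\<close>
 have Q1: "bwd_rate ka F P1 \<phi> r \<xi> = mu (?K r) (a2 r) (%\<eta>. bwd_rate ka F P1 (%t \<xi>. ps t \<xi> \<eta>) r \<xi>)" if r: "r \<in> {0..L}" for r \<xi>
 proof -
  let ?e = "%k. iexp (r * (P1 (\<xi> + k) - P1 \<xi>))"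
  define g where "g = (%k \<eta>. ?e k * ps r (\<xi> + k) \<eta> - ps r \<xi> \<eta>)"
  have gm: "(%(k, \<eta>). g k \<eta>) \<in> borel_measurable (borel \<Otimes>\<^sub>M borel)"
  proof -
   have [measurable]: "(%x. ps r (\<xi> + fst x) (snd x)) \<in> borel_measurable (borel \<Otimes>\<^sub>M borel)" "(%x. ps r \<xi> (snd x)) \<in> borel_measurable (borel \<Otimes>\<^sub>M borel)"
    by (rule t1; measurable)+
   show ?thesis unfolding g_def case_prod_beta'
    by (intro borel_measurable_times borel_measurable_diff) measurable
  qed
  have gb: "cmod (g k \<eta>) \<le> 2 * D" for k \<eta>
   using norm_triangle_ineq4[of "?e k * ps r (\<xi> + k) \<eta>" "ps r \<xi> \<eta>"] D(1)[OF r, of "\<xi> + k" \<eta>] D(1)[OF r, of \<xi> \<eta>]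
   unfolding g_def norm_mult norm_exp_i_times by linarith
  have e: "?e k * \<phi> r (\<xi> + k) - \<phi> r \<xi> = mu (?K r) (a2 r) (g k)" for k
  proof -
   have "mu (?K r) (a2 r) (g k) = mu (?K r) (a2 r) (%\<eta>. ?e k * ps r (\<xi> + k) \<eta>) - mu (?K r) (a2 r) (ps r \<xi>)"
    unfolding g_def
    by (rule mu_diff[OF a2i[OF r], where B=D and D=D]) (use pss D(1)[OF r] in \<open>auto simp: norm_mult\<close>)
   then show ?thesis by (simp only: mu_cmult \<phi>_def)
  qed
  have "bwd_rate ka F P1 \<phi> r \<xi> = ka * (LINT k|lborel. F k * mu (?K r) (a2 r) (g k))"
   unfolding bwd_rate_def e ..
  also have "\<dots> = ka * mu (?K r) (a2 r) (%\<eta>. LINT k|lborel. F k * g k \<eta>)"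
   by (simp only: mu_integral[OF F a2i[OF r] gm gb])
  finally show ?thesis unfolding mu_cmult[symmetric] g_def bwd_rate_def .
 qed
 have "mu (?K L) (a1 L) (\<phi> L) - mu (?K 0) (a1 0) (\<phi> 0)
  = (LINT r:{0..L}|lborel. mu (?K r) (a1 r) (bwd_rate ka F P1 \<phi> r) - mu (?K r) (a1 r) (\<phi>' r))"
  by (rule forward_duality[OF F P1 a1 _ \<phi>m \<phi>'m \<phi>b \<phi>'b \<phi>]) (use L in auto)
 also have "\<dots> = (LINT r:{0..L}|lborel. mu2 (?K r) (a1 r) (a2 r)
    (%\<xi> \<eta>. bwd_rate ka F P1 (%t \<xi>. ps t \<xi> \<eta>) r \<xi> + bwd_rate ka F P2 (%t. ps t \<xi>) r \<eta> - ps' r \<xi> \<eta>))"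
 proof (rule set_lebesgue_integral_cong)
  show "\<forall>r. r \<in> {0..L} \<longrightarrow> mu (?K r) (a1 r) (bwd_rate ka F P1 \<phi> r) - mu (?K r) (a1 r) (\<phi>' r) = mu2 (?K r) (a1 r) (a2 r)
    (%\<xi> \<eta>. bwd_rate ka F P1 (%t \<xi>. ps t \<xi> \<eta>) r \<xi> + bwd_rate ka F P2 (%t. ps t \<xi>) r \<eta> - ps' r \<xi> \<eta>)"
  proof (intro allI impI)
   fix r assume r: "r \<in> {0..L}"
   have q1m: "(%\<eta>. bwd_rate ka F P1 (%t \<xi>. ps t \<xi> \<eta>) r \<xi>) \<in> borel_measurable borel" for \<xi>
   proof -
    have [measurable]: "(%x. ps r (\<xi> + snd x) (fst x)) \<in> borel_measurable (borel \<Otimes>\<^sub>M lborel)" "(%x. ps r \<xi> (fst x)) \<in> borel_measurable (borel \<Otimes>\<^sub>M lborel)"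
     by (rule t1; measurable)+
    have "(%x. F (snd x) * (iexp (r * (P1 (\<xi> + snd x) - P1 \<xi>)) * ps r (\<xi> + snd x) (fst x) - ps r \<xi> (fst x))) \<in> borel_measurable (borel \<Otimes>\<^sub>M lborel)"
     by (intro borel_measurable_times borel_measurable_diff) measurable
    then show ?thesis unfolding bwd_rate_def
     by (intro borel_measurable_times borel_measurable_const lborel.borel_measurable_lebesgue_integral) (simp only: case_prod_beta')
   qed
   have q1b: "cmod (bwd_rate ka F P1 (%t \<xi>. ps t \<xi> \<eta>) r \<xi>) \<le> E" for \<xi> \<eta>
    unfolding E_def by (rule bwd_rate_bound[OF F P1]) (use pss D(1)[OF r] in auto)
   have s2: "mu (?K r) (a2 r) (%\<eta>. bwd_rate ka F P1 (%t \<xi>. ps t \<xi> \<eta>) r \<xi> + bwd_rate ka F P2 (%t. ps t \<xi>) r \<eta> - ps' r \<xi> \<eta>)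
    = bwd_rate ka F P1 \<phi> r \<xi> - \<phi>' r \<xi>" for \<xi>
   proof -
    have "mu (?K r) (a2 r) (%\<eta>. (bwd_rate ka F P1 (%t \<xi>. ps t \<xi> \<eta>) r \<xi> + bwd_rate ka F P2 (%t. ps t \<xi>) r \<eta>) - ps' r \<xi> \<eta>)
     = mu (?K r) (a2 r) (%\<eta>. bwd_rate ka F P1 (%t \<xi>. ps t \<xi> \<eta>) r \<xi> + bwd_rate ka F P2 (%t. ps t \<xi>) r \<eta>) - mu (?K r) (a2 r) (ps' r \<xi>)"
     by (rule mu_diff[OF a2i[OF r] borel_measurable_add[OF q1m bw2m] norm_triangle_mono[OF q1b bw2b[OF r]] pss(2) D(2)[OF r]])
    also have "mu (?K r) (a2 r) (%\<eta>. bwd_rate ka F P1 (%t \<xi>. ps t \<xi> \<eta>) r \<xi> + bwd_rate ka F P2 (%t. ps t \<xi>) r \<eta>)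
     = mu (?K r) (a2 r) (%\<eta>. bwd_rate ka F P1 (%t \<xi>. ps t \<xi> \<eta>) r \<xi>) + mu (?K r) (a2 r) (bwd_rate ka F P2 (%t. ps t \<xi>) r)"
     by (rule mu_add[OF a2i[OF r] q1m q1b bw2m bw2b[OF r]])
    finally show ?thesis unfolding Q1[OF r] \<phi>'_def by simp
   qed
   show "mu (?K r) (a1 r) (bwd_rate ka F P1 \<phi> r) - mu (?K r) (a1 r) (\<phi>' r) = mu2 (?K r) (a1 r) (a2 r)
    (%\<xi> \<eta>. bwd_rate ka F P1 (%t \<xi>. ps t \<xi> \<eta>) r \<xi> + bwd_rate ka F P2 (%t. ps t \<xi>) r \<eta> - ps' r \<xi> \<eta>)"
    unfolding mu2_def s2
    by (rule mu_diff[OF a1i[OF r] measurable_slice[OF bwd_rate_measurable[OF Fm P1 \<phi>m]] bwd_rate_bound[where \<phi>=\<phi> and s=r, OF F P1 measurable_slice[OF \<phi>m] \<phi>b[OF r]] measurable_slice[OF \<phi>'m] \<phi>'b[OF r], symmetric])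
  qed
 qed simp
 \<comment> \<open>At time 0 both densities vanish almost everywhere, which leaves the product of
   the two atoms.\<close>
 also have "mu (?K 0) (a1 0) (\<phi> 0) = K0 * K0 * ps 0 0 0"
 proof -
  have z: "AE \<xi> in lborel. a 0 \<xi> = 0" if "fwd_density ka F K0 P L B a" for a P
  proof -
   have "0 \<in> {0..L}" using L by simp
   then have "AE \<xi> in lborel. a 0 \<xi> = (LINT s:{0..0}|lborel. fwd_rate ka F ?K P a s \<xi>)"
    using that unfolding fwd_density_def by blast
   moreover have "(LINT s:{0..0::real}|lborel. f s) = 0" for f :: "real => complex"
    unfolding set_lebesgue_integral_def
    by (rule integral_eq_zero_AE, rule AE_mp[OF AE_lborel_singleton[of 0]]) (auto split: split_indicator)
   ultimately show ?thesis by (simp only:)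
  qed
  have "(LINT \<xi>|lborel. a 0 \<xi> * f \<xi>) = 0" if "fwd_density ka F K0 P L B a" for a P and f :: "'b => complex"
   by (rule integral_eq_zero_AE) (use z[OF that] in \<open>eventually_elim, simp\<close>)
  from this[OF a1] this[OF a2] show ?thesis unfolding mu_def \<phi>_def by (simp add: fwd_atom_def)
 qed
 finally show ?thesis unfolding mu2_def \<phi>_def .
qed

section \<open>Limits and linearity of product pairings\<close>

lemma jump_add: "jump j (a + b) = jump j a + jump j b" and jump_0 [simp]: "jump j 0 = 0"
 by (auto simp: jump_def zero_prod_def)

lemma set_integrable_bounded:
 fixes g :: "real => complex"
 assumes [measurable]: "g \<in> borel_measurable borel" and b: "!!t. t \<in> {a..b} ==> cmod (g t) \<le> M"
 shows "set_integrable lborel {a..b} g"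
 unfolding set_integrable_def
proof (rule Bochner_Integration.integrable_bound[where f="%t. M * indicator {a..b} t"])
 show "AE x in lborel. norm (indicator {a..b} x *\<^sub>R g x) \<le> norm (M * indicator {a..b} x)"
  using order_trans[OF b abs_ge_self] by (intro AE_I2) (auto split: split_indicator)
qed (simp_all add: emeasure_lborel_Icc_eq)

lemma mult_bounded_tendsto:
 fixes F :: "'y => complex" and u :: "nat => 'y => complex"
 assumes F: "integrable N F" and [measurable]: "!!n. u n \<in> borel_measurable N" "v \<in> borel_measurable N"
  and M: "!!n y. y \<in> space N ==> cmod (u n y) \<le> M" and l: "!!y. y \<in> space N ==> (%n. u n y) \<longlonglongrightarrow> v y"
 shows "(%n. LINT y|N. F y * u n y) \<longlonglongrightarrow> (LINT y|N. F y * v y)"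
proof (rule integral_dominated_convergence[where w="%y. cmod (F y) * M"])
 have [measurable]: "F \<in> borel_measurable N" using F by auto
 show "(%y. F y * v y) \<in> borel_measurable N" "!!n. (%y. F y * u n y) \<in> borel_measurable N" by measurable
 show "integrable N (%y. cmod (F y) * M)" using F by simp
 show "AE y in N. (%n. F y * u n y) \<longlonglongrightarrow> F y * v y" by (intro AE_I2 tendsto_mult tendsto_const l)
 show "AE y in N. cmod (F y * u n y) \<le> cmod (F y) * M" for n
  unfolding norm_mult by (intro AE_I2 mult_left_mono M) auto
qed

lemma mu_tendsto:
 assumes "integrable lborel a" "!!n. f n \<in> borel_measurable borel" "g \<in> borel_measurable borel"
  and "!!n x. cmod (f n x) \<le> M" "!!x. (%n. f n x) \<longlonglongrightarrow> g x"
 shows "(%n. mu K a (f n)) \<longlonglongrightarrow> mu K a g"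
 unfolding mu_def by (intro tendsto_add tendsto_mult tendsto_const assms(5) mult_bounded_tendsto[where M=M]) (use assms in auto)

lemma mu2_tendsto:
 fixes f :: "nat => 'b::euclidean_space => 'b => complex"
 assumes a: "integrable lborel a" and b: "integrable lborel b"
  and [measurable]: "!!n. (%(x, y). f n x y) \<in> borel_measurable (borel \<Otimes>\<^sub>M borel)" "(%(x, y). g x y) \<in> borel_measurable (borel \<Otimes>\<^sub>M borel)"
  and M: "!!n x y. cmod (f n x y) \<le> M" and l: "!!x y. (%n. f n x y) \<longlonglongrightarrow> g x y"
 shows "(%n. mu2 K a b (f n)) \<longlonglongrightarrow> mu2 K a b g"
proof -
 have [measurable]: "a \<in> borel_measurable borel" "b \<in> borel_measurable borel" using a b by auto
 have s: "f n x \<in> borel_measurable borel" "g x \<in> borel_measurable borel" for n x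
 proof -
  have "(%y. f n x y) \<in> borel_measurable borel" "(%y. g x y) \<in> borel_measurable borel" by measurable
  then show "f n x \<in> borel_measurable borel" "g x \<in> borel_measurable borel" by simp_all
 qed
 have m: "(%x. mu K b (f n x)) \<in> borel_measurable borel" "(%x. mu K b (g x)) \<in> borel_measurable borel" for n
  unfolding mu_def by measurable
 show ?thesis unfolding mu2_def
  by (rule mu_tendsto[OF a m mu_bound[OF b s(1) M] mu_tendsto[OF b s M l]])
qed

lemma mu2_bound:
 fixes f :: "'b::euclidean_space => 'b => complex"
 assumes a: "integrable lborel a" and b: "integrable lborel b"
  and [measurable]: "(%(x, y). f x y) \<in> borel_measurable (borel \<Otimes>\<^sub>M borel)" and M: "!!x y. cmod (f x y) \<le> M"
 shows "cmod (mu2 K a b f) \<le> (cmod K + (LINT x|lborel. cmod (a x))) * ((cmod K + (LINT x|lborel. cmod (b x))) * M)"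
proof -
 have [measurable]: "a \<in> borel_measurable borel" "b \<in> borel_measurable borel" using a b by auto
 have s: "f x \<in> borel_measurable borel" for x
 proof -
  have "(%y. f x y) \<in> borel_measurable borel" by measurable
  then show "f x \<in> borel_measurable borel" by simp
 qed
 have m: "(%x. mu K b (f x)) \<in> borel_measurable borel" unfolding mu_def by measurable
 show ?thesis unfolding mu2_def by (rule mu_bound[OF a m mu_bound[OF b s M]])
qed

lemma mu2_diff:
 fixes f g :: "'b::euclidean_space => 'b => complex"
 assumes a: "integrable lborel a" and b: "integrable lborel b"
  and [measurable]: "(%(x, y). f x y) \<in> borel_measurable (borel \<Otimes>\<^sub>M borel)" "(%(x, y). g x y) \<in> borel_measurable (borel \<Otimes>\<^sub>M borel)"
  and M: "!!x y. cmod (f x y) \<le> M" and D: "!!x y. cmod (g x y) \<le> D"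
 shows "mu2 K a b (%x y. f x y - g x y) = mu2 K a b f - mu2 K a b g"
proof -
 have [measurable]: "a \<in> borel_measurable borel" "b \<in> borel_measurable borel" using a b by auto
 have s: "f x \<in> borel_measurable borel" "g x \<in> borel_measurable borel" for x
 proof -
  have "(%y. f x y) \<in> borel_measurable borel" "(%y. g x y) \<in> borel_measurable borel" by measurable
  then show "f x \<in> borel_measurable borel" "g x \<in> borel_measurable borel" by simp_all
 qed
 have m: "(%x. mu K b (f x)) \<in> borel_measurable borel" "(%x. mu K b (g x)) \<in> borel_measurable borel"
  unfolding mu_def by measurable
 show ?thesis unfolding mu2_def mu_diff[OF b s(1) M s(2) D]
  by (rule mu_diff[OF a m(1) mu_bound[OF b s(1) M] m(2) mu_bound[OF b s(2) D]])
qed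

lemma mu2_cmult: "mu2 K a b (%x y. z * f x y) = z * mu2 K a b f"
 unfolding mu2_def mu_cmult ..

lemma mu2_sum:
 fixes f :: "'j => 'b::euclidean_space => 'b => complex"
 assumes a: "integrable lborel a" and b: "integrable lborel b" and J: "finite J"
  and m: "!!j. j \<in> J ==> (%(x, y). f j x y) \<in> borel_measurable (borel \<Otimes>\<^sub>M borel)" and M: "!!j x y. j \<in> J ==> cmod (f j x y) \<le> M j"
 shows "mu2 K a b (%x y. \<Sum>j\<in>J. f j x y) = (\<Sum>j\<in>J. mu2 K a b (f j))"
 using J m M
proof (induct J rule: finite_induct)
 case empty
 show ?case by (simp add: mu2_def mu_def)
next
 case (insert j J)
 have mj: "(%(x, y). f j x y) \<in> borel_measurable (borel \<Otimes>\<^sub>M borel)" using insert by simp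
 have mJ: "(%(x, y). - (\<Sum>i\<in>J. f i x y)) \<in> borel_measurable (borel \<Otimes>\<^sub>M borel)"
  using insert(4) by (auto simp: case_prod_beta' intro!: borel_measurable_sum borel_measurable_uminus)
 have bJ: "cmod (- (\<Sum>i\<in>J. f i x y)) \<le> (\<Sum>i\<in>J. M i)" for x y
  unfolding norm_minus_cancel by (rule order_trans[OF norm_sum sum_mono]) (use insert(5) in auto)
 have "mu2 K a b (%x y. f j x y - (- (\<Sum>i\<in>J. f i x y))) = mu2 K a b (f j) - mu2 K a b (%x y. - (\<Sum>i\<in>J. f i x y))"
  by (rule mu2_diff[OF a b mj mJ _ bJ]) (use insert(5) in auto)
 also have "mu2 K a b (%x y. - (\<Sum>i\<in>J. f i x y)) = - mu2 K a b (%x y. \<Sum>i\<in>J. f i x y)"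
  using mu2_cmult[of K a b "- 1" "%x y. \<Sum>i\<in>J. f i x y"] by simp
 finally show ?case using insert by simp
qed

text \<open>Isolates the part in which both variables sit at the atom. In the other three parts the
  two variables differ almost everywhere, and the oscillation argument needs exactly this.\<close>

lemma mu2_expand:
 fixes f :: "'b::euclidean_space => 'b => complex"
 assumes a: "integrable lborel a" and b: "integrable lborel b"
  and fm[measurable]: "(%(x, y). f x y) \<in> borel_measurable (borel \<Otimes>\<^sub>M borel)" and M: "!!x y. cmod (f x y) \<le> M"
 shows "mu2 K a b f = K * K * f 0 0 + (LINT y|lborel. (K * b y) * f 0 y) + (LINT x|lborel. (K * a x) * f x 0)
  + (LINT z|(lborel \<Otimes>\<^sub>M lborel). (a (fst z) * b (snd z)) * f (fst z) (snd z))"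
proof -
 have [measurable]: "a \<in> borel_measurable borel" "b \<in> borel_measurable borel" using a b by auto
 have I: "integrable (lborel \<Otimes>\<^sub>M lborel) (%z. (a (fst z) * b (snd z)) * f (fst z) (snd z))"
  using mult_bounded_integrable(1)[OF integrable_tensor[OF sigma_finite_lborel sigma_finite_lborel a b], of "%(x, y). f x y" M] M
  by (simp add: case_prod_beta')
 have i1: "integrable lborel (%x. a x * (K * f x 0))"
  by (rule mult_bounded_integrable(1)[OF a, where B="cmod K * M"]) (auto simp: norm_mult intro!: mult_left_mono M)
 have i2: "integrable lborel (%x. LINT y|lborel. (a x * b y) * f x y)" using lborel_pair.integrable_fst'[OF I] by simp
 have "(LINT z|(lborel \<Otimes>\<^sub>M lborel). (a (fst z) * b (snd z)) * f (fst z) (snd z)) = (LINT x|lborel. LINT y|lborel. (a x * b y) * f x y)"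
  using lborel_pair.integral_fst'[OF I] by simp
 moreover have "(LINT x|lborel. a x * (K * f x 0 + (LINT y|lborel. b y * f x y)))
   = (LINT x|lborel. a x * (K * f x 0)) + (LINT x|lborel. LINT y|lborel. (a x * b y) * f x y)"
 proof -
  have "(LINT x|lborel. a x * (K * f x 0 + (LINT y|lborel. b y * f x y))) = (LINT x|lborel. a x * (K * f x 0) + (LINT y|lborel. (a x * b y) * f x y))"
   by (intro Bochner_Integration.integral_cong refl) (simp only: distrib_left mult.assoc integral_mult_right_zero)
  then show ?thesis using i1 i2 by simp
 qed
 ultimately show ?thesis unfolding mu2_def mu_def distrib_left
  by (simp only: mult.assoc integral_mult_right_zero mult.left_commute[of "a _" K] add.assoc)
qed

text \<open>Natural thresholds reduce divergence to countably many conditions. Measurability of the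
  event is required to combine almost-everywhere statements on a product space.\<close>

lemma filterlim_at_top_measurable [measurable]:
 assumes [measurable]: "!!n. \<Theta> n \<in> borel_measurable N"
 shows "Measurable.pred N (%y. filterlim (%n. \<bar>\<Theta> n y :: real\<bar>) at_top sequentially)"
proof -
 have "filterlim f at_top sequentially \<longleftrightarrow> (\<forall>Z::nat. \<exists>m. \<forall>n. n \<ge> m \<longrightarrow> real Z \<le> f n)" for f :: "nat => real"
  unfolding filterlim_at_top eventually_sequentially
  by (meson order_trans real_arch_simple)
 then show ?thesis by simp
qed

section \<open>Oscillating jumps and ladder limits for a sequence of dual solutions\<close>

text \<open>The data of the dual problems along a sequence of values of \<open>eps\<close>: \<open>S n\<close> is the rescaled
 free symbol and \<open>ps n\<close> the solution of the backward equation.\<close>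
locale dual_sequence =
 fixes F :: "R2 => complex" and L :: real and S :: "nat => R2x4 => real" and \<sigma> :: "nat => nat => complex"
  and ps :: "nat => real => R2x4 => complex" and ka K0 :: complex and D :: real
 assumes F: "integrable lborel F" and L: "L \<ge> 0"
  and Sm [measurable]: "!!n. S n \<in> borel_measurable borel"
  and psm [measurable]: "!!n. (%(s, p). ps n s p) \<in> borel_measurable (borel \<Otimes>\<^sub>M borel)"
  and psb: "!!n s p. s \<in> {0..L} ==> cmod (ps n s p) \<le> D"
  and gb: "!!n s p. s \<in> {0..L} ==> cmod (jump_gen {..<7} (\<sigma> n) jump F (S n) (ps n) s p) \<le> D"
  and ps: "!!n s p. s \<in> {0..L} ==> ps n s p = ps n L p + (LINT t:{s..L}|lborel. jump_gen {..<7} (\<sigma> n) jump F (S n) (ps n) t p)"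
  and \<sigma>6: "(%n. \<sigma> n 6) \<longlonglongrightarrow> - (2 * ka)"
  and \<sigma>b: "!!j. convergent (%n. \<sigma> n j)"
begin

abbreviation "K \<equiv> fwd_atom ka F K0"
abbreviation "gen n \<equiv> jump_gen {..<7} (\<sigma> n) jump F (S n) (ps n)"
abbreviation "J n j \<equiv> jump_op F (S n) (jump j) (ps n)"

lemma Fm [measurable]: "F \<in> borel_measurable borel"
 using F by auto

lemma genm [measurable]: "(%(s, p). gen n s p) \<in> borel_measurable (borel \<Otimes>\<^sub>M borel)"
 by (rule jump_gen_measurable) measurable

lemma Jm [measurable]: "(%(s, p). J n j s p) \<in> borel_measurable (borel \<Otimes>\<^sub>M borel)"
 by (rule jump_op_measurable) measurable

lemma Jb: "s \<in> {0..L} ==> cmod (J n j s p) \<le> (LINT k|lborel. cmod (F k)) * D"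
 by (rule jump_op_integrable(2)[where \<phi>="ps n" and s=s, OF F Sm jump_measurable measurable_slice[OF psm] psb])

lemma J6: "J n 6 s p = (LINT k|lborel. F k) * ps n s p"
 by (simp add: jump_op_def jump_def)

text \<open>The wave vector \<open>k\<close> of the jump joins \<open>y\<close> as a parameter, and
  the phase difference across the jump is the large frequency. The amplitude is \<open>ps n\<close>
  after the jump; it is bounded together with its derivative \<open>- gen n\<close>, which is what
  \<open>oscillatory_integral_parametric\<close> asks for in place of convergence.\<close>

lemma jump_op_oscillation:
 assumes Y: "sigma_finite_measure Y"
  and [measurable]: "(%(s, y). w s y) \<in> borel_measurable (borel \<Otimes>\<^sub>M Y)" "!!n. q n \<in> borel_measurable Y"
  and w: "!!s. s \<in> {0..L} ==> integrable Y (w s)" "!!s. s \<in> {0..L} ==> (LINT y|Y. cmod (w s y)) \<le> Bw"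
  and osc: "AE y in Y. AE k in lborel. filterlim (%n. \<bar>S n (q n y + jump j k) - S n (q n y)\<bar>) at_top sequentially"
 shows "(%n. LINT s:{0..L}|lborel. LINT y|Y. w s y * J n j s (q n y)) \<longlonglongrightarrow> 0"
proof -
 interpret Y: sigma_finite_measure Y by fact
 interpret P: pair_sigma_finite Y "lborel :: R2 measure" by standard
 let ?Y = "Y \<Otimes>\<^sub>M (lborel :: R2 measure)"
 have sY: "sigma_finite_measure ?Y" by standard
 have ti: "integrable ?Y (%z. w s (fst z) * F (snd z))" if "s \<in> {0..L}" for s
  by (rule integrable_tensor[OF Y sigma_finite_lborel w(1)[OF that] F])
 have A: "(%n. LINT s:{0..L}|lborel. (LINT z|?Y. (w s (fst z) * F (snd z)) * iexp (s * (S n (q n (fst z) + jump j (snd z)) - S n (q n (fst z)))) * ps n s (q n (fst z) + jump j (snd z)))) \<longlonglongrightarrow> 0"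
 proof (rule oscillatory_integral_parametric[OF sY L, where B=D and \<Phi>'="%n s z. gen n s (q n (fst z) + jump j (snd z))"])
  show "integrable (lborel \<Otimes>\<^sub>M ?Y) (%(s, z). indicator {0..L} s *\<^sub>R (w s (fst z) * F (snd z)))"
  proof (rule integrable_slices[OF sY _ ti])
   show "(LINT z|?Y. cmod (w s (fst z) * F (snd z))) \<le> Bw * (LINT k|lborel. cmod (F k))" if "s \<in> {0..L}" for s
   proof -
    have "(LINT z|?Y. cmod (w s (fst z) * F (snd z))) = (LINT y|Y. LINT k|lborel. cmod (w s y * F k))"
     using P.integral_fst'[OF integrable_norm[OF ti[OF that]]] by simp
    also have "\<dots> = (LINT y|Y. cmod (w s y)) * (LINT k|lborel. cmod (F k))" by (simp add: norm_mult)
    also have "\<dots> \<le> Bw * (LINT k|lborel. cmod (F k))" by (intro mult_right_mono w that) simp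
    finally show ?thesis .
   qed
  qed measurable
  show "AE z in ?Y. filterlim (%n. \<bar>S n (q n (fst z) + jump j (snd z)) - S n (q n (fst z))\<bar>) at_top sequentially"
  proof (rule P.AE_pair_measure)
   show "{z \<in> space ?Y. filterlim (%n. \<bar>S n (q n (fst z) + jump j (snd z)) - S n (q n (fst z))\<bar>) at_top sequentially} \<in> sets ?Y"
    by measurable
   show "AE y in Y. AE k in lborel. filterlim (%n. \<bar>S n (q n (fst (y, k)) + jump j (snd (y, k))) - S n (q n (fst (y, k)))\<bar>) at_top sequentially"
    using osc by simp
  qed
  show "ps n s (q n (fst z) + jump j (snd z)) = ps n L (q n (fst z) + jump j (snd z)) + (LINT r:{s..L}|lborel. gen n r (q n (fst z) + jump j (snd z)))"
   if "s \<in> {0..L}" for n s z by (rule ps[OF that])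
 qed (use psb gb in \<open>measurable\<close>)
 have B: "(LINT z|?Y. (w s (fst z) * F (snd z)) * iexp (s * (S n (q n (fst z) + jump j (snd z)) - S n (q n (fst z)))) * ps n s (q n (fst z) + jump j (snd z)))
  = (LINT y|Y. w s y * J n j s (q n y))" if s: "s \<in> {0..L}" for n s
 proof -
  have I: "integrable ?Y (%z. (w s (fst z) * F (snd z)) * (iexp (s * (S n (q n (fst z) + jump j (snd z)) - S n (q n (fst z)))) * ps n s (q n (fst z) + jump j (snd z))))"
   by (rule mult_bounded_integrable(1)[OF ti[OF s], where B=D]) (use psb[OF s] in \<open>measurable, simp add: norm_mult\<close>)
  from P.integral_fst'[OF I] show ?thesis
   unfolding jump_op_def integral_mult_right_zero[symmetric] by (simp add: mult.assoc)
 qed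
 have "(LINT s:{0..L}|lborel. (LINT z|?Y. (w s (fst z) * F (snd z)) * iexp (s * (S n (q n (fst z) + jump j (snd z)) - S n (q n (fst z)))) * ps n s (q n (fst z) + jump j (snd z))))
  = (LINT s:{0..L}|lborel. LINT y|Y. w s y * J n j s (q n y))" for n
  by (rule set_lebesgue_integral_cong) (simp, intro allI impI B)
 with A show ?thesis by (simp only:)
qed

text \<open>The case of a single point, obtained from a parameter space with one element.\<close>

lemma atom_oscillation:
 assumes osc: "AE k in lborel. filterlim (%n. \<bar>S n (e n + jump j k) - S n (e n)\<bar>) at_top sequentially"
 shows "(%n. LINT s:{0..L}|lborel. K s * K s * J n j s (e n)) \<longlonglongrightarrow> 0"
proof -
 obtain DK where DK: "!!t. t \<in> {0..L} ==> cmod (K t) \<le> DK" using fwd_atom_bounded[of L ka F K0] by blast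
 have f: "(LINT y|count_space (UNIV::unit set). f y) = f ()" for f :: "unit => 'z::{banach, second_countable_topology}"
  by (subst lebesgue_integral_count_space_finite) (auto simp: UNIV_unit)
 have "(%n. LINT s:{0..L}|lborel. LINT y|count_space (UNIV::unit set). (K s * K s) * J n j s (e n)) \<longlonglongrightarrow> 0"
 proof (rule jump_op_oscillation[where Bw="DK * DK"])
  show "sigma_finite_measure (count_space (UNIV::unit set))" by (rule sigma_finite_measure_count_space_finite) simp
  show "integrable (count_space (UNIV::unit set)) (%y. K s * K s)" for s by (rule integrable_count_space) simp
  show "(LINT y|count_space (UNIV::unit set). cmod (K s * K s)) \<le> DK * DK" if "s \<in> {0..L}" for s
   unfolding f norm_mult using DK[OF that] order_trans[OF norm_ge_zero DK[OF that]] by (intro mult_mono) auto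
 qed (use osc in auto)
 then show ?thesis unfolding f .
qed

lemma Kb: obtains DK where "!!t. t \<in> {0..L} ==> cmod (K t) \<le> DK" "DK \<ge> 0"
proof -
 obtain DK where DK: "!!t. t \<in> {0..L} ==> cmod (K t) \<le> DK" using fwd_atom_bounded[of L ka F K0] by blast
 moreover have "DK \<ge> 0" using order_trans[OF norm_ge_zero DK[of 0]] L by simp
 ultimately show thesis by (rule that)
qed

lemma D0: "D \<ge> 0"
 using order_trans[OF norm_ge_zero psb[of 0 0 0]] L by simp

lemma gen_split: "gen n s p = (\<Sum>j<6. \<sigma> n j * J n j s p) + \<sigma> n 6 * ((LINT k|lborel. F k) * ps n s p)"
proof -
 have "{..<7::nat} = insert 6 {..<6}" by auto
 then show ?thesis unfolding jump_gen_def J6[symmetric] by (simp add: add.commute)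
qed

text \<open>Pairs \<open>ps n\<close> at the point \<open>e n\<close> with the product of the two
  atoms. Their joint decay rate \<open>2 * ka\<close> matches the limit of the diagonal coupling, so
  the losses cancel and the jumps away from \<open>e n\<close> remain. These are kept as they stand,
  because the ladder jumps do not oscillate at this point.\<close>

lemma atoms_limit:
 "(%n. K L * K L * ps n L (e n) - K0 * K0 * ps n 0 (e n) + (\<Sum>j<6. LINT s:{0..L}|lborel. K s * K s * (\<sigma> n j * J n j s (e n)))) \<longlonglongrightarrow> 0"
proof -
 let ?H = "LINT k|lborel. F k"
 obtain DK where DK: "!!t. t \<in> {0..L} ==> cmod (K t) \<le> DK" "DK \<ge> 0" using Kb by blast
 \<comment> \<open>The product of the two atoms is again an atom, with doubled rate, so
   \<open>fwd_atom_integral\<close> applies to it.\<close>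
 have K2: "K t * K t = fwd_atom (2 * ka) F (K0 * K0) t" for t
  by (simp add: fwd_atom_def mult_ac mult_2 flip: exp_add)
 have KKb: "cmod (K t * K t) \<le> DK * DK" if "t \<in> {0..L}" for t
  unfolding norm_mult using DK(1)[OF that] DK(2) by (intro mult_mono) auto
 have slice: "(%s. ps n s p) \<in> borel_measurable borel" "(%s. gen n s p) \<in> borel_measurable borel" "(%s. J n j s p) \<in> borel_measurable borel" for n j p
  by measurable
 have eq: "K L * K L * ps n L (e n) - K0 * K0 * ps n 0 (e n) + (\<Sum>j<6. LINT s:{0..L}|lborel. K s * K s * (\<sigma> n j * J n j s (e n)))
  = - (2 * ka + \<sigma> n 6) * (LINT s:{0..L}|lborel. K s * K s * (?H * ps n s (e n)))" for n
 proof -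
  have ibp: "(LINT t:{0..L}|lborel. (- (2 * ka * ?H) * fwd_atom (2 * ka) F (K0 * K0) t) * ps n t (e n) - fwd_atom (2 * ka) F (K0 * K0) t * gen n t (e n))
   = fwd_atom (2 * ka) F (K0 * K0) L * ps n L (e n) - fwd_atom (2 * ka) F (K0 * K0) 0 * ps n 0 (e n)"
  proof (rule integral_by_parts_AE[OF L])
   have c: "continuous_on {0..L} (%t. - (2 * ka * ?H) * fwd_atom (2 * ka) F (K0 * K0) t)" unfolding fwd_atom_def by (intro continuous_intros)
   show "set_integrable lborel {0..L} (%t. - (2 * ka * ?H) * fwd_atom (2 * ka) F (K0 * K0) t)" by (rule borel_integrable_atLeastAtMost'[OF c])
   show "set_integrable lborel {0..L} (%t. gen n t (e n))" by (rule set_integrable_bounded[OF slice(2) gb])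
   show "AE t in lborel. t \<in> {0..L} \<longrightarrow> fwd_atom (2 * ka) F (K0 * K0) t = fwd_atom (2 * ka) F (K0 * K0) 0 + (LINT r:{0..t}|lborel. - (2 * ka * ?H) * fwd_atom (2 * ka) F (K0 * K0) r)"
    by (intro AE_I2 impI fwd_atom_integral) auto
   show "fwd_atom (2 * ka) F (K0 * K0) L = fwd_atom (2 * ka) F (K0 * K0) 0 + (LINT r:{0..L}|lborel. - (2 * ka * ?H) * fwd_atom (2 * ka) F (K0 * K0) r)"
    by (rule fwd_atom_integral[OF L])
   show "ps n t (e n) = ps n L (e n) + (LINT r:{t..L}|lborel. gen n r (e n))" if "t \<in> {0..L}" for t by (rule ps[OF that])
   show "set_borel_measurable borel {0..L} (fwd_atom (2 * ka) F (K0 * K0))" "set_borel_measurable borel {0..L} (%t. ps n t (e n))"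
    unfolding set_borel_measurable_def by measurable
  qed
  have i1: "set_integrable lborel {0..L} (%s. K s * K s * (\<sigma> n j * J n j s (e n)))" for j
  proof (rule set_integrable_bounded)
   show "(%s. K s * K s * (\<sigma> n j * J n j s (e n))) \<in> borel_measurable borel" using slice(3) by measurable
   show "cmod (K s * K s * (\<sigma> n j * J n j s (e n))) \<le> DK * DK * (cmod (\<sigma> n j) * ((LINT k|lborel. cmod (F k)) * D))" if "s \<in> {0..L}" for s
    unfolding norm_mult[of "K s * K s"] norm_mult[of "\<sigma> n j"] using DK(2) by (intro mult_mono KKb that mult_left_mono Jb) auto
  qed
  have i2: "set_integrable lborel {0..L} (%t. (- (2 * ka * ?H) * (K t * K t)) * ps n t (e n) - (K t * K t) * gen n t (e n))"
  proof (rule set_integral_diff(1); rule set_integrable_bounded)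
   show "(%t. (- (2 * ka * ?H) * (K t * K t)) * ps n t (e n)) \<in> borel_measurable borel" "(%t. (K t * K t) * gen n t (e n)) \<in> borel_measurable borel"
    using slice by measurable
   fix t assume t: "t \<in> {0..L}"
   show "cmod ((- (2 * ka * ?H) * (K t * K t)) * ps n t (e n)) \<le> cmod (- (2 * ka * ?H)) * (DK * DK) * D"
    unfolding norm_mult[of "- (2 * ka * ?H) * (K t * K t)"] norm_mult[of "- (2 * ka * ?H)"] using DK(2)
    by (intro mult_mono KKb[OF t] mult_left_mono psb[OF t]) auto
   show "cmod ((K t * K t) * gen n t (e n)) \<le> (DK * DK) * D"
    unfolding norm_mult[of "K t * K t"] using DK(2) by (intro mult_mono KKb[OF t] gb[OF t]) auto
  qed
  have "K L * K L * ps n L (e n) - K0 * K0 * ps n 0 (e n) + (\<Sum>j<6. LINT s:{0..L}|lborel. K s * K s * (\<sigma> n j * J n j s (e n)))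
   = (LINT t:{0..L}|lborel. (- (2 * ka * ?H) * (K t * K t)) * ps n t (e n) - (K t * K t) * gen n t (e n)) + (\<Sum>j<6. LINT s:{0..L}|lborel. K s * K s * (\<sigma> n j * J n j s (e n)))"
   unfolding K2 ibp by (simp add: fwd_atom_def)
  also have sm: "(\<Sum>j<6. LINT s:{0..L}|lborel. K s * K s * (\<sigma> n j * J n j s (e n))) = (LINT s:{0..L}|lborel. (\<Sum>j<6. K s * K s * (\<sigma> n j * J n j s (e n))))"
   unfolding set_lebesgue_integral_def scaleR_sum_right
   by (rule Bochner_Integration.integral_sum[symmetric]) (use i1 in \<open>simp only: set_integrable_def\<close>)
  also have "(LINT t:{0..L}|lborel. (- (2 * ka * ?H) * (K t * K t)) * ps n t (e n) - (K t * K t) * gen n t (e n)) + (LINT s:{0..L}|lborel. (\<Sum>j<6. K s * K s * (\<sigma> n j * J n j s (e n))))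
   = (LINT t:{0..L}|lborel. ((- (2 * ka * ?H) * (K t * K t)) * ps n t (e n) - (K t * K t) * gen n t (e n)) + (\<Sum>j<6. K t * K t * (\<sigma> n j * J n j t (e n))))"
  proof (rule set_integral_add(2)[symmetric, OF i2])
   show "set_integrable lborel {0..L} (%t. \<Sum>j<6. K t * K t * (\<sigma> n j * J n j t (e n)))"
    unfolding set_integrable_def scaleR_sum_right
    by (rule Bochner_Integration.integrable_sum) (use i1 in \<open>simp only: set_integrable_def\<close>)
  qed
  also have "\<dots> = (LINT t:{0..L}|lborel. - (2 * ka + \<sigma> n 6) * (K t * K t * (?H * ps n t (e n))))"
   unfolding gen_split sum_distrib_left[symmetric]
   by (rule set_lebesgue_integral_cong) (simp_all add: algebra_simps)
  finally show ?thesis unfolding sm by simp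
 qed
 have "(%n. - (2 * ka + \<sigma> n 6)) \<longlonglongrightarrow> - (2 * ka + - (2 * ka))" by (intro tendsto_minus tendsto_add tendsto_const \<sigma>6)
 then have c: "(%n. cmod (- (2 * ka + \<sigma> n 6))) \<longlonglongrightarrow> 0" using tendsto_norm_zero by fastforce
 show ?thesis unfolding eq
 proof (rule Lim_null_comparison[OF always_eventually])
  show "\<forall>n. norm (- (2 * ka + \<sigma> n 6) * (LINT s:{0..L}|lborel. K s * K s * (?H * ps n s (e n)))) \<le> cmod (- (2 * ka + \<sigma> n 6)) * (DK * DK * (cmod ?H * D) * L)"
  proof
   fix n
   have b: "cmod (K s * K s * (?H * ps n s (e n))) \<le> DK * DK * (cmod ?H * D)" if "s \<in> {0..L}" for s
    unfolding norm_mult[of "K s * K s"] norm_mult[of ?H] using DK(2) by (intro mult_mono KKb that mult_left_mono psb) auto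
   have i: "set_integrable lborel {0..L} (%s. K s * K s * (?H * ps n s (e n)))"
    by (rule set_integrable_bounded[OF _ b]) (use slice in measurable)
   have "cmod (LINT s|lborel. indicator {0..L} s *\<^sub>R (K s * K s * (?H * ps n s (e n)))) \<le> (LINT s|lborel. (DK * DK * (cmod ?H * D)) * indicator {0..L} s)"
   proof (rule Bochner_Integration.integral_norm_bound[THEN order_trans], rule integral_mono)
    show "integrable lborel (%s. norm (indicator {0..L} s *\<^sub>R (K s * K s * (?H * ps n s (e n)))))"
     using i unfolding set_integrable_def by (rule integrable_norm)
    show "norm (indicator {0..L} s *\<^sub>R (K s * K s * (?H * ps n s (e n)))) \<le> (DK * DK * (cmod ?H * D)) * indicator {0..L} s" for s
     using b[of s] by (cases "s \<in> {0..L}") (simp_all only: indicator_simps scaleR_one scaleR_zero_left mult_1_right mult_zero_right norm_zero order_refl not_False_eq_True)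
   qed (simp add: emeasure_lborel_Icc_eq)
   also have "\<dots> = DK * DK * (cmod ?H * D) * L" using L by simp
   finally show "norm (- (2 * ka + \<sigma> n 6) * (LINT s:{0..L}|lborel. K s * K s * (?H * ps n s (e n)))) \<le> cmod (- (2 * ka + \<sigma> n 6)) * (DK * DK * (cmod ?H * D) * L)"
    unfolding norm_mult[of "- (2 * ka + \<sigma> n 6)"] set_lebesgue_integral_def by (rule mult_left_mono) simp
  qed
  show "(%n. cmod (- (2 * ka + \<sigma> n 6)) * (DK * DK * (cmod ?H * D) * L)) \<longlonglongrightarrow> 0"
   using tendsto_mult[OF c tendsto_const] by simp
 qed
qed

end

lemma mu2_measurable:
 fixes a b :: "real => 'b::euclidean_space => complex"
 assumes [measurable]: "(%(t, x). a t x) \<in> borel_measurable (borel \<Otimes>\<^sub>M borel)" and b: "(%(t, x). b t x) \<in> borel_measurable (borel \<Otimes>\<^sub>M borel)"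
  and K[measurable]: "K \<in> borel_measurable borel"
  and f: "(%((t, x), y). f t x y) \<in> borel_measurable ((borel \<Otimes>\<^sub>M borel) \<Otimes>\<^sub>M borel)"
 shows "(%t. mu2 (K t) (a t) (b t) (f t)) \<in> borel_measurable borel"
proof -
 define g where "g = (%t x. mu (K t) (b t) (f t x))"
 have [measurable]: "(%(t, x). g t x) \<in> borel_measurable (borel \<Otimes>\<^sub>M borel)"
  unfolding g_def by (rule mu_measurable[OF b K f])
 have "(%t. K t * g t 0 + (LINT x|lborel. a t x * g t x)) \<in> borel_measurable borel" by measurable
 then show ?thesis by (simp only: mu2_def mu_def[of _ "a _"] g_def)
qed

lemma set_integral_tendsto_0:
 fixes f :: "nat => real => complex"
 assumes [measurable]: "!!n. f n \<in> borel_measurable borel" and M: "!!n t. t \<in> {a..b} ==> cmod (f n t) \<le> M"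
  and l: "!!t. t \<in> {a..b} ==> (%n. f n t) \<longlonglongrightarrow> 0"
 shows "(%n. LINT t:{a..b}|lborel. f n t) \<longlonglongrightarrow> 0"
proof -
 have "(%n. LINT t|lborel. indicator {a..b} t *\<^sub>R f n t) \<longlonglongrightarrow> (LINT t|(lborel::real measure). 0)"
 proof (rule integral_dominated_convergence[where w="%t. M * indicator {a..b} t"])
  show "AE t in lborel. (%n. indicator {a..b} t *\<^sub>R f n t) \<longlonglongrightarrow> 0"
  proof (intro AE_I2)
   fix t show "(%n. indicator {a..b} t *\<^sub>R f n t) \<longlonglongrightarrow> 0"
    using l[of t] by (cases "t \<in> {a..b}") simp_all
  qed
  show "AE t in lborel. norm (indicator {a..b} t *\<^sub>R f n t) \<le> M * indicator {a..b} t" for n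
   using M[of _ n] by (intro AE_I2) (auto split: split_indicator)
 qed (simp_all add: emeasure_lborel_Icc_eq)
 then show ?thesis by (simp add: set_lebesgue_integral_def)
qed

context dual_sequence
begin

text \<open>\<open>ps n\<close> is tested against the product of two densities carried by the jumps
  \<open>i1\<close> and \<open>i2\<close> from \<open>e n\<close>. These jumps and the loss are
  matched by the backward rates of the densities up to \<open>DD\<close>, which vanishes in the
  limit. Every other jump oscillates as soon as \<open>\<xi> \<noteq> \<eta>\<close>, hence on the
  whole product measure apart from the pair of atoms; that contribution is the sum left in the
  statement.\<close>

lemma ladder_limit:
 assumes i: "i1 < 6" "i2 < 6" "i1 \<noteq> i2"
  and P1[measurable]: "P1 \<in> borel_measurable borel" and P2[measurable]: "P2 \<in> borel_measurable borel"
  and a1: "fwd_density ka F K0 P1 L B a1" and a2: "fwd_density ka F K0 P2 L B a2"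
  and \<sigma>1: "(%n. \<sigma> n i1) \<longlonglongrightarrow> ka" and \<sigma>2: "(%n. \<sigma> n i2) \<longlonglongrightarrow> ka"
  and ph1: "!!\<xi> \<eta> k. (%n. S n (e n + jump i1 \<xi> + jump i2 \<eta> + jump i1 k) - S n (e n + jump i1 \<xi> + jump i2 \<eta>)) \<longlonglongrightarrow> P1 (\<xi> + k) - P1 \<xi>"
  and ph2: "!!\<xi> \<eta> k. (%n. S n (e n + jump i1 \<xi> + jump i2 \<eta> + jump i2 k) - S n (e n + jump i1 \<xi> + jump i2 \<eta>)) \<longlonglongrightarrow> P2 (\<eta> + k) - P2 \<eta>"
  and osc: "!!j \<xi> \<eta>. j < 6 ==> j \<noteq> i1 ==> j \<noteq> i2 ==> \<xi> \<noteq> \<eta> ==>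
    AE k in lborel. filterlim (%n. \<bar>S n (e n + jump i1 \<xi> + jump i2 \<eta> + jump j k) - S n (e n + jump i1 \<xi> + jump i2 \<eta>)\<bar>) at_top sequentially"
 shows "(%n. mu2 (K L) (a1 L) (a2 L) (%\<xi> \<eta>. ps n L (e n + jump i1 \<xi> + jump i2 \<eta>)) - K0 * K0 * ps n 0 (e n)
  + (\<Sum>j\<in>{..<6} - {i1, i2}. LINT s:{0..L}|lborel. K s * K s * (\<sigma> n j * J n j s (e n)))) \<longlonglongrightarrow> 0"
proof -
 let ?H = "LINT k|lborel. F k" and ?N = "LINT k|lborel. cmod (F k)"
 let ?p = "%n \<xi> \<eta>. e n + jump i1 \<xi> + jump i2 \<eta>"
 obtain DK where DK: "!!t. t \<in> {0..L} ==> cmod (K t) \<le> DK" "DK \<ge> 0" using Kb by blast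
 have a1m[measurable]: "(%(s, \<xi>). a1 s \<xi>) \<in> borel_measurable (borel \<Otimes>\<^sub>M borel)" and a2m[measurable]: "(%(s, \<xi>). a2 s \<xi>) \<in> borel_measurable (borel \<Otimes>\<^sub>M borel)"
  and a1i: "!!t. t \<in> {0..L} ==> integrable lborel (a1 t)" and a2i: "!!t. t \<in> {0..L} ==> integrable lborel (a2 t)"
  and a1B: "!!t. t \<in> {0..L} ==> (LINT \<xi>|lborel. cmod (a1 t \<xi>)) \<le> B" and a2B: "!!t. t \<in> {0..L} ==> (LINT \<xi>|lborel. cmod (a2 t \<xi>)) \<le> B"
  using a1 a2 by (auto simp: fwd_density_def)
 have B0: "B \<ge> 0" using order_trans[OF _ a1B[of 0]] L by simp
 have N0: "?N \<ge> 0" by simp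
 have "\<exists>Bs. \<forall>n. cmod (\<sigma> n j) \<le> Bs" for j
  using convergent_imp_Bseq[OF \<sigma>b[of j]] unfolding Bseq_def by blast
 then obtain Bs where Bs: "!!n j. cmod (\<sigma> n j) \<le> Bs j" by metis
 have Bs0: "Bs j \<ge> 0" for j using order_trans[OF norm_ge_zero Bs[of 0 j]] .
 define Q1 where "Q1 = (%n r \<xi> \<eta>. bwd_rate ka F P1 (%t \<xi>. ps n t (?p n \<xi> \<eta>)) r \<xi>)"
 define Q2 where "Q2 = (%n r \<xi> \<eta>. bwd_rate ka F P2 (%t \<eta>. ps n t (?p n \<xi> \<eta>)) r \<eta>)"
 \<comment> \<open>What remains of the two backward rates after the jumps \<open>i1\<close>,
   \<open>i2\<close> and the diagonal term are subtracted; the coefficients on both sides have the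
   same limits.\<close>
 define DD where "DD = (%n r \<xi> \<eta>. Q1 n r \<xi> \<eta> + Q2 n r \<xi> \<eta> - (\<sigma> n i1 * J n i1 r (?p n \<xi> \<eta>) + \<sigma> n i2 * J n i2 r (?p n \<xi> \<eta>) + \<sigma> n 6 * (?H * ps n r (?p n \<xi> \<eta>))))"
 define oth where "oth = {..<6} - {i1, i2}"
 have fin: "finite oth" by (simp add: oth_def)
 have six: "{..<6} = insert i1 (insert i2 oth)" using i by (auto simp: oth_def)
 have gs: "gen n r p = (\<sigma> n i1 * J n i1 r p + \<sigma> n i2 * J n i2 r p + \<sigma> n 6 * (?H * ps n r p)) + (\<Sum>j\<in>oth. \<sigma> n j * J n j r p)" for n r p
  unfolding gen_split six using i(3) fin by (simp add: oth_def)
 have Q1m[measurable]: "(%((t, \<xi>), \<eta>). Q1 n t \<xi> \<eta>) \<in> borel_measurable ((borel \<Otimes>\<^sub>M borel) \<Otimes>\<^sub>M borel)" for n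
  unfolding Q1_def bwd_rate_def unfolding case_prod_beta' by measurable
 have Q2m[measurable]: "(%((t, \<xi>), \<eta>). Q2 n t \<xi> \<eta>) \<in> borel_measurable ((borel \<Otimes>\<^sub>M borel) \<Otimes>\<^sub>M borel)" for n
  unfolding Q2_def bwd_rate_def unfolding case_prod_beta' by measurable
 have Jpm: "(%((t, \<xi>), \<eta>). J n j t (?p n \<xi> \<eta>)) \<in> borel_measurable ((borel \<Otimes>\<^sub>M borel) \<Otimes>\<^sub>M borel)"
  and pspm: "(%((t, \<xi>), \<eta>). ps n t (?p n \<xi> \<eta>)) \<in> borel_measurable ((borel \<Otimes>\<^sub>M borel) \<Otimes>\<^sub>M borel)"
  and gpm: "(%((t, \<xi>), \<eta>). gen n t (?p n \<xi> \<eta>)) \<in> borel_measurable ((borel \<Otimes>\<^sub>M borel) \<Otimes>\<^sub>M borel)" for n j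
  unfolding case_prod_beta' by measurable
 have DDm: "(%((t, \<xi>), \<eta>). DD n t \<xi> \<eta>) \<in> borel_measurable ((borel \<Otimes>\<^sub>M borel) \<Otimes>\<^sub>M borel)" for n
 proof -
  have 1: "(%x. Q1 n (fst (fst x)) (snd (fst x)) (snd x)) \<in> borel_measurable ((borel \<Otimes>\<^sub>M borel) \<Otimes>\<^sub>M borel)"
   and 2: "(%x. Q2 n (fst (fst x)) (snd (fst x)) (snd x)) \<in> borel_measurable ((borel \<Otimes>\<^sub>M borel) \<Otimes>\<^sub>M borel)"
   using Q1m[of n] Q2m[of n] unfolding case_prod_beta' by simp_all
  have 3: "(%x. \<sigma> n i1 * J n i1 (fst (fst x)) (?p n (snd (fst x)) (snd x)) + \<sigma> n i2 * J n i2 (fst (fst x)) (?p n (snd (fst x)) (snd x))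
   + \<sigma> n 6 * (?H * ps n (fst (fst x)) (?p n (snd (fst x)) (snd x)))) \<in> borel_measurable ((borel \<Otimes>\<^sub>M borel) \<Otimes>\<^sub>M borel)"
   by measurable
  have "(%x. DD n (fst (fst x)) (snd (fst x)) (snd x)) \<in> borel_measurable ((borel \<Otimes>\<^sub>M borel) \<Otimes>\<^sub>M borel)"
   unfolding DD_def by (rule borel_measurable_diff[OF borel_measurable_add[OF 1 2] 3])
  then show ?thesis unfolding case_prod_beta' .
 qed
 have slice2: "(%(\<xi>, \<eta>). f t \<xi> \<eta>) \<in> borel_measurable (borel \<Otimes>\<^sub>M borel)"
  if "(%((t, \<xi>), \<eta>). f t \<xi> \<eta>) \<in> borel_measurable ((borel \<Otimes>\<^sub>M borel) \<Otimes>\<^sub>M borel)" for f :: "real => R2 => R2 => complex" and t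
 proof -
  have "(%x. ((t, fst x), snd x)) \<in> measurable (borel \<Otimes>\<^sub>M borel) ((borel \<Otimes>\<^sub>M borel) \<Otimes>\<^sub>M borel)" by measurable
  from measurable_compose[OF this that] show ?thesis by (simp add: case_prod_beta')
 qed
 have pss: "ps n r \<in> borel_measurable borel" for n r by (rule measurable_slice[OF psm])
 define M where "M = cmod ka * ?N * (2 * D) + cmod ka * ?N * (2 * D) + (Bs i1 * (?N * D) + Bs i2 * (?N * D) + Bs 6 * (cmod ?H * D))"
 have Q1b: "cmod (Q1 n r \<xi> \<eta>) \<le> cmod ka * ?N * (2 * D)" and Q2b: "cmod (Q2 n r \<xi> \<eta>) \<le> cmod ka * ?N * (2 * D)" if r: "r \<in> {0..L}" for n r \<xi> \<eta>
  unfolding Q1_def Q2_def by (rule bwd_rate_bound[OF F]; use pss psb[OF r] in measurable)+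
 have DDb: "cmod (DD n r \<xi> \<eta>) \<le> M" if r: "r \<in> {0..L}" for n r \<xi> \<eta>
  unfolding DD_def M_def
 proof (intro order_trans[OF norm_triangle_ineq4] add_mono order_trans[OF norm_triangle_ineq] Q1b Q2b r)
  show "cmod (\<sigma> n i1 * J n i1 r (?p n \<xi> \<eta>)) \<le> Bs i1 * (?N * D)" "cmod (\<sigma> n i2 * J n i2 r (?p n \<xi> \<eta>)) \<le> Bs i2 * (?N * D)"
   unfolding norm_mult by (intro mult_mono Bs Jb r Bs0 norm_ge_zero)+
  show "cmod (\<sigma> n 6 * (?H * ps n r (?p n \<xi> \<eta>))) \<le> Bs 6 * (cmod ?H * D)"
   unfolding norm_mult by (intro mult_mono Bs mult_left_mono psb r Bs0 norm_ge_zero mult_nonneg_nonneg)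
 qed
 define KB where "KB = DK + B"
 have KB: "KB \<ge> 0" "!!t. t \<in> {0..L} ==> cmod (K t) + (LINT \<xi>|lborel. cmod (a1 t \<xi>)) \<le> KB" "!!t. t \<in> {0..L} ==> cmod (K t) + (LINT \<xi>|lborel. cmod (a2 t \<xi>)) \<le> KB"
  using DK B0 add_mono[OF DK(1) a1B] add_mono[OF DK(1) a2B] by (auto simp: KB_def)
 have mu2b: "cmod (mu2 (K r) (a1 r) (a2 r) f) \<le> KB * (KB * Mf)"
  if r: "r \<in> {0..L}" and f: "(%(x, y). f x y) \<in> borel_measurable (borel \<Otimes>\<^sub>M borel)" "!!x y. cmod (f x y) \<le> Mf" for r f Mf
 proof -
  have Mf: "Mf \<ge> 0" using order_trans[OF norm_ge_zero f(2)] .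
  have "cmod (mu2 (K r) (a1 r) (a2 r) f) \<le> (cmod (K r) + (LINT x|lborel. cmod (a1 r x))) * ((cmod (K r) + (LINT x|lborel. cmod (a2 r x))) * Mf)"
   by (rule mu2_bound[OF a1i[OF r] a2i[OF r] f])
  also have "\<dots> \<le> KB * (KB * Mf)" using Mf KB(1) by (intro mult_mono KB(2,3) r mult_right_mono) auto
  finally show ?thesis .
 qed
 have S1: "mu2 (K L) (a1 L) (a2 L) (%\<xi> \<eta>. ps n L (?p n \<xi> \<eta>)) - K0 * K0 * ps n 0 (e n)
  = (LINT r:{0..L}|lborel. mu2 (K r) (a1 r) (a2 r) (%\<xi> \<eta>. DD n r \<xi> \<eta> - (\<Sum>j\<in>oth. \<sigma> n j * J n j r (?p n \<xi> \<eta>))))" for n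
 proof -
  have e: "bwd_rate ka F P1 (%t \<xi>. ps n t (?p n \<xi> \<eta>)) r \<xi> + bwd_rate ka F P2 (%t \<eta>. ps n t (?p n \<xi> \<eta>)) r \<eta> - gen n r (?p n \<xi> \<eta>)
   = DD n r \<xi> \<eta> - (\<Sum>j\<in>oth. \<sigma> n j * J n j r (?p n \<xi> \<eta>))" for r \<xi> \<eta>
   unfolding gs DD_def Q1_def Q2_def by (simp only: diff_diff_eq)
  have "mu2 (K L) (a1 L) (a2 L) (%\<xi> \<eta>. ps n L (?p n \<xi> \<eta>)) - K0 * K0 * ps n 0 (?p n 0 0)
   = (LINT r:{0..L}|lborel. mu2 (K r) (a1 r) (a2 r)
    (%\<xi> \<eta>. bwd_rate ka F P1 (%t \<xi>. ps n t (?p n \<xi> \<eta>)) r \<xi> + bwd_rate ka F P2 (%t \<eta>. ps n t (?p n \<xi> \<eta>)) r \<eta> - gen n r (?p n \<xi> \<eta>)))"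
   by (rule product_duality[where ps="%t \<xi> \<eta>. ps n t (?p n \<xi> \<eta>)", OF F P1 P2 a1 a2 L pspm gpm psb gb ps])
  then show ?thesis unfolding e by simp
 qed
 have Jb': "cmod (\<sigma> n j * J n j r p) \<le> Bs j * (?N * D)" if "r \<in> {0..L}" for n j r p
  unfolding norm_mult by (intro mult_mono Bs Jb that Bs0 norm_ge_zero)
 have S2: "mu2 (K r) (a1 r) (a2 r) (%\<xi> \<eta>. DD n r \<xi> \<eta> - (\<Sum>j\<in>oth. \<sigma> n j * J n j r (?p n \<xi> \<eta>)))
  = mu2 (K r) (a1 r) (a2 r) (DD n r) - (\<Sum>j\<in>oth. \<sigma> n j * mu2 (K r) (a1 r) (a2 r) (%\<xi> \<eta>. J n j r (?p n \<xi> \<eta>)))" if r: "r \<in> {0..L}" for n r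
 proof -
  have mj: "(%(\<xi>, \<eta>). \<sigma> n j * J n j r (?p n \<xi> \<eta>)) \<in> borel_measurable (borel \<Otimes>\<^sub>M borel)" for j by measurable
  have ms: "(%(\<xi>, \<eta>). \<Sum>j\<in>oth. \<sigma> n j * J n j r (?p n \<xi> \<eta>)) \<in> borel_measurable (borel \<Otimes>\<^sub>M borel)" by measurable
  have bs: "cmod (\<Sum>j\<in>oth. \<sigma> n j * J n j r (?p n \<xi> \<eta>)) \<le> (\<Sum>j\<in>oth. Bs j * (?N * D))" for \<xi> \<eta>
   by (rule order_trans[OF norm_sum sum_mono]) (rule Jb'[OF r])
  have "mu2 (K r) (a1 r) (a2 r) (%\<xi> \<eta>. DD n r \<xi> \<eta> - (\<Sum>j\<in>oth. \<sigma> n j * J n j r (?p n \<xi> \<eta>)))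
   = mu2 (K r) (a1 r) (a2 r) (DD n r) - mu2 (K r) (a1 r) (a2 r) (%\<xi> \<eta>. \<Sum>j\<in>oth. \<sigma> n j * J n j r (?p n \<xi> \<eta>))"
   by (rule mu2_diff[OF a1i[OF r] a2i[OF r] slice2[OF DDm] ms DDb[OF r] bs])
  also have "mu2 (K r) (a1 r) (a2 r) (%\<xi> \<eta>. \<Sum>j\<in>oth. \<sigma> n j * J n j r (?p n \<xi> \<eta>))
   = (\<Sum>j\<in>oth. mu2 (K r) (a1 r) (a2 r) (%\<xi> \<eta>. \<sigma> n j * J n j r (?p n \<xi> \<eta>)))"
   by (rule mu2_sum[OF a1i[OF r] a2i[OF r] fin mj Jb'[OF r]])
  finally show ?thesis unfolding mu2_cmult .
 qed
 have mDD: "(%r. mu2 (K r) (a1 r) (a2 r) (DD n r)) \<in> borel_measurable borel" for n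
  by (rule mu2_measurable[OF a1m a2m fwd_atom_measurable DDm])
 have mJ: "(%r. mu2 (K r) (a1 r) (a2 r) (%\<xi> \<eta>. J n j r (?p n \<xi> \<eta>))) \<in> borel_measurable borel" for n j
  by (rule mu2_measurable[OF a1m a2m fwd_atom_measurable Jpm])
 have bDD: "cmod (mu2 (K r) (a1 r) (a2 r) (DD n r)) \<le> KB * (KB * M)" if r: "r \<in> {0..L}" for n r
  by (rule mu2b[OF r slice2[OF DDm] DDb[OF r]])
 have bJ: "cmod (mu2 (K r) (a1 r) (a2 r) (%\<xi> \<eta>. J n j r (?p n \<xi> \<eta>))) \<le> KB * (KB * (?N * D))" if r: "r \<in> {0..L}" for n j r
  by (rule mu2b[OF r slice2[OF Jpm] Jb[OF r]])
 have iJ: "set_integrable lborel {0..L} (%r. \<sigma> n j * mu2 (K r) (a1 r) (a2 r) (%\<xi> \<eta>. J n j r (?p n \<xi> \<eta>)))" for n j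
  by (intro set_integrable_mult_right set_integrable_bounded[OF mJ bJ])
 have S3: "mu2 (K L) (a1 L) (a2 L) (%\<xi> \<eta>. ps n L (?p n \<xi> \<eta>)) - K0 * K0 * ps n 0 (e n)
  + (\<Sum>j\<in>oth. LINT s:{0..L}|lborel. K s * K s * (\<sigma> n j * J n j s (e n)))
  = (LINT r:{0..L}|lborel. mu2 (K r) (a1 r) (a2 r) (DD n r))
   - (\<Sum>j\<in>oth. \<sigma> n j * ((LINT r:{0..L}|lborel. mu2 (K r) (a1 r) (a2 r) (%\<xi> \<eta>. J n j r (?p n \<xi> \<eta>))) - (LINT s:{0..L}|lborel. K s * K s * J n j s (e n))))" for n
 proof -
  have "(LINT r:{0..L}|lborel. mu2 (K r) (a1 r) (a2 r) (%\<xi> \<eta>. DD n r \<xi> \<eta> - (\<Sum>j\<in>oth. \<sigma> n j * J n j r (?p n \<xi> \<eta>))))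
   = (LINT r:{0..L}|lborel. mu2 (K r) (a1 r) (a2 r) (DD n r) - (\<Sum>j\<in>oth. \<sigma> n j * mu2 (K r) (a1 r) (a2 r) (%\<xi> \<eta>. J n j r (?p n \<xi> \<eta>))))"
   by (rule set_lebesgue_integral_cong) (simp, intro allI impI S2)
  also have "\<dots> = (LINT r:{0..L}|lborel. mu2 (K r) (a1 r) (a2 r) (DD n r)) - (LINT r:{0..L}|lborel. (\<Sum>j\<in>oth. \<sigma> n j * mu2 (K r) (a1 r) (a2 r) (%\<xi> \<eta>. J n j r (?p n \<xi> \<eta>))))"
  proof (rule set_integral_diff(2)[OF set_integrable_bounded[OF mDD bDD]])
   show "set_integrable lborel {0..L} (%r. \<Sum>j\<in>oth. \<sigma> n j * mu2 (K r) (a1 r) (a2 r) (%\<xi> \<eta>. J n j r (?p n \<xi> \<eta>)))"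
    unfolding set_integrable_def scaleR_sum_right
    by (rule Bochner_Integration.integrable_sum) (use iJ in \<open>simp only: set_integrable_def\<close>)
  qed
  also have "(LINT r:{0..L}|lborel. (\<Sum>j\<in>oth. \<sigma> n j * mu2 (K r) (a1 r) (a2 r) (%\<xi> \<eta>. J n j r (?p n \<xi> \<eta>))))
   = (\<Sum>j\<in>oth. LINT r:{0..L}|lborel. \<sigma> n j * mu2 (K r) (a1 r) (a2 r) (%\<xi> \<eta>. J n j r (?p n \<xi> \<eta>)))"
   unfolding set_lebesgue_integral_def scaleR_sum_right
   by (rule Bochner_Integration.integral_sum) (use iJ in \<open>simp only: set_integrable_def\<close>)
  finally have "(LINT r:{0..L}|lborel. mu2 (K r) (a1 r) (a2 r) (%\<xi> \<eta>. DD n r \<xi> \<eta> - (\<Sum>j\<in>oth. \<sigma> n j * J n j r (?p n \<xi> \<eta>))))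
   = (LINT r:{0..L}|lborel. mu2 (K r) (a1 r) (a2 r) (DD n r)) - (\<Sum>j\<in>oth. \<sigma> n j * (LINT r:{0..L}|lborel. mu2 (K r) (a1 r) (a2 r) (%\<xi> \<eta>. J n j r (?p n \<xi> \<eta>))))"
   unfolding set_integral_mult_right .
  moreover have "(\<Sum>j\<in>oth. LINT s:{0..L}|lborel. K s * K s * (\<sigma> n j * J n j s (e n))) = (\<Sum>j\<in>oth. \<sigma> n j * (LINT s:{0..L}|lborel. K s * K s * J n j s (e n)))"
   unfolding mult.left_commute[of "K _ * K _" "\<sigma> n _"] set_integral_mult_right ..
  ultimately show ?thesis unfolding S1 by (simp only: right_diff_distrib sum_subtractf) simp
 qed
 have limD: "(%n. LINT r:{0..L}|lborel. mu2 (K r) (a1 r) (a2 r) (DD n r)) \<longlonglongrightarrow> 0"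
 proof (rule set_integral_tendsto_0[OF mDD bDD])
  fix r assume r: "r \<in> {0..L}"
  have "(%n. mu2 (K r) (a1 r) (a2 r) (DD n r)) \<longlonglongrightarrow> mu2 (K r) (a1 r) (a2 r) (%_ _. 0)"
  proof (rule mu2_tendsto[OF a1i[OF r] a2i[OF r] slice2[OF DDm] _ DDb[OF r]])
   show "(%n. DD n r \<xi> \<eta>) \<longlonglongrightarrow> 0" for \<xi> \<eta>
   proof -
    \<comment> \<open>The coefficient of \<open>ps n\<close> tends to 0 for each \<open>k\<close>,
      and \<open>ps n\<close> is merely bounded: no convergence of the dual solutions
      enters.\<close>
    have X: "(%n. LINT k|lborel. F k * ((ka * iexp (r * (P (z + k) - P z)) - \<sigma> n i * iexp (r * (S n (?p n \<xi> \<eta> + jump i k) - S n (?p n \<xi> \<eta>)))) * ps n r (?p n \<xi> \<eta> + jump i k))) \<longlonglongrightarrow> 0"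
     if s: "(%n. \<sigma> n i) \<longlonglongrightarrow> ka" and [measurable]: "P \<in> borel_measurable borel"
      and p: "!!k. (%n. S n (?p n \<xi> \<eta> + jump i k) - S n (?p n \<xi> \<eta>)) \<longlonglongrightarrow> P (z + k) - P z" for i P and z :: R2
    proof -
     let ?c = "%n k. ka * iexp (r * (P (z + k) - P z)) - \<sigma> n i * iexp (r * (S n (?p n \<xi> \<eta> + jump i k) - S n (?p n \<xi> \<eta>)))"
     have cb: "cmod (?c n k) \<le> cmod ka + Bs i" for n k
      using norm_triangle_ineq4[of "ka * iexp (r * (P (z + k) - P z))" "\<sigma> n i * iexp (r * (S n (?p n \<xi> \<eta> + jump i k) - S n (?p n \<xi> \<eta>)))"] Bs[of n i]
      unfolding norm_mult norm_exp_i_times mult_1_right by linarith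
     have "(%n. LINT k|lborel. F k * (?c n k * ps n r (?p n \<xi> \<eta> + jump i k))) \<longlonglongrightarrow> (LINT k|lborel. F k * 0)"
     proof (rule mult_bounded_tendsto[OF F, where M="(cmod ka + Bs i) * D"])
      show "cmod (?c n k * ps n r (?p n \<xi> \<eta> + jump i k)) \<le> (cmod ka + Bs i) * D" for n k
       unfolding norm_mult[of "?c n k"] by (intro mult_mono cb psb[OF r] norm_ge_zero add_nonneg_nonneg Bs0)
      show "(%n. ?c n k * ps n r (?p n \<xi> \<eta> + jump i k)) \<longlonglongrightarrow> 0" for k
      proof (rule Lim_null_comparison[OF always_eventually])
       have "(%n. ?c n k) \<longlonglongrightarrow> ka * iexp (r * (P (z + k) - P z)) - ka * iexp (r * (P (z + k) - P z))"
        by (intro tendsto_diff tendsto_mult tendsto_const tendsto_exp tendsto_of_real s p)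
       then have "(%n. cmod (?c n k)) \<longlonglongrightarrow> 0" unfolding diff_self by (rule tendsto_norm_zero)
       from tendsto_mult[OF this tendsto_const[of D]] show "(%n. cmod (?c n k) * D) \<longlonglongrightarrow> 0" by (simp only: mult_zero_left)
       show "\<forall>n. norm (?c n k * ps n r (?p n \<xi> \<eta> + jump i k)) \<le> cmod (?c n k) * D"
        unfolding norm_mult[of "?c _ k"] by (intro allI mult_left_mono psb[OF r] norm_ge_zero)
      qed
     qed measurable
     then show ?thesis by (simp only: mult_zero_right integral_zero)
    qed
    have Y: "bwd_rate ka F P (%t. f t) r z - \<sigma> n i * J n i r (?p n \<xi> \<eta>) = (LINT k|lborel. F k * ((ka * iexp (r * (P (z + k) - P z)) - \<sigma> n i * iexp (r * (S n (?p n \<xi> \<eta> + jump i k) - S n (?p n \<xi> \<eta>)))) * ps n r (?p n \<xi> \<eta> + jump i k))) - ka * (?H * ps n r (?p n \<xi> \<eta>))"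
     if [measurable]: "P \<in> borel_measurable borel" and f: "!!k. f r (z + k) = ps n r (?p n \<xi> \<eta> + jump i k)" "f r z = ps n r (?p n \<xi> \<eta>)" for P f n i and z :: R2
    proof -
     let ?u = "%k. ps n r (?p n \<xi> \<eta> + jump i k)"
     let ?e1 = "%k. iexp (r * (P (z + k) - P z))" and ?e2 = "%k. iexp (r * (S n (?p n \<xi> \<eta> + jump i k) - S n (?p n \<xi> \<eta>)))"
     have i1: "integrable lborel (%k. F k * (?e1 k * ?u k))"
      by (rule mult_bounded_integrable(1)[OF F, where B=D], measurable, unfold norm_mult norm_exp_i_times mult_1_left, rule psb[OF r])
     have i2: "integrable lborel (%k. F k * (?e2 k * ?u k))"
      by (rule mult_bounded_integrable(1)[OF F, where B=D], measurable, unfold norm_mult norm_exp_i_times mult_1_left, rule psb[OF r])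
     have "(LINT k|lborel. F k * (?e1 k * ?u k - ps n r (?p n \<xi> \<eta>))) = (LINT k|lborel. F k * (?e1 k * ?u k) - F k * ps n r (?p n \<xi> \<eta>))"
      by (simp only: right_diff_distrib)
     also have "\<dots> = (LINT k|lborel. F k * (?e1 k * ?u k)) - ?H * ps n r (?p n \<xi> \<eta>)"
      using Bochner_Integration.integral_diff[OF i1 integrable_mult_left[OF F]] by (simp only: integral_mult_left_zero)
     finally have 1: "bwd_rate ka F P (%t. f t) r z = ka * (LINT k|lborel. F k * (?e1 k * ?u k)) - ka * (?H * ps n r (?p n \<xi> \<eta>))"
      unfolding bwd_rate_def f by (simp only: right_diff_distrib)
     have "(LINT k|lborel. F k * ((ka * ?e1 k - \<sigma> n i * ?e2 k) * ?u k)) = (LINT k|lborel. ka * (F k * (?e1 k * ?u k)) - \<sigma> n i * (F k * (?e2 k * ?u k)))"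
      by (intro Bochner_Integration.integral_cong refl) (simp add: algebra_simps)
     also have "\<dots> = ka * (LINT k|lborel. F k * (?e1 k * ?u k)) - \<sigma> n i * (LINT k|lborel. F k * (?e2 k * ?u k))"
      using Bochner_Integration.integral_diff[OF integrable_mult_right[OF i1] integrable_mult_right[OF i2]] by (simp only: integral_mult_right_zero)
     finally have 2: "(LINT k|lborel. F k * ((ka * ?e1 k - \<sigma> n i * ?e2 k) * ?u k)) = ka * (LINT k|lborel. F k * (?e1 k * ?u k)) - \<sigma> n i * (LINT k|lborel. F k * (?e2 k * ?u k))" .
     show ?thesis unfolding 1 2 jump_op_def mult.assoc diff_diff_eq by (intro arg_cong2[where f=minus] refl add.commute)
    qed
    have p1: "?p n (\<xi> + k) \<eta> = ?p n \<xi> \<eta> + jump i1 k" and p2: "?p n \<xi> (\<eta> + k) = ?p n \<xi> \<eta> + jump i2 k" for n k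
     by (simp_all add: jump_add)
    define A1 where "A1 = (%n. LINT k|lborel. F k * ((ka * iexp (r * (P1 (\<xi> + k) - P1 \<xi>)) - \<sigma> n i1 * iexp (r * (S n (?p n \<xi> \<eta> + jump i1 k) - S n (?p n \<xi> \<eta>)))) * ps n r (?p n \<xi> \<eta> + jump i1 k)))"
    define A2 where "A2 = (%n. LINT k|lborel. F k * ((ka * iexp (r * (P2 (\<eta> + k) - P2 \<eta>)) - \<sigma> n i2 * iexp (r * (S n (?p n \<xi> \<eta> + jump i2 k) - S n (?p n \<xi> \<eta>)))) * ps n r (?p n \<xi> \<eta> + jump i2 k)))"
    have y1: "Q1 n r \<xi> \<eta> - \<sigma> n i1 * J n i1 r (?p n \<xi> \<eta>) = A1 n - ka * (?H * ps n r (?p n \<xi> \<eta>))" for n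
     unfolding Q1_def A1_def by (rule Y[OF P1]) (simp_all only: p1)
    have y2: "Q2 n r \<xi> \<eta> - \<sigma> n i2 * J n i2 r (?p n \<xi> \<eta>) = A2 n - ka * (?H * ps n r (?p n \<xi> \<eta>))" for n
     unfolding Q2_def A2_def by (rule Y[OF P2]) (simp_all only: p2)
    \<comment> \<open>Each backward rate brings one loss \<open>ka\<close>; together they compensate
      the diagonal coupling with limit \<open>- (2 * ka)\<close>.\<close>
    have alg: "q1 + q2 - (s1 + s2 + s6 * w) = b1 + b2 + (- (2 * ka) - s6) * w"
     if "q1 - s1 = b1 - ka * w" "q2 - s2 = b2 - ka * w" for q1 q2 s1 s2 s6 w b1 b2 :: complex
    proof -
     have q: "q1 = b1 - ka * w + s1" "q2 = b2 - ka * w + s2" using that by (simp_all only: diff_eq_eq)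
     show ?thesis unfolding q by (simp add: algebra_simps)
    qed
    have DDe: "DD n r \<xi> \<eta> = A1 n + A2 n + (- (2 * ka) - \<sigma> n 6) * (?H * ps n r (?p n \<xi> \<eta>))" for n
     unfolding DD_def by (rule alg[OF y1 y2])
    have z3: "(%n. (- (2 * ka) - \<sigma> n 6) * (?H * ps n r (?p n \<xi> \<eta>))) \<longlonglongrightarrow> 0"
    proof (rule Lim_null_comparison[OF always_eventually])
     show "\<forall>n. norm ((- (2 * ka) - \<sigma> n 6) * (?H * ps n r (?p n \<xi> \<eta>))) \<le> cmod (- (2 * ka) - \<sigma> n 6) * (cmod ?H * D)"
      unfolding norm_mult[of "- (2 * ka) - \<sigma> _ 6"] norm_mult[of ?H] by (intro allI mult_left_mono psb[OF r] norm_ge_zero)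
     have "(%n. - (2 * ka) - \<sigma> n 6) \<longlonglongrightarrow> - (2 * ka) - - (2 * ka)" by (intro tendsto_diff tendsto_const \<sigma>6)
     then have "(%n. cmod (- (2 * ka) - \<sigma> n 6)) \<longlonglongrightarrow> 0" unfolding diff_self by (rule tendsto_norm_zero)
     from tendsto_mult[OF this tendsto_const[of "cmod ?H * D"]]
     show "(%n. cmod (- (2 * ka) - \<sigma> n 6) * (cmod ?H * D)) \<longlonglongrightarrow> 0" by (simp only: mult_zero_left)
    qed
    have "A1 \<longlonglongrightarrow> 0" "A2 \<longlonglongrightarrow> 0" unfolding A1_def A2_def by (rule X[OF \<sigma>1 P1 ph1], rule X[OF \<sigma>2 P2 ph2])
    from tendsto_add[OF tendsto_add[OF this] z3] show ?thesis unfolding DDe by simp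
   qed
  qed measurable
  then show "(%n. mu2 (K r) (a1 r) (a2 r) (DD n r)) \<longlonglongrightarrow> 0" by (simp add: mu2_def mu_def)
 qed
 \<comment> \<open>Subtracting the contribution of the pair of atoms leaves the three parts
   \<open>?T1\<close>, \<open>?T2\<close>, \<open>?T3\<close> of the product measure, and each of
   them oscillates.\<close>
 have limJ: "(%n. (LINT r:{0..L}|lborel. mu2 (K r) (a1 r) (a2 r) (%\<xi> \<eta>. J n j r (?p n \<xi> \<eta>))) - (LINT s:{0..L}|lborel. K s * K s * J n j s (e n))) \<longlonglongrightarrow> 0"
  if j: "j \<in> oth" for j
 proof -
  have j': "j < 6" "j \<noteq> i1" "j \<noteq> i2" using j by (auto simp: oth_def)
  have ne: "AE \<eta> in lborel. \<eta> \<noteq> (z :: R2)" for z using AE_lborel_singleton[of z] .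
  let ?T1 = "%n r. LINT \<eta>|lborel. (K r * a2 r \<eta>) * J n j r (?p n 0 \<eta>)"
  let ?T2 = "%n r. LINT \<xi>|lborel. (K r * a1 r \<xi>) * J n j r (?p n \<xi> 0)"
  let ?T3 = "%n r. LINT z|(lborel \<Otimes>\<^sub>M lborel). (a1 r (fst z) * a2 r (snd z)) * J n j r (?p n (fst z) (snd z))"
  have w1: "integrable lborel (%x. K t * a t x)" "(LINT x|lborel. cmod (K t * a t x)) \<le> DK * B"
   if "t \<in> {0..L}" "integrable lborel (a t)" "(LINT x|lborel. cmod (a t x)) \<le> B" for t and a :: "real => R2 => complex"
  proof -
   show "integrable lborel (%x. K t * a t x)" using that(2) by simp
   have "(LINT x|lborel. cmod (K t * a t x)) = cmod (K t) * (LINT x|lborel. cmod (a t x))" by (simp add: norm_mult)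
   also have "\<dots> \<le> DK * B" using DK(2) by (intro mult_mono DK(1) that) auto
   finally show "(LINT x|lborel. cmod (K t * a t x)) \<le> DK * B" .
  qed
  have L1: "(%n. LINT r:{0..L}|lborel. ?T1 n r) \<longlonglongrightarrow> 0"
  proof (rule jump_op_oscillation[OF sigma_finite_lborel _ _ w1(1)[OF _ a2i a2B] w1(2)[OF _ a2i a2B]])
   show "AE \<eta> in lborel. AE k in lborel. filterlim (%n. \<bar>S n (?p n 0 \<eta> + jump j k) - S n (?p n 0 \<eta>)\<bar>) at_top sequentially"
    using ne[of 0] by eventually_elim (rule osc[OF j'], simp)
  qed measurable
  have L2: "(%n. LINT r:{0..L}|lborel. ?T2 n r) \<longlonglongrightarrow> 0"
  proof (rule jump_op_oscillation[OF sigma_finite_lborel _ _ w1(1)[OF _ a1i a1B] w1(2)[OF _ a1i a1B]])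
   show "AE \<xi> in lborel. AE k in lborel. filterlim (%n. \<bar>S n (?p n \<xi> 0 + jump j k) - S n (?p n \<xi> 0)\<bar>) at_top sequentially"
    using ne[of 0] by eventually_elim (rule osc[OF j'], simp)
  qed measurable
  have L3: "(%n. LINT r:{0..L}|lborel. ?T3 n r) \<longlonglongrightarrow> 0"
  proof (rule jump_op_oscillation[where Bw="B * B"])
   show "sigma_finite_measure (lborel \<Otimes>\<^sub>M lborel :: (R2 \<times> R2) measure)" by (simp add: lborel_prod sigma_finite_lborel)
   have ti: "integrable (lborel \<Otimes>\<^sub>M lborel) (%z. a1 t (fst z) * a2 t (snd z))" if "t \<in> {0..L}" for t
    by (rule integrable_tensor[OF sigma_finite_lborel sigma_finite_lborel a1i[OF that] a2i[OF that]])
   then show "integrable (lborel \<Otimes>\<^sub>M lborel) (%z. a1 t (fst z) * a2 t (snd z))" if "t \<in> {0..L}" for t using that .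
   show "(LINT z|(lborel \<Otimes>\<^sub>M lborel). cmod (a1 t (fst z) * a2 t (snd z))) \<le> B * B" if t: "t \<in> {0..L}" for t
   proof -
    have "(LINT z|(lborel \<Otimes>\<^sub>M lborel). cmod (a1 t (fst z) * a2 t (snd z))) = (LINT x|lborel. LINT y|lborel. cmod (a1 t x * a2 t y))"
     using lborel_pair.integral_fst'[OF integrable_norm[OF ti[OF t]]] by simp
    also have "\<dots> = (LINT x|lborel. cmod (a1 t x)) * (LINT y|lborel. cmod (a2 t y))" by (simp add: norm_mult)
    also have "\<dots> \<le> B * B" using B0 by (intro mult_mono a1B a2B t) auto
    finally show ?thesis .
   qed
   show "AE z in lborel \<Otimes>\<^sub>M lborel. AE k in lborel. filterlim (%n. \<bar>S n (?p n (fst z) (snd z) + jump j k) - S n (?p n (fst z) (snd z))\<bar>) at_top sequentially"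
   proof -
    \<comment> \<open>The diagonal, where the other jumps fail to oscillate, is a null set of the
      product.\<close>
    have "AE z in lborel \<Otimes>\<^sub>M lborel. fst z \<noteq> (snd z :: R2)"
    proof (rule lborel_pair.AE_pair_measure)
     show "{z \<in> space (lborel \<Otimes>\<^sub>M lborel). fst z \<noteq> (snd z :: R2)} \<in> sets (lborel \<Otimes>\<^sub>M lborel)" by measurable
     show "AE x in lborel. AE y in lborel. fst (x, y) \<noteq> (snd (x, y) :: R2)"
     proof (rule AE_I2)
      fix x :: R2
      show "AE y in lborel. fst (x, y) \<noteq> snd (x, y)" using ne[of x] by eventually_elim simp
     qed
    qed
    then show ?thesis by eventually_elim (rule osc[OF j'])
   qed
  qed measurable
  have T1m: "?T1 n \<in> borel_measurable borel" and T2m: "?T2 n \<in> borel_measurable borel" and T3m: "?T3 n \<in> borel_measurable borel" for n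
  proof -
   interpret Q: sigma_finite_measure "lborel \<Otimes>\<^sub>M lborel :: (R2 \<times> R2) measure" by (simp add: lborel_prod sigma_finite_lborel)
   show "?T1 n \<in> borel_measurable borel" "?T2 n \<in> borel_measurable borel" "?T3 n \<in> borel_measurable borel" by measurable
  qed
  have T1b: "cmod (?T1 n r) \<le> DK * B * (?N * D)" and T2b: "cmod (?T2 n r) \<le> DK * B * (?N * D)" if r: "r \<in> {0..L}" for n r
  proof -
   have ND: "?N * D \<ge> 0" using D0 by simp
   have "cmod (?T1 n r) \<le> (LINT x|lborel. cmod (K r * a2 r x)) * (?N * D)"
    by (rule mult_bounded_integrable(2)[OF w1(1)[where t=r and a=a2, OF r a2i[OF r] a2B[OF r]]]) (use Jb[OF r] in measurable)
   also have "\<dots> \<le> DK * B * (?N * D)" by (rule mult_right_mono[OF w1(2)[where t=r and a=a2, OF r a2i[OF r] a2B[OF r]] ND])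
   finally show "cmod (?T1 n r) \<le> DK * B * (?N * D)" .
   have "cmod (?T2 n r) \<le> (LINT x|lborel. cmod (K r * a1 r x)) * (?N * D)"
    by (rule mult_bounded_integrable(2)[OF w1(1)[where t=r and a=a1, OF r a1i[OF r] a1B[OF r]]]) (use Jb[OF r] in measurable)
   also have "\<dots> \<le> DK * B * (?N * D)" by (rule mult_right_mono[OF w1(2)[where t=r and a=a1, OF r a1i[OF r] a1B[OF r]] ND])
   finally show "cmod (?T2 n r) \<le> DK * B * (?N * D)" .
  qed
  have ex: "mu2 (K r) (a1 r) (a2 r) (%\<xi> \<eta>. J n j r (?p n \<xi> \<eta>)) - K r * K r * J n j r (e n) = (?T1 n r + ?T2 n r) + ?T3 n r" if r: "r \<in> {0..L}" for n r
   using mu2_expand[OF a1i[OF r] a2i[OF r] slice2[OF Jpm] Jb[OF r], of "K r" n j] by (simp add: add.assoc)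
  have kk: "set_integrable lborel {0..L} (%r. K r * K r * J n j r (e n))" for n
  proof (rule set_integrable_bounded)
   show "(%r. K r * K r * J n j r (e n)) \<in> borel_measurable borel" by measurable
   show "cmod (K r * K r * J n j r (e n)) \<le> DK * DK * (?N * D)" if "r \<in> {0..L}" for r
    unfolding norm_mult using DK that D0 by (intro mult_mono DK(1) Jb) auto
  qed
  have i1: "set_integrable lborel {0..L} (?T1 n)" for n by (rule set_integrable_bounded[OF T1m T1b])
  have i2: "set_integrable lborel {0..L} (?T2 n)" for n by (rule set_integrable_bounded[OF T2m T2b])
  have iall: "set_integrable lborel {0..L} (%r. mu2 (K r) (a1 r) (a2 r) (%\<xi> \<eta>. J n j r (?p n \<xi> \<eta>)) - K r * K r * J n j r (e n))" for n
   by (rule set_integral_diff(1)[OF set_integrable_bounded[OF mJ bJ] kk])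
  have i3: "set_integrable lborel {0..L} (?T3 n)" for n
  proof -
   have "set_integrable lborel {0..L} (%r. (mu2 (K r) (a1 r) (a2 r) (%\<xi> \<eta>. J n j r (?p n \<xi> \<eta>)) - K r * K r * J n j r (e n)) - (?T1 n r + ?T2 n r))"
    by (intro set_integral_diff(1)[OF iall] set_integral_add(1) i1 i2)
   then show ?thesis
    by (subst (asm) set_integrable_cong[OF refl, where f'="?T3 n"]) (simp_all add: ex)
  qed
  have "(LINT r:{0..L}|lborel. mu2 (K r) (a1 r) (a2 r) (%\<xi> \<eta>. J n j r (?p n \<xi> \<eta>))) - (LINT s:{0..L}|lborel. K s * K s * J n j s (e n))
   = ((LINT r:{0..L}|lborel. ?T1 n r) + (LINT r:{0..L}|lborel. ?T2 n r)) + (LINT r:{0..L}|lborel. ?T3 n r)" for n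
  proof -
   have "(LINT r:{0..L}|lborel. mu2 (K r) (a1 r) (a2 r) (%\<xi> \<eta>. J n j r (?p n \<xi> \<eta>))) - (LINT s:{0..L}|lborel. K s * K s * J n j s (e n))
    = (LINT r:{0..L}|lborel. mu2 (K r) (a1 r) (a2 r) (%\<xi> \<eta>. J n j r (?p n \<xi> \<eta>)) - K r * K r * J n j r (e n))"
    by (rule set_integral_diff(2)[OF set_integrable_bounded[OF mJ bJ] kk, symmetric])
   also have "\<dots> = (LINT r:{0..L}|lborel. (?T1 n r + ?T2 n r) + ?T3 n r)"
    by (rule set_lebesgue_integral_cong) (simp, intro allI impI ex)
   also have "\<dots> = (LINT r:{0..L}|lborel. ?T1 n r + ?T2 n r) + (LINT r:{0..L}|lborel. ?T3 n r)"
    by (rule set_integral_add(2)[OF set_integral_add(1)[OF i1 i2] i3])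
   also have "(LINT r:{0..L}|lborel. ?T1 n r + ?T2 n r) = (LINT r:{0..L}|lborel. ?T1 n r) + (LINT r:{0..L}|lborel. ?T2 n r)"
    by (rule set_integral_add(2)[OF i1 i2])
   finally show ?thesis .
  qed
  then show ?thesis using tendsto_add[OF tendsto_add[OF L1 L2] L3] by (simp only: add_0_left)
 qed
 have lS: "(%n. \<Sum>j\<in>oth. \<sigma> n j * ((LINT r:{0..L}|lborel. mu2 (K r) (a1 r) (a2 r) (%\<xi> \<eta>. J n j r (?p n \<xi> \<eta>))) - (LINT s:{0..L}|lborel. K s * K s * J n j s (e n)))) \<longlonglongrightarrow> (\<Sum>j\<in>oth. lim (%n. \<sigma> n j) * 0)"
  by (intro tendsto_sum tendsto_mult limJ \<sigma>b[unfolded convergent_LIMSEQ_iff])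
 show ?thesis unfolding oth_def[symmetric] S3 using tendsto_diff[OF limD lS] by simp
qed

end

section \<open>The equation for \<open>A\<close> in the interaction picture\<close>

definition phase :: "real => real => R2 => R2 => real" where
 "phase q h ze \<xi> = - (q * (norm \<xi>)\<^sup>2) + h * (\<xi> \<bullet> ze)"

lemma phase_measurable [measurable]: "phase q h ze \<in> borel_measurable borel"
 unfolding phase_def by measurable

lemma cnj_measurable: "cnj \<in> borel_measurable borel"
 by (intro borel_measurable_continuous_onI continuous_intros)

lemma cnj_iexp: "cnj (iexp t) = iexp (- t)"
 by (simp add: exp_cnj)

text \<open>Conjugation reverses all phases, while the rates and the atom are real and stay as they
  are. The second jump of a ladder sees the negative phase in the limit, so its density is a
  conjugate.\<close>

lemma fwd_density_cnj:
 fixes a :: "real => 'b::euclidean_space => complex"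
 assumes d: "fwd_density (cor ka) F (cor K0) P L B a" and F: "!!k. cnj (F k) = F k"
 shows "fwd_density (cor ka) F (cor K0) (%\<xi>. - P \<xi>) L B (%s \<xi>. cnj (a s \<xi>))"
proof -
 let ?K = "fwd_atom (cor ka) F (cor K0)"
 have cF: "cnj (LINT k|lborel. F k) = (LINT k|lborel. F k)"
  unfolding Bochner_Integration.integral_cnj[symmetric] F ..
 have Kc: "cnj (?K s) = ?K s" for s
  unfolding fwd_atom_def by (simp add: exp_cnj cF)
 have ph: "s * (- P u - - P v) = - (s * (P u - P v))" for s u v by (simp add: algebra_simps)
 have rate: "fwd_rate (cor ka) F ?K (%\<xi>. - P \<xi>) (%s \<xi>. cnj (a s \<xi>)) s \<xi> = cnj (fwd_rate (cor ka) F ?K P a s \<xi>)" for s \<xi>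
  unfolding fwd_rate_def
  by (simp only: complex_cnj_add complex_cnj_mult Bochner_Integration.integral_cnj[symmetric] complex_cnj_diff F cnj_iexp ph Kc complex_cnj_complex_of_real)
 have si: "(LINT s:{0..z}|lborel. cnj (f s)) = cnj (LINT s:{0..z}|lborel. f s)" for f :: "real => complex" and z :: real
  by (simp only: set_lebesgue_integral_def Bochner_Integration.integral_cnj[symmetric] complex_cnj_scaleR)
 have m: "(%(s, \<xi>). a s \<xi>) \<in> borel_measurable (borel \<Otimes>\<^sub>M borel)"
  and i: "!!s. s \<in> {0..L} ==> integrable lborel (a s)" "!!s. s \<in> {0..L} ==> (LINT \<xi>|lborel. cmod (a s \<xi>)) \<le> B"
  and e: "!!z. z \<in> {0..L} ==> AE \<xi> in lborel. a z \<xi> = (LINT s:{0..z}|lborel. fwd_rate (cor ka) F ?K P a s \<xi>)"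
  using d unfolding fwd_density_def by auto
 show ?thesis unfolding fwd_density_def
 proof (intro conjI ballI)
  have "(%(s, \<xi>). cnj (a s \<xi>)) = (%z. cnj (case z of (s, \<xi>) => a s \<xi>))" by auto
  then show "(%(s, \<xi>). cnj (a s \<xi>)) \<in> borel_measurable (borel \<Otimes>\<^sub>M borel)"
   using measurable_compose[OF m cnj_measurable] by simp
  show "integrable lborel (%\<xi>. cnj (a s \<xi>))" if "s \<in> {0..L}" for s using i(1)[OF that] by simp
  show "(LINT \<xi>|lborel. cmod (cnj (a s \<xi>))) \<le> B" if "s \<in> {0..L}" for s using i(2)[OF that] by simp
  show "AE \<xi> in lborel. cnj (a z \<xi>) = (LINT s:{0..z}|lborel. fwd_rate (cor ka) F ?K (%\<xi>. - P \<xi>) (%s \<xi>. cnj (a s \<xi>)) s \<xi>)"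
   if "z \<in> {0..L}" for z
   unfolding rate si using e[OF that] by eventually_elim simp
 qed
qed

text \<open>A Gronwall bound: the maximum of \<open>exp (- l * s) * \<integral>\<bar>a s\<bar>\<close> over \<open>{0..L}\<close> is compared with itself.\<close>
lemma fwd_density_uniform_bound:
 fixes a :: "real => 'b::euclidean_space => complex" and F :: "'b => complex"
 assumes F: "integrable lborel F" and P[measurable]: "P \<in> borel_measurable borel" and L: "L \<ge> 0"
  and d: "fwd_density ka F K0 P L B a"
  and cont: "continuous_on {0..L} (%s. LINT \<xi>|lborel. cmod (a s \<xi>))"
  and DK: "!!s. s \<in> {0..L} ==> cmod (fwd_atom ka F K0 s) \<le> DK"
  and N: "N = cmod ka * (LINT k|lborel. cmod (F k))"
 shows "fwd_density ka F K0 P L (2 * N * DK * L * exp ((4 * N + 1) * L)) a"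
proof -
 have [measurable]: "F \<in> borel_measurable borel" using F by auto
 let ?K = "fwd_atom ka F K0"
 let ?R = "fwd_rate ka F ?K P a"
 have m[measurable]: "(%(s, \<xi>). a s \<xi>) \<in> borel_measurable (borel \<Otimes>\<^sub>M borel)"
  and i: "!!s. s \<in> {0..L} ==> integrable lborel (a s)" "!!s. s \<in> {0..L} ==> (LINT \<xi>|lborel. cmod (a s \<xi>)) \<le> B"
  and e: "!!z. z \<in> {0..L} ==> AE \<xi> in lborel. a z \<xi> = (LINT s:{0..z}|lborel. ?R s \<xi>)"
  using d unfolding fwd_density_def by auto
 have Rm[measurable]: "(%(s, \<xi>). ?R s \<xi>) \<in> borel_measurable (borel \<Otimes>\<^sub>M borel)"
  by (rule fwd_rate_measurable) measurable
 have N0: "N \<ge> 0" unfolding N by (intro mult_nonneg_nonneg integral_nonneg) auto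
 have DK0: "DK \<ge> 0" using order_trans[OF norm_ge_zero DK[of 0]] L by simp
 define al where "al s = (LINT \<xi>|lborel. cmod (a s \<xi>))" for s
 have al0: "al s \<ge> 0" for s unfolding al_def by simp
 \<comment> \<open>Gain and loss together have size \<open>2 * N\<close>. This exponent ensures
   \<open>2 * N / l \<le> 1 / 2\<close>, so that their contribution is at most half of the maximum
   and can be absorbed.\<close>
 define l where "l = 4 * N + 1"
 have l0: "l > 0" using N0 by (simp add: l_def)
 have "continuous_on {0..L} (%s. exp (- l * s) * al s)"
  unfolding al_def by (intro continuous_intros cont)
 from continuous_attains_sup[OF compact_Icc _ this] L obtain z0
  where z0: "z0 \<in> {0..L}" and mx: "!!z. z \<in> {0..L} ==> exp (- l * z) * al z \<le> exp (- l * z0) * al z0" by auto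
 define M where "M = exp (- l * z0) * al z0"
 have M0: "M \<ge> 0" unfolding M_def using al0 by simp
 have le: "al s \<le> M * exp (l * s)" if "s \<in> {0..L}" for s
 proof -
  have e: "exp (l * s) * (exp (- l * s) * al s) = al s" by (simp add: mult.assoc[symmetric] exp_add[symmetric])
  have "exp (l * s) * (exp (- l * s) * al s) \<le> exp (l * s) * M"
   unfolding M_def by (rule mult_left_mono[OF mx[OF that]]) simp
  then show ?thesis unfolding e by (simp only: mult.commute)
 qed
 define b where "b t = 2 * N * M * exp (l * t) + N * DK" for t
 have Rb: "integrable lborel (?R t)" "(LINT \<xi>|lborel. cmod (?R t \<xi>)) \<le> b t" if t: "t \<in> {0..L}" for t
 proof -
  have ms: "?R t \<in> borel_measurable borel" by (rule measurable_slice[OF Rm])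
  show "integrable lborel (?R t)" by (rule fwd_rate_integrable(1)[OF F P i(1)[OF t] order_refl ms])
  have "(LINT \<xi>|lborel. cmod (?R t \<xi>)) \<le> N * (2 * al t + cmod (?K t))"
   using fwd_rate_integrable(2)[OF F P i(1)[OF t] order_refl ms] unfolding N al_def .
  also have "\<dots> \<le> N * (2 * (M * exp (l * t)) + DK)"
   by (intro mult_left_mono add_mono le DK t N0 order_refl) simp
  finally show "(LINT \<xi>|lborel. cmod (?R t \<xi>)) \<le> b t" by (simp add: b_def algebra_simps)
 qed
 have zL: "t \<in> {0..L}" if "t \<in> {0..z0}" for t using that z0 by auto
 have bb: "b t \<le> b L" if "t \<in> {0..L}" for t unfolding b_def using that M0 N0 l0
  by (intro add_mono mult_left_mono order_refl) auto
 have I: "integrable (lborel \<Otimes>\<^sub>M lborel) (%(t, \<xi>). indicator {0..z0} t *\<^sub>R ?R t \<xi>)"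
 proof (rule integrable_slices[OF sigma_finite_lborel, where B="b L"])
  show "(%(t, \<xi>). ?R t \<xi>) \<in> borel_measurable (borel \<Otimes>\<^sub>M lborel)" by measurable
  show "integrable lborel (?R t)" if "t \<in> {0..z0}" for t by (rule Rb(1)[OF zL[OF that]])
  show "(LINT \<xi>|lborel. cmod (?R t \<xi>)) \<le> b L" if "t \<in> {0..z0}" for t
   by (rule order_trans[OF Rb(2)[OF zL[OF that]] bb[OF zL[OF that]]])
 qed
 have I': "integrable (lborel \<Otimes>\<^sub>M lborel) (%(t, \<xi>). cmod (indicator {0..z0} t *\<^sub>R ?R t \<xi>))"
  using integrable_norm[OF I] by (simp only: case_prod_beta')
 have "al z0 = (LINT \<xi>|lborel. cmod (LINT t|lborel. indicator {0..z0} t *\<^sub>R ?R t \<xi>))"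
  unfolding al_def
 proof (rule integral_cong_AE)
  show "(%\<xi>. cmod (a z0 \<xi>)) \<in> borel_measurable lborel" using i(1)[OF z0] by auto
  show "(%\<xi>. cmod (LINT t|lborel. indicator {0..z0} t *\<^sub>R ?R t \<xi>)) \<in> borel_measurable lborel" by measurable
  show "AE \<xi> in lborel. cmod (a z0 \<xi>) = cmod (LINT t|lborel. indicator {0..z0} t *\<^sub>R ?R t \<xi>)"
   using e[OF z0] unfolding set_lebesgue_integral_def by eventually_elim (rule arg_cong)
 qed
 also have "\<dots> \<le> (LINT \<xi>|lborel. LINT t|lborel. cmod (indicator {0..z0} t *\<^sub>R ?R t \<xi>))"
 proof (rule integral_mono)
  show "integrable lborel (%\<xi>. cmod (LINT t|lborel. indicator {0..z0} t *\<^sub>R ?R t \<xi>))"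
   using integrable_norm[OF lborel_pair.integrable_snd[OF I]] .
  show "integrable lborel (%\<xi>. LINT t|lborel. cmod (indicator {0..z0} t *\<^sub>R ?R t \<xi>))"
   using lborel_pair.integrable_snd[OF I'] .
 qed (rule Bochner_Integration.integral_norm_bound)
 also have "\<dots> = (LINT t|lborel. LINT \<xi>|lborel. cmod (indicator {0..z0} t *\<^sub>R ?R t \<xi>))"
  by (rule lborel_pair.Fubini_integral[OF I'])
 also have "\<dots> \<le> (LINT t|lborel. indicator {0..z0} t *\<^sub>R b t)"
 proof (rule integral_mono)
  show "integrable lborel (%t. LINT \<xi>|lborel. cmod (indicator {0..z0} t *\<^sub>R ?R t \<xi>))"
   using lborel_pair.integrable_fst[OF I'] .
  have "continuous_on {0..z0} b" unfolding b_def by (intro continuous_intros)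
  from borel_integrable_atLeastAtMost'[OF this] show "integrable lborel (%t. indicator {0..z0} t *\<^sub>R b t)"
   by (simp only: set_integrable_def)
  show "(LINT \<xi>|lborel. cmod (indicator {0..z0} t *\<^sub>R ?R t \<xi>)) \<le> indicator {0..z0} t *\<^sub>R b t" for t
  proof (cases "t \<in> {0..z0}")
   case True then show ?thesis using Rb(2)[OF zL[OF True]] by simp
  qed simp
 qed
 also have "\<dots> = (2 * N * M / l * exp (l * z0) + N * DK * z0) - (2 * N * M / l * exp (l * 0) + N * DK * 0)"
 proof (rule integral_FTC_atLeastAtMost)
  show "continuous_on {0..z0} b" unfolding b_def by (intro continuous_intros)
  show "((%t. 2 * N * M / l * exp (l * t) + N * DK * t) has_vector_derivative b x) (at x within {0..z0})" for x
   unfolding b_def has_real_derivative_iff_has_vector_derivative[symmetric]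
   by (rule derivative_eq_intros refl)+ (use l0 in \<open>simp add: field_simps\<close>)
 qed (use z0 in auto)
 also have "\<dots> \<le> 2 * N * M / l * exp (l * z0) + N * DK * L"
 proof -
  have "N * DK * z0 \<le> N * DK * L" using z0 N0 DK0 by (intro mult_left_mono) auto
  moreover have "0 \<le> 2 * N * M / l * exp (l * 0)" using N0 M0 l0 by simp
  ultimately show ?thesis by linarith
 qed
 also have "2 * N * M / l * exp (l * z0) \<le> M / 2 * exp (l * z0)"
 proof (rule mult_right_mono)
  have "2 * N * M * 2 \<le> M * l" unfolding l_def using M0 by (simp add: algebra_simps)
  then show "2 * N * M / l \<le> M / 2" using l0 by (simp add: field_simps)
 qed simp
 finally have "al z0 \<le> M / 2 * exp (l * z0) + N * DK * L" by simp
 then have "exp (- l * z0) * al z0 \<le> exp (- l * z0) * (M / 2 * exp (l * z0) + N * DK * L)"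
  by (rule mult_left_mono) simp
 also have "\<dots> = M / 2 + exp (- l * z0) * (N * DK * L)" by (simp add: exp_minus field_simps)
 also have "\<dots> \<le> M / 2 + 1 * (N * DK * L)"
 proof (intro add_left_mono mult_right_mono)
  show "exp (- l * z0) \<le> 1" using l0 z0 by simp
  show "0 \<le> N * DK * L" using N0 DK0 L by simp
 qed
 finally have M: "M \<le> 2 * N * DK * L" unfolding M_def[symmetric] by simp
 have "al z \<le> 2 * N * DK * L * exp (l * L)" if z: "z \<in> {0..L}" for z
 proof -
  have "al z \<le> M * exp (l * z)" by (rule le[OF z])
  also have "\<dots> \<le> (2 * N * DK * L) * exp (l * L)"
   using z l0 N0 DK0 L M by (intro mult_mono) auto
  finally show ?thesis .
 qed
 then show ?thesis unfolding fwd_density_def al_def l_def using m i(1) e by auto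
qed

lemma A_mild_measurable:
 assumes A: "A_mild_solution c C \<omega>0 A"
 shows "(%(z, k). indicator {0..} z *\<^sub>R A z (fst k) (snd k) \<Omega>) \<in> borel_measurable (borel \<Otimes>\<^sub>M borel)"
proof (rule set_borel_measurable_slices)
 have "(%(z, \<xi>, ze). A z \<xi> ze \<Omega>) = (%(z, k). A z (fst k) (snd k) \<Omega>)" by (auto simp: fun_eq_iff)
 moreover have "set_borel_measurable borel ({0..} \<times> UNIV) (%(z, \<xi>, ze). A z \<xi> ze \<Omega>)"
  using A unfolding A_mild_solution_def by blast
 ultimately show "set_borel_measurable borel ({0..} \<times> UNIV) (%(z, k). A z (fst k) (snd k) \<Omega>)" by (simp only:)
qed

text \<open>Multiplication by the exponential of minus the free term turns Duhamel's formula into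
  \<open>fwd_density\<close>: in the gain term the exponentials leave the difference across a jump
  of the quadratic part of \<open>phase\<close>, and the exponential in \<open>A_scattering\<close>
  is its linear part. The bound is the same for all \<open>ze\<close>, because the phase enters the
  Gronwall estimate with modulus one.\<close>

lemma A_mild_density:
 assumes c: "c > 0" and \<omega>0: "\<omega>0 > 0" and L: "L \<ge> 0" and F: "integrable lborel (fourier C)"
  and A: "A_mild_solution c C \<omega>0 A"
  and ka: "ka = cor (\<omega>0\<^sup>2 / (4 * (2 * pi)\<^sup>2 * c\<^sup>2))"
  and K: "!!s. fwd_atom ka (fourier C) K0 s = cor (K_fun c C \<omega>0 s)"
 obtains B where "!!ze. fwd_density ka (fourier C) K0 (phase (c * \<Omega> / \<omega>0\<^sup>2) (c / \<omega>0) ze) L B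
  (%s \<xi>. iexp (- (c * \<Omega> / \<omega>0\<^sup>2 * (norm \<xi>)\<^sup>2 * s)) * (indicator {0..} s *\<^sub>R A s \<xi> ze \<Omega>))"
proof -
 let ?F = "fourier C"
 let ?q = "c * \<Omega> / \<omega>0\<^sup>2"
 let ?a = "%ze s \<xi>. iexp (- (?q * (norm \<xi>)\<^sup>2 * s)) * (indicator {0..} s *\<^sub>R A s \<xi> ze \<Omega>)"
 obtain DK where DK: "!!s. s \<in> {0..L} ==> cmod (fwd_atom ka ?F K0 s) \<le> DK"
  using fwd_atom_bounded[of L ka ?F K0] by auto
 define N where "N = cmod ka * (LINT k|lborel. cmod (?F k))"
 have Gm: "(%(z, k). indicator {0..} z *\<^sub>R A z (fst k) (snd k) \<Omega>) \<in> borel_measurable (borel \<Otimes>\<^sub>M borel)"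
  by (rule A_mild_measurable[OF A])
 note AA = A[unfolded A_mild_solution_def, THEN spec, of \<Omega>, THEN conjunct2]
 have d: "fwd_density ka ?F K0 (phase ?q (c / \<omega>0) ze) L (2 * N * DK * L * exp ((4 * N + 1) * L)) (?a ze)" for ze
 proof -
  let ?P = "phase ?q (c / \<omega>0) ze"
  have L1: "L1_continuous (%z \<xi>. A z \<xi> ze \<Omega>)" using AA[THEN spec, of ze] by (rule conjunct1)
  have eq: "AE \<xi> in lborel. A z \<xi> ze \<Omega> = (LINT s:{0..z}|lborel.
      exp (\<i> * cor (?q * (norm \<xi>)\<^sup>2 * (z - s))) * A_scattering c C \<omega>0 ze (%z \<xi>. A z \<xi> ze \<Omega>) s \<xi>)"
   if "z \<ge> 0" for z
   using AA[THEN spec, of ze, THEN conjunct2, THEN spec, of z] that by (rule mp)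
  obtain B where B: "!!z. z \<in> {0..L} ==> integrable lborel (%\<xi>. A z \<xi> ze \<Omega>)"
   "!!z. z \<in> {0..L} ==> (LINT k|lborel. cmod (A z k ze \<Omega>)) \<le> B"
   "continuous_on {0..} (%z. LINT k|lborel. cmod (A z k ze \<Omega>))"
   by (rule L1_continuous_bounded[OF L1, where T=L], rule that)
  have g1: "(%z. (fst z, (snd z, ze))) \<in> measurable (borel \<Otimes>\<^sub>M borel) ((borel :: real measure) \<Otimes>\<^sub>M (borel :: (R2 \<times> R2) measure))"
   by measurable
  have am0: "(%z. indicator {0..} (fst z) *\<^sub>R A (fst z) (snd z) ze \<Omega>) \<in> borel_measurable (borel \<Otimes>\<^sub>M borel)"
   using measurable_compose[OF g1 Gm] by simp
  have am: "(%(s, \<xi>). ?a ze s \<xi>) \<in> borel_measurable (borel \<Otimes>\<^sub>M borel)"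
   unfolding case_prod_beta' by (intro borel_measurable_times am0) measurable
  have cm: "cmod (?a ze s \<xi>) = cmod (A s \<xi> ze \<Omega>)" if "s \<ge> 0" for s \<xi>
   using that by (simp add: norm_mult)
  have ai: "integrable lborel (?a ze s)" if s: "s \<in> {0..L}" for s
  proof -
   have "integrable lborel (%\<xi>. A s \<xi> ze \<Omega> * iexp (- (?q * (norm \<xi>)\<^sup>2 * s)))"
    by (rule mult_bounded_integrable(1)[OF B(1)[OF s], where B=1]) auto
   then show ?thesis using s by (simp add: mult.commute)
  qed
  have rate: "iexp (- (?q * (norm \<xi>)\<^sup>2 * z)) * (exp (\<i> * cor (?q * (norm \<xi>)\<^sup>2 * (z - s))) * A_scattering c C \<omega>0 ze (%z \<xi>. A z \<xi> ze \<Omega>) s \<xi>)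
   = fwd_rate ka ?F (fwd_atom ka ?F K0) ?P (?a ze) s \<xi>" if s: "s \<in> {0..z}" for s z \<xi>
  proof -
   let ?e = "iexp (- (?q * (norm \<xi>)\<^sup>2 * s))"
   let ?I = "LINT k|lborel. ?F k * (A s (\<xi> - k) ze \<Omega> * iexp (c * s / \<omega>0 * (k \<bullet> ze)) - A s \<xi> ze \<Omega>)"
   have s0: "s \<ge> 0" using s by auto
   have e1: "iexp (- (?q * (norm \<xi>)\<^sup>2 * z)) * iexp (?q * (norm \<xi>)\<^sup>2 * (z - s)) = ?e"
    unfolding iexp_mult by (simp only: right_diff_distrib add_diff_eq) simp
   have p0: "- (q * n2 * s) + s * ((- (q * n1) + h * xz) - (- (q * n2) + h * (xz - kz))) = - (q * n1 * s) + s * h * kz"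
    for q n1 n2 h xz kz :: real by (simp add: algebra_simps)
   have p: "- (?q * (norm (\<xi> - k))\<^sup>2 * s) + s * (?P \<xi> - ?P (\<xi> - k)) = - (?q * (norm \<xi>)\<^sup>2 * s) + c * s / \<omega>0 * (k \<bullet> ze)" for k
    unfolding phase_def inner_diff_left p0 by simp
   have ph: "iexp (- (?q * (norm (\<xi> - k))\<^sup>2 * s)) * iexp (s * (?P \<xi> - ?P (\<xi> - k))) = ?e * iexp (c * s / \<omega>0 * (k \<bullet> ze))" for k
    unfolding iexp_mult p ..
   have alg: "e2 * p = e1 * pp ==> f * (e2 * A2 * p - e1 * A1) = e1 * (f * (A2 * pp - A1))" for e2 p e1 pp f A2 A1 :: complex
    by algebra
   have "(LINT k|lborel. ?F k * (iexp (- (?q * (norm (\<xi> - k))\<^sup>2 * s)) * A s (\<xi> - k) ze \<Omega> * iexp (s * (?P \<xi> - ?P (\<xi> - k))) - ?e * A s \<xi> ze \<Omega>)) = ?e * ?I"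
    unfolding alg[OF ph] by (rule integral_mult_right_zero)
   moreover have "- (?q * (norm \<xi>)\<^sup>2 * s) + c * s / \<omega>0 * (\<xi> \<bullet> ze) = s * (?P \<xi> - ?P 0)"
    by (simp add: phase_def right_diff_distrib distrib_left mult_ac)
   then have "?e * iexp (c * s / \<omega>0 * (\<xi> \<bullet> ze)) = iexp (s * (?P \<xi> - ?P 0))"
    unfolding iexp_mult by simp
   ultimately have "fwd_rate ka ?F (fwd_atom ka ?F K0) ?P (?a ze) s \<xi> = ka * (?e * ?I) + ka * K_fun c C \<omega>0 s * ?F \<xi> * (?e * iexp (c * s / \<omega>0 * (\<xi> \<bullet> ze)))"
    unfolding fwd_rate_def K using s0 by simp
   also have "\<dots> = ?e * A_scattering c C \<omega>0 ze (%z \<xi>. A z \<xi> ze \<Omega>) s \<xi>"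
    unfolding A_scattering_def ka by (simp only: ring_distribs mult_ac)
   finally show ?thesis unfolding mult.assoc[symmetric] e1 by (simp only:)
  qed
  \<comment> \<open>This \<open>B\<close> comes from continuity in \<open>z\<close> and may depend
    on \<open>ze\<close>; it is the input that \<open>fwd_density_uniform_bound\<close> replaces by
    a uniform one.\<close>
  have "fwd_density ka ?F K0 ?P L B (?a ze)" unfolding fwd_density_def
  proof (intro conjI ballI)
   show "(%(s, \<xi>). ?a ze s \<xi>) \<in> borel_measurable (borel \<Otimes>\<^sub>M borel)" by (rule am)
   show "integrable lborel (?a ze s)" if "s \<in> {0..L}" for s by (rule ai[OF that])
   show "(LINT \<xi>|lborel. cmod (?a ze s \<xi>)) \<le> B" if "s \<in> {0..L}" for s
   proof -
    have "s \<ge> 0" using that by auto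
    then show ?thesis unfolding cm[OF \<open>s \<ge> 0\<close>] by (intro B(2) that)
   qed
   show "AE \<xi> in lborel. ?a ze z \<xi> = (LINT s:{0..z}|lborel. fwd_rate ka ?F (fwd_atom ka ?F K0) ?P (?a ze) s \<xi>)" if z: "z \<in> {0..L}" for z
   proof -
    have z0: "z \<ge> 0" using z by auto
    from eq[OF z0] show ?thesis
    proof eventually_elim
     case (elim \<xi>)
     have "(LINT s:{0..z}|lborel. fwd_rate ka ?F (fwd_atom ka ?F K0) ?P (?a ze) s \<xi>)
      = (LINT s:{0..z}|lborel. iexp (- (?q * (norm \<xi>)\<^sup>2 * z)) * (exp (\<i> * cor (?q * (norm \<xi>)\<^sup>2 * (z - s))) * A_scattering c C \<omega>0 ze (%z \<xi>. A z \<xi> ze \<Omega>) s \<xi>))"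
      by (rule set_lebesgue_integral_cong) (use rate in auto)
     also have "\<dots> = iexp (- (?q * (norm \<xi>)\<^sup>2 * z)) * A z \<xi> ze \<Omega>"
      unfolding set_integral_mult_right elim[symmetric] ..
     finally show ?case using z0 by simp
    qed
   qed
  qed
  then show ?thesis
  proof (rule fwd_density_uniform_bound[OF F phase_measurable L _ _ DK N_def])
   have "continuous_on {0..L} (%z. LINT k|lborel. cmod (A z k ze \<Omega>))"
    by (rule continuous_on_subset[OF B(3)]) auto
   then show "continuous_on {0..L} (%s. LINT \<xi>|lborel. cmod (?a ze s \<xi>))"
   proof (rule continuous_on_eq)
    fix s assume "s \<in> {0..L}"
    then have s0: "s \<ge> 0" by auto
    show "(LINT k|lborel. cmod (A s k ze \<Omega>)) = (LINT \<xi>|lborel. cmod (?a ze s \<xi>))" unfolding cm[OF s0] ..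
   qed
  qed
 qed
 then show thesis by (rule that)
qed

section \<open>Phases of jumps in the scintillation regime\<close>

lemma AE_inner_nonzero:
 fixes v :: R2
 assumes "v \<noteq> 0"
 shows "AE k in lborel. v \<bullet> k \<noteq> 0"
 by (rule AE_lborel_if_negligible[OF negligible_hyperplane[of v 0]]) (use assms in auto)

text \<open>Completing the square puts the exceptional set on the sphere centred at minus half of
  \<open>v\<close> with radius half the norm of \<open>v\<close>.\<close>

lemma AE_quadratic_nonzero:
 fixes v :: R2
 shows "AE k in lborel. v \<bullet> k + (norm k)\<^sup>2 \<noteq> 0"
proof (rule AE_lborel_if_negligible[OF negligible_sphere])
 show "{k. \<not> v \<bullet> k + (norm k)\<^sup>2 \<noteq> 0} \<subseteq> sphere (- (1/2) *\<^sub>R v) (norm v / 2)"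
 proof
  fix k assume "k \<in> {k. \<not> v \<bullet> k + (norm k)\<^sup>2 \<noteq> 0}"
  then have "v \<bullet> k + k \<bullet> k = 0" by (simp add: power2_norm_eq_inner)
  then have "(norm (- (1/2) *\<^sub>R v - k))\<^sup>2 = (norm v / 2)\<^sup>2"
   by (simp add: power2_norm_eq_inner power_divide inner_diff_left inner_diff_right inner_commute)
  then have "norm (- (1/2) *\<^sub>R v - k) = norm v / 2" by (rule power2_eq_imp_eq) auto
  then show "k \<in> sphere (- (1/2) *\<^sub>R v) (norm v / 2)" by (simp add: dist_norm)
 qed
qed measurable

lemma mu2_product: "mu2 K a b (%\<xi> \<eta>. f \<xi> * g \<eta>) = mu K a f * mu K b g"
proof -
 have "mu2 K a b (%\<xi> \<eta>. f \<xi> * g \<eta>) = mu K a (%\<xi>. f \<xi> * mu K b g)"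
  unfolding mu2_def mu_cmult ..
 also have "\<dots> = mu K a (%\<xi>. mu K b g * f \<xi>)" by (simp only: mult.commute)
 finally show ?thesis unfolding mu_cmult by (simp only: mult.commute)
qed

lemma free_symbol_0 [simp]: "free_symbol c w1 w2 v1 v2 0 = 0"
 by (simp add: free_symbol_def zero_prod_def)

lemma free_symbol_measurable [measurable]: "free_symbol c w1 w2 v1 v2 \<in> borel_measurable borel"
proof -
 have "continuous_on UNIV (free_symbol c w1 w2 v1 v2)"
  unfolding free_symbol_def case_prod_beta' divide_inverse by (intro continuous_intros)
 then show ?thesis by (rule borel_measurable_continuous_onI)
qed

lemma free_symbol_scale: "free_symbol c w1 w2 v1 v2 (t *\<^sub>R p) = t\<^sup>2 * free_symbol c w1 w2 v1 v2 p"
proof -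
 obtain a b d e where p: "p = (a, b, d, e)" by (cases p) auto
 show ?thesis unfolding p free_symbol_def by (simp add: power_mult_distrib algebra_simps add_divide_distrib)
qed

lemma free_symbol_tendsto:
 assumes "w1 \<longlonglongrightarrow> u" "w2 \<longlonglongrightarrow> u" "v1 \<longlonglongrightarrow> u" "v2 \<longlonglongrightarrow> u" and u: "u \<noteq> (0::real)" and p: "p \<longlonglongrightarrow> q"
 shows "(%n. free_symbol c (w1 n) (w2 n) (v1 n) (v2 n) (p n)) \<longlonglongrightarrow> free_symbol c u u u u q"
 unfolding free_symbol_def case_prod_beta' by (intro tendsto_intros assms)

text \<open>The frequencies are \<open>\<omega>0 \<plusminus> eps n * \<Omega>\<close>, and \<open>e n = eps n *\<^sub>R \<eta>\<close> is the rescaled dual variable.\<close>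
locale scintillation = dual_sequence "fourier C" L "%n p. free_symbol c (\<omega>0 + eps n * \<Omega>) (\<omega>0 - eps n * \<Omega>) (\<omega>0 - eps n * \<Omega>) (\<omega>0 + eps n * \<Omega>) p / eps n"
  "%n j. cor (coupling (\<omega>0 + eps n * \<Omega>) (\<omega>0 - eps n * \<Omega>) (\<omega>0 - eps n * \<Omega>) (\<omega>0 + eps n * \<Omega>) j / (4 * c\<^sup>2 * (2 * pi)\<^sup>2))"
  ps "cor (\<omega>0\<^sup>2 / (4 * (2 * pi)\<^sup>2 * c\<^sup>2))" "cor K00" D
 for C :: "R2 => real" and L c \<omega>0 \<Omega> :: real and eps :: "nat => real" and ps K00 D +
 fixes x y :: R2
 assumes c: "c > 0" and \<omega>0: "\<omega>0 > 0" and eps0: "!!n. eps n > 0" and eps: "eps \<longlonglongrightarrow> 0"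
  and wp: "!!n. \<omega>0 + eps n * \<Omega> > 0" and wm: "!!n. \<omega>0 - eps n * \<Omega> > 0"
  and real_F: "!!k. cnj (fourier C k) = fourier C k"
  and terminal: "!!n p. ps n L p = iexp (p \<bullet> (y /\<^sub>R eps n + x, y /\<^sub>R eps n, y /\<^sub>R eps n, y /\<^sub>R eps n + x))
   * iexp (- (L * (free_symbol c (\<omega>0 + eps n * \<Omega>) (\<omega>0 - eps n * \<Omega>) (\<omega>0 - eps n * \<Omega>) (\<omega>0 + eps n * \<Omega>) p / eps n)))"
begin

abbreviation "w n \<equiv> \<omega>0 + eps n * \<Omega>"
abbreviation "w' n \<equiv> \<omega>0 - eps n * \<Omega>"
abbreviation "\<Phi> n \<equiv> free_symbol c (w n) (w' n) (w' n) (w n)"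
abbreviation "S n p \<equiv> \<Phi> n p / eps n"
abbreviation "\<Phi>0 \<equiv> free_symbol c \<omega>0 \<omega>0 \<omega>0 \<omega>0"
abbreviation "ka \<equiv> cor (\<omega>0\<^sup>2 / (4 * (2 * pi)\<^sup>2 * c\<^sup>2))"
abbreviation "X n \<equiv> (y /\<^sub>R eps n + x, y /\<^sub>R eps n, y /\<^sub>R eps n, y /\<^sub>R eps n + x)"
abbreviation "sig n j \<equiv> cor (coupling (w n) (w' n) (w' n) (w n) j / (4 * c\<^sup>2 * (2 * pi)\<^sup>2))"

lemma w_lim: "w \<longlonglongrightarrow> \<omega>0" "w' \<longlonglongrightarrow> \<omega>0"
 using tendsto_add[OF tendsto_const tendsto_mult[OF eps tendsto_const], of \<omega>0 \<Omega>] tendsto_diff[OF tendsto_const tendsto_mult[OF eps tendsto_const], of \<omega>0 \<Omega>]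
 by simp_all

lemma w_ne: "w n \<noteq> 0" "w' n \<noteq> 0" "eps n \<noteq> 0"
 using wp[of n] wm[of n] eps0[of n] by auto

lemma e_lim: "(%n. eps n *\<^sub>R (\<eta> :: R2x4)) \<longlonglongrightarrow> 0"
 using tendsto_scaleR[OF eps tendsto_const[of \<eta>]] by simp

text \<open>The increment of the free symbol tends to a nonzero number, and \<open>S n\<close>
  divides it by \<open>eps n\<close>.\<close>

lemma oscillates:
 assumes "\<Phi>0 (p + jump j k) \<noteq> \<Phi>0 p" and e: "e \<longlonglongrightarrow> 0"
 shows "filterlim (%n. \<bar>S n (e n + p + jump j k) - S n (e n + p)\<bar>) at_top sequentially"
proof -
 have ep: "(%n. e n + p + jump j k) \<longlonglongrightarrow> p + jump j k" "(%n. e n + p) \<longlonglongrightarrow> p"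
  using tendsto_add[OF tendsto_add[OF e tendsto_const] tendsto_const, of p "jump j k"] tendsto_add[OF e tendsto_const, of p] by simp_all
 have "(%n. \<Phi> n (e n + p + jump j k) - \<Phi> n (e n + p)) \<longlonglongrightarrow> \<Phi>0 (p + jump j k) - \<Phi>0 p"
  using \<omega>0 by (intro tendsto_diff free_symbol_tendsto w_lim ep) auto
 then have l: "(%n. \<bar>\<Phi> n (e n + p + jump j k) - \<Phi> n (e n + p)\<bar>) \<longlonglongrightarrow> \<bar>\<Phi>0 (p + jump j k) - \<Phi>0 p\<bar>" by (rule tendsto_rabs)
 have i: "filterlim (%n. inverse (eps n)) at_top sequentially"
  using eps eps0 by (intro filterlim_inverse_at_top) auto
 have "filterlim (%n. \<bar>\<Phi> n (e n + p + jump j k) - \<Phi> n (e n + p)\<bar> * inverse (eps n)) at_top sequentially"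
  by (rule filterlim_tendsto_pos_mult_at_top[OF l _ i]) (use assms(1) in auto)
 moreover have "\<bar>\<Phi> n (e n + p + jump j k) - \<Phi> n (e n + p)\<bar> * inverse (eps n) = \<bar>S n (e n + p + jump j k) - S n (e n + p)\<bar>" for n
  unfolding diff_divide_distrib[symmetric] abs_divide using eps0[of n] by (simp add: divide_inverse)
 ultimately show ?thesis by simp
qed

lemma coupling_limit:
 "(%n. sig n 0) \<longlonglongrightarrow> ka" "(%n. sig n 1) \<longlonglongrightarrow> ka" "(%n. sig n 2) \<longlonglongrightarrow> ka" "(%n. sig n 3) \<longlonglongrightarrow> ka"
proof -
 have e: "\<omega>0\<^sup>2 / (4 * (2 * pi)\<^sup>2 * c\<^sup>2) = \<omega>0 * \<omega>0 / (4 * c\<^sup>2 * (2 * pi)\<^sup>2)" by (simp add: power2_eq_square mult_ac)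
 have c0: "4 * c\<^sup>2 * (2 * pi)\<^sup>2 \<noteq> 0" using c by simp
 show "(%n. sig n 0) \<longlonglongrightarrow> ka" "(%n. sig n 1) \<longlonglongrightarrow> ka" "(%n. sig n 2) \<longlonglongrightarrow> ka" "(%n. sig n 3) \<longlonglongrightarrow> ka"
  unfolding e coupling_def by (simp_all only: if_True if_False one_neq_zero zero_neq_one numeral_eq_iff num.distinct num.inject refl simp_thms
    numeral_eq_one_iff zero_neq_numeral one_eq_numeral_iff numeral_neq_zero) (intro tendsto_of_real tendsto_divide tendsto_mult w_lim tendsto_const c0)+
qed

text \<open>For a pair of arguments with frequencies \<open>p\<close> and \<open>q\<close> the
  quadratic terms of the free symbol cancel up to \<open>1 / p - 1 / q\<close>. In the first ladder
  the frequencies are \<open>w n\<close> and \<open>w' n\<close>, this difference is of order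
  \<open>eps n\<close>, and division by \<open>eps n\<close> leaves the quadratic part of
  \<open>phase\<close>. In the second ladder the two frequencies of a pair coincide, whence
  \<open>phase 0\<close>. The linear part comes from the cross terms with
  \<open>eps n *\<^sub>R \<eta>\<close>, in which only the sum of the two components of
  \<open>\<eta>\<close> belonging to the pair survives.\<close>

lemma phase_limits:
 assumes \<eta>: "\<eta> = (a1, a2, b1, b2)"
 shows "(%n. S n (eps n *\<^sub>R \<eta> + jump 0 \<xi> + jump 1 \<xi>' + jump 0 k) - S n (eps n *\<^sub>R \<eta> + jump 0 \<xi> + jump 1 \<xi>'))
   \<longlonglongrightarrow> phase (c * \<Omega> / \<omega>0\<^sup>2) (c / \<omega>0) (a1 + b1) (\<xi> + k) - phase (c * \<Omega> / \<omega>0\<^sup>2) (c / \<omega>0) (a1 + b1) \<xi>" (is ?A)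
  and "(%n. S n (eps n *\<^sub>R \<eta> + jump 0 \<xi> + jump 1 \<xi>' + jump 1 k) - S n (eps n *\<^sub>R \<eta> + jump 0 \<xi> + jump 1 \<xi>'))
   \<longlonglongrightarrow> - phase (c * \<Omega> / \<omega>0\<^sup>2) (c / \<omega>0) (- (a2 + b2)) (\<xi>' + k) - - phase (c * \<Omega> / \<omega>0\<^sup>2) (c / \<omega>0) (- (a2 + b2)) \<xi>'" (is ?B)
  and "(%n. S n (eps n *\<^sub>R \<eta> + jump 2 \<xi> + jump 3 \<xi>' + jump 2 k) - S n (eps n *\<^sub>R \<eta> + jump 2 \<xi> + jump 3 \<xi>'))
   \<longlonglongrightarrow> phase 0 (c / \<omega>0) (a1 + b2) (\<xi> + k) - phase 0 (c / \<omega>0) (a1 + b2) \<xi>" (is ?C)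
  and "(%n. S n (eps n *\<^sub>R \<eta> + jump 2 \<xi> + jump 3 \<xi>' + jump 3 k) - S n (eps n *\<^sub>R \<eta> + jump 2 \<xi> + jump 3 \<xi>'))
   \<longlonglongrightarrow> - phase 0 (c / \<omega>0) (- (a2 + b1)) (\<xi>' + k) - - phase 0 (c / \<omega>0) (- (a2 + b1)) \<xi>'" (is ?D)
proof -
 note inn = power2_norm_eq_inner inner_add_left inner_add_right inner_diff_left inner_diff_right inner_minus_left inner_minus_right
 have n2: "(norm (u + k))\<^sup>2 = (norm u)\<^sup>2 + 2 * (u \<bullet> k) + (norm k)\<^sup>2" "(norm (u - k))\<^sup>2 = (norm u)\<^sup>2 - 2 * (u \<bullet> k) + (norm k)\<^sup>2" for u k :: R2
  by (simp_all add: inn inner_commute)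
 \<comment> \<open>The four identities differ in which of the four terms of the free symbol are
   moved by the jump.\<close>
 have alg: "(c / 2 * ((U + 2 * u + N) / p + R - (V - 2 * v + N) / q - T) - c / 2 * (U / p + R - V / q - T)) / e
   = c / 2 * ((2 * u + N) / p + (2 * v - N) / q) / e"
  "(c / 2 * (R + (U + 2 * u + N) / p - T - (V - 2 * v + N) / q) - c / 2 * (R + U / p - T - V / q)) / e
   = c / 2 * ((2 * u + N) / p + (2 * v - N) / q) / e"
  "(c / 2 * ((U + 2 * u + N) / p + R - T - (V - 2 * v + N) / q) - c / 2 * (U / p + R - T - V / q)) / e
   = c / 2 * ((2 * u + N) / p + (2 * v - N) / q) / e"
  "(c / 2 * (R + (U + 2 * u + N) / p - (V - 2 * v + N) / q - T) - c / 2 * (R + U / p - V / q - T)) / e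
   = c / 2 * ((2 * u + N) / p + (2 * v - N) / q) / e" for U u N p R V v q T e :: real
  by (simp_all add: algebra_simps add_divide_distrib diff_divide_distrib)
 \<comment> \<open>\<open>p\<close>, \<open>q\<close> are the frequencies of the pair,
   \<open>s\<close> stands for the inner product of the ladder variable with \<open>k\<close>, and
   \<open>N\<close> for the squared norm of \<open>k\<close>. The quotient
   \<open>(q - p) / e\<close>, which has a finite value by \<open>d\<close>, is isolated.\<close>
 have red: "c / 2 * ((2 * (e * a + s) + N) / p + (2 * (e * b - s) - N) / q) / e = c * ((2 * s + N) * ((q - p) / e) / (2 * (p * q)) + a / p + b / q)"
  if "p \<noteq> 0" "q \<noteq> 0" "e \<noteq> 0" for e a b s N p q :: real
  using that by (simp add: field_simps)
 have lim: "(%n. c * (M * (t * \<Omega>) / (2 * (p n * q n)) + a / p n + b / q n)) \<longlonglongrightarrow> c * (M * (t * \<Omega>) / (2 * (\<omega>0 * \<omega>0)) + a / \<omega>0 + b / \<omega>0)"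
  if "p \<longlonglongrightarrow> \<omega>0" "q \<longlonglongrightarrow> \<omega>0" for p q :: "nat => real" and M t a b :: real
  using \<omega>0 by (intro tendsto_intros that) auto
 have d: "(w' n - w n) / eps n = - 2 * \<Omega>" "(w n - w' n) / eps n = 2 * \<Omega>" "(w n - w n) / eps n = 0 * \<Omega>" "(w' n - w' n) / eps n = 0 * \<Omega>" for n
  using w_ne(3)[of n] by (simp_all add: field_simps)
 note j = jump_def if_True if_False one_neq_zero zero_neq_one refl simp_thms zero_neq_numeral one_eq_numeral_iff numeral_eq_one_iff numeral_neq_zero numeral_eq_iff num.distinct num.inject
 have fin: "c * ((2 * s + N) * (t * \<Omega>) / (2 * (\<omega>0 * \<omega>0)) + a / \<omega>0 + b / \<omega>0) = - (- t / 2 * (c * \<Omega> / \<omega>0\<^sup>2) * (2 * s + N)) + c / \<omega>0 * (a + b)" for s N t a b :: real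
  by (simp add: power2_eq_square algebra_simps add_divide_distrib)
 have ph: "phase q h ze (u + k) - phase q h ze u = - (q * (2 * (u \<bullet> k) + (norm k)\<^sup>2)) + h * (ze \<bullet> k)" for q h ze u k
  unfolding phase_def n2 by (simp add: inner_add_left inner_commute algebra_simps)
 show ?A
 proof -
  have e: "S n (eps n *\<^sub>R \<eta> + jump 0 \<xi> + jump 1 \<xi>' + jump 0 k) - S n (eps n *\<^sub>R \<eta> + jump 0 \<xi> + jump 1 \<xi>')
   = c * ((2 * (\<xi> \<bullet> k) + (norm k)\<^sup>2) * (-2 * \<Omega>) / (2 * (w n * w' n)) + (a1 \<bullet> k) / w n + (b1 \<bullet> k) / w' n)" for n
  proof -
   have "S n (eps n *\<^sub>R \<eta> + jump 0 \<xi> + jump 1 \<xi>' + jump 0 k) - S n (eps n *\<^sub>R \<eta> + jump 0 \<xi> + jump 1 \<xi>')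
    = c / 2 * ((2 * ((eps n *\<^sub>R a1 + \<xi>) \<bullet> k) + (norm k)\<^sup>2) / w n + (2 * ((eps n *\<^sub>R b1 - \<xi>) \<bullet> k) - (norm k)\<^sup>2) / w' n) / eps n"
   proof -
    have f1: "\<Phi> n (eps n *\<^sub>R \<eta> + jump 0 \<xi> + jump 1 \<xi>' + jump 0 k) = c / 2 * ((norm ((eps n *\<^sub>R a1 + \<xi>) + k))\<^sup>2 / w n + (norm (eps n *\<^sub>R a2 + \<xi>'))\<^sup>2 / w' n - (norm ((eps n *\<^sub>R b1 - \<xi>) - k))\<^sup>2 / w' n - (norm (eps n *\<^sub>R b2 - \<xi>'))\<^sup>2 / w n)"
     by (simp add: \<eta> jump_def free_symbol_def)
    have f0: "\<Phi> n (eps n *\<^sub>R \<eta> + jump 0 \<xi> + jump 1 \<xi>') = c / 2 * ((norm (eps n *\<^sub>R a1 + \<xi>))\<^sup>2 / w n + (norm (eps n *\<^sub>R a2 + \<xi>'))\<^sup>2 / w' n - (norm (eps n *\<^sub>R b1 - \<xi>))\<^sup>2 / w' n - (norm (eps n *\<^sub>R b2 - \<xi>'))\<^sup>2 / w n)"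
     by (simp add: \<eta> jump_def free_symbol_def)
    show ?thesis unfolding f1 f0 diff_divide_distrib[symmetric] n2(1)[of "eps n *\<^sub>R a1 + \<xi>" k] n2(2)[of "eps n *\<^sub>R b1 - \<xi>" k] alg ..
   qed
   then show ?thesis unfolding inner_add_left inner_diff_left inner_scaleR_left red[OF w_ne] d .
  qed
  show ?thesis unfolding e ph using lim[OF w_lim, of "2 * (\<xi> \<bullet> k) + (norm k)\<^sup>2" "-2" "a1 \<bullet> k" "b1 \<bullet> k"] unfolding fin by (simp add: inner_add_left)
 qed
 show ?B
 proof -
  have e: "S n (eps n *\<^sub>R \<eta> + jump 0 \<xi> + jump 1 \<xi>' + jump 1 k) - S n (eps n *\<^sub>R \<eta> + jump 0 \<xi> + jump 1 \<xi>')
   = c * ((2 * (\<xi>' \<bullet> k) + (norm k)\<^sup>2) * (2 * \<Omega>) / (2 * (w' n * w n)) + (a2 \<bullet> k) / w' n + (b2 \<bullet> k) / w n)" for n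
  proof -
   have "S n (eps n *\<^sub>R \<eta> + jump 0 \<xi> + jump 1 \<xi>' + jump 1 k) - S n (eps n *\<^sub>R \<eta> + jump 0 \<xi> + jump 1 \<xi>')
    = c / 2 * ((2 * ((eps n *\<^sub>R a2 + \<xi>') \<bullet> k) + (norm k)\<^sup>2) / w' n + (2 * ((eps n *\<^sub>R b2 - \<xi>') \<bullet> k) - (norm k)\<^sup>2) / w n) / eps n"
   proof -
    have f1: "\<Phi> n (eps n *\<^sub>R \<eta> + jump 0 \<xi> + jump 1 \<xi>' + jump 1 k) = c / 2 * ((norm (eps n *\<^sub>R a1 + \<xi>))\<^sup>2 / w n + (norm ((eps n *\<^sub>R a2 + \<xi>') + k))\<^sup>2 / w' n - (norm (eps n *\<^sub>R b1 - \<xi>))\<^sup>2 / w' n - (norm ((eps n *\<^sub>R b2 - \<xi>') - k))\<^sup>2 / w n)"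
     by (simp add: \<eta> jump_def free_symbol_def)
    have f0: "\<Phi> n (eps n *\<^sub>R \<eta> + jump 0 \<xi> + jump 1 \<xi>') = c / 2 * ((norm (eps n *\<^sub>R a1 + \<xi>))\<^sup>2 / w n + (norm (eps n *\<^sub>R a2 + \<xi>'))\<^sup>2 / w' n - (norm (eps n *\<^sub>R b1 - \<xi>))\<^sup>2 / w' n - (norm (eps n *\<^sub>R b2 - \<xi>'))\<^sup>2 / w n)"
     by (simp add: \<eta> jump_def free_symbol_def)
    show ?thesis unfolding f1 f0 diff_divide_distrib[symmetric] n2(1)[of "eps n *\<^sub>R a2 + \<xi>'" k] n2(2)[of "eps n *\<^sub>R b2 - \<xi>'" k] alg ..
   qed
   then show ?thesis unfolding inner_add_left inner_diff_left inner_scaleR_left red[OF w_ne(2,1,3)] d .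
  qed
  show ?thesis unfolding e minus_diff_minus ph using lim[OF w_lim(2,1), of "2 * (\<xi>' \<bullet> k) + (norm k)\<^sup>2" "2" "a2 \<bullet> k" "b2 \<bullet> k"] unfolding fin by (simp add: inner_add_left inner_diff_left algebra_simps)
 qed
 show ?C
 proof -
  have e: "S n (eps n *\<^sub>R \<eta> + jump 2 \<xi> + jump 3 \<xi>' + jump 2 k) - S n (eps n *\<^sub>R \<eta> + jump 2 \<xi> + jump 3 \<xi>')
   = c * ((2 * (\<xi> \<bullet> k) + (norm k)\<^sup>2) * (0 * \<Omega>) / (2 * (w n * w n)) + (a1 \<bullet> k) / w n + (b2 \<bullet> k) / w n)" for n
  proof -
   have "S n (eps n *\<^sub>R \<eta> + jump 2 \<xi> + jump 3 \<xi>' + jump 2 k) - S n (eps n *\<^sub>R \<eta> + jump 2 \<xi> + jump 3 \<xi>')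
    = c / 2 * ((2 * ((eps n *\<^sub>R a1 + \<xi>) \<bullet> k) + (norm k)\<^sup>2) / w n + (2 * ((eps n *\<^sub>R b2 - \<xi>) \<bullet> k) - (norm k)\<^sup>2) / w n) / eps n"
   proof -
    have f1: "\<Phi> n (eps n *\<^sub>R \<eta> + jump 2 \<xi> + jump 3 \<xi>' + jump 2 k) = c / 2 * ((norm ((eps n *\<^sub>R a1 + \<xi>) + k))\<^sup>2 / w n + (norm (eps n *\<^sub>R a2 + \<xi>'))\<^sup>2 / w' n - (norm (eps n *\<^sub>R b1 - \<xi>'))\<^sup>2 / w' n - (norm ((eps n *\<^sub>R b2 - \<xi>) - k))\<^sup>2 / w n)"
     by (simp add: \<eta> jump_def free_symbol_def)
    have f0: "\<Phi> n (eps n *\<^sub>R \<eta> + jump 2 \<xi> + jump 3 \<xi>') = c / 2 * ((norm (eps n *\<^sub>R a1 + \<xi>))\<^sup>2 / w n + (norm (eps n *\<^sub>R a2 + \<xi>'))\<^sup>2 / w' n - (norm (eps n *\<^sub>R b1 - \<xi>'))\<^sup>2 / w' n - (norm (eps n *\<^sub>R b2 - \<xi>))\<^sup>2 / w n)"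
     by (simp add: \<eta> jump_def free_symbol_def)
    show ?thesis unfolding f1 f0 diff_divide_distrib[symmetric] n2(1)[of "eps n *\<^sub>R a1 + \<xi>" k] n2(2)[of "eps n *\<^sub>R b2 - \<xi>" k] alg ..
   qed
   then show ?thesis unfolding inner_add_left inner_diff_left inner_scaleR_left red[OF w_ne(1,1,3)] d .
  qed
  show ?thesis unfolding e ph using lim[OF w_lim(1,1), of "2 * (\<xi> \<bullet> k) + (norm k)\<^sup>2" "0" "a1 \<bullet> k" "b2 \<bullet> k"] unfolding fin by (simp add: inner_add_left)
 qed
 show ?D
 proof -
  have e: "S n (eps n *\<^sub>R \<eta> + jump 2 \<xi> + jump 3 \<xi>' + jump 3 k) - S n (eps n *\<^sub>R \<eta> + jump 2 \<xi> + jump 3 \<xi>')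
   = c * ((2 * (\<xi>' \<bullet> k) + (norm k)\<^sup>2) * (0 * \<Omega>) / (2 * (w' n * w' n)) + (a2 \<bullet> k) / w' n + (b1 \<bullet> k) / w' n)" for n
  proof -
   have "S n (eps n *\<^sub>R \<eta> + jump 2 \<xi> + jump 3 \<xi>' + jump 3 k) - S n (eps n *\<^sub>R \<eta> + jump 2 \<xi> + jump 3 \<xi>')
    = c / 2 * ((2 * ((eps n *\<^sub>R a2 + \<xi>') \<bullet> k) + (norm k)\<^sup>2) / w' n + (2 * ((eps n *\<^sub>R b1 - \<xi>') \<bullet> k) - (norm k)\<^sup>2) / w' n) / eps n"
   proof -
    have f1: "\<Phi> n (eps n *\<^sub>R \<eta> + jump 2 \<xi> + jump 3 \<xi>' + jump 3 k) = c / 2 * ((norm (eps n *\<^sub>R a1 + \<xi>))\<^sup>2 / w n + (norm ((eps n *\<^sub>R a2 + \<xi>') + k))\<^sup>2 / w' n - (norm ((eps n *\<^sub>R b1 - \<xi>') - k))\<^sup>2 / w' n - (norm (eps n *\<^sub>R b2 - \<xi>))\<^sup>2 / w n)"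
     by (simp add: \<eta> jump_def free_symbol_def)
    have f0: "\<Phi> n (eps n *\<^sub>R \<eta> + jump 2 \<xi> + jump 3 \<xi>') = c / 2 * ((norm (eps n *\<^sub>R a1 + \<xi>))\<^sup>2 / w n + (norm (eps n *\<^sub>R a2 + \<xi>'))\<^sup>2 / w' n - (norm (eps n *\<^sub>R b1 - \<xi>'))\<^sup>2 / w' n - (norm (eps n *\<^sub>R b2 - \<xi>))\<^sup>2 / w n)"
     by (simp add: \<eta> jump_def free_symbol_def)
    show ?thesis unfolding f1 f0 diff_divide_distrib[symmetric] n2(1)[of "eps n *\<^sub>R a2 + \<xi>'" k] n2(2)[of "eps n *\<^sub>R b1 - \<xi>'" k] alg ..
   qed
   then show ?thesis unfolding inner_add_left inner_diff_left inner_scaleR_left red[OF w_ne(2,2,3)] d .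
  qed
  show ?thesis unfolding e minus_diff_minus ph using lim[OF w_lim(2,2), of "2 * (\<xi>' \<bullet> k) + (norm k)\<^sup>2" "0" "a2 \<bullet> k" "b1 \<bullet> k"] unfolding fin by (simp add: inner_add_left inner_diff_left algebra_simps)
 qed
qed

lemma phase_0 [simp]: "phase q h ze 0 = 0" by (simp add: phase_def)

text \<open>A telescoping sum over the two jumps, each evaluated by \<open>phase_limits\<close>. The
  starting value tends to 0 since the symbol is quadratic: at \<open>eps n *\<^sub>R \<eta>\<close>
  one factor \<open>eps n\<close> is left after the division.\<close>

lemma terminal_symbol_limit:
 assumes \<eta>: "\<eta> = (a1, a2, b1, b2)"
 shows "(%n. S n (eps n *\<^sub>R \<eta> + jump 0 \<xi> + jump 1 \<xi>')) \<longlonglongrightarrow> phase (c * \<Omega> / \<omega>0\<^sup>2) (c / \<omega>0) (a1 + b1) \<xi> - phase (c * \<Omega> / \<omega>0\<^sup>2) (c / \<omega>0) (- (a2 + b2)) \<xi>'"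
  and "(%n. S n (eps n *\<^sub>R \<eta> + jump 2 \<xi> + jump 3 \<xi>')) \<longlonglongrightarrow> phase 0 (c / \<omega>0) (a1 + b2) \<xi> - phase 0 (c / \<omega>0) (- (a2 + b1)) \<xi>'"
  and "(%n. S n (eps n *\<^sub>R \<eta>)) \<longlonglongrightarrow> 0"
proof -
 have "(%n. eps n * \<Phi> n \<eta>) \<longlonglongrightarrow> 0 * \<Phi>0 \<eta>"
  using \<omega>0 by (intro tendsto_mult eps free_symbol_tendsto w_lim tendsto_const) auto
 moreover have "eps n * \<Phi> n \<eta> = S n (eps n *\<^sub>R \<eta>)" for n
  unfolding free_symbol_scale using w_ne(3)[of n] by (simp add: power2_eq_square)
 ultimately show 0: "(%n. S n (eps n *\<^sub>R \<eta>)) \<longlonglongrightarrow> 0" by simp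
 note a = tendsto_add[OF tendsto_add[OF 0 phase_limits(1)[OF \<eta>, of 0 0 \<xi>, unfolded jump_0 add_0_right]] phase_limits(2)[OF \<eta>, of \<xi> 0 \<xi>', unfolded jump_0 add_0_right]]
 show "(%n. S n (eps n *\<^sub>R \<eta> + jump 0 \<xi> + jump 1 \<xi>')) \<longlonglongrightarrow> phase (c * \<Omega> / \<omega>0\<^sup>2) (c / \<omega>0) (a1 + b1) \<xi> - phase (c * \<Omega> / \<omega>0\<^sup>2) (c / \<omega>0) (- (a2 + b2)) \<xi>'"
  using a unfolding add_0_left phase_0 diff_0_right by (simp only: add_diff_cancel_left' add_diff_cancel diff_add_cancel add.commute[of _ "_ - _"] minus_zero diff_0_right diff_minus_eq_add add_0_right)
   (simp only: add.commute diff_conv_add_uminus)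
 note b = tendsto_add[OF tendsto_add[OF 0 phase_limits(3)[OF \<eta>, of 0 0 \<xi>, unfolded jump_0 add_0_right]] phase_limits(4)[OF \<eta>, of \<xi> 0 \<xi>', unfolded jump_0 add_0_right]]
 show "(%n. S n (eps n *\<^sub>R \<eta> + jump 2 \<xi> + jump 3 \<xi>')) \<longlonglongrightarrow> phase 0 (c / \<omega>0) (a1 + b2) \<xi> - phase 0 (c / \<omega>0) (- (a2 + b1)) \<xi>'"
  using b unfolding add_0_left phase_0 diff_0_right by (simp only: add_diff_cancel_left' add_diff_cancel diff_add_cancel add.commute[of _ "_ - _"] minus_zero diff_0_right diff_minus_eq_add add_0_right)
   (simp only: add.commute diff_conv_add_uminus)
qed

text \<open>The two components of a jump are opposite, so the large offset
  \<open>y /\<^sub>R eps n\<close> drops out of its contribution. Positions 1 and 4 of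
  \<open>X n\<close> carry the extra \<open>x\<close>: the first ladder pairs each of them with a
  position that does not, the second pairs them with each other. Hence \<open>x\<close> is coupled
  to the ladder variables in the first ladder only.\<close>

lemma terminal_phase:
 assumes \<eta>: "\<eta> = (a1, a2, b1, b2)"
 shows "(eps n *\<^sub>R \<eta> + jump 0 \<xi> + jump 1 \<xi>') \<bullet> X n = y \<bullet> (a1 + a2 + b1 + b2) + x \<bullet> (\<xi> - \<xi>') + eps n * (x \<bullet> (a1 + b2))"
  and "(eps n *\<^sub>R \<eta> + jump 2 \<xi> + jump 3 \<xi>') \<bullet> X n = y \<bullet> (a1 + a2 + b1 + b2) + x \<bullet> 0 + eps n * (x \<bullet> (a1 + b2))"
proof -
 have e: "eps n * (inverse (eps n) * t) = t" "inverse (eps n) * (eps n * t) = t" for t using w_ne(3)[of n] by simp_all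
 show "(eps n *\<^sub>R \<eta> + jump 0 \<xi> + jump 1 \<xi>') \<bullet> X n = y \<bullet> (a1 + a2 + b1 + b2) + x \<bullet> (\<xi> - \<xi>') + eps n * (x \<bullet> (a1 + b2))"
  "(eps n *\<^sub>R \<eta> + jump 2 \<xi> + jump 3 \<xi>') \<bullet> X n = y \<bullet> (a1 + a2 + b1 + b2) + x \<bullet> 0 + eps n * (x \<bullet> (a1 + b2))"
  unfolding \<eta> by (simp_all add: jump_def inner_add_left inner_add_right inner_diff_left inner_diff_right inner_commute e distrib_left)
qed

text \<open>The limiting symbol is a difference of two phases, one for each ladder variable, so the
  terminal value factorises. The second factor is written as a conjugate to match
  \<open>fwd_density_cnj\<close>.\<close>

lemma terminal_limit:
 assumes \<eta>: "\<eta> = (a1, a2, b1, b2)"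
 shows "(%n. ps n L (eps n *\<^sub>R \<eta> + jump 0 \<xi> + jump 1 \<xi>')) \<longlonglongrightarrow> iexp (y \<bullet> (a1 + a2 + b1 + b2))
   * (iexp (x \<bullet> \<xi> - L * phase (c * \<Omega> / \<omega>0\<^sup>2) (c / \<omega>0) (a1 + b1) \<xi>) * cnj (iexp (x \<bullet> \<xi>' - L * phase (c * \<Omega> / \<omega>0\<^sup>2) (c / \<omega>0) (- (a2 + b2)) \<xi>')))"
  and "(%n. ps n L (eps n *\<^sub>R \<eta> + jump 2 \<xi> + jump 3 \<xi>')) \<longlonglongrightarrow> iexp (y \<bullet> (a1 + a2 + b1 + b2))
   * (iexp (0 \<bullet> \<xi> - L * phase 0 (c / \<omega>0) (a1 + b2) \<xi>) * cnj (iexp (0 \<bullet> \<xi>' - L * phase 0 (c / \<omega>0) (- (a2 + b1)) \<xi>')))"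
  and "(%n. ps n L (eps n *\<^sub>R \<eta>)) \<longlonglongrightarrow> iexp (y \<bullet> (a1 + a2 + b1 + b2))"
proof -
 have l: "(%n. iexp (Y + Z + eps n * t) * iexp (- (L * s n))) \<longlonglongrightarrow> iexp Y * (iexp (z - L * p) * cnj (iexp (z' - L * p')))"
  if "s \<longlonglongrightarrow> p - p'" "Z = z - z'" for s :: "nat => real" and Y Z t z z' p p'
 proof -
  have "(%n. iexp (Y + Z + eps n * t + - (L * s n))) \<longlonglongrightarrow> iexp (Y + Z + 0 * t + - (L * (p - p')))"
   by (intro tendsto_intros eps that(1))
  moreover have "Y + Z + 0 * t + - (L * (p - p')) = Y + ((z - L * p) + - (z' - L * p'))" using that(2) by (simp add: algebra_simps)
  ultimately show ?thesis unfolding cnj_iexp iexp_mult by (simp only:)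
 qed
 show "(%n. ps n L (eps n *\<^sub>R \<eta> + jump 0 \<xi> + jump 1 \<xi>')) \<longlonglongrightarrow> iexp (y \<bullet> (a1 + a2 + b1 + b2))
   * (iexp (x \<bullet> \<xi> - L * phase (c * \<Omega> / \<omega>0\<^sup>2) (c / \<omega>0) (a1 + b1) \<xi>) * cnj (iexp (x \<bullet> \<xi>' - L * phase (c * \<Omega> / \<omega>0\<^sup>2) (c / \<omega>0) (- (a2 + b2)) \<xi>')))"
  unfolding terminal terminal_phase[OF \<eta>] by (rule l[OF terminal_symbol_limit(1)[OF \<eta>]]) (rule inner_diff_right)
 show "(%n. ps n L (eps n *\<^sub>R \<eta> + jump 2 \<xi> + jump 3 \<xi>')) \<longlonglongrightarrow> iexp (y \<bullet> (a1 + a2 + b1 + b2))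
   * (iexp (0 \<bullet> \<xi> - L * phase 0 (c / \<omega>0) (a1 + b2) \<xi>) * cnj (iexp (0 \<bullet> \<xi>' - L * phase 0 (c / \<omega>0) (- (a2 + b1)) \<xi>')))"
  unfolding terminal terminal_phase[OF \<eta>] by (rule l[OF terminal_symbol_limit(2)[OF \<eta>]]) simp
 have tp: "(eps n *\<^sub>R \<eta>) \<bullet> X n = y \<bullet> (a1 + a2 + b1 + b2) + 0 + eps n * (x \<bullet> (a1 + b2))" for n
  using terminal_phase(1)[OF \<eta>, of n 0 0] by simp
 have z: "0 = (0::real) - 0" by simp
 have "(%n. ps n L (eps n *\<^sub>R \<eta>)) \<longlonglongrightarrow> iexp (y \<bullet> (a1 + a2 + b1 + b2)) * (iexp (0 - L * 0) * cnj (iexp (0 - L * 0)))"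
  unfolding terminal tp by (rule l[OF _ z]) (use terminal_symbol_limit(3)[of \<eta>] \<eta> in simp)
 then show "(%n. ps n L (eps n *\<^sub>R \<eta>)) \<longlonglongrightarrow> iexp (y \<bullet> (a1 + a2 + b1 + b2))" by simp
qed

text \<open>Under a jump of the other ladder the limiting symbol changes by a multiple of
  \<open>(\<xi> - \<xi>') \<bullet> k\<close>, which for \<open>\<xi> \<noteq> \<xi>'\<close>
  vanishes on a line of \<open>k\<close>. Under jumps 4 and 5 a squared norm of \<open>k\<close> is
  added, and the zero set is a circle or a point; this is why those two oscillate even at the
  atom.\<close>

lemma oscillation_ladder:
 assumes e: "e \<longlonglongrightarrow> 0"
 shows "\<xi> \<noteq> \<xi>' ==> j \<in> {2, 3, 4, 5} ==> AE k in lborel. filterlim (%n. \<bar>S n (e n + jump 0 \<xi> + jump 1 \<xi>' + jump j k) - S n (e n + jump 0 \<xi> + jump 1 \<xi>')\<bar>) at_top sequentially"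
  and "\<xi> \<noteq> \<xi>' ==> j \<in> {0, 1, 4, 5} ==> AE k in lborel. filterlim (%n. \<bar>S n (e n + jump 2 \<xi> + jump 3 \<xi>' + jump j k) - S n (e n + jump 2 \<xi> + jump 3 \<xi>')\<bar>) at_top sequentially"
  and "j \<in> {4, 5} ==> AE k in lborel. filterlim (%n. \<bar>S n (e n + jump j k) - S n (e n)\<bar>) at_top sequentially"
proof -
 note inn = power2_norm_eq_inner inner_add_left inner_add_right inner_diff_left inner_diff_right inner_minus_left inner_minus_right
 have c0: "c / \<omega>0 \<noteq> 0" using c \<omega>0 by simp
 have A: "\<Phi>0 (jump 0 \<xi> + jump 1 \<xi>' + jump 2 k) - \<Phi>0 (jump 0 \<xi> + jump 1 \<xi>') = c / \<omega>0 * ((\<xi> - \<xi>') \<bullet> k)"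
  "\<Phi>0 (jump 0 \<xi> + jump 1 \<xi>' + jump 3 k) - \<Phi>0 (jump 0 \<xi> + jump 1 \<xi>') = - (c / \<omega>0 * ((\<xi> - \<xi>') \<bullet> k))"
  "\<Phi>0 (jump 0 \<xi> + jump 1 \<xi>' + jump 4 k) - \<Phi>0 (jump 0 \<xi> + jump 1 \<xi>') = c / \<omega>0 * ((\<xi> - \<xi>') \<bullet> k + (norm k)\<^sup>2)"
  "\<Phi>0 (jump 0 \<xi> + jump 1 \<xi>' + jump 5 k) - \<Phi>0 (jump 0 \<xi> + jump 1 \<xi>') = - (c / \<omega>0 * ((\<xi>' - \<xi>) \<bullet> k + (norm k)\<^sup>2))" for \<xi> \<xi>' k
  using \<omega>0 by (simp_all add: jump_def free_symbol_def inn inner_commute field_simps)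
 have B: "\<Phi>0 (jump 2 \<xi> + jump 3 \<xi>' + jump 0 k) - \<Phi>0 (jump 2 \<xi> + jump 3 \<xi>') = c / \<omega>0 * ((\<xi> - \<xi>') \<bullet> k)"
  "\<Phi>0 (jump 2 \<xi> + jump 3 \<xi>' + jump 1 k) - \<Phi>0 (jump 2 \<xi> + jump 3 \<xi>') = - (c / \<omega>0 * ((\<xi> - \<xi>') \<bullet> k))"
  "\<Phi>0 (jump 2 \<xi> + jump 3 \<xi>' + jump 4 k) - \<Phi>0 (jump 2 \<xi> + jump 3 \<xi>') = c / \<omega>0 * ((\<xi> - \<xi>') \<bullet> k + (norm k)\<^sup>2)"
  "\<Phi>0 (jump 2 \<xi> + jump 3 \<xi>' + jump 5 k) - \<Phi>0 (jump 2 \<xi> + jump 3 \<xi>') = - (c / \<omega>0 * ((\<xi> - \<xi>') \<bullet> k + (norm k)\<^sup>2))" for \<xi> \<xi>' k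
  using \<omega>0 by (simp_all add: jump_def free_symbol_def inn inner_commute field_simps)
 have osc: "filterlim (%n. \<bar>S n (e n + p + jump j k) - S n (e n + p)\<bar>) at_top sequentially"
  if "\<Phi>0 (p + jump j k) - \<Phi>0 p \<noteq> 0" for p k j by (rule oscillates[OF _ e]) (use that in simp)
 show "AE k in lborel. filterlim (%n. \<bar>S n (e n + jump 0 \<xi> + jump 1 \<xi>' + jump j k) - S n (e n + jump 0 \<xi> + jump 1 \<xi>')\<bar>) at_top sequentially"
  if "\<xi> \<noteq> \<xi>'" and j: "j \<in> {2, 3, 4, 5}"
 proof -
  have "\<xi> - \<xi>' \<noteq> 0" using that by simp
  from AE_inner_nonzero[OF this] AE_quadratic_nonzero[of "\<xi> - \<xi>'"] AE_quadratic_nonzero[of "\<xi>' - \<xi>"] show ?thesis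
  proof eventually_elim
   case (elim k)
   have "\<Phi>0 (jump 0 \<xi> + jump 1 \<xi>' + jump j k) - \<Phi>0 (jump 0 \<xi> + jump 1 \<xi>') \<noteq> 0"
    using j A[of \<xi> \<xi>' k] elim c0 by (elim insertE emptyE) (simp_all only: neg_equal_0_iff_equal mult_eq_0_iff simp_thms)
   from osc[OF this] show ?case by (simp only: add.assoc)
  qed
 qed
 show "AE k in lborel. filterlim (%n. \<bar>S n (e n + jump 2 \<xi> + jump 3 \<xi>' + jump j k) - S n (e n + jump 2 \<xi> + jump 3 \<xi>')\<bar>) at_top sequentially"
  if "\<xi> \<noteq> \<xi>'" and j: "j \<in> {0, 1, 4, 5}"
 proof -
  have "\<xi> - \<xi>' \<noteq> 0" using that by simp
  from AE_inner_nonzero[OF this] AE_quadratic_nonzero[of "\<xi> - \<xi>'"] show ?thesis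
  proof eventually_elim
   case (elim k)
   have "\<Phi>0 (jump 2 \<xi> + jump 3 \<xi>' + jump j k) - \<Phi>0 (jump 2 \<xi> + jump 3 \<xi>') \<noteq> 0"
    using j B[of \<xi> \<xi>' k] elim c0 by (elim insertE emptyE) (simp_all only: neg_equal_0_iff_equal mult_eq_0_iff simp_thms)
   from osc[OF this] show ?case by (simp only: add.assoc)
  qed
 qed
 show "AE k in lborel. filterlim (%n. \<bar>S n (e n + jump j k) - S n (e n)\<bar>) at_top sequentially" if j: "j \<in> {4, 5}"
  using AE_quadratic_nonzero[of 0]
 proof eventually_elim
  case (elim k)
  have "\<Phi>0 (0 + jump j k) - \<Phi>0 0 \<noteq> 0"
   using j A(3,4)[of 0 0 k] elim c0 by (elim insertE emptyE) (simp_all only: jump_0 add_0_right diff_0_right neg_equal_0_iff_equal mult_eq_0_iff simp_thms)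
  from osc[OF this] show ?case by (simp only: add_0_right)
 qed
qed

lemma K_real: "cnj (K L) = K L"
proof -
 have "cnj (LINT k|lborel. fourier C k) = (LINT k|lborel. fourier C k)"
  unfolding Bochner_Integration.integral_cnj[symmetric] real_F ..
 then show ?thesis unfolding fwd_atom_def by (simp add: exp_cnj)
qed

text \<open>The two ladder limits minus \<open>atoms_limit\<close>: the integrals of the jumps 0 to
  3 from the atom, for which no oscillation is available, cancel, and those of 4 and 5 tend to 0.
  The wanted value occurs once in each of the three relations, hence once in the combination, and is
  thereby determined.\<close>

lemma pointwise_limit:
 assumes \<eta>: "\<eta> = (a1, a2, b1, b2)"
  and dA: "!!ze. fwd_density ka (fourier C) (cor K00) (phase (c * \<Omega> / \<omega>0\<^sup>2) (c / \<omega>0) ze) L BA (aA ze)"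
  and dB: "!!ze. fwd_density ka (fourier C) (cor K00) (phase 0 (c / \<omega>0) ze) L BB (aB ze)"
  and HA: "!!ze. HA ze = (LINT \<xi>|lborel. aA ze L \<xi> * iexp (x \<bullet> \<xi> - L * phase (c * \<Omega> / \<omega>0\<^sup>2) (c / \<omega>0) ze \<xi>))"
  and HB: "!!ze. HB ze = (LINT \<xi>|lborel. aB ze L \<xi> * iexp (0 \<bullet> \<xi> - L * phase 0 (c / \<omega>0) ze \<xi>))"
 shows "(%n. cor K00 * cor K00 * ps n 0 (eps n *\<^sub>R \<eta>)) \<longlonglongrightarrow> iexp (y \<bullet> (a1 + a2 + b1 + b2))
  * ((K L + HA (a1 + b1)) * cnj (K L + HA (- (a2 + b2))) + (K L + HB (a1 + b2)) * cnj (K L + HB (- (a2 + b1))) - K L * K L)"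
proof -
 let ?e = "%n. eps n *\<^sub>R \<eta>" and ?Y = "y \<bullet> (a1 + a2 + b1 + b2)"
 let ?I = "%n j. LINT s:{0..L}|lborel. K s * K s * (sig n j * J n j s (?e n))"
 let ?Q = "%n. cor K00 * cor K00 * ps n 0 (?e n)"
 let ?PA = "phase (c * \<Omega> / \<omega>0\<^sup>2) (c / \<omega>0)" and ?PB = "phase 0 (c / \<omega>0)"
 have LL: "L \<in> {0..L}" using L by simp
 have psL[measurable]: "ps n L \<in> borel_measurable borel" for n by (rule measurable_slice[OF psm])
 \<comment> \<open>The terminal value factorises in the limit, so the product measure yields a
   product of two one-variable pairings, the second the conjugate of one of the same kind.\<close>
 have lim: "(%n. mu2 (K L) (a ze L) (%\<xi>. cnj (a ze' L \<xi>)) (%\<xi> \<xi>'. ps n L (?e n + jump i1 \<xi> + jump i2 \<xi>')))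
   \<longlonglongrightarrow> iexp ?Y * ((K L + H ze) * cnj (K L + H ze'))"
  if d: "!!ze. fwd_density ka (fourier C) (cor K00) (phase q (c / \<omega>0) ze) L BA (a ze)"
   and l: "!!\<xi> \<xi>'. (%n. ps n L (?e n + jump i1 \<xi> + jump i2 \<xi>')) \<longlonglongrightarrow> iexp ?Y
    * (iexp (v \<bullet> \<xi> - L * phase q (c / \<omega>0) ze \<xi>) * cnj (iexp (v \<bullet> \<xi>' - L * phase q (c / \<omega>0) ze' \<xi>')))"
   and H: "!!ze. H ze = (LINT \<xi>|lborel. a ze L \<xi> * iexp (v \<bullet> \<xi> - L * phase q (c / \<omega>0) ze \<xi>))"
  for a q BA i1 i2 v ze ze' H
 proof -
  have ai: "integrable lborel (a ze L)" for ze using d[of ze] LL unfolding fwd_density_def by blast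
  let ?u = "%ze \<xi>. iexp (v \<bullet> \<xi> - L * phase q (c / \<omega>0) ze \<xi>)"
  have "(%n. mu2 (K L) (a ze L) (%\<xi>. cnj (a ze' L \<xi>)) (%\<xi> \<xi>'. ps n L (?e n + jump i1 \<xi> + jump i2 \<xi>')))
   \<longlonglongrightarrow> mu2 (K L) (a ze L) (%\<xi>. cnj (a ze' L \<xi>)) (%\<xi> \<xi>'. iexp ?Y * (?u ze \<xi> * cnj (?u ze' \<xi>')))"
  proof (rule mu2_tendsto[OF ai _ _ _ psb[OF LL] l])
   show "integrable lborel (%\<xi>. cnj (a ze' L \<xi>))" using ai by simp
   show "(%(\<xi>, \<xi>'). ps n L (?e n + jump i1 \<xi> + jump i2 \<xi>')) \<in> borel_measurable (borel \<Otimes>\<^sub>M borel)" for n by measurable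
   show "(%(\<xi>, \<xi>'). iexp ?Y * (?u ze \<xi> * cnj (?u ze' \<xi>'))) \<in> borel_measurable (borel \<Otimes>\<^sub>M borel)"
    unfolding cnj_iexp by measurable
  qed
  also have "mu2 (K L) (a ze L) (%\<xi>. cnj (a ze' L \<xi>)) (%\<xi> \<xi>'. iexp ?Y * (?u ze \<xi> * cnj (?u ze' \<xi>')))
   = iexp ?Y * (mu (K L) (a ze L) (?u ze) * mu (K L) (%\<xi>. cnj (a ze' L \<xi>)) (%\<xi>. cnj (?u ze' \<xi>)))"
   unfolding mu2_cmult mu2_product ..
  also have "mu (K L) (a ze L) (?u ze) = K L + H ze" unfolding mu_def H by simp
  also have "mu (K L) (%\<xi>. cnj (a ze' L \<xi>)) (%\<xi>. cnj (?u ze' \<xi>)) = cnj (K L + H ze')"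
  proof -
   have "mu (K L) (%\<xi>. cnj (a ze' L \<xi>)) (%\<xi>. cnj (?u ze' \<xi>)) = K L + (LINT \<xi>|lborel. cnj (a ze' L \<xi> * ?u ze' \<xi>))"
    unfolding mu_def by simp
   then show ?thesis unfolding Bochner_Integration.integral_cnj H complex_cnj_add K_real .
  qed
  finally show ?thesis .
 qed
 have cA: "fwd_density ka (fourier C) (cor K00) (%\<xi>. - ?PA ze \<xi>) L BA (%s \<xi>. cnj (aA ze s \<xi>))"
  and cB: "fwd_density ka (fourier C) (cor K00) (%\<xi>. - ?PB ze \<xi>) L BB (%s \<xi>. cnj (aB ze s \<xi>))" for ze
  by (intro fwd_density_cnj dA dB real_F)+
 have sets: "{..<6} - {0, 1} = {2, 3, 4, 5::nat}" "{..<6} - {2, 3} = {0, 1, 4, 5::nat}" "{..<6} = {0, 1, 2, 3, 4, 5::nat}" by auto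
 note lA = ladder_limit[where e="?e" and ?i1.0="0" and ?i2.0="1", OF _ _ _ phase_measurable borel_measurable_uminus[OF phase_measurable] dA cA coupling_limit(1,2) phase_limits(1)[OF \<eta>] phase_limits(2)[OF \<eta>], unfolded sets(1)]
 have LA: "(%n. mu2 (K L) (aA (a1 + b1) L) (%\<xi>. cnj (aA (- (a2 + b2)) L \<xi>)) (%\<xi> \<xi>'. ps n L (?e n + jump 0 \<xi> + jump 1 \<xi>'))
   - ?Q n + (\<Sum>j\<in>{2, 3, 4, 5}. ?I n j)) \<longlonglongrightarrow> 0"
 proof (rule lA)
  show "AE k in lborel. filterlim (%n. \<bar>S n (?e n + jump 0 \<xi> + jump 1 \<xi>' + jump j k) - S n (?e n + jump 0 \<xi> + jump 1 \<xi>')\<bar>) at_top sequentially"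
   if "j < 6" "j \<noteq> 0" "j \<noteq> 1" "\<xi> \<noteq> \<xi>'" for j \<xi> \<xi>'
  proof (rule oscillation_ladder(1)[OF e_lim that(4)])
   have "j \<in> {..<6} - {0, 1}" using that by simp
   then show "j \<in> {2, 3, 4, 5}" unfolding sets(1) .
  qed
 qed simp_all
 note lB = ladder_limit[where e="?e" and ?i1.0="2" and ?i2.0="3", OF _ _ _ phase_measurable borel_measurable_uminus[OF phase_measurable] dB cB coupling_limit(3,4) phase_limits(3)[OF \<eta>] phase_limits(4)[OF \<eta>], unfolded sets(2)]
 have LB: "(%n. mu2 (K L) (aB (a1 + b2) L) (%\<xi>. cnj (aB (- (a2 + b1)) L \<xi>)) (%\<xi> \<xi>'. ps n L (?e n + jump 2 \<xi> + jump 3 \<xi>'))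
   - ?Q n + (\<Sum>j\<in>{0, 1, 4, 5}. ?I n j)) \<longlonglongrightarrow> 0"
 proof (rule lB)
  show "AE k in lborel. filterlim (%n. \<bar>S n (?e n + jump 2 \<xi> + jump 3 \<xi>' + jump j k) - S n (?e n + jump 2 \<xi> + jump 3 \<xi>')\<bar>) at_top sequentially"
   if "j < 6" "j \<noteq> 2" "j \<noteq> 3" "\<xi> \<noteq> \<xi>'" for j \<xi> \<xi>'
  proof (rule oscillation_ladder(2)[OF e_lim that(4)])
   have "j \<in> {..<6} - {2, 3}" using that by simp
   then show "j \<in> {0, 1, 4, 5}" unfolding sets(2) .
  qed
 qed simp_all
 note L0 = atoms_limit[where e="?e", unfolded sets(3)]
 have I: "(%n. ?I n j) \<longlonglongrightarrow> 0" if j: "j \<in> {4, 5}" for j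
 proof -
  obtain l where l: "(%n. sig n j) \<longlonglongrightarrow> l" using \<sigma>b[of j] unfolding convergent_def by auto
  have Ie: "?I n j = sig n j * (LINT s:{0..L}|lborel. K s * K s * J n j s (?e n))" for n
   unfolding set_integral_mult_right[symmetric] by (simp only: mult.left_commute)
  show ?thesis unfolding Ie
   using tendsto_mult[OF l atom_oscillation[where e="?e" and j=j, OF oscillation_ladder(3)[OF e_lim j]]] unfolding mult_zero_right .
 qed
 have T: "(%n. mu2 (K L) (aA (a1 + b1) L) (%\<xi>. cnj (aA (- (a2 + b2)) L \<xi>)) (%\<xi> \<xi>'. ps n L (?e n + jump 0 \<xi> + jump 1 \<xi>'))
  + mu2 (K L) (aB (a1 + b2) L) (%\<xi>. cnj (aB (- (a2 + b1)) L \<xi>)) (%\<xi> \<xi>'. ps n L (?e n + jump 2 \<xi> + jump 3 \<xi>'))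
  - K L * K L * ps n L (?e n) + (?I n 4 + ?I n 5) - ?Q n) \<longlonglongrightarrow> 0"
 proof -
  have sm: "(\<Sum>j\<in>{2, 3, 4, 5}. g j) = g 2 + g 3 + g 4 + g 5" "(\<Sum>j\<in>{0, 1, 4, 5}. g j) = g 0 + g 1 + g 4 + g 5"
   "(\<Sum>j\<in>{0, 1, 2, 3, 4, 5}. g j) = g 0 + g 1 + g 2 + g 3 + g 4 + g 5" for g :: "nat => complex" by simp_all
  \<comment> \<open>\<open>g0\<close> to \<open>g3\<close> cancel, and \<open>Q\<close> remains with
    coefficient \<open>1 + 1 - 1\<close>.\<close>
  have alg: "(A - Q + (g2 + g3 + g4 + g5)) + (B - Q + (g0 + g1 + g4 + g5)) - (E - Q + (g0 + g1 + g2 + g3 + g4 + g5))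
   = A + B - E + (g4 + g5) - Q" for A B E Q g0 g1 g2 g3 g4 g5 :: complex by (simp add: algebra_simps)
  show ?thesis
   using tendsto_diff[OF tendsto_add[OF LA LB] L0] unfolding sm alg add_0_left diff_zero .
 qed
 have U: "(%n. mu2 (K L) (aA (a1 + b1) L) (%\<xi>. cnj (aA (- (a2 + b2)) L \<xi>)) (%\<xi> \<xi>'. ps n L (?e n + jump 0 \<xi> + jump 1 \<xi>'))
  + mu2 (K L) (aB (a1 + b2) L) (%\<xi>. cnj (aB (- (a2 + b1)) L \<xi>)) (%\<xi> \<xi>'. ps n L (?e n + jump 2 \<xi> + jump 3 \<xi>'))
  - K L * K L * ps n L (?e n) + (?I n 4 + ?I n 5)) \<longlonglongrightarrow> iexp ?Y * ((K L + HA (a1 + b1)) * cnj (K L + HA (- (a2 + b2))))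
  + iexp ?Y * ((K L + HB (a1 + b2)) * cnj (K L + HB (- (a2 + b1)))) - K L * K L * iexp ?Y + (0 + 0)"
  by (intro tendsto_add tendsto_diff tendsto_mult tendsto_const I lim[OF dA terminal_limit(1)[OF \<eta>] HA]
    lim[OF dB terminal_limit(2)[OF \<eta>] HB] terminal_limit(3)[OF \<eta>]) auto
 have d: "u - (u - q) = q" for u q :: complex by simp
 have le: "z * p + z * q - k * z + (0 + 0) = z * (p + q - k)" for z p q k :: complex by (simp add: algebra_simps)
 show ?thesis using tendsto_diff[OF U T] unfolding d le diff_zero .
qed

end

section \<open>Orthogonal changes of variables and iterated integrals\<close>

lemma nn_integral_lborel_affine:
 fixes f :: "'a::euclidean_space => ennreal"
 assumes [measurable]: "f \<in> borel_measurable borel" and c: "c \<noteq> 0"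
 shows "(\<integral>\<^sup>+x. f x \<partial>lborel) = ennreal (\<bar>c\<bar> ^ DIM('a)) * (\<integral>\<^sup>+x. f (t + c *\<^sub>R x) \<partial>lborel)"
 by (subst lborel_affine[OF c, of t]) (simp add: nn_integral_density nn_integral_distr nn_integral_cmult)

lemma nn_integral_lborel_pair:
 fixes f :: "'a::euclidean_space \<times> 'b::euclidean_space => ennreal"
 assumes "f \<in> borel_measurable borel"
 shows "(\<integral>\<^sup>+p. f p \<partial>lborel) = (\<integral>\<^sup>+a. \<integral>\<^sup>+b. f (a, b) \<partial>lborel \<partial>lborel)"
 by (subst lborel_prod[symmetric], subst lborel.nn_integral_fst) (use assms in \<open>auto simp: borel_prod[symmetric]\<close>)

lemma borel_measurable_slice:
 fixes f :: "'a::euclidean_space \<times> 'b::euclidean_space => 'c::topological_space"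
 assumes "f \<in> borel_measurable borel"
 shows "(%b. f (a, b)) \<in> borel_measurable borel"
 by (rule measurable_compose[OF _ assms]) simp

lemma measurable_fst_borel [measurable]: "fst \<in> (borel :: ('a::euclidean_space \<times> 'b::euclidean_space) measure) \<rightarrow>\<^sub>M borel"
 and measurable_snd_borel [measurable]: "snd \<in> (borel :: ('a::euclidean_space \<times> 'b::euclidean_space) measure) \<rightarrow>\<^sub>M borel"
 by (intro borel_measurable_continuous_onI continuous_intros)+

text \<open>The orthogonal map is treated one variable at a time: an affine substitution on either
  side, with Tonelli in between, reduces both integrals to the same double integral with the same
  Jacobian \<open>?c\<close>.\<close>

lemma nn_pair_rotate:
 fixes h :: "'a::euclidean_space \<times> 'a => ennreal"
 assumes h[measurable]: "h \<in> borel_measurable borel" and s: "s = 1 / sqrt 2"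
 shows "(\<integral>\<^sup>+a. \<integral>\<^sup>+b. h (s *\<^sub>R (a + b), s *\<^sub>R (a - b)) \<partial>lborel \<partial>lborel) = (\<integral>\<^sup>+a. \<integral>\<^sup>+b. h (a, b) \<partial>lborel \<partial>lborel)"
proof -
 let ?c = "ennreal (\<bar>sqrt 2\<bar> ^ DIM('a))"
 have s2: "s * sqrt 2 = 1" "s * 2 = sqrt 2" unfolding s by (simp_all add: real_div_sqrt)
 have e1: "s *\<^sub>R (a + (- a + sqrt 2 *\<^sub>R t)) = t" for a t :: 'a using s2 by simp
 have e2: "s *\<^sub>R (a - (- a + sqrt 2 *\<^sub>R t)) = - t + sqrt 2 *\<^sub>R a" for a t :: 'a
 proof -
  have "s *\<^sub>R (a - (- a + sqrt 2 *\<^sub>R t)) = s *\<^sub>R (2 *\<^sub>R a - sqrt 2 *\<^sub>R t)" by (simp add: scaleR_2)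
  also have "\<dots> = (s * 2) *\<^sub>R a - (s * sqrt 2) *\<^sub>R t" by (simp only: scaleR_right_diff_distrib scaleR_scaleR)
  finally show ?thesis unfolding s2 by simp
 qed
 have 1: "(\<integral>\<^sup>+b. h (s *\<^sub>R (a + b), s *\<^sub>R (a - b)) \<partial>lborel) = ?c * (\<integral>\<^sup>+t. h (t, - t + sqrt 2 *\<^sub>R a) \<partial>lborel)" for a
 proof -
  have m: "(%b. h (s *\<^sub>R (a + b), s *\<^sub>R (a - b))) \<in> borel_measurable borel" by measurable
  show ?thesis using nn_integral_lborel_affine[OF m, of "sqrt 2" "- a"] unfolding e1 e2 by simp
 qed
 have 2: "(\<integral>\<^sup>+b. h (t, b) \<partial>lborel) = ?c * (\<integral>\<^sup>+a. h (t, - t + sqrt 2 *\<^sub>R a) \<partial>lborel)" for t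
  by (rule nn_integral_lborel_affine[OF borel_measurable_slice[OF h]]) simp
 have "(\<integral>\<^sup>+a. \<integral>\<^sup>+b. h (s *\<^sub>R (a + b), s *\<^sub>R (a - b)) \<partial>lborel \<partial>lborel)
  = (\<integral>\<^sup>+a. \<integral>\<^sup>+t. ?c * h (t, - t + sqrt 2 *\<^sub>R a) \<partial>lborel \<partial>lborel)"
  unfolding 1 by (simp add: nn_integral_cmult)
 also have "\<dots> = (\<integral>\<^sup>+t. \<integral>\<^sup>+a. ?c * h (t, - t + sqrt 2 *\<^sub>R a) \<partial>lborel \<partial>lborel)"
  by (rule lborel_pair.Fubini'[symmetric, where f="%a t. ?c * h (t, - t + sqrt 2 *\<^sub>R a)", symmetric, THEN sym]) measurable
 also have "\<dots> = (\<integral>\<^sup>+a. \<integral>\<^sup>+b. h (a, b) \<partial>lborel \<partial>lborel)"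
  unfolding 2 by (simp add: nn_integral_cmult)
 finally show ?thesis .
qed

lemma lborel_distr_eqI:
 assumes [measurable]: "T \<in> borel_measurable borel"
  and "!!f :: 'a::euclidean_space => ennreal. f \<in> borel_measurable borel ==> (\<integral>\<^sup>+p. f (T p) \<partial>lborel) = (\<integral>\<^sup>+p. f p \<partial>lborel)"
 shows "distr lborel borel (T :: 'b::euclidean_space => 'a) = lborel"
proof (rule measure_eqI)
 fix A assume "A \<in> sets (distr lborel borel T)"
 then have A[measurable]: "A \<in> sets borel" by simp
 have "emeasure (distr lborel borel T) A = (\<integral>\<^sup>+p. indicator A p \<partial>distr lborel borel T)" by simp
 also have "\<dots> = (\<integral>\<^sup>+p. indicator A (T p) \<partial>lborel)" by (rule nn_integral_distr) measurable
 also have "\<dots> = (\<integral>\<^sup>+p. indicator A p \<partial>lborel)" by (rule assms(2)) measurable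
 finally show "emeasure (distr lborel borel T) A = emeasure lborel A" by simp
qed simp

lemma lborel_integral_distr:
 fixes f :: "'a::euclidean_space => complex"
 assumes T: "distr lborel borel T = lborel" and [measurable]: "T \<in> borel_measurable borel" "f \<in> borel_measurable borel"
 shows "integrable lborel (%x. f (T x)) \<longleftrightarrow> integrable lborel f" "(LINT x|lborel. f (T x)) = (LINT x|lborel. f x)"
 using integrable_distr_eq[of T lborel borel f] integral_distr[of T lborel borel f] by (simp_all add: T)

definition rotation :: "R2 \<times> R2 => R2 \<times> R2" where
 "rotation z = ((1 / sqrt 2) *\<^sub>R (fst z + snd z), (1 / sqrt 2) *\<^sub>R (fst z - snd z))"

text \<open>A symmetric orthogonal matrix with entries of modulus 1/2, its own inverse. It
  diagonalises the exponent of \<open>M2_initial\<close>, and the sums of dual variables occurring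
  in the phases become a sum or difference of two coordinates, one of which is always the first; see
  \<open>hadamard_sums\<close>.\<close>

definition hadamard :: "R2x4 => R2x4" where
 "hadamard = (%(a1, a2, b1, b2). ((1/2) *\<^sub>R (a1 + a2 + b1 + b2), (1/2) *\<^sub>R (a1 - a2 + b1 - b2),
   (1/2) *\<^sub>R (a1 + a2 - b1 - b2), (1/2) *\<^sub>R (a1 - a2 - b1 + b2)))"

lemma rotation_measurable [measurable]: "rotation \<in> borel_measurable borel"
 unfolding rotation_def by (intro borel_measurable_continuous_onI continuous_intros)

lemma hadamard_measurable [measurable]: "hadamard \<in> borel_measurable borel"
 unfolding hadamard_def case_prod_beta' by (intro borel_measurable_continuous_onI continuous_intros)

lemma hadamard_involution: "hadamard (hadamard p) = p"
proof -
 obtain a b c d where p: "p = (a, b, c, d)" by (cases p) auto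
 show ?thesis unfolding p hadamard_def by (simp add: vec_eq_iff field_simps)
qed

lemma hadamard_inner: "hadamard p \<bullet> q = p \<bullet> hadamard q"
proof -
 obtain a b c d where p: "p = (a, b, c, d)" by (cases p) auto
 obtain a' b' c' d' where q: "q = (a', b', c', d')" by (cases q) auto
 show ?thesis unfolding p q hadamard_def by (simp add: inner_add_left inner_add_right inner_diff_left inner_diff_right field_simps)
qed

lemma distr_rotation: "distr lborel borel rotation = lborel"
proof (rule lborel_distr_eqI)
 fix f :: "R2 \<times> R2 => ennreal" assume [measurable]: "f \<in> borel_measurable borel"
 have "(\<integral>\<^sup>+p. f (rotation p) \<partial>lborel) = (\<integral>\<^sup>+a. \<integral>\<^sup>+b. f (rotation (a, b)) \<partial>lborel \<partial>lborel)"
  by (rule nn_integral_lborel_pair) measurable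
 also have "\<dots> = (\<integral>\<^sup>+a. \<integral>\<^sup>+b. f (a, b) \<partial>lborel \<partial>lborel)"
  unfolding rotation_def fst_conv snd_conv by (rule nn_pair_rotate) auto
 finally show "(\<integral>\<^sup>+p. f (rotation p) \<partial>lborel) = (\<integral>\<^sup>+p. f p \<partial>lborel)"
  by (subst (2) nn_integral_lborel_pair) auto
qed measurable

lemma nn_integral_lborel4:
 fixes f :: "R2x4 => ennreal"
 assumes f: "f \<in> borel_measurable borel"
 shows "(\<integral>\<^sup>+p. f p \<partial>lborel) = (\<integral>\<^sup>+a. \<integral>\<^sup>+b. \<integral>\<^sup>+c. \<integral>\<^sup>+d. f (a, b, c, d) \<partial>lborel \<partial>lborel \<partial>lborel \<partial>lborel)"
proof -
 have 2: "(\<integral>\<^sup>+w. f (a, b, w) \<partial>lborel) = (\<integral>\<^sup>+c. \<integral>\<^sup>+d. f (a, b, c, d) \<partial>lborel \<partial>lborel)" for a b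
  by (rule nn_integral_lborel_pair) (intro borel_measurable_slice f)
 have 1: "(\<integral>\<^sup>+w. f (a, w) \<partial>lborel) = (\<integral>\<^sup>+b. \<integral>\<^sup>+w. f (a, b, w) \<partial>lborel \<partial>lborel)" for a
  by (rule nn_integral_lborel_pair) (intro borel_measurable_slice f)
 show ?thesis unfolding nn_integral_lborel_pair[OF f] 1 2 ..
qed

text \<open>The matrix is the tensor square of that of \<open>rotation\<close>. It splits into plane
  maps on the pairs \<open>a1\<close>, \<open>b1\<close> and \<open>a2\<close>, \<open>b2\<close>,
  followed by plane maps on the pair of sums and the pair of differences; each is an instance of
  \<open>nn_pair_rotate\<close> once the integrals are reordered.\<close>

lemma distr_hadamard: "distr lborel borel hadamard = lborel"
proof (rule lborel_distr_eqI)
 fix f :: "R2x4 => ennreal" assume f[measurable]: "f \<in> borel_measurable borel"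
 define s where "s = 1 / sqrt 2"
 have ss: "s * s = 1 / 2" unfolding s_def by simp
 define k where "k = (%(x1, x2, y1, y2). f (s *\<^sub>R (x1 + x2), s *\<^sub>R (x1 - x2), s *\<^sub>R (y1 + y2), s *\<^sub>R (y1 - y2)))"
 have "(%(x1, x2, y1, y2). (s *\<^sub>R (x1 + x2), s *\<^sub>R (x1 - x2), s *\<^sub>R (y1 + y2), s *\<^sub>R (y1 - y2))) \<in> (borel :: R2x4 measure) \<rightarrow>\<^sub>M (borel :: R2x4 measure)"
  unfolding case_prod_beta' by (intro borel_measurable_continuous_onI continuous_intros)
 from measurable_compose[OF this f] have km[measurable]: "k \<in> borel_measurable borel"
  unfolding k_def by (simp add: case_prod_beta')
 have sp: "s *\<^sub>R (s *\<^sub>R u + s *\<^sub>R v) = (1/2) *\<^sub>R (u + v)" "s *\<^sub>R (s *\<^sub>R u - s *\<^sub>R v) = (1/2) *\<^sub>R (u - v)" for u v :: R2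
  by (simp_all only: scaleR_right_distrib scaleR_right_diff_distrib scaleR_scaleR ss)
 have fk: "f (hadamard (a1, a2, b1, b2)) = k (s *\<^sub>R (a1 + b1), s *\<^sub>R (a2 + b2), s *\<^sub>R (a1 - b1), s *\<^sub>R (a2 - b2))" for a1 a2 b1 b2
  unfolding k_def hadamard_def prod.case sp by (simp add: algebra_simps)
 have "(\<integral>\<^sup>+p. f (hadamard p) \<partial>lborel) = (\<integral>\<^sup>+a1. \<integral>\<^sup>+a2. \<integral>\<^sup>+b1. \<integral>\<^sup>+b2. f (hadamard (a1, a2, b1, b2)) \<partial>lborel \<partial>lborel \<partial>lborel \<partial>lborel)"
  by (rule nn_integral_lborel4) measurable
 also have "\<dots> = (\<integral>\<^sup>+a1. \<integral>\<^sup>+b1. \<integral>\<^sup>+a2. \<integral>\<^sup>+b2. k (s *\<^sub>R (a1 + b1), s *\<^sub>R (a2 + b2), s *\<^sub>R (a1 - b1), s *\<^sub>R (a2 - b2)) \<partial>lborel \<partial>lborel \<partial>lborel \<partial>lborel)"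
  unfolding fk by (rule nn_integral_cong, rule lborel_pair.Fubini') measurable
 also have "\<dots> = (\<integral>\<^sup>+a1. \<integral>\<^sup>+b1. \<integral>\<^sup>+a2. \<integral>\<^sup>+b2. k (s *\<^sub>R (a1 + b1), a2, s *\<^sub>R (a1 - b1), b2) \<partial>lborel \<partial>lborel \<partial>lborel \<partial>lborel)"
 proof (rule nn_integral_cong, rule nn_integral_cong)
  fix a1 b1
  show "(\<integral>\<^sup>+a2. \<integral>\<^sup>+b2. k (s *\<^sub>R (a1 + b1), s *\<^sub>R (a2 + b2), s *\<^sub>R (a1 - b1), s *\<^sub>R (a2 - b2)) \<partial>lborel \<partial>lborel)
   = (\<integral>\<^sup>+a2. \<integral>\<^sup>+b2. k (s *\<^sub>R (a1 + b1), a2, s *\<^sub>R (a1 - b1), b2) \<partial>lborel \<partial>lborel)"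
  proof -
   have "(%z. k (s *\<^sub>R (a1 + b1), fst z, s *\<^sub>R (a1 - b1), snd z)) \<in> borel_measurable (borel :: (R2 \<times> R2) measure)"
    unfolding borel_prod[symmetric] by measurable
   from nn_pair_rotate[OF this s_def] show ?thesis by (simp only: fst_conv snd_conv)
  qed
 qed
 also have "\<dots> = (\<integral>\<^sup>+x. \<integral>\<^sup>+y. \<integral>\<^sup>+a2. \<integral>\<^sup>+b2. k (x, a2, y, b2) \<partial>lborel \<partial>lborel \<partial>lborel \<partial>lborel)"
 proof -
  have "(%z. \<integral>\<^sup>+a2. \<integral>\<^sup>+b2. k (fst z, a2, snd z, b2) \<partial>lborel \<partial>lborel) \<in> borel_measurable (borel :: (R2 \<times> R2) measure)"
   unfolding borel_prod[symmetric] by measurable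
  from nn_pair_rotate[OF this s_def] show ?thesis by simp
 qed
 also have "\<dots> = (\<integral>\<^sup>+x. \<integral>\<^sup>+a2. \<integral>\<^sup>+y. \<integral>\<^sup>+b2. k (x, a2, y, b2) \<partial>lborel \<partial>lborel \<partial>lborel \<partial>lborel)"
  by (rule nn_integral_cong, rule lborel_pair.Fubini') measurable
 also have "\<dots> = (\<integral>\<^sup>+x. \<integral>\<^sup>+a2. \<integral>\<^sup>+y. \<integral>\<^sup>+b2. f (s *\<^sub>R (x + a2), s *\<^sub>R (x - a2), y, b2) \<partial>lborel \<partial>lborel \<partial>lborel \<partial>lborel)"
 proof (rule nn_integral_cong, rule nn_integral_cong)
  fix x a2
  show "(\<integral>\<^sup>+y. \<integral>\<^sup>+b2. k (x, a2, y, b2) \<partial>lborel \<partial>lborel)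
   = (\<integral>\<^sup>+y. \<integral>\<^sup>+b2. f (s *\<^sub>R (x + a2), s *\<^sub>R (x - a2), y, b2) \<partial>lborel \<partial>lborel)"
  proof -
   have "(%z. f (s *\<^sub>R (x + a2), s *\<^sub>R (x - a2), fst z, snd z)) \<in> borel_measurable (borel :: (R2 \<times> R2) measure)"
    unfolding borel_prod[symmetric] by measurable
   from nn_pair_rotate[OF this s_def] show ?thesis by (simp only: fst_conv snd_conv k_def prod.case)
  qed
 qed
 also have "\<dots> = (\<integral>\<^sup>+x. \<integral>\<^sup>+a2. \<integral>\<^sup>+y. \<integral>\<^sup>+b2. f (x, a2, y, b2) \<partial>lborel \<partial>lborel \<partial>lborel \<partial>lborel)"
 proof -
  have "(%z. \<integral>\<^sup>+y. \<integral>\<^sup>+b2. f (fst z, snd z, y, b2) \<partial>lborel \<partial>lborel) \<in> borel_measurable (borel :: (R2 \<times> R2) measure)"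
   unfolding borel_prod[symmetric] by measurable
  from nn_pair_rotate[OF this s_def] show ?thesis by simp
 qed
 also have "\<dots> = (\<integral>\<^sup>+p. f p \<partial>lborel)" by (rule nn_integral_lborel4[symmetric]) measurable
 finally show "(\<integral>\<^sup>+p. f (hadamard p) \<partial>lborel) = (\<integral>\<^sup>+p. f p \<partial>lborel)" .
qed measurable

lemma distr_reassoc: "distr lborel borel (%(a, b, u). ((a, b), u)) = (lborel :: ((R2 \<times> R2) \<times> (R2 \<times> R2)) measure)"
proof (rule lborel_distr_eqI)
 show m: "(%(a, b, u). ((a, b), u)) \<in> (borel :: R2x4 measure) \<rightarrow>\<^sub>M (borel :: ((R2 \<times> R2) \<times> (R2 \<times> R2)) measure)"
  unfolding case_prod_beta' by (intro borel_measurable_continuous_onI continuous_intros)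
 fix f :: "(R2 \<times> R2) \<times> (R2 \<times> R2) => ennreal" assume f[measurable]: "f \<in> borel_measurable borel"
 have fm: "(%p. f (case p of (a, b, u) => ((a, b), u))) \<in> borel_measurable borel" by (rule measurable_compose[OF m f])
 have 1: "(\<integral>\<^sup>+p. f (case p of (a, b, u) => ((a, b), u)) \<partial>lborel) = (\<integral>\<^sup>+a. \<integral>\<^sup>+w. f (case (a, w) of (a, b, u) => ((a, b), u)) \<partial>lborel \<partial>lborel)"
  by (rule nn_integral_lborel_pair[OF fm])
 have 2: "(\<integral>\<^sup>+w. f (case (a, w) of (a, b, u) => ((a, b), u)) \<partial>lborel) = (\<integral>\<^sup>+b. \<integral>\<^sup>+u. f ((a, b), u) \<partial>lborel \<partial>lborel)" for a
  using nn_integral_lborel_pair[OF borel_measurable_slice[OF fm, of a]] by simp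
 have m3: "(%w. \<integral>\<^sup>+u. f (w, u) \<partial>lborel) \<in> borel_measurable borel" by measurable
 show "(\<integral>\<^sup>+p. f (case p of (a, b, u) => ((a, b), u)) \<partial>lborel) = (\<integral>\<^sup>+p. f p \<partial>lborel)"
  unfolding 1 2 nn_integral_lborel_pair[OF f] nn_integral_lborel_pair[OF m3] ..
qed

lemma lborel_nested:
 fixes f :: "'a::euclidean_space \<times> 'b::euclidean_space => complex"
 assumes f: "integrable lborel f"
 shows "(LINT z|lborel. f z) = (LINT x|lborel. LINT y|lborel. f (x, y))"
  and "(LINT z|lborel. f z) = (LINT y|lborel. LINT x|lborel. f (x, y))"
proof -
 have I: "integrable (lborel \<Otimes>\<^sub>M lborel) f" using f by (simp add: lborel_prod)
 show 1: "(LINT z|lborel. f z) = (LINT x|lborel. LINT y|lborel. f (x, y))"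
  using lborel_pair.integral_fst'[OF I] by (simp add: lborel_prod)
 have "integrable (lborel \<Otimes>\<^sub>M lborel) (%(x, y). f (x, y))" using I by simp
 from lborel_pair.Fubini_integral[OF this] show "(LINT z|lborel. f z) = (LINT y|lborel. LINT x|lborel. f (x, y))"
  unfolding 1 by simp
qed

lemma lborel_tensor:
 fixes f :: "'a::euclidean_space => complex" and g :: "'b::euclidean_space => complex"
 assumes f: "integrable lborel f" and g: "integrable lborel g"
 shows "integrable lborel (%z. f (fst z) * g (snd z))"
  and "(LINT z|lborel. f (fst z) * g (snd z)) = (LINT x|lborel. f x) * (LINT y|lborel. g y)"
proof -
 show i: "integrable lborel (%z. f (fst z) * g (snd z))"
  using integrable_tensor[OF sigma_finite_lborel sigma_finite_lborel f g] by (simp add: lborel_prod)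
 show "(LINT z|lborel. f (fst z) * g (snd z)) = (LINT x|lborel. f x) * (LINT y|lborel. g y)"
  unfolding lborel_nested(1)[OF i] by simp
qed

text \<open>The inner norms are bounded uniformly in \<open>ze\<close>, so an integrable kernel
  makes the product jointly integrable.\<close>

lemma integral_kernel_swap:
 fixes a :: "'a::euclidean_space => 'b::euclidean_space => complex"
 assumes k: "integrable lborel k" and am[measurable]: "(%(\<xi>, ze). a \<xi> ze) \<in> borel_measurable (borel \<Otimes>\<^sub>M borel)"
  and a: "!!ze. integrable lborel (%\<xi>. a \<xi> ze)" "!!ze. (LINT \<xi>|lborel. cmod (a \<xi> ze)) \<le> B"
 shows "integrable lborel (%z. k (snd z) * a (fst z) (snd z))"
  and "(LINT ze|lborel. k ze * (LINT \<xi>|lborel. a \<xi> ze)) = (LINT z|lborel. k (snd z) * a (fst z) (snd z))"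
proof -
 have [measurable]: "k \<in> borel_measurable borel" using k by auto
 have B: "(LINT \<xi>|lborel. cmod (k ze * a \<xi> ze)) = cmod (k ze) * (LINT \<xi>|lborel. cmod (a \<xi> ze))" for ze
  by (simp add: norm_mult)
 have I: "integrable (lborel \<Otimes>\<^sub>M lborel) (%(ze, \<xi>). k ze * a \<xi> ze)"
 proof (rule lborel_pair.Fubini_integrable)
  show "(%(ze, \<xi>). k ze * a \<xi> ze) \<in> borel_measurable (lborel \<Otimes>\<^sub>M lborel)" by measurable
  show "integrable lborel (%ze. LINT \<xi>|lborel. cmod (case (ze, \<xi>) of (ze, \<xi>) => k ze * a \<xi> ze))"
   unfolding prod.case B
  proof (rule Bochner_Integration.integrable_bound[OF integrable_mult_left[OF integrable_norm[OF k], of B]])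
   show "AE ze in lborel. norm (cmod (k ze) * (LINT \<xi>|lborel. cmod (a \<xi> ze))) \<le> norm (cmod (k ze) * B)"
   proof (rule AE_I2)
    fix ze
    have "0 \<le> (LINT \<xi>|lborel. cmod (a \<xi> ze))" by simp
    then show "norm (cmod (k ze) * (LINT \<xi>|lborel. cmod (a \<xi> ze))) \<le> norm (cmod (k ze) * B)"
     using a(2)[of ze] by (auto simp: abs_mult intro!: mult_left_mono)
   qed
  qed measurable
  show "AE ze in lborel. integrable lborel (%\<xi>. case (ze, \<xi>) of (ze, \<xi>) => k ze * a \<xi> ze)"
   using a(1) by simp
 qed
 have "integrable (lborel \<Otimes>\<^sub>M lborel) (%(\<xi>, ze). (%(ze, \<xi>). k ze * a \<xi> ze) (ze, \<xi>))"
  by (rule lborel_pair.integrable_product_swap[OF I])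
 then show i: "integrable lborel (%z. k (snd z) * a (fst z) (snd z))" by (simp add: lborel_prod case_prod_beta')
 show "(LINT ze|lborel. k ze * (LINT \<xi>|lborel. a \<xi> ze)) = (LINT z|lborel. k (snd z) * a (fst z) (snd z))"
  unfolding lborel_nested(2)[OF i] by simp
qed

section \<open>Gaussian averages of the ladder contributions\<close>

lemma gaussian_R2: "al > 0 ==> gaussian al (u::R2) = al / (2 * pi) * exp (- (al * (norm u)\<^sup>2 / 2))"
 by (simp add: gaussian_def)

lemma gaussian_complex_integral:
 assumes "al > 0"
 shows "integrable lborel (%u::'a::euclidean_space. cor (gaussian al u))"
  and "(LINT u|lborel. cor (gaussian al (u::'a))) = 1"
 using gaussian_fourier[OF assms, of "0::'a"] by simp_all

text \<open>Completing the square in \<open>k\<close>. In probabilistic terms: of two independent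
  normal vectors with precisions \<open>al\<close>, \<open>be\<close> and sum \<open>p\<close>, the
  first has conditional mean \<open>(be / (al + be)) *\<^sub>R p\<close> and conditional precision
  \<open>al + be\<close>.\<close>

lemma gaussian_product:
 fixes k p :: R2
 assumes al: "al > 0" and be: "be > 0"
 shows "gaussian al k * gaussian be (p - k) = gaussian (al + be) (k - (be / (al + be)) *\<^sub>R p) * gaussian (al * be / (al + be)) p"
proof -
 have s: "al + be > 0" "al * be / (al + be) > 0" using al be by auto
 have id: "al * kk + be * (pp - 2 * kp + kk) = (al + be) * (kk - 2 * (be / (al + be)) * kp + (be / (al + be))\<^sup>2 * pp) + al * be / (al + be) * pp"
  for kk pp kp :: real
 proof -
  define t where "t = be / (al + be)"
  have t: "(al + be) * t = be" using s unfolding t_def by simp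
  have t2: "al * be / (al + be) = al * t" unfolding t_def by simp
  have "(al + be) * (kk - 2 * t * kp + t\<^sup>2 * pp) + al * t * pp = (al + be) * kk - 2 * ((al + be) * t) * kp + ((al + be) * t) * t * pp + al * t * pp"
   by (simp add: algebra_simps power2_eq_square)
  also have "\<dots> = (al + be) * kk - 2 * be * kp + be * t * pp + al * t * pp" unfolding t ..
  also have "\<dots> = (al + be) * kk - 2 * be * kp + ((al + be) * t) * pp" by (simp only: distrib_right add.assoc add.commute[of "be * t * pp"])
  also have "\<dots> = al * kk + be * (pp - 2 * kp + kk)" unfolding t by (simp add: algebra_simps)
  finally show ?thesis unfolding t2 t_def[symmetric] ..
 qed
 have e: "al * (norm k)\<^sup>2 + be * (norm (p - k))\<^sup>2 = (al + be) * (norm (k - (be / (al + be)) *\<^sub>R p))\<^sup>2 + al * be / (al + be) * (norm p)\<^sup>2"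
 proof -
  have n1: "(norm (p - k))\<^sup>2 = p \<bullet> p - 2 * (k \<bullet> p) + k \<bullet> k"
   by (simp add: power2_norm_eq_inner inner_diff_left inner_diff_right inner_commute)
  have n2: "(norm (k - t *\<^sub>R p))\<^sup>2 = k \<bullet> k - 2 * t * (k \<bullet> p) + t\<^sup>2 * (p \<bullet> p)" for t
   unfolding power2_norm_eq_inner by (simp add: inner_diff_left inner_diff_right inner_commute power2_eq_square)
  show ?thesis unfolding n1 n2 unfolding power2_norm_eq_inner by (rule id)
 qed
 have half: "- (A / 2) + - (B / 2) = - (C / 2) + - (D / 2)" if "A + B = C + D" for A B C D :: real
  using that by linarith
 have ee: "exp (- (al * (norm k)\<^sup>2 / 2)) * exp (- (be * (norm (p - k))\<^sup>2 / 2))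
  = exp (- ((al + be) * (norm (k - (be / (al + be)) *\<^sub>R p))\<^sup>2 / 2)) * exp (- (al * be / (al + be) * (norm p)\<^sup>2 / 2))"
  unfolding exp_add[symmetric] half[OF e] ..
 have cc: "al / (2 * pi) * (be / (2 * pi)) = (al + be) / (2 * pi) * (al * be / (al + be) / (2 * pi))"
 proof -
  have "(al + be) * (al * be / (al + be)) = al * be" using s by simp
  then show ?thesis unfolding times_divide_times_eq by (simp only:)
 qed
 have m4: "(u * a) * (v * b) = (u' * a') * (v' * b')" if "u * v = u' * v'" "a * b = a' * b'" for u v a b u' v' a' b' :: real
 proof -
  have "(u * a) * (v * b) = (u * v) * (a * b)" by (simp only: mult_ac)
  also have "\<dots> = (u' * a') * (v' * b')" unfolding that by (simp only: mult_ac)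
  finally show ?thesis .
 qed
 show ?thesis unfolding gaussian_R2[OF al] gaussian_R2[OF be] gaussian_R2[OF s(1)] gaussian_R2[OF s(2)]
  by (rule m4[OF cc ee])
qed

text \<open>The density of the sum of independent normal vectors with precisions \<open>al\<close>
  and \<open>be\<close>, times the conditional mean, given the sum, of the exponential of 2 i times
  the inner product of \<open>y\<close> with the first vector.\<close>

definition ladder_kernel :: "real => real => R2 => R2 => complex" where
 "ladder_kernel al be y ze = cor (gaussian (al * be / (al + be)) ze)
  * (iexp (2 * be / (al + be) * (y \<bullet> ze)) * cor (exp (- (2 * (norm y)\<^sup>2 / (al + be)))))"

text \<open>For independent normal \<open>u\<close> and \<open>v\<close> with precisions
  \<open>al\<close> and \<open>be\<close>: the joint density of \<open>v + u\<close> and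
  \<open>v - u\<close>, times the exponential of 2 i times \<open>y \<bullet> u\<close>. The
  division by 4 is the Jacobian of this change of variables.\<close>

definition ladder_pair_kernel :: "real => real => R2 => R2 \<times> R2 => complex" where
 "ladder_pair_kernel al be y z = cor (gaussian al ((1/2) *\<^sub>R (fst z - snd z)) * gaussian be ((1/2) *\<^sub>R (fst z + snd z)) / 4)
  * iexp (y \<bullet> (fst z - snd z))"

lemma ladder_kernel_integrable:
 assumes al: "al > 0" and be: "be > 0"
 shows "integrable lborel (ladder_kernel al be y)"
proof -
 have s: "al * be / (al + be) > 0" using al be by auto
 show ?thesis unfolding ladder_kernel_def
  by (rule mult_bounded_integrable(1)[OF gaussian_complex_integral(1)[OF s], where B="exp (- (2 * (norm y)\<^sup>2 / (al + be)))"])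
   (auto simp: norm_mult)
qed

lemma gaussian_pair_integrable:
 fixes \<Phi> :: "R2 \<times> R2 => complex"
 assumes "al > 0" "be > 0" "\<Phi> \<in> borel_measurable borel" "!!z. cmod (\<Phi> z) \<le> b"
 shows "integrable lborel (%z. cor (gaussian al (fst z)) * cor (gaussian be (snd z)) * \<Phi> z)"
 by (rule mult_bounded_integrable(1)[OF lborel_tensor(1)[OF gaussian_complex_integral(1) gaussian_complex_integral(1)], where B=b])
  (use assms in auto)

lemma ladder_kernel_expectation:
 fixes H :: "R2 => complex"
 assumes al: "al > 0" and be: "be > 0" and H[measurable]: "H \<in> borel_measurable borel" and b: "!!ze. cmod (H ze) \<le> b"
 shows "(LINT z|lborel. cor (gaussian al (fst z)) * cor (gaussian be (snd z)) * (iexp (2 * (y \<bullet> fst z)) * H (fst z + snd z)))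
  = (LINT ze|lborel. ladder_kernel al be y ze * H ze)"
proof -
 let ?g = "%al u. cor (gaussian al (u::R2))"
 have s: "al + be > 0" using al be by auto
 have i: "integrable lborel (%z. ?g al (fst z) * ?g be (snd z) * (iexp (2 * (y \<bullet> fst z)) * H (fst z + snd z)))"
  by (rule gaussian_pair_integrable[OF al be, where b=b]) (measurable, use b in \<open>simp add: norm_mult\<close>)
 have "(LINT z|lborel. ?g al (fst z) * ?g be (snd z) * (iexp (2 * (y \<bullet> fst z)) * H (fst z + snd z)))
  = (LINT p|lborel. LINT k|lborel. ?g al k * ?g be p * (iexp (2 * (y \<bullet> k)) * H (p + k)))"
  unfolding lborel_nested(2)[OF i] by (simp add: add.commute)
 \<comment> \<open>Translation by \<open>k\<close> makes the sum of the two vectors the outer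
   variable; this is \<open>jump_duality\<close> read backwards.\<close>
 also have "\<dots> = (LINT p|lborel. LINT k|lborel. ?g al k * ?g be (p - k) * (iexp (2 * (y \<bullet> k)) * H p))"
  by (rule jump_duality(3)[symmetric, OF gaussian_complex_integral(1)[OF al] gaussian_complex_integral(1)[OF be], where d="%k. k" and b=b
    and G="%k p. iexp (2 * (y \<bullet> k)) * H p"]) (use b in \<open>auto simp: norm_mult\<close>)
 also have "\<dots> = (LINT ze|lborel. ladder_kernel al be y ze * H ze)"
 proof (rule Bochner_Integration.integral_cong[OF refl])
  fix p :: R2
  define m where "m = (be / (al + be)) *\<^sub>R p"
  have "(LINT k|lborel. ?g al k * ?g be (p - k) * (iexp (2 * (y \<bullet> k)) * H p))
   = (LINT k|lborel. (?g (al * be / (al + be)) p * H p) * (?g (al + be) (k - m) * iexp (2 * (y \<bullet> k))))"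
   unfolding of_real_mult[symmetric] gaussian_product[OF al be] m_def[symmetric]
   by (simp only: of_real_mult mult_ac)
  also have "\<dots> = (?g (al * be / (al + be)) p * H p) * (LINT k|lborel. ?g (al + be) (k - m) * iexp (2 * (y \<bullet> k)))"
   by (rule integral_mult_right_zero)
  \<comment> \<open>Centred at the conditional mean \<open>m\<close>, the inner integral is a
    Gaussian Fourier transform.\<close>
  also have "(LINT k|lborel. ?g (al + be) (k - m) * iexp (2 * (y \<bullet> k))) = (LINT k|lborel. ?g (al + be) k * iexp (2 * (y \<bullet> (k + m))))"
   using lborel_shift(2)[of "%k. ?g (al + be) (k - m) * iexp (2 * (y \<bullet> k))" m] by simp
  also have "\<dots> = (LINT k|lborel. (?g (al + be) k * iexp ((2 *\<^sub>R y) \<bullet> k)) * iexp (2 * (y \<bullet> m)))"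
  proof (rule Bochner_Integration.integral_cong[OF refl])
   fix k :: R2
   have "2 * (y \<bullet> (k + m)) = (2 *\<^sub>R y) \<bullet> k + 2 * (y \<bullet> m)" by (simp add: inner_add_right)
   then show "?g (al + be) k * iexp (2 * (y \<bullet> (k + m))) = (?g (al + be) k * iexp ((2 *\<^sub>R y) \<bullet> k)) * iexp (2 * (y \<bullet> m))"
    by (simp only: iexp_mult[symmetric] mult.assoc)
  qed
  also have "\<dots> = exp (- ((norm (2 *\<^sub>R y))\<^sup>2 / (2 * (al + be)))) * iexp (2 * (y \<bullet> m))"
   unfolding integral_mult_left_zero gaussian_fourier(2)[OF s] ..
  also have "(norm (2 *\<^sub>R y))\<^sup>2 / (2 * (al + be)) = 2 * (norm y)\<^sup>2 / (al + be)" using s by (simp add: power_mult_distrib field_simps)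
  also have "2 * (y \<bullet> m) = 2 * be / (al + be) * (y \<bullet> p)" unfolding m_def by simp
  finally show "(LINT k|lborel. ?g al k * ?g be (p - k) * (iexp (2 * (y \<bullet> k)) * H p)) = ladder_kernel al be y p * H p"
   unfolding ladder_kernel_def by (simp only: mult_ac)
 qed
 finally show ?thesis .
qed

text \<open>Reflecting the first vector preserves its law, turns the difference into the sum and the
  exponential into its conjugate.\<close>

lemma reflected_expectation:
 fixes H :: "R2 => complex"
 assumes al: "al > 0" and be: "be > 0" and H[measurable]: "H \<in> borel_measurable borel" and b: "!!ze. cmod (H ze) \<le> b"
 shows "(LINT z|lborel. cor (gaussian al (fst z)) * cor (gaussian be (snd z)) * (iexp (2 * (y \<bullet> fst z)) * cnj (H (snd z - fst z))))
  = cnj (LINT z|lborel. cor (gaussian al (fst z)) * cor (gaussian be (snd z)) * (iexp (2 * (y \<bullet> fst z)) * H (fst z + snd z)))"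
proof -
 let ?g = "%al u. cor (gaussian al (u::R2))"
 have [measurable]: "cnj \<in> borel_measurable borel" by (intro borel_measurable_continuous_onI continuous_intros)
 have i1: "integrable lborel (%z. ?g al (fst z) * ?g be (snd z) * (iexp (2 * (y \<bullet> fst z)) * H (fst z + snd z)))"
  by (rule gaussian_pair_integrable[OF al be, where b=b]) (measurable, use b in \<open>simp add: norm_mult\<close>)
 have i2: "integrable lborel (%z. ?g al (fst z) * ?g be (snd z) * (iexp (2 * (y \<bullet> fst z)) * cnj (H (snd z - fst z))))"
  by (rule gaussian_pair_integrable[OF al be, where b=b]) (measurable, use b in \<open>simp add: norm_mult\<close>)
 have g: "gaussian al (- u) = gaussian al u" for u :: R2 by (simp add: gaussian_def)
 have "(LINT x|lborel. ?g al x * ?g be q * (iexp (2 * (y \<bullet> x)) * cnj (H (q - x)))) = (LINT x|lborel. cnj (?g al x * ?g be q * (iexp (2 * (y \<bullet> x)) * H (x + q))))" for q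
  using lborel_integral_affine(2)[where t=0 and c="-1" and f="%x. ?g al x * ?g be q * (iexp (2 * (y \<bullet> x)) * cnj (H (q - x)))"]
  by (simp add: g exp_cnj add.commute)
 then show ?thesis
  unfolding lborel_nested(2)[OF i1] lborel_nested(2)[OF i2] by (simp del: complex_cnj_mult)
qed

text \<open>The passage to sum and difference is \<open>rotation\<close> followed by dilations by
  \<open>sqrt 2\<close> and \<open>- sqrt 2\<close>; the sign is there because the second variable
  is \<open>snd z - fst z\<close>. Each dilation of \<open>R2\<close> contributes a factor 2,
  together the 4 in \<open>\<theta>\<close>.\<close>

lemma rotated_expectation:
 fixes H :: "R2 => complex"
 assumes al: "al > 0" and be: "be > 0" and H[measurable]: "H \<in> borel_measurable borel" and b: "!!ze. cmod (H ze) \<le> b"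
 shows "integrable lborel (%z. ladder_pair_kernel al be y z * (H (fst z) * cnj (H (snd z))))"
  and "(LINT z|lborel. cor (gaussian al (fst z)) * cor (gaussian be (snd z)) * (iexp (2 * (y \<bullet> fst z)) * (H (fst z + snd z) * cnj (H (snd z - fst z)))))
  = (LINT z|lborel. ladder_pair_kernel al be y z * (H (fst z) * cnj (H (snd z))))"
proof -
 let ?g = "%al u. cor (gaussian al (u::R2))"
 have [measurable]: "cnj \<in> borel_measurable borel" by (intro borel_measurable_continuous_onI continuous_intros)
 define \<theta> where "\<theta> z = 4 * (ladder_pair_kernel al be y z * (H (fst z) * cnj (H (snd z))))" for z
 have [measurable]: "\<theta> \<in> borel_measurable borel" unfolding \<theta>_def ladder_pair_kernel_def by measurable
 define f where "f z = \<theta> (sqrt 2 *\<^sub>R fst z, - sqrt 2 *\<^sub>R snd z)" for z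
 have fm[measurable]: "f \<in> borel_measurable borel" unfolding f_def by measurable
 have i0: "integrable lborel (%z. ?g al (fst z) * ?g be (snd z) * (iexp (2 * (y \<bullet> fst z)) * (H (fst z + snd z) * cnj (H (snd z - fst z)))))"
 proof (rule gaussian_pair_integrable[OF al be, where b="b * b"])
  show "cmod (iexp (2 * (y \<bullet> fst z)) * (H (fst z + snd z) * cnj (H (snd z - fst z)))) \<le> b * b" for z
   using b order_trans[OF norm_ge_zero b] by (auto simp: norm_mult intro!: mult_mono)
 qed measurable
 have eq: "f (rotation z) = ?g al (fst z) * ?g be (snd z) * (iexp (2 * (y \<bullet> fst z)) * (H (fst z + snd z) * cnj (H (snd z - fst z))))" for z
 proof -
  have h: "(1/2) *\<^sub>R (fst z + snd z - (snd z - fst z)) = fst z" "(1/2) *\<^sub>R (fst z + snd z + (snd z - fst z)) = snd z"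
   by (simp_all add: vec_eq_iff)
  have y: "y \<bullet> (fst z + snd z - (snd z - fst z)) = 2 * (y \<bullet> fst z)"
   unfolding inner_add_right inner_diff_right by linarith
  have r: "sqrt 2 *\<^sub>R fst (rotation z) = fst z + snd z" "- sqrt 2 *\<^sub>R snd (rotation z) = snd z - fst z"
   unfolding rotation_def by simp_all
  show ?thesis unfolding f_def r \<theta>_def ladder_pair_kernel_def fst_conv snd_conv h y by simp
 qed
 have fi: "integrable lborel f" using i0 lborel_integral_distr(1)[OF distr_rotation rotation_measurable fm] unfolding eq by simp
 have sc1: "(LINT v|lborel. g v) = 2 * (LINT v|lborel. g (sqrt 2 *\<^sub>R v))" "integrable lborel (%v. g (sqrt 2 *\<^sub>R v)) = integrable lborel g" for g :: "R2 => complex"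
  using lborel_integral_affine(2)[where t=0 and c="sqrt 2" and f=g] lborel_integral_affine(1)[where t=0 and c="sqrt 2" and f=g]
  by (simp_all add: scaleR_conv_of_real)
 have sc2: "(LINT v|lborel. g v) = 2 * (LINT v|lborel. g (- sqrt 2 *\<^sub>R v))" for g :: "R2 => complex"
  using lborel_integral_affine(2)[where t=0 and c="- sqrt 2" and f=g] by (simp add: scaleR_conv_of_real)
 have i\<theta>: "integrable lborel \<theta>"
 proof -
  have u: "(%z. (fst z, - snd z)) \<in> (borel :: (R2 \<times> R2) measure) \<rightarrow>\<^sub>M (borel :: (R2 \<times> R2) measure)"
   by (intro borel_measurable_continuous_onI continuous_intros)
  have "distr lborel borel (%z. (fst z, - snd z)) = (lborel :: (R2 \<times> R2) measure)"
  proof (rule lborel_distr_eqI[OF u])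
   fix h :: "R2 \<times> R2 => ennreal" assume h[measurable]: "h \<in> borel_measurable borel"
   have hm: "(%z. h (fst z, - snd z)) \<in> borel_measurable borel" by (rule measurable_compose[OF u h])
   have "(\<integral>\<^sup>+b. h (a, b) \<partial>lborel) = (\<integral>\<^sup>+b. h (a, - b) \<partial>lborel)" for a
    using nn_integral_lborel_affine[OF borel_measurable_slice[OF h], of "-1" a 0] by simp
   then show "(\<integral>\<^sup>+p. h (fst p, - snd p) \<partial>lborel) = (\<integral>\<^sup>+p. h p \<partial>lborel)"
    unfolding nn_integral_lborel_pair[OF h] nn_integral_lborel_pair[OF hm] by simp
  qed
  from lborel_integral_distr(1)[OF this u, of "%z. \<theta> (sqrt 2 *\<^sub>R z)"] fi
  have "integrable lborel (%z. \<theta> (sqrt 2 *\<^sub>R z))" unfolding f_def by (simp add: scaleR_prod_def)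
  then show ?thesis using lborel_integral_affine(1)[where t=0 and c="sqrt 2" and f=\<theta>] by simp
 qed
 have "ladder_pair_kernel al be y z * (H (fst z) * cnj (H (snd z))) = (1/4) * \<theta> z" for z by (simp add: \<theta>_def)
 then show "integrable lborel (%z. ladder_pair_kernel al be y z * (H (fst z) * cnj (H (snd z))))"
  using integrable_mult_right[OF i\<theta>, of "1/4"] by (simp only:)
 have "(LINT z|lborel. ?g al (fst z) * ?g be (snd z) * (iexp (2 * (y \<bullet> fst z)) * (H (fst z + snd z) * cnj (H (snd z - fst z))))) = (LINT z|lborel. f z)"
  using lborel_integral_distr(2)[OF distr_rotation rotation_measurable fm] unfolding eq .
 also have "4 * \<dots> = (LINT z|lborel. \<theta> z)"
 proof -
  have "(LINT z|lborel. \<theta> z) = (LINT u|lborel. LINT v|lborel. \<theta> (u, v))" by (rule lborel_nested(1)[OF i\<theta>])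
  also have "\<dots> = (LINT u|lborel. 2 * (LINT v|lborel. \<theta> (u, - sqrt 2 *\<^sub>R v)))" by (subst sc2) (rule refl)
  also have "\<dots> = 2 * (LINT u|lborel. 2 * (LINT v|lborel. \<theta> (sqrt 2 *\<^sub>R u, - sqrt 2 *\<^sub>R v)))" by (rule sc1(1))
  also have "\<dots> = 4 * (LINT u|lborel. LINT v|lborel. \<theta> (sqrt 2 *\<^sub>R u, - sqrt 2 *\<^sub>R v))" by simp
  also have "\<dots> = 4 * (LINT z|lborel. f z)" unfolding lborel_nested(1)[OF fi] by (simp add: f_def)
  finally show ?thesis ..
 qed
 finally show "(LINT z|lborel. ?g al (fst z) * ?g be (snd z) * (iexp (2 * (y \<bullet> fst z)) * (H (fst z + snd z) * cnj (H (snd z - fst z)))))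
  = (LINT z|lborel. ladder_pair_kernel al be y z * (H (fst z) * cnj (H (snd z))))"
  unfolding \<theta>_def by simp
qed

text \<open>The product is expanded into atom-atom, mixed and density-density terms. By
  \<open>reflected_expectation\<close> the two mixed terms are conjugate to each other, whence twice
  a real part.\<close>

lemma ladder_expectation:
 fixes H :: "R2 => complex" and K :: real
 assumes al: "al > 0" and be: "be > 0" and H[measurable]: "H \<in> borel_measurable borel" and b: "!!ze. cmod (H ze) \<le> b"
 shows "(LINT z|lborel. cor (gaussian al (fst z)) * cor (gaussian be (snd z)) * (iexp (2 * (y \<bullet> fst z)) * ((K + H (fst z + snd z)) * cnj (K + H (snd z - fst z)))))
  = cor (K\<^sup>2 * exp (- (2 * (norm y)\<^sup>2 / al))) + cor (2 * K * Re (LINT ze|lborel. ladder_kernel al be y ze * H ze))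
   + (LINT z|lborel. ladder_pair_kernel al be y z * (H (fst z) * cnj (H (snd z))))"
proof -
 let ?g = "%al u. cor (gaussian al (u::R2))"
 let ?G = "%z. ?g al (fst z) * ?g be (snd z)"
 let ?e = "%z::R2 \<times> R2. iexp (2 * (y \<bullet> fst z))"
 have [measurable]: "cnj \<in> borel_measurable borel" by (intro borel_measurable_continuous_onI continuous_intros)
 have i0: "integrable lborel (%z. ?G z * ?e z)"
 proof (rule gaussian_pair_integrable[OF al be, where b=1])
  show "?e \<in> borel_measurable borel" by measurable
  show "cmod (?e z) \<le> 1" for z by simp
 qed
 have i1: "integrable lborel (%z. ?G z * (?e z * H (fst z + snd z)))"
  by (rule gaussian_pair_integrable[OF al be, where b=b]) (measurable, use b in \<open>simp add: norm_mult\<close>)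
 have i2: "integrable lborel (%z. ?G z * (?e z * cnj (H (snd z - fst z))))"
  by (rule gaussian_pair_integrable[OF al be, where b=b]) (measurable, use b in \<open>simp add: norm_mult\<close>)
 have i3: "integrable lborel (%z. ?G z * (?e z * (H (fst z + snd z) * cnj (H (snd z - fst z)))))"
 proof (rule gaussian_pair_integrable[OF al be, where b="b * b"])
  show "cmod (?e z * (H (fst z + snd z) * cnj (H (snd z - fst z)))) \<le> b * b" for z
   using b order_trans[OF norm_ge_zero b] by (auto simp: norm_mult intro!: mult_mono)
 qed measurable
 have v0: "(LINT z|lborel. ?G z * ?e z) = cor (exp (- (2 * (norm y)\<^sup>2 / al)))"
 proof -
  have "(LINT z|lborel. ?G z * ?e z) = (LINT z|lborel. (?g al (fst z) * iexp ((2 *\<^sub>R y) \<bullet> fst z)) * ?g be (snd z))"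
   by (rule Bochner_Integration.integral_cong[OF refl]) (simp add: mult_ac)
  also have "\<dots> = exp (- ((norm (2 *\<^sub>R y))\<^sup>2 / (2 * al))) * 1"
   unfolding lborel_tensor(2)[OF gaussian_fourier(1)[OF al, of "2 *\<^sub>R y"] gaussian_complex_integral(1)[OF be]]
    gaussian_fourier(2)[OF al] gaussian_complex_integral(2)[OF be] by simp
  also have "(norm (2 *\<^sub>R y))\<^sup>2 / (2 * al) = 2 * (norm y)\<^sup>2 / al" using al by (simp add: power_mult_distrib field_simps)
  finally show ?thesis by simp
 qed
 have "(LINT z|lborel. ?G z * (?e z * ((K + H (fst z + snd z)) * cnj (K + H (snd z - fst z)))))
  = (LINT z|lborel. cor (K\<^sup>2) * (?G z * ?e z) + cor K * (?G z * (?e z * H (fst z + snd z)))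
   + cor K * (?G z * (?e z * cnj (H (snd z - fst z)))) + ?G z * (?e z * (H (fst z + snd z) * cnj (H (snd z - fst z)))))"
  by (rule Bochner_Integration.integral_cong[OF refl]) (simp add: algebra_simps power2_eq_square)
 also have "\<dots> = cor (K\<^sup>2) * (LINT z|lborel. ?G z * ?e z) + cor K * (LINT z|lborel. ?G z * (?e z * H (fst z + snd z)))
   + cor K * (LINT z|lborel. ?G z * (?e z * cnj (H (snd z - fst z)))) + (LINT z|lborel. ?G z * (?e z * (H (fst z + snd z) * cnj (H (snd z - fst z)))))"
  using i0 i1 i2 i3 by simp
 also have "\<dots> = cor (K\<^sup>2) * cor (exp (- (2 * (norm y)\<^sup>2 / al))) + cor K * (LINT ze|lborel. ladder_kernel al be y ze * H ze)
   + cor K * cnj (LINT ze|lborel. ladder_kernel al be y ze * H ze) + (LINT z|lborel. ladder_pair_kernel al be y z * (H (fst z) * cnj (H (snd z))))"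
  unfolding v0 reflected_expectation[OF al be H b] ladder_kernel_expectation[OF al be H b] rotated_expectation(2)[OF al be H b] ..
 also have "\<dots> = cor (K\<^sup>2 * exp (- (2 * (norm y)\<^sup>2 / al))) + cor K * ((LINT ze|lborel. ladder_kernel al be y ze * H ze)
   + cnj (LINT ze|lborel. ladder_kernel al be y ze * H ze)) + (LINT z|lborel. ladder_pair_kernel al be y z * (H (fst z) * cnj (H (snd z))))"
  unfolding of_real_mult distrib_left by (simp only: add.assoc)
 finally show ?thesis unfolding complex_add_cnj by (simp only: of_real_mult of_real_numeral mult.assoc mult.left_commute)
qed

section \<open>The initial condition in Fourier space\<close>

text \<open>The density of \<open>hadamard p\<close>, where \<open>p\<close> is distributed according to the Fourier transform
 of the initial condition.\<close>
definition initial_weight :: "real => real => R2x4 => complex" where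
 "initial_weight al be q = cor (gaussian al (fst q)) * (cor (gaussian al (fst (snd q)))
  * (cor (gaussian be (fst (snd (snd q)))) * cor (gaussian be (snd (snd (snd q))))))"

lemma initial_weight_integrable:
 assumes al: "al > 0" and be: "be > 0"
 shows "integrable lborel (initial_weight al be)"
 unfolding initial_weight_def
 by (rule lborel_tensor(1)[OF gaussian_complex_integral(1)[OF al] lborel_tensor(1)[OF gaussian_complex_integral(1)[OF al]
    lborel_tensor(1)[OF gaussian_complex_integral(1)[OF be] gaussian_complex_integral(1)[OF be]]]])

lemma initial_weight_fourier:
 assumes al: "al > 0" and be: "be > 0"
 shows "(LINT q|lborel. initial_weight al be q * iexp (q \<bullet> X))
  = exp (- ((norm (fst X))\<^sup>2 / (2 * al))) * (exp (- ((norm (fst (snd X)))\<^sup>2 / (2 * al)))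
   * (exp (- ((norm (fst (snd (snd X))))\<^sup>2 / (2 * be))) * exp (- ((norm (snd (snd (snd X))))\<^sup>2 / (2 * be)))))"
proof -
 let ?g = "%al X u. cor (gaussian al (u::R2)) * iexp (X \<bullet> u)"
 obtain x1 x2 x3 x4 where X: "X = (x1, x2, x3, x4)" by (cases X) auto
 have e: "initial_weight al be q * iexp (q \<bullet> X) = ?g al x1 (fst q) * (?g al x2 (fst (snd q)) * (?g be x3 (fst (snd (snd q))) * ?g be x4 (snd (snd (snd q)))))" for q
 proof -
  have "q \<bullet> X = x1 \<bullet> fst q + (x2 \<bullet> fst (snd q) + (x3 \<bullet> fst (snd (snd q)) + x4 \<bullet> snd (snd (snd q))))"
   unfolding X by (simp add: inner_prod_def inner_commute)
  then show ?thesis unfolding initial_weight_def by (simp only: iexp_mult[symmetric] mult_ac)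
 qed
 have 3: "integrable lborel (%z. ?g be x3 (fst z) * ?g be x4 (snd z))" by (intro lborel_tensor gaussian_fourier be)
 have 2: "integrable lborel (%z. ?g al x2 (fst z) * (?g be x3 (fst (snd z)) * ?g be x4 (snd (snd z))))" by (intro lborel_tensor gaussian_fourier al 3)
 show ?thesis unfolding e
  lborel_tensor(2)[OF gaussian_fourier(1)[OF al, of x1] 2] lborel_tensor(2)[OF gaussian_fourier(1)[OF al, of x2] 3]
  lborel_tensor(2)[OF gaussian_fourier(1)[OF be, of x3] gaussian_fourier(1)[OF be, of x4]]
  gaussian_fourier(2)[OF al] gaussian_fourier(2)[OF be]
  by (simp add: X)
qed

text \<open>In the coordinates \<open>hadamard X\<close> the exponent separates by the parallelogram
  identity: the sums \<open>x1 + y1\<close>, \<open>x2 + y2\<close> fill the first two coordinates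
  with width \<open>r\<close>, the differences the last two with width \<open>\<rho>\<close>. The
  transform is a product of Gaussians, and symmetry of \<open>hadamard\<close> carries it
  back.\<close>

lemma M2_initial_fourier:
 assumes r: "r > 0" and \<rho>: "\<rho> > 0"
 shows "cor (M2_initial r \<rho> X) = (LINT p|lborel. initial_weight (r\<^sup>2) (\<rho>\<^sup>2) (hadamard p) * iexp (p \<bullet> X))"
  and "integrable lborel (%p. initial_weight (r\<^sup>2) (\<rho>\<^sup>2) (hadamard p))"
proof -
 have al: "r\<^sup>2 > 0" and be: "\<rho>\<^sup>2 > 0" using r \<rho> by auto
 have wm: "initial_weight (r\<^sup>2) (\<rho>\<^sup>2) \<in> borel_measurable borel" using initial_weight_integrable[OF al be] by auto
 show "integrable lborel (%p. initial_weight (r\<^sup>2) (\<rho>\<^sup>2) (hadamard p))"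
  using lborel_integral_distr(1)[OF distr_hadamard hadamard_measurable wm] initial_weight_integrable[OF al be] by simp
 obtain x1 x2 y1 y2 where X: "X = (x1, x2, y1, y2)" by (cases X) auto
 have m: "(%q. initial_weight (r\<^sup>2) (\<rho>\<^sup>2) q * iexp (q \<bullet> hadamard X)) \<in> borel_measurable borel" using wm by measurable
 have "hadamard p \<bullet> hadamard X = p \<bullet> X" for p unfolding hadamard_inner hadamard_involution ..
 then have "(LINT p|lborel. initial_weight (r\<^sup>2) (\<rho>\<^sup>2) (hadamard p) * iexp (p \<bullet> X)) = (LINT q|lborel. initial_weight (r\<^sup>2) (\<rho>\<^sup>2) q * iexp (q \<bullet> hadamard X))"
  using lborel_integral_distr(2)[OF distr_hadamard hadamard_measurable m] by simp
 also have "\<dots> = cor (M2_initial r \<rho> X)"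
 proof -
  have par: "(norm ((1/2) *\<^sub>R (u + v)))\<^sup>2 + (norm ((1/2) *\<^sub>R (u - v)))\<^sup>2 = ((norm u)\<^sup>2 + (norm v)\<^sup>2) / 2" for u v :: R2
   by (simp add: power_mult_distrib power2_norm_eq_inner inner_add_left inner_add_right inner_diff_left inner_diff_right inner_commute field_simps)
  have h: "hadamard X = ((1/2) *\<^sub>R ((x1 + y1) + (x2 + y2)), (1/2) *\<^sub>R ((x1 + y1) - (x2 + y2)), (1/2) *\<^sub>R ((x1 - y1) + (x2 - y2)), (1/2) *\<^sub>R ((x1 - y1) - (x2 - y2)))"
   unfolding X hadamard_def by (simp add: algebra_simps)
  have q: "- (A / (2 * a)) + (- (B / (2 * a)) + (- (C / (2 * b)) + - (D / (2 * b)))) = - (P + Q) / (4 * a) - (R + S) / (4 * b)"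
   if "A + B = (P + Q) / 2" "C + D = (R + S) / 2" for A B C D P Q R S a b :: real
  proof -
   have "- (A / (2 * a)) + (- (B / (2 * a)) + (- (C / (2 * b)) + - (D / (2 * b)))) = - ((A + B) / (2 * a)) - (C + D) / (2 * b)"
    by (cases "a = 0"; cases "b = 0") (simp_all add: field_simps)
   then show ?thesis unfolding that by (cases "a = 0"; cases "b = 0") (simp_all add: field_simps)
  qed
  show ?thesis
   unfolding initial_weight_fourier[OF al be] h fst_conv snd_conv of_real_mult[symmetric] exp_add[symmetric] q[OF par par]
   unfolding X M2_initial_def prod.case ..
 qed
 finally show "cor (M2_initial r \<rho> X) = (LINT p|lborel. initial_weight (r\<^sup>2) (\<rho>\<^sup>2) (hadamard p) * iexp (p \<bullet> X))" ..
qed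

text \<open>The first ladder depends on coordinates 1 and 2, both of precision \<open>al\<close>;
  the second on 1 and 4, of precisions \<open>al\<close> and \<open>be\<close>. The other
  coordinates integrate to one. This is why the terms of the limit with frequency shift
  \<open>\<Omega>\<close> involve the radius \<open>r0\<close> alone, while those with shift 0
  involve both radii.\<close>

lemma initial_weight_marginals:
 fixes \<Phi> :: "R2 \<times> R2 => complex"
 assumes al: "al > 0" and be: "be > 0" and \<Phi>[measurable]: "\<Phi> \<in> borel_measurable borel" and b: "!!z. cmod (\<Phi> z) \<le> b"
 shows "integrable lborel (%q. initial_weight al be q * \<Phi> (fst q, fst (snd q)))"
  and "integrable lborel (%q. initial_weight al be q * \<Phi> (fst q, snd (snd (snd q))))"
  and "(LINT q|lborel. initial_weight al be q * \<Phi> (fst q, fst (snd q)))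
   = (LINT z|lborel. cor (gaussian al (fst z)) * cor (gaussian al (snd z)) * \<Phi> z)"
  and "(LINT q|lborel. initial_weight al be q * \<Phi> (fst q, snd (snd (snd q))))
   = (LINT z|lborel. cor (gaussian al (fst z)) * cor (gaussian be (snd z)) * \<Phi> z)"
proof -
 let ?g = "%al u. cor (gaussian al (u::R2))"
 note ga = gaussian_complex_integral[OF al, where 'a=R2] and gb = gaussian_complex_integral[OF be, where 'a=R2]
 have s: "(%q. \<Phi> (x, q)) \<in> borel_measurable borel" for x by (rule borel_measurable_slice[OF \<Phi>])
 have i: "integrable lborel (%q. ?g \<gamma> q * \<Phi> (x, q))" if "\<gamma> > 0" for \<gamma> x
  by (rule mult_bounded_integrable(1)[OF gaussian_complex_integral(1)[OF that], where B=b]) (use s b in auto)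
 show i1: "integrable lborel (%q. initial_weight al be q * \<Phi> (fst q, fst (snd q)))"
  by (rule mult_bounded_integrable(1)[OF initial_weight_integrable[OF al be], where B=b]) (measurable, use b in auto)
 show i2: "integrable lborel (%q. initial_weight al be q * \<Phi> (fst q, snd (snd (snd q))))"
  by (rule mult_bounded_integrable(1)[OF initial_weight_integrable[OF al be], where B=b]) (measurable, use b in auto)
 have j1: "integrable lborel (%z. ?g al (fst z) * ?g al (snd z) * \<Phi> z)" by (rule gaussian_pair_integrable[OF al al \<Phi> b])
 have j2: "integrable lborel (%z. ?g al (fst z) * ?g be (snd z) * \<Phi> z)" by (rule gaussian_pair_integrable[OF al be \<Phi> b])
 have k1: "(LINT w|lborel. initial_weight al be (x, w) * \<Phi> (x, fst w)) = ?g al x * (LINT q|lborel. ?g al q * \<Phi> (x, q))" for x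
 proof -
  have "(LINT w|lborel. initial_weight al be (x, w) * \<Phi> (x, fst w))
   = (LINT w|lborel. ?g al x * ((?g al (fst w) * \<Phi> (x, fst w)) * (?g be (fst (snd w)) * ?g be (snd (snd w)))))"
   unfolding initial_weight_def fst_conv snd_conv by (simp only: mult_ac)
  also have "\<dots> = ?g al x * (LINT w|lborel. (?g al (fst w) * \<Phi> (x, fst w)) * (?g be (fst (snd w)) * ?g be (snd (snd w))))"
   by (rule integral_mult_right_zero)
  also have "(LINT w|lborel. (?g al (fst w) * \<Phi> (x, fst w)) * (?g be (fst (snd w)) * ?g be (snd (snd w)))) = (LINT q|lborel. ?g al q * \<Phi> (x, q)) * (1 * 1)"
   unfolding lborel_tensor(2)[OF i[OF al] lborel_tensor(1)[OF gb(1) gb(1)]] lborel_tensor(2)[OF gb(1) gb(1)] gb(2) ..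
  finally show ?thesis by simp
 qed
 have k2: "(LINT w|lborel. initial_weight al be (x, w) * \<Phi> (x, snd (snd w))) = ?g al x * (LINT q|lborel. ?g be q * \<Phi> (x, q))" for x
 proof -
  have "(LINT w|lborel. initial_weight al be (x, w) * \<Phi> (x, snd (snd w)))
   = (LINT w|lborel. ?g al x * (?g al (fst w) * (?g be (fst (snd w)) * (?g be (snd (snd w)) * \<Phi> (x, snd (snd w))))))"
   unfolding initial_weight_def fst_conv snd_conv by (simp only: mult_ac)
  also have "\<dots> = ?g al x * (LINT w|lborel. ?g al (fst w) * (?g be (fst (snd w)) * (?g be (snd (snd w)) * \<Phi> (x, snd (snd w)))))"
   by (rule integral_mult_right_zero)
  also have "(LINT w|lborel. ?g al (fst w) * (?g be (fst (snd w)) * (?g be (snd (snd w)) * \<Phi> (x, snd (snd w))))) = 1 * (1 * (LINT q|lborel. ?g be q * \<Phi> (x, q)))"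
   unfolding lborel_tensor(2)[OF ga(1) lborel_tensor(1)[OF gb(1) i[OF be]]] lborel_tensor(2)[OF gb(1) i[OF be]] ga(2) gb(2) ..
  finally show ?thesis by simp
 qed
 show "(LINT q|lborel. initial_weight al be q * \<Phi> (fst q, fst (snd q))) = (LINT z|lborel. ?g al (fst z) * ?g al (snd z) * \<Phi> z)"
  unfolding lborel_nested(1)[OF i1] lborel_nested(1)[OF j1] fst_conv snd_conv k1 by (simp only: mult.assoc integral_mult_right_zero)
 show "(LINT q|lborel. initial_weight al be q * \<Phi> (fst q, snd (snd (snd q)))) = (LINT z|lborel. ?g al (fst z) * ?g be (snd z) * \<Phi> z)"
  unfolding lborel_nested(1)[OF i2] lborel_nested(1)[OF j2] fst_conv snd_conv k2 by (simp only: mult.assoc integral_mult_right_zero)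
qed

section \<open>The limit along a sequence of scales\<close>

lemma coupling_bound:
 assumes "0 < w" "w \<le> 2 * u" "0 < w'" "w' \<le> 2 * u" and j: "j < 7"
 shows "\<bar>coupling w w' w' w j\<bar> \<le> 8 * u\<^sup>2"
proof -
 have u: "u \<ge> 0" using assms by linarith
 have p: "\<bar>a * b\<bar> \<le> 4 * u\<^sup>2" if "0 < a" "a \<le> 2 * u" "0 < b" "b \<le> 2 * u" for a b
 proof -
  have "a * b \<le> (2 * u) * (2 * u)" using that by (intro mult_mono) auto
  then show ?thesis using that by (simp add: power2_eq_square)
 qed
 have u2: "4 * u\<^sup>2 \<le> 8 * u\<^sup>2" by simp
 have q: "\<bar>- ((w\<^sup>2 + w'\<^sup>2 + w'\<^sup>2 + w\<^sup>2) / 2)\<bar> \<le> 8 * u\<^sup>2"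
  using p[of w w] p[of w' w'] assms by (simp add: power2_eq_square)
 have r: "\<bar>a * b\<bar> \<le> 8 * u\<^sup>2" if "0 < a" "a \<le> 2 * u" "0 < b" "b \<le> 2 * u" for a b
  by (rule order_trans[OF p[OF that] u2])
 show ?thesis unfolding coupling_def
  using q r[OF assms(1,2,1,2)] r[OF assms(1,2,3,4)] r[OF assms(3,4,1,2)] r[OF assms(3,4,3,4)] by simp
qed

lemma coupling_tendsto:
 assumes "w \<longlonglongrightarrow> u" "w' \<longlonglongrightarrow> u"
 shows "(%n. coupling (w n) (w' n) (w' n) (w n) j) \<longlonglongrightarrow> coupling u u u u j"
proof -
 have ti: "(%n. if P then f n else g n) \<longlonglongrightarrow> (if P then a else b)" if "f \<longlonglongrightarrow> a" "g \<longlonglongrightarrow> b" for P and f g :: "nat => real" and a b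
  using that by simp
 show ?thesis unfolding coupling_def by (intro ti tendsto_intros assms) simp_all
qed

lemma M2_initial_scale:
 assumes "t > 0"
 shows "M2_initial (r / t) (\<rho> / t) X = M2_initial r \<rho> (t *\<^sub>R X)"
proof -
 obtain x1 x2 y1 y2 where X: "X = (x1, x2, y1, y2)" by (cases X) auto
 have n: "(norm (t *\<^sub>R u + t *\<^sub>R v))\<^sup>2 = t\<^sup>2 * (norm (u + v))\<^sup>2" "(norm (t *\<^sub>R u - t *\<^sub>R v))\<^sup>2 = t\<^sup>2 * (norm (u - v))\<^sup>2" for u v :: R2
  unfolding scaleR_right_distrib[symmetric] scaleR_right_diff_distrib[symmetric] by (simp_all add: power_mult_distrib)
 have d: "- (t\<^sup>2 * a + t\<^sup>2 * b) / (4 * s\<^sup>2) = - (a + b) / (4 * (s / t)\<^sup>2)" "(t\<^sup>2 * a + t\<^sup>2 * b) / (4 * s\<^sup>2) = (a + b) / (4 * (s / t)\<^sup>2)" for a b s :: real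
  using assms by (cases "s = 0"; simp add: power_divide field_simps)+
 show ?thesis unfolding X M2_initial_def scaleR_Pair prod.case n d ..
qed

lemma hadamard_sums:
 assumes "hadamard q = (a1, a2, b1, b2)"
 shows "a1 + b1 = fst q + fst (snd q)" "- (a2 + b2) = fst (snd q) - fst q"
  "a1 + b2 = fst q + snd (snd (snd q))" "- (a2 + b1) = snd (snd (snd q)) - fst q"
  "a1 + a2 + b1 + b2 = 2 *\<^sub>R fst q"
proof -
 obtain r s t u where q: "q = (r, s, t, u)" by (cases q) auto
 have E: "a1 = (1/2) *\<^sub>R (r + s + t + u)" "a2 = (1/2) *\<^sub>R (r - s + t - u)" "b1 = (1/2) *\<^sub>R (r + s - t - u)" "b2 = (1/2) *\<^sub>R (r - s - t + u)"
  using assms unfolding q hadamard_def by auto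
 show "a1 + b1 = fst q + fst (snd q)" "- (a2 + b2) = fst (snd q) - fst q"
  "a1 + b2 = fst q + snd (snd (snd q))" "- (a2 + b1) = snd (snd (snd q)) - fst q"
  "a1 + a2 + b1 + b2 = 2 *\<^sub>R fst q"
  unfolding E q fst_conv snd_conv by (simp_all add: vec_eq_iff field_simps)
qed

lemma set_integral_singleton: "(LINT t:{L..L}|lborel. (g t :: complex)) = 0" for L :: real
 unfolding set_lebesgue_integral_def
proof (rule integral_eq_zero_AE)
 show "AE t in lborel. indicator {L..L} t *\<^sub>R g t = 0"
  using AE_lborel_singleton[of L] by eventually_elim (auto split: split_indicator)
qed

text \<open>The pairing of the density with the terminal value, expressed by \<open>A\<close>
  itself: the quadratic phase at distance \<open>L\<close> cancels against the factor of the
  interaction picture, and the linear one stays. \<open>v\<close> is \<open>x\<close> for the first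
  ladder and 0 for the second.\<close>

definition scattered_field :: "real => real => R2 => (R2 => R2 => complex) => R2 => complex" where
 "scattered_field L h v a ze = (LINT \<xi>|lborel. a \<xi> ze * iexp (v \<bullet> \<xi> - L * h * (\<xi> \<bullet> ze)))"

lemma scattered_field_measurable:
 assumes [measurable]: "(%(\<xi>, ze). a \<xi> ze) \<in> borel_measurable (borel \<Otimes>\<^sub>M borel)"
 shows "scattered_field L h v a \<in> borel_measurable borel"
 unfolding scattered_field_def by measurable

lemma scattered_field_bound:
 assumes "(LINT \<xi>|lborel. cmod (a \<xi> ze)) \<le> B"
 shows "cmod (scattered_field L h v a ze) \<le> B"
proof -
 have "cmod (scattered_field L h v a ze) \<le> (LINT \<xi>|lborel. cmod (a \<xi> ze * iexp (v \<bullet> \<xi> - L * h * (\<xi> \<bullet> ze))))"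
  unfolding scattered_field_def by (rule Bochner_Integration.integral_norm_bound)
 also have "\<dots> \<le> B" using assms by (simp add: norm_mult)
 finally show ?thesis .
qed

definition ladder_mean :: "real => real => R2 => real => (R2 => complex) => complex" where
 "ladder_mean al be y K H = (LINT z|lborel. cor (gaussian al (fst z)) * cor (gaussian be (snd z))
  * (iexp (2 * (y \<bullet> fst z)) * ((K + H (fst z + snd z)) * cnj (K + H (snd z - fst z)))))"

text \<open>The pointwise limits are averaged over the initial condition by dominated convergence,
  with the Dyson bound uniform in \<open>n\<close>. \<open>K0 * K0\<close> is the product of the
  atoms at time 0 and sets the normalisation. The subtracted mean has no scattered field, and so
  equals the atom-atom part of either ladder.\<close>

lemma refocused_limit_sequence:
 fixes C :: "R2 => real" and aA aB :: "R2 => real => R2 => complex"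
 assumes c: "c > 0" and \<omega>0: "\<omega>0 > 0" and r: "r > 0" and \<rho>: "\<rho> > 0" and L: "L > 0"
  and F: "integrable lborel (fourier C)" and real_F: "!!k. cnj (fourier C k) = fourier C k"
  and Cinv: "!!x. cor (C x) = (LINT k|lborel. fourier C k * iexp (k \<bullet> x)) / cor ((2 * pi) ^ DIM(R2))"
  and eps0: "!!n. eps n > 0" and eps: "eps \<longlonglongrightarrow> 0" and wp: "!!n. \<omega>0 + eps n * \<Omega> > 0" and wm: "!!n. \<omega>0 - eps n * \<Omega> > 0"
  and M: "!!n. refocused_second_moment c (%x. eps n * C x) (r / eps n) (\<rho> / eps n) (\<omega>0 + eps n * \<Omega>) (\<omega>0 - eps n * \<Omega>) (Etr2 (eps n))"
  and KL: "fwd_atom (cor (\<omega>0\<^sup>2 / (4 * (2 * pi)\<^sup>2 * c\<^sup>2))) (fourier C) (cor K0) L = cor K"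
  and dA: "!!ze. fwd_density (cor (\<omega>0\<^sup>2 / (4 * (2 * pi)\<^sup>2 * c\<^sup>2))) (fourier C) (cor K0) (phase (c * \<Omega> / \<omega>0\<^sup>2) (c / \<omega>0) ze) L BA (aA ze)"
  and dB: "!!ze. fwd_density (cor (\<omega>0\<^sup>2 / (4 * (2 * pi)\<^sup>2 * c\<^sup>2))) (fourier C) (cor K0) (phase 0 (c / \<omega>0) ze) L BB (aB ze)"
  and HA: "!!ze. HA ze = (LINT \<xi>|lborel. aA ze L \<xi> * iexp (x \<bullet> \<xi> - L * phase (c * \<Omega> / \<omega>0\<^sup>2) (c / \<omega>0) ze \<xi>))"
  and HB: "!!ze. HB ze = (LINT \<xi>|lborel. aB ze L \<xi> * iexp (0 \<bullet> \<xi> - L * phase 0 (c / \<omega>0) ze \<xi>))"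
  and HAm[measurable]: "HA \<in> borel_measurable borel" and HBm[measurable]: "HB \<in> borel_measurable borel"
  and HAb: "!!ze. cmod (HA ze) \<le> BA" and HBb: "!!ze. cmod (HB ze) \<le> BB"
 shows "(%n. cor (K0 * K0) * Etr2 (eps n) (L / eps n) (y /\<^sub>R eps n + x) (y /\<^sub>R eps n))
  \<longlonglongrightarrow> ladder_mean (r\<^sup>2) (r\<^sup>2) y K HA + ladder_mean (r\<^sup>2) (\<rho>\<^sup>2) y K HB - ladder_mean (r\<^sup>2) (r\<^sup>2) y K (%_. 0)"
proof -
 let ?F = "fourier C"
 let ?w = "%n. \<omega>0 + eps n * \<Omega>" and ?w' = "%n. \<omega>0 - eps n * \<Omega>"
 let ?S = "%n p. free_symbol c (?w n) (?w' n) (?w' n) (?w n) p / eps n"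
 let ?sig = "%n j. cor (coupling (?w n) (?w' n) (?w' n) (?w n) j / (4 * c\<^sup>2 * (2 * pi)\<^sup>2))"
 let ?X = "%n. (y /\<^sub>R eps n + x, y /\<^sub>R eps n, y /\<^sub>R eps n, y /\<^sub>R eps n + x)"
 let ?f = "%n p. iexp (p \<bullet> ?X n) * iexp (- (L * ?S n p))"
 let ?den = "4 * c\<^sup>2 * (2 * pi)\<^sup>2"
 let ?N = "LINT k|lborel. cmod (?F k)"
 let ?ka = "cor (\<omega>0\<^sup>2 / (4 * (2 * pi)\<^sup>2 * c\<^sup>2))"
 have den: "?den > 0" using c by simp
 \<comment> \<open>The two frequencies are positive with sum \<open>2 * \<omega>0\<close>, so
   neither exceeds \<open>2 * \<omega>0\<close> and each of the seven couplings has modulus at most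
   \<open>8 * \<omega>0\<^sup>2\<close>, whatever \<open>n\<close>. The added 1 makes
   \<open>\<Lambda>\<close> positive.\<close>
 define \<Lambda> where "\<Lambda> = 7 * (8 * \<omega>0\<^sup>2 / ?den) * ?N + 1"
 have \<Lambda>0: "\<Lambda> > 0" unfolding \<Lambda>_def using den by (intro add_nonneg_pos mult_nonneg_nonneg divide_nonneg_pos) auto
 have \<Lambda>: "(\<Sum>j\<in>{..<7}. cmod (?sig n j)) * ?N \<le> \<Lambda>" for n
 proof -
  have sb: "cmod (?sig n j) \<le> 8 * \<omega>0\<^sup>2 / ?den" if "j \<in> {..<7}" for j
  proof -
   have "\<bar>coupling (?w n) (?w' n) (?w' n) (?w n) j\<bar> \<le> 8 * \<omega>0\<^sup>2"
    using that wp[of n] wm[of n] by (intro coupling_bound) auto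
   then have "\<bar>coupling (?w n) (?w' n) (?w' n) (?w n) j\<bar> / ?den \<le> 8 * \<omega>0\<^sup>2 / ?den" by (rule divide_right_mono) (use den in simp)
   then show ?thesis using den by (simp only: norm_of_real abs_divide abs_of_pos)
  qed
  have "(\<Sum>j\<in>{..<7}. cmod (?sig n j)) \<le> (\<Sum>j\<in>{..<7::nat}. 8 * \<omega>0\<^sup>2 / ?den)" by (rule sum_mono) (rule sb)
  also have "\<dots> = 7 * (8 * \<omega>0\<^sup>2 / ?den)" by (simp only: sum_constant card_lessThan of_nat_numeral)
  finally have "(\<Sum>j\<in>{..<7}. cmod (?sig n j)) \<le> 7 * (8 * \<omega>0\<^sup>2 / ?den)" .
  then have "(\<Sum>j\<in>{..<7}. cmod (?sig n j)) * ?N \<le> 7 * (8 * \<omega>0\<^sup>2 / ?den) * ?N" by (rule mult_right_mono) simp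
  then show ?thesis unfolding \<Lambda>_def by linarith
 qed
 have Sm[measurable]: "?S n \<in> borel_measurable borel" for n by measurable
 have fm: "?f n \<in> borel_measurable borel" for n by measurable
 have fb: "cmod (?f n p) \<le> 1" for n p unfolding norm_mult norm_exp_i_times by simp
 define D1 where "D1 = 2 * exp (2 * \<Lambda> * L)"
 \<comment> \<open>A dual solution is chosen for every \<open>n\<close>, all of them with the one
   bound \<open>D1\<close>.\<close>
 have "\<forall>n. \<exists>ps. (%(s, p). ps s p) \<in> borel_measurable (borel \<Otimes>\<^sub>M borel) \<and> (\<forall>s\<in>{0..L}. \<forall>p. cmod (ps s p) \<le> D1)
  \<and> (\<forall>s\<in>{0..L}. \<forall>p. ps s p = ?f n p + (LINT t:{s..L}|lborel. jump_gen {..<7} (?sig n) jump ?F (?S n) ps t p))"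
 proof
  fix n
  show "\<exists>ps. (%(s, p). ps s p) \<in> borel_measurable (borel \<Otimes>\<^sub>M borel) \<and> (\<forall>s\<in>{0..L}. \<forall>p. cmod (ps s p) \<le> D1)
  \<and> (\<forall>s\<in>{0..L}. \<forall>p. ps s p = ?f n p + (LINT t:{s..L}|lborel. jump_gen {..<7} (?sig n) jump ?F (?S n) ps t p))"
   unfolding D1_def
  proof (rule dyson_series[OF F Sm[of n] jump_measurable fm[of n] fb[where n=n] \<Lambda>[of n] \<Lambda>0, where L=L])
   fix ps assume 1: "(%(s, p). ps s p) \<in> borel_measurable (borel \<Otimes>\<^sub>M borel)"
    and 2: "!!s p. s \<in> {0..L} ==> cmod (ps s p) \<le> 2 * exp (2 * \<Lambda> * L)"
    and 3: "!!s p. s \<in> {0..L} ==> ps s p = ?f n p + (LINT t:{s..L}|lborel. jump_gen {..<7} (?sig n) jump ?F (?S n) ps t p)"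
   show "\<exists>ps. (%(s, p). ps s p) \<in> borel_measurable (borel \<Otimes>\<^sub>M borel) \<and> (\<forall>s\<in>{0..L}. \<forall>p. cmod (ps s p) \<le> 2 * exp (2 * \<Lambda> * L))
  \<and> (\<forall>s\<in>{0..L}. \<forall>p. ps s p = ?f n p + (LINT t:{s..L}|lborel. jump_gen {..<7} (?sig n) jump ?F (?S n) ps t p))"
    by (intro exI[of _ ps] conjI ballI allI 1) (fact 2, fact 3)
  qed
 qed
 from choice[OF this] obtain ps where ps: "\<forall>n. (%(s, p). ps n s p) \<in> borel_measurable (borel \<Otimes>\<^sub>M borel) \<and> (\<forall>s\<in>{0..L}. \<forall>p. cmod (ps n s p) \<le> D1)
  \<and> (\<forall>s\<in>{0..L}. \<forall>p. ps n s p = ?f n p + (LINT t:{s..L}|lborel. jump_gen {..<7} (?sig n) jump ?F (?S n) (ps n) t p))" by (rule exE) (rule that)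
 have psm[measurable]: "(%(s, p). ps n s p) \<in> borel_measurable (borel \<Otimes>\<^sub>M borel)" for n
  using ps[THEN spec, of n] by (rule conjunct1)
 have psb: "cmod (ps n s p) \<le> D1" if "s \<in> {0..L}" for n s p
  using ps[THEN spec, of n, THEN conjunct2, THEN conjunct1, THEN bspec, OF that] by (rule spec)
 have pse: "ps n s p = ?f n p + (LINT t:{s..L}|lborel. jump_gen {..<7} (?sig n) jump ?F (?S n) (ps n) t p)" if "s \<in> {0..L}" for n s p
  using ps[THEN spec, of n, THEN conjunct2, THEN conjunct2, THEN bspec, OF that] by (rule spec)
 have LL: "L \<in> {0..L}" and L0: "L \<ge> 0" and O0: "0 \<in> {0..L}" using L by auto
 have terminal: "ps n L p = ?f n p" for n p using pse[OF LL, of n p] unfolding set_integral_singleton by simp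
 have D10: "D1 \<ge> 0" unfolding D1_def by simp
 \<comment> \<open>One constant that dominates both the dual solutions and their generators.\<close>
 define D where "D = (1 + \<Lambda>) * D1"
 have DD: "D1 \<le> D" "\<Lambda> * D1 \<le> D" unfolding D_def using D10 \<Lambda>0 by (auto simp: distrib_right)
 have psb': "cmod (ps n s p) \<le> D" if "s \<in> {0..L}" for n s p by (rule order_trans[OF psb[OF that] DD(1)])
 have gb: "cmod (jump_gen {..<7} (?sig n) jump ?F (?S n) (ps n) s p) \<le> D" if "s \<in> {0..L}" for n s p
  by (rule order_trans[OF jump_gen_bound[where \<phi>="ps n" and b=D1 and \<Lambda>=\<Lambda>] DD(2)])
   (rule F Sm jump_measurable measurable_slice[OF psm] psb[OF that] \<Lambda>)+
 have pse': "ps n s p = ps n L p + (LINT t:{s..L}|lborel. jump_gen {..<7} (?sig n) jump ?F (?S n) (ps n) t p)" if "s \<in> {0..L}" for n s p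
  unfolding terminal by (rule pse[OF that])
 have wl: "?w \<longlonglongrightarrow> \<omega>0" "?w' \<longlonglongrightarrow> \<omega>0"
  using tendsto_add[OF tendsto_const tendsto_mult[OF eps tendsto_const], of \<omega>0 \<Omega>] tendsto_diff[OF tendsto_const tendsto_mult[OF eps tendsto_const], of \<omega>0 \<Omega>]
  by simp_all
 have sl: "(%n. ?sig n j) \<longlonglongrightarrow> cor (coupling \<omega>0 \<omega>0 \<omega>0 \<omega>0 j / ?den)" for j
 proof -
  have den0: "?den \<noteq> 0" using c by simp
  show ?thesis by (intro tendsto_of_real tendsto_divide tendsto_const coupling_tendsto wl den0)
 qed
 have \<sigma>b: "convergent (%n. ?sig n j)" for j using sl[of j] unfolding convergent_def by (rule exI)
 have \<sigma>6: "(%n. ?sig n 6) \<longlonglongrightarrow> - (2 * ?ka)"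
 proof -
  have "coupling \<omega>0 \<omega>0 \<omega>0 \<omega>0 6 / ?den = - (2 * (\<omega>0\<^sup>2 / (4 * (2 * pi)\<^sup>2 * c\<^sup>2)))" using c by (simp add: coupling_def field_simps)
  from arg_cong[OF this, of cor] have e: "cor (coupling \<omega>0 \<omega>0 \<omega>0 \<omega>0 6 / ?den) = - (2 * ?ka)"
   by (simp only: of_real_minus of_real_mult of_real_numeral)
  show ?thesis using sl[of 6] unfolding e .
 qed
 interpret sc: scintillation C L c \<omega>0 \<Omega> eps ps K0 D x y
  by unfold_locales (fact F L0 Sm psm psb' gb pse' \<sigma>6 \<sigma>b c \<omega>0 eps0 eps wp wm real_F terminal)+
 let ?W = "initial_weight (r\<^sup>2) (\<rho>\<^sup>2)"
 have r2: "r\<^sup>2 > 0" and \<rho>2: "\<rho>\<^sup>2 > 0" using r \<rho> by auto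
 have Wi: "integrable lborel ?W" by (rule initial_weight_integrable[OF r2 \<rho>2])
 have Wm[measurable]: "?W \<in> borel_measurable borel" using Wi by auto
 have ps0m[measurable]: "ps n 0 \<in> borel_measurable borel" for n by (rule measurable_slice[OF psm])
 have rep: "Etr2 (eps n) (L / eps n) (y /\<^sub>R eps n + x) (y /\<^sub>R eps n) = (LINT q|lborel. ?W q * ps n 0 (eps n *\<^sub>R hadamard q))" for n
 proof -
  let ?t = "eps n"
  have t0: "?t > 0" by (rule eps0)
  obtain Mn where Mn: "M2_mild_solution c (%x. ?t * C x) (r / ?t) (\<rho> / ?t) (?w n) (?w' n) (?w' n) (?w n) Mn"
   and E: "\<forall>L\<ge>0. \<forall>x y. Etr2 ?t L x y = Mn L (x, y, y, x)"
   using M[of n] unfolding refocused_second_moment_def by auto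
  \<comment> \<open>The transform of the initial condition with radii \<open>r / ?t\<close> and
    \<open>\<rho> / ?t\<close> is concentrated at scale \<open>?t\<close>, and the eighth power
    normalises it in dimension eight. Undoing the scaling evaluates the dual solution at
    \<open>?t *\<^sub>R p\<close>.\<close>
  define g where "g p = cor ((1 / ?t) ^ 8) * ?W (hadamard ((1 / ?t) *\<^sub>R p))" for p
  have sc: "(LINT p|lborel. g p * G p) = (LINT p|lborel. ?W (hadamard p) * G (?t *\<^sub>R p))" for G :: "R2x4 => complex"
  proof -
   have "(LINT p|lborel. g p * G p) = \<bar>?t\<bar> ^ DIM(R2x4) *\<^sub>R (LINT p|lborel. g (0 + ?t *\<^sub>R p) * G (0 + ?t *\<^sub>R p))"
    by (rule lborel_integral_affine(2)) (use t0 in simp)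
   also have "\<dots> = cor (?t ^ 8) * (LINT p|lborel. cor ((1 / ?t) ^ 8) * (?W (hadamard p) * G (?t *\<^sub>R p)))"
   proof -
    have e: "g (?t *\<^sub>R p) = cor ((1 / ?t) ^ 8) * ?W (hadamard p)" for p
     unfolding g_def scaleR_scaleR using t0 by simp
    have d: "\<bar>?t\<bar> ^ DIM(R2x4) = ?t ^ 8" using t0 by simp
    show ?thesis unfolding add_0_left e d scaleR_conv_of_real mult.assoc ..
   qed
   also have "\<dots> = (LINT p|lborel. ?W (hadamard p) * G (?t *\<^sub>R p))"
   proof -
    have one: "?t ^ 8 * (1 / ?t) ^ 8 = (1::real)" unfolding power_mult_distrib[symmetric] using t0 by simp
    have o: "cor (?t ^ 8) * cor ((1 / ?t) ^ 8) = 1" unfolding of_real_mult[symmetric] one by (rule of_real_1)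
    have "cor (?t ^ 8) * (cor ((1 / ?t) ^ 8) * z) = z" for z
     unfolding mult.assoc[symmetric] o by (rule mult_1_left)
    then show ?thesis unfolding integral_mult_right_zero .
   qed
   finally show ?thesis .
  qed
  have gi: "integrable lborel g"
  proof -
   have i: "integrable lborel (%p. ?W (hadamard ((1 / ?t) *\<^sub>R p)))"
    using lborel_integral_affine(1)[where f="%p. ?W (hadamard p)" and t=0 and c="1 / ?t"] M2_initial_fourier(2)[OF r \<rho>] t0 by simp
   show ?thesis unfolding g_def by (rule integrable_mult_right[OF i])
  qed
  have gf: "cor (M2_initial (r / ?t) (\<rho> / ?t) X) = (LINT p|lborel. g p * iexp (p \<bullet> X))" for X
   unfolding M2_initial_scale[OF t0] M2_initial_fourier(1)[OF r \<rho>] sc by simp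
  have "Etr2 ?t (L / ?t) (y /\<^sub>R ?t + x) (y /\<^sub>R ?t) = Mn (L / ?t) (?X n)" using E t0 L by simp
  also have "\<dots> = (LINT p|lborel. g p * ps n 0 p)"
  proof (rule M2_dual_representation[OF c t0 L F Cinv Mn, where S="?S n" and \<sigma>="?sig n" and g=g and B=D1])
  qed (fact psm psb pse gi gf | rule refl)+
  also have "\<dots> = (LINT p|lborel. ?W (hadamard p) * ps n 0 (?t *\<^sub>R p))" by (rule sc)
  \<comment> \<open>Inserting the involution makes the integrand a function of
    \<open>hadamard p\<close>, to which invariance of \<open>lborel\<close> applies.\<close>
  also have "\<dots> = (LINT p|lborel. ?W (hadamard p) * ps n 0 (?t *\<^sub>R hadamard (hadamard p)))" unfolding hadamard_involution ..
  also have "\<dots> = (LINT q|lborel. ?W q * ps n 0 (?t *\<^sub>R hadamard q))"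
   by (rule lborel_integral_distr(2)[OF distr_hadamard hadamard_measurable, where f="%q. ?W q * ps n 0 (?t *\<^sub>R hadamard q)"]) measurable
  finally show ?thesis .
 qed
 define \<Phi> where "\<Phi> H z = iexp (2 * (y \<bullet> fst z)) * ((K + H (fst z + snd z)) * cnj (K + H (snd z - fst z)))" for H :: "R2 => complex" and z :: "R2 \<times> R2"
 note cnj_measurable[measurable]
 have \<Phi>m[measurable]: "\<Phi> H \<in> borel_measurable borel" if [measurable]: "H \<in> borel_measurable borel" for H
  unfolding \<Phi>_def by measurable
 have \<Phi>b: "cmod (\<Phi> H z) \<le> (\<bar>K\<bar> + b) * (\<bar>K\<bar> + b)" if b: "!!ze. cmod (H ze) \<le> b" for H z b
 proof -
  have "cmod (K + H ze) \<le> \<bar>K\<bar> + b" for ze using norm_triangle_ineq[of "cor K" "H ze"] b[of ze] by simp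
  from this this order_trans[OF norm_ge_zero this]
  show ?thesis unfolding \<Phi>_def norm_mult complex_mod_cnj norm_exp_i_times mult_1_left by (rule mult_mono) simp
 qed
 define \<Psi> where "\<Psi> q = \<Phi> HA (fst q, fst (snd q)) + \<Phi> HB (fst q, snd (snd (snd q))) - \<Phi> (%_. 0) (fst q, fst (snd q))" for q :: R2x4
 have pl: "(%n. cor (K0 * K0) * ps n 0 (eps n *\<^sub>R hadamard q)) \<longlonglongrightarrow> \<Psi> q" for q
 proof -
  obtain a1 a2 b1 b2 where h: "hadamard q = (a1, a2, b1, b2)" by (cases "hadamard q") auto
  note p = sc.pointwise_limit[where aA=aA and aB=aB and HA=HA and HB=HB, OF h dA dB HA HB, unfolded KL hadamard_sums[OF h]]
  have y: "y \<bullet> (2 *\<^sub>R fst q) = 2 * (y \<bullet> fst q)" by simp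
  have e: "iexp (y \<bullet> (2 *\<^sub>R fst q)) * ((K + HA (fst q + fst (snd q))) * cnj (K + HA (fst (snd q) - fst q))
    + (K + HB (fst q + snd (snd (snd q)))) * cnj (K + HB (snd (snd (snd q)) - fst q)) - cor K * cor K) = \<Psi> q"
   unfolding \<Psi>_def \<Phi>_def fst_conv snd_conv y by (simp add: algebra_simps)
  show ?thesis using p unfolding e of_real_mult .
 qed
 have z0: "(%_. 0) \<in> borel_measurable (borel :: R2 measure)" "!!ze::R2. cmod 0 \<le> 0" by auto
 note mA = initial_weight_marginals[OF r2 \<rho>2 \<Phi>m[OF HAm] \<Phi>b[OF HAb]]
 note mB = initial_weight_marginals[OF r2 \<rho>2 \<Phi>m[OF HBm] \<Phi>b[OF HBb]]
 note m0 = initial_weight_marginals[OF r2 \<rho>2 \<Phi>m[OF z0(1)] \<Phi>b[where b=0]]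
 have m0': "integrable lborel (%q. ?W q * \<Phi> (%_. 0) (fst q, fst (snd q)))"
  "(LINT q|lborel. ?W q * \<Phi> (%_. 0) (fst q, fst (snd q))) = (LINT z|lborel. cor (gaussian (r\<^sup>2) (fst z)) * cor (gaussian (r\<^sup>2) (snd z)) * \<Phi> (%_. 0) z)"
  by (rule m0(1), simp) (rule m0(3), simp)
 have \<Psi>m[measurable]: "\<Psi> \<in> borel_measurable borel"
 proof -
  have [measurable]: "\<Phi> HA \<in> borel_measurable borel" "\<Phi> HB \<in> borel_measurable borel" "\<Phi> (%_. 0) \<in> borel_measurable borel"
   by (rule \<Phi>m[OF HAm] \<Phi>m[OF HBm] \<Phi>m[OF z0(1)])+
  show ?thesis unfolding \<Psi>_def by measurable
 qed
 have l1: "(%n. LINT q|lborel. ?W q * (cor (K0 * K0) * ps n 0 (eps n *\<^sub>R hadamard q))) \<longlonglongrightarrow> (LINT q|lborel. ?W q * \<Psi> q)"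
 proof (rule mult_bounded_tendsto[OF Wi])
  show "cmod (cor (K0 * K0) * ps n 0 (eps n *\<^sub>R hadamard q)) \<le> \<bar>K0 * K0\<bar> * D1" for n q
   unfolding norm_mult norm_of_real by (rule mult_left_mono[OF psb[OF O0]]) simp
  show "(%q. cor (K0 * K0) * ps n 0 (eps n *\<^sub>R hadamard q)) \<in> borel_measurable lborel" for n by measurable
  show "\<Psi> \<in> borel_measurable lborel" using \<Psi>m by simp
  show "(%n. cor (K0 * K0) * ps n 0 (eps n *\<^sub>R hadamard q)) \<longlonglongrightarrow> \<Psi> q" for q by (rule pl)
 qed
 have l2: "(LINT q|lborel. ?W q * (cor (K0 * K0) * ps n 0 (eps n *\<^sub>R hadamard q)))
   = cor (K0 * K0) * Etr2 (eps n) (L / eps n) (y /\<^sub>R eps n + x) (y /\<^sub>R eps n)" for n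
  unfolding rep integral_mult_right_zero[symmetric] by (simp only: mult.left_commute)
 have l3: "(LINT q|lborel. ?W q * \<Psi> q) = ladder_mean (r\<^sup>2) (r\<^sup>2) y K HA + ladder_mean (r\<^sup>2) (\<rho>\<^sup>2) y K HB - ladder_mean (r\<^sup>2) (r\<^sup>2) y K (%_. 0)"
 proof -
  have "(LINT q|lborel. ?W q * \<Psi> q) = (LINT q|lborel. ?W q * \<Phi> HA (fst q, fst (snd q)) + ?W q * \<Phi> HB (fst q, snd (snd (snd q))) - ?W q * \<Phi> (%_. 0) (fst q, fst (snd q)))"
   unfolding \<Psi>_def by (simp only: distrib_left right_diff_distrib)
  also have "\<dots> = (LINT q|lborel. ?W q * \<Phi> HA (fst q, fst (snd q))) + (LINT q|lborel. ?W q * \<Phi> HB (fst q, snd (snd (snd q)))) - (LINT q|lborel. ?W q * \<Phi> (%_. 0) (fst q, fst (snd q)))"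
   by (subst Bochner_Integration.integral_diff[OF Bochner_Integration.integrable_add[OF mA(1) mB(2)] m0'(1)],
     subst Bochner_Integration.integral_add[OF mA(1) mB(2)]) (rule refl)
  finally show ?thesis unfolding mA(3) mB(4) m0'(2) unfolding ladder_mean_def \<Phi>_def .
 qed
 show ?thesis using l1 unfolding l2 l3 .
qed

section \<open>Identification of the five terms of the limit\<close>

lemma exp_split: "exp (cor p + \<i> * cor q) = cor (exp p) * iexp q"
 by (simp only: exp_add exp_of_real)

lemma ladder_kernel_eq:
 assumes al: "al > 0" and be: "be > 0"
 shows "ladder_kernel al be y ze = cor (al * be / (2 * pi * (al + be)))
  * exp (cor (- (al * be * (norm ze)\<^sup>2 / (2 * (al + be))) - 2 * (norm y)\<^sup>2 / (al + be)) + \<i> * cor (2 * be / (al + be) * (y \<bullet> ze)))"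
proof -
 have s: "al * be / (al + be) > 0" using al be by simp
 have e: "exp (- (al * be * (norm ze)\<^sup>2 / (2 * (al + be))) - 2 * (norm y)\<^sup>2 / (al + be))
  = exp (- (al * be / (al + be) * (norm ze)\<^sup>2 / 2)) * exp (- (2 * (norm y)\<^sup>2 / (al + be)))"
  unfolding exp_add[symmetric] by (simp add: mult.commute)
 have k: "al * be / (2 * pi * (al + be)) = al * be / (al + be) / (2 * pi)" by (simp add: mult.commute)
 show ?thesis unfolding ladder_kernel_def gaussian_R2[OF s] exp_split e k by (simp only: of_real_mult mult_ac)
qed

lemma ladder_term:
 assumes al: "al > 0" and be: "be > 0"
  and k: "k = al * be / (2 * pi * (al + be))"
  and w: "w = cor (- (al * be * (norm ze)\<^sup>2 / (2 * (al + be))) - 2 * (norm y)\<^sup>2 / (al + be))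
   + \<i> * cor (2 * be / (al + be) * (y \<bullet> ze)) + \<i> * cor t"
 shows "cor k * exp w * a = ladder_kernel al be y ze * (a * iexp t)"
 unfolding ladder_kernel_eq[OF al be] k w exp_add[of _ "\<i> * cor t"] by (simp only: mult_ac)

lemma ladder_pair_kernel_eq:
 assumes al: "al > 0" and be: "be > 0"
 shows "ladder_pair_kernel al be y (a, b) = cor (al * be / (4 * pi)\<^sup>2)
  * exp (cor (- ((al + be) / 8 * ((norm a)\<^sup>2 + (norm b)\<^sup>2)) + (al - be) / 4 * (a \<bullet> b))) * iexp (y \<bullet> (a - b))"
proof -
 have n: "(norm ((1/2) *\<^sub>R (a - b)))\<^sup>2 = ((norm a)\<^sup>2 - 2 * (a \<bullet> b) + (norm b)\<^sup>2) / 4"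
  "(norm ((1/2) *\<^sub>R (a + b)))\<^sup>2 = ((norm a)\<^sup>2 + 2 * (a \<bullet> b) + (norm b)\<^sup>2) / 4"
  by (simp_all add: power2_norm_eq_inner inner_add_left inner_add_right inner_diff_left inner_diff_right inner_commute field_simps)
 have x: "- (al * ((A - 2 * I + B) / 4) / 2) + - (be * ((A + 2 * I + B) / 4) / 2) = - ((al + be) / 8 * (A + B)) + (al - be) / 4 * I" for A B I :: real
  by (simp add: field_simps)
 have "gaussian al ((1/2) *\<^sub>R (a - b)) * gaussian be ((1/2) *\<^sub>R (a + b)) / 4
  = (al / (2 * pi) * (be / (2 * pi)) / 4) * (exp (- (al * (norm ((1/2) *\<^sub>R (a - b)))\<^sup>2 / 2)) * exp (- (be * (norm ((1/2) *\<^sub>R (a + b)))\<^sup>2 / 2)))"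
  unfolding gaussian_R2[OF al] gaussian_R2[OF be] by simp
 also have "\<dots> = al * be / (4 * pi)\<^sup>2 * exp (- ((al + be) / 8 * ((norm a)\<^sup>2 + (norm b)\<^sup>2)) + (al - be) / 4 * (a \<bullet> b))"
  unfolding exp_add[symmetric] n x by (simp add: power2_eq_square)
 finally show ?thesis unfolding ladder_pair_kernel_def fst_conv snd_conv by (simp only: of_real_mult exp_of_real)
qed

text \<open>For equal precisions the sum and the difference of the two vectors are independent: the
  cross term \<open>a \<bullet> b\<close> disappears and the kernel factorises. The factor with
  \<open>norm y\<close> undoes the damping built into \<open>ladder_kernel\<close>.\<close>

lemma ladder_pair_kernel_diagonal:
 assumes al: "al > 0"
 shows "ladder_pair_kernel al al y (a, b) = (cor (exp ((norm y)\<^sup>2 / al)) * ladder_kernel al al y a) * cnj (cor (exp ((norm y)\<^sup>2 / al)) * ladder_kernel al al y b)"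
proof -
 have f: "cor (exp ((norm y)\<^sup>2 / al)) * ladder_kernel al al y ze = cor (al / (4 * pi) * exp (- (al * (norm ze)\<^sup>2 / 4))) * iexp (y \<bullet> ze)" for ze
 proof -
  have c: "al * al / (2 * pi * (al + al)) = al / (4 * pi)" "al * al * n / (2 * (al + al)) = al * n / 4" "2 * (norm y)\<^sup>2 / (al + al) = (norm y)\<^sup>2 / al" "2 * al / (al + al) * m = m" for n m
   using al by (simp_all add: field_simps)
  have "exp ((norm y)\<^sup>2 / al) * exp (- (al * (norm ze)\<^sup>2 / 4) - (norm y)\<^sup>2 / al) = exp (- (al * (norm ze)\<^sup>2 / 4))"
   unfolding exp_add[symmetric] by simp
  then have h: "cor (exp ((norm y)\<^sup>2 / al)) * cor (exp (- (al * (norm ze)\<^sup>2 / 4) - (norm y)\<^sup>2 / al)) = cor (exp (- (al * (norm ze)\<^sup>2 / 4)))"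
   by (simp only: of_real_mult[symmetric])
  have alg: "u * (k * (e * q)) = (k * e') * q" if "u * e = e'" for u k e e' q :: complex
   unfolding that[symmetric] by (simp only: mult_ac)
  from h show ?thesis unfolding ladder_kernel_eq[OF al al] exp_split c of_real_mult[of "al / (4 * pi)"] by (rule alg)
 qed
 have x: "exp (- ((al + al) / 8 * ((norm a)\<^sup>2 + (norm b)\<^sup>2)) + (al - al) / 4 * (a \<bullet> b)) = exp (- (al * (norm a)\<^sup>2 / 4)) * exp (- (al * (norm b)\<^sup>2 / 4))"
  unfolding exp_add[symmetric] by (simp add: field_simps)
 have k: "al * al / (4 * pi)\<^sup>2 = al / (4 * pi) * (al / (4 * pi))" by (simp add: power2_eq_square)
 have y: "iexp (y \<bullet> (a - b)) = iexp (y \<bullet> a) * cnj (iexp (y \<bullet> b))" unfolding cnj_iexp iexp_mult by (simp add: inner_diff_right)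
 show ?thesis unfolding f ladder_pair_kernel_eq[OF al al] exp_of_real x k y complex_cnj_mult complex_cnj_complex_of_real
  by (simp only: of_real_mult mult_ac)
qed

text \<open>After factorisation the double integral is a number times its conjugate; this is the
  origin of the squared modulus in the limit.\<close>

lemma ladder_pair_diagonal_integral:
 assumes al: "al > 0" and Hm[measurable]: "H \<in> borel_measurable borel" and b: "!!ze. cmod (H ze) \<le> B"
 shows "(LINT z|lborel. ladder_pair_kernel al al y z * (H (fst z) * cnj (H (snd z))))
  = cor ((cmod (cor (exp ((norm y)\<^sup>2 / al)) * (LINT ze|lborel. ladder_kernel al al y ze * H ze)))\<^sup>2)"
proof -
 let ?e = "cor (exp ((norm y)\<^sup>2 / al))"
 let ?f = "%ze. ?e * (ladder_kernel al al y ze * H ze)"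
 have i: "integrable lborel ?f"
  by (intro integrable_mult_right mult_bounded_integrable(1)[OF ladder_kernel_integrable[OF al al], where B=B]) (use b in auto)
 have ic: "integrable lborel (%ze. cnj (?f ze))" by (rule integrable_cnj[OF i])
 have "(LINT z|lborel. ladder_pair_kernel al al y z * (H (fst z) * cnj (H (snd z)))) = (LINT z|lborel. ?f (fst z) * cnj (?f (snd z)))"
 proof (rule Bochner_Integration.integral_cong[OF refl])
  fix z :: "R2 \<times> R2"
  have "ladder_pair_kernel al al y z = ladder_pair_kernel al al y (fst z, snd z)" by simp
  then show "ladder_pair_kernel al al y z * (H (fst z) * cnj (H (snd z))) = ?f (fst z) * cnj (?f (snd z))"
   unfolding ladder_pair_kernel_diagonal[OF al] by (simp only: complex_cnj_mult mult_ac)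
 qed
 also have "\<dots> = (LINT ze|lborel. ?f ze) * cnj (LINT ze|lborel. ?f ze)"
  unfolding lborel_tensor(2)[OF i ic] Bochner_Integration.integral_cnj ..
 also have "(LINT ze|lborel. ?f ze) = ?e * (LINT ze|lborel. ladder_kernel al al y ze * H ze)" by (rule integral_mult_right_zero)
 finally show ?thesis unfolding complex_norm_square .
qed

text \<open>A product of two inner integrals is one integral over pairs, so
  \<open>integral_kernel_swap\<close> applies with pairs as variables; reassociating the tuple gives
  the order of variables in the last term of the limit.\<close>

lemma ladder_pair_integral:
 fixes a :: "R2 => R2 => complex"
 assumes al: "al > 0" and be: "be > 0" and am[measurable]: "(%(\<xi>, ze). a \<xi> ze) \<in> borel_measurable (borel \<Otimes>\<^sub>M borel)"
  and a: "!!ze. integrable lborel (%\<xi>. a \<xi> ze)" "!!ze. (LINT \<xi>|lborel. cmod (a \<xi> ze)) \<le> B"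
 shows "(LINT z|lborel. ladder_pair_kernel al be y z * ((LINT \<xi>|lborel. a \<xi> (fst z)) * cnj (LINT \<xi>|lborel. a \<xi> (snd z))))
  = (LINT (\<xi>a, \<xi>b, zea, zeb)|lborel. ladder_pair_kernel al be y (zea, zeb) * (a \<xi>a zea * cnj (a \<xi>b zeb)))"
proof -
 note cnj_measurable[measurable]
 let ?k = "ladder_pair_kernel al be y"
 let ?b = "%\<xi> ze. a (fst \<xi>) (fst ze) * cnj (a (snd \<xi>) (snd ze))"
 have k: "integrable lborel ?k"
  using rotated_expectation(1)[OF al be, where H="%_. 1" and b=1] by simp
 have ic: "integrable lborel (%\<xi>. cnj (a \<xi> ze))" for ze by (rule integrable_cnj[OF a(1)])
 have bm: "(%(\<xi>, ze). ?b \<xi> ze) \<in> borel_measurable ((borel :: (R2 \<times> R2) measure) \<Otimes>\<^sub>M (borel :: (R2 \<times> R2) measure))"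
  unfolding case_prod_beta' by measurable
 have bi: "integrable lborel (%\<xi>. ?b \<xi> ze)" for ze by (rule lborel_tensor(1)[OF a(1) ic])
 have bB: "(LINT \<xi>|lborel. cmod (?b \<xi> ze)) \<le> B * B" for ze :: "R2 \<times> R2"
 proof -
  have "cor (LINT \<xi>|lborel. cmod (?b \<xi> ze)) = (LINT \<xi>|lborel. cor (cmod (a (fst \<xi>) (fst ze))) * cor (cmod (a (snd \<xi>) (snd ze))))"
   unfolding integral_complex_of_real[symmetric] norm_mult complex_mod_cnj of_real_mult ..
  also have "\<dots> = (LINT \<xi>|lborel. cor (cmod (a \<xi> (fst ze)))) * (LINT \<xi>|lborel. cor (cmod (a \<xi> (snd ze))))"
   by (rule lborel_tensor(2)) (intro integrable_of_real integrable_norm a(1))+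
  finally have "(LINT \<xi>|lborel. cmod (?b \<xi> ze)) = (LINT \<xi>|lborel. cmod (a \<xi> (fst ze))) * (LINT \<xi>|lborel. cmod (a \<xi> (snd ze)))"
   unfolding integral_complex_of_real of_real_mult[symmetric] of_real_eq_iff .
  moreover have "B \<ge> 0" by (rule order_trans[OF _ a(2)[of 0]]) simp
  ultimately show ?thesis using mult_mono[OF a(2)[of "fst ze"] a(2)[of "snd ze"]] by simp
 qed
 have bv: "(LINT \<xi>|lborel. ?b \<xi> z) = (LINT \<xi>|lborel. a \<xi> (fst z)) * cnj (LINT \<xi>|lborel. a \<xi> (snd z))" for z
  unfolding lborel_tensor(2)[OF a(1) ic] Bochner_Integration.integral_cnj ..
 have m: "(%(a, b, u). ((a, b), u)) \<in> (borel :: R2x4 measure) \<rightarrow>\<^sub>M (borel :: ((R2 \<times> R2) \<times> (R2 \<times> R2)) measure)"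
  unfolding case_prod_beta' by (intro borel_measurable_continuous_onI continuous_intros)
 have fm: "(%w. ?k (snd w) * ?b (fst w) (snd w)) \<in> borel_measurable borel"
  using integral_kernel_swap(1)[OF k bm bi bB] by auto
 have "(LINT z|lborel. ?k z * ((LINT \<xi>|lborel. a \<xi> (fst z)) * cnj (LINT \<xi>|lborel. a \<xi> (snd z)))) = (LINT w|lborel. ?k (snd w) * ?b (fst w) (snd w))"
  unfolding integral_kernel_swap(2)[OF k bm bi bB, symmetric] bv ..
 also have "\<dots> = (LINT p|lborel. (%w. ?k (snd w) * ?b (fst w) (snd w)) (case p of (a, b, u) => ((a, b), u)))"
  by (rule lborel_integral_distr(2)[OF distr_reassoc m fm, symmetric])
 also have "\<dots> = (LINT (\<xi>a, \<xi>b, zea, zeb)|lborel. ?k (zea, zeb) * (a \<xi>a zea * cnj (a \<xi>b zeb)))"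
  by (rule Bochner_Integration.integral_cong[OF refl]) auto
 finally show ?thesis .
qed

theorem proposition6p2:
  fixes c \<omega>0 r0 \<rho>0 L \<Omega> :: real
    and C :: "R2 \<Rightarrow> real"
    and x y :: R2
    and A :: "real \<Rightarrow> R2 \<Rightarrow> R2 \<Rightarrow> real \<Rightarrow> complex"
    and Etr2 :: "real \<Rightarrow> real \<Rightarrow> R2 \<Rightarrow> R2 \<Rightarrow> complex"
  assumes "c > 0" "\<omega>0 > 0" "r0 > 0" "\<rho>0 > 0" "L > 0"
    and "\<And>x. C (- x) = C x"
    and "continuous_on UNIV C"
    and "integrable lborel C"
    and "\<And>k. fourier C k \<in> \<real>\<^sub>\<ge>\<^sub>0"
    and "integrable lborel (fourier C)"
    and "\<forall>\<^sub>F \<epsilon> in at_right 0. refocused_second_moment c (\<lambda>x. \<epsilon> * C x) (r0 / \<epsilon>) (\<rho>0 / \<epsilon>)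
           (\<omega>0 + \<epsilon> * \<Omega>) (\<omega>0 - \<epsilon> * \<Omega>) (Etr2 \<epsilon>)"
    and "A_mild_solution c C \<omega>0 A"
  shows "((\<lambda>\<epsilon>. Etr2 \<epsilon> (L / \<epsilon>) (y /\<^sub>R \<epsilon> + x) (y /\<^sub>R \<epsilon>)) \<longlongrightarrow>
      complex_of_real ((K_fun c C \<omega>0 L)\<^sup>2 / (2 * pi) ^ 8)
        * (LINT \<zeta>|lborel. complex_of_real (r0\<^sup>2 / (2 * pi))
            * exp (complex_of_real (- (r0\<^sup>2 * (norm \<zeta>)\<^sup>2 / 2)) + 2 * \<i> * complex_of_real (y \<bullet> \<zeta>)))
    + complex_of_real (2 * K_fun c C \<omega>0 L / (2 * pi) ^ 8
        * Re (LINT (\<xi>, \<zeta>)|lborel. complex_of_real (r0\<^sup>2 / (4 * pi))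
            * exp (complex_of_real (- (r0\<^sup>2 * (norm \<zeta>)\<^sup>2 / 4))
                + \<i> * complex_of_real (x \<bullet> \<xi>) + \<i> * complex_of_real (y \<bullet> \<zeta>)
                - complex_of_real ((norm y)\<^sup>2 / r0\<^sup>2)
                - \<i> * complex_of_real (L * c / \<omega>0 * (\<xi> \<bullet> \<zeta>)))
            * A L \<xi> \<zeta> \<Omega>))
    + complex_of_real (2 * K_fun c C \<omega>0 L / (2 * pi) ^ 8
        * Re (LINT (\<xi>, \<zeta>)|lborel. complex_of_real (\<rho>0\<^sup>2 * r0\<^sup>2 / (2 * pi * (\<rho>0\<^sup>2 + r0\<^sup>2)))
            * exp (complex_of_real (- (r0\<^sup>2 * \<rho>0\<^sup>2 * (norm \<zeta>)\<^sup>2 / (2 * (r0\<^sup>2 + \<rho>0\<^sup>2))))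
                + \<i> * complex_of_real (2 * \<rho>0\<^sup>2 / (r0\<^sup>2 + \<rho>0\<^sup>2) * (y \<bullet> \<zeta>))
                - complex_of_real (2 * (norm y)\<^sup>2 / (r0\<^sup>2 + \<rho>0\<^sup>2))
                - \<i> * complex_of_real (L * c / \<omega>0 * (\<xi> \<bullet> \<zeta>)))
            * A L \<xi> \<zeta> 0))
    + complex_of_real ((cmod (1 / (2 * pi) ^ 4
        * (LINT (\<xi>, \<zeta>)|lborel. complex_of_real (r0\<^sup>2 / (4 * pi))
            * exp (complex_of_real (- (r0\<^sup>2 * (norm \<zeta>)\<^sup>2 / 4))
                + \<i> * complex_of_real (x \<bullet> \<xi>) + \<i> * complex_of_real (y \<bullet> \<zeta>)
                - \<i> * complex_of_real (L * c / \<omega>0 * (\<xi> \<bullet> \<zeta>)))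
            * A L \<xi> \<zeta> \<Omega>)))\<^sup>2)
    + complex_of_real (1 / (2 * pi) ^ 8)
        * (LINT (\<xi>a, \<xi>b, \<zeta>a, \<zeta>b)|lborel. complex_of_real (r0\<^sup>2 * \<rho>0\<^sup>2 / (4 * pi)\<^sup>2)
            * exp (complex_of_real (- ((r0\<^sup>2 + \<rho>0\<^sup>2) / 8 * ((norm \<zeta>a)\<^sup>2 + (norm \<zeta>b)\<^sup>2))
                + (r0\<^sup>2 - \<rho>0\<^sup>2) / 4 * (\<zeta>a \<bullet> \<zeta>b)))
            * exp (\<i> * complex_of_real (y \<bullet> (\<zeta>a - \<zeta>b))
                - \<i> * complex_of_real (L * c / \<omega>0 * (\<xi>a \<bullet> \<zeta>a - \<xi>b \<bullet> \<zeta>b)))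
            * A L \<xi>a \<zeta>a 0 * cnj (A L \<xi>b \<zeta>b 0)))
    (at_right 0)"
proof -
 let ?F = "fourier C"
 define ka where "ka = \<omega>0\<^sup>2 / (4 * (2 * pi)\<^sup>2 * c\<^sup>2)"
 define K0 :: real where "K0 = (2 * pi) ^ 4"
 define K where "K = K_fun c C \<omega>0 L"
 define h where "h = c / \<omega>0"
 note c = assms(1) and \<omega>0 = assms(2) and r0 = assms(3) and \<rho>0 = assms(4) and L = assms(5)
 have L0: "L \<ge> 0" "L \<in> {0..L}" using L by auto
 have al: "r0\<^sup>2 > 0" and be: "\<rho>0\<^sup>2 > 0" using r0 \<rho>0 by auto
 have F: "integrable lborel ?F" by (rule assms(10))
 have real_F: "cnj (?F k) = ?F k" for k
  using assms(9)[of k] by (simp add: complex_nonneg_Reals_iff complex_eq_iff)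
 have Cinv: "cor (C x) = (LINT k|lborel. ?F k * iexp (k \<bullet> x)) / cor ((2 * pi) ^ DIM(R2))" for x
 proof (rule fourier_inversion[OF _ _ F])
  show "integrable lborel (%x. cor (C x))" using assms(8) by simp
  show "continuous_on UNIV (%x. cor (C x))" by (intro continuous_intros assms(7))
 qed
 \<comment> \<open>Inversion at 0 expresses the total scattering rate by \<open>C 0\<close>, which
   identifies the decay of \<open>fwd_atom\<close> with that of \<open>K_fun\<close>.\<close>
 have IF: "(LINT k|lborel. ?F k) = cor ((2 * pi)\<^sup>2 * C 0)"
 proof -
  have q: "cor ((2 * pi)\<^sup>2) \<noteq> 0" by simp
  have "cor (C 0) = (LINT k|lborel. ?F k) / cor ((2 * pi)\<^sup>2)" using Cinv[of 0] by simp
  then have "(LINT k|lborel. ?F k) = cor (C 0) * cor ((2 * pi)\<^sup>2)" unfolding nonzero_eq_divide_eq[OF q] by (rule sym)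
  then show ?thesis by (simp only: of_real_mult mult.commute)
 qed
 have Katom: "fwd_atom (cor ka) ?F (cor K0) s = cor (K_fun c C \<omega>0 s)" for s
 proof -
  have "- (ka * ((2 * pi)\<^sup>2 * C 0) * s) = - \<omega>0\<^sup>2 / (4 * c\<^sup>2) * C 0 * s" unfolding ka_def using c by (simp add: field_simps)
  then show ?thesis unfolding fwd_atom_def IF K_fun_def K0_def
   by (simp only: of_real_mult[symmetric] of_real_minus[symmetric] exp_of_real)
 qed
 let ?a = "%\<Omega> ze s \<xi>. iexp (- (c * \<Omega> / \<omega>0\<^sup>2 * (norm \<xi>)\<^sup>2 * s)) * (indicator {0..} s *\<^sub>R A s \<xi> ze \<Omega>)"
 obtain BA where dA: "!!ze. fwd_density (cor ka) ?F (cor K0) (phase (c * \<Omega> / \<omega>0\<^sup>2) (c / \<omega>0) ze) L BA (?a \<Omega> ze)"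
  by (rule A_mild_density[OF c \<omega>0 L0(1) F assms(12) arg_cong[OF ka_def, of cor] Katom, of \<Omega>]) (rule that)
 obtain BB where dB': "!!ze. fwd_density (cor ka) ?F (cor K0) (phase (c * 0 / \<omega>0\<^sup>2) (c / \<omega>0) ze) L BB (?a 0 ze)"
  by (rule A_mild_density[OF c \<omega>0 L0(1) F assms(12) arg_cong[OF ka_def, of cor] Katom, of 0]) (rule that)
 \<comment> \<open>At frequency shift 0 the phase is purely linear, as the second ladder
   requires.\<close>
 have q0: "c * 0 / \<omega>0\<^sup>2 = 0" by simp
 note dB = dB'[unfolded q0]
 have Am[measurable]: "(%(\<xi>, ze). A L \<xi> ze \<Omega>) \<in> borel_measurable (borel \<Otimes>\<^sub>M borel)" for \<Omega>
 proof -
  have g: "(%k. (L, k)) \<in> (borel :: (R2 \<times> R2) measure) \<rightarrow>\<^sub>M borel \<Otimes>\<^sub>M borel" by measurable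
  have "(%k. A L (fst k) (snd k) \<Omega>) \<in> borel_measurable borel"
   using measurable_compose[OF g A_mild_measurable[OF assms(12), of \<Omega>]] L0 by simp
  then show ?thesis by (simp add: borel_prod case_prod_beta')
 qed
 have cm: "cmod (?a \<Omega> ze L \<xi>) = cmod (A L \<xi> ze \<Omega>)" for \<Omega> ze \<xi> using L by (simp add: norm_mult)
 have Ai: "integrable lborel (%\<xi>. A L \<xi> ze \<Omega>)" for ze \<Omega>
  by (rule assms(12)[unfolded A_mild_solution_def, THEN spec, of \<Omega>, THEN conjunct2, THEN spec, of ze, THEN conjunct1,
     unfolded L1_continuous_def, THEN conjunct1, THEN spec, of L, THEN mp, OF L0(1)])
 have AB: "(LINT \<xi>|lborel. cmod (A L \<xi> ze \<Omega>)) \<le> BA" "(LINT \<xi>|lborel. cmod (A L \<xi> ze 0)) \<le> BB" for ze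
 proof -
  have "(LINT \<xi>|lborel. cmod (?a \<Omega> ze L \<xi>)) \<le> BA" using dA[of ze] L0(2) unfolding fwd_density_def by blast
  then show "(LINT \<xi>|lborel. cmod (A L \<xi> ze \<Omega>)) \<le> BA" unfolding cm .
  have "(LINT \<xi>|lborel. cmod (?a 0 ze L \<xi>)) \<le> BB" using dB'[of ze] L0(2) unfolding fwd_density_def by blast
  then show "(LINT \<xi>|lborel. cmod (A L \<xi> ze 0)) \<le> BB" unfolding cm .
 qed
 define HA where "HA = scattered_field L h x (%\<xi> ze. A L \<xi> ze \<Omega>)"
 define HB where "HB = scattered_field L h 0 (%\<xi> ze. A L \<xi> ze 0)"
 have ph: "?a \<Omega>' ze L \<xi> * iexp (v \<bullet> \<xi> - L * phase (c * \<Omega>' / \<omega>0\<^sup>2) (c / \<omega>0) ze \<xi>) = A L \<xi> ze \<Omega>' * iexp (v \<bullet> \<xi> - L * h * (\<xi> \<bullet> ze))" for \<Omega>' ze \<xi> v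
 proof -
  have t0: "- (q * n * L) + (t - L * (- (q * n) + h * m)) = t - L * h * m" for q n t m :: real by (simp add: algebra_simps)
  have "iexp (- (c * \<Omega>' / \<omega>0\<^sup>2 * (norm \<xi>)\<^sup>2 * L)) * iexp (v \<bullet> \<xi> - L * phase (c * \<Omega>' / \<omega>0\<^sup>2) (c / \<omega>0) ze \<xi>) = iexp (v \<bullet> \<xi> - L * h * (\<xi> \<bullet> ze))"
   unfolding iexp_mult phase_def unfolding h_def[symmetric] t0 ..
  moreover have "indicator {0..} L = (1::real)" using L by simp
  ultimately show ?thesis by (simp only: scaleR_one mult_ac)
 qed
 have HAe: "HA ze = (LINT \<xi>|lborel. ?a \<Omega> ze L \<xi> * iexp (x \<bullet> \<xi> - L * phase (c * \<Omega> / \<omega>0\<^sup>2) (c / \<omega>0) ze \<xi>))" for ze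
  unfolding ph HA_def scattered_field_def ..
 have HBe': "HB ze = (LINT \<xi>|lborel. ?a 0 ze L \<xi> * iexp (0 \<bullet> \<xi> - L * phase (c * 0 / \<omega>0\<^sup>2) (c / \<omega>0) ze \<xi>))" for ze
  unfolding ph HB_def scattered_field_def ..
 note HBe = HBe'[unfolded q0]
 have HAm: "HA \<in> borel_measurable borel" and HBm: "HB \<in> borel_measurable borel"
  unfolding HA_def HB_def by (intro scattered_field_measurable Am)+
 have HAb: "cmod (HA ze) \<le> BA" and HBb: "cmod (HB ze) \<le> BB" for ze
  unfolding HA_def HB_def by (intro scattered_field_bound AB)+
 define V where "V = ladder_mean (r0\<^sup>2) (r0\<^sup>2) y K HA + ladder_mean (r0\<^sup>2) (\<rho>0\<^sup>2) y K HB - ladder_mean (r0\<^sup>2) (r0\<^sup>2) y K (%_. 0)"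
 let ?E = "%eps. Etr2 eps (L / eps) (y /\<^sub>R eps + x) (y /\<^sub>R eps)"
 obtain b where b: "b > 0" "!!eps. 0 < eps ==> eps < b ==> refocused_second_moment c (%x. eps * C x) (r0 / eps) (\<rho>0 / eps) (\<omega>0 + eps * \<Omega>) (\<omega>0 - eps * \<Omega>) (Etr2 eps)"
  using assms(11) unfolding eventually_at_right_field by blast
 \<comment> \<open>Below this threshold the moment equation is available and both frequencies are
   positive; the 1 keeps the denominator positive when \<open>\<Omega>\<close> is 0.\<close>
 define b' where "b' = min b (\<omega>0 / (\<bar>\<Omega>\<bar> + 1))"
 have b'0: "0 < b'" using b \<omega>0 unfolding b'_def by auto
 have lim: "((%eps. cor (K0 * K0) * ?E eps) \<longlongrightarrow> V) (at_right 0)"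
 proof (rule tendsto_at_right_sequentially[OF b'0])
  fix eps :: "nat => real" assume e: "!!n. 0 < eps n" "!!n. eps n < b'" "eps \<longlonglongrightarrow> 0"
  have w: "\<bar>eps n * \<Omega>\<bar> < \<omega>0" for n
  proof -
   have "eps n < \<omega>0 / (\<bar>\<Omega>\<bar> + 1)" using e(2)[of n] unfolding b'_def by simp
   then have "eps n * (\<bar>\<Omega>\<bar> + 1) < \<omega>0" by (simp add: pos_less_divide_eq)
   then show ?thesis using e(1)[of n] by (simp add: abs_mult distrib_left)
  qed
  show "(%n. cor (K0 * K0) * ?E (eps n)) \<longlonglongrightarrow> V" unfolding V_def
  proof (rule refocused_limit_sequence[OF c \<omega>0 r0 \<rho>0 L F real_F Cinv e(1) e(3) _ _ _ Katom[of L, folded K_def, unfolded ka_def] dA[unfolded ka_def] dB[unfolded ka_def] HAe HBe HAm HBm HAb HBb])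
   show "\<omega>0 + eps n * \<Omega> > 0" "\<omega>0 - eps n * \<Omega> > 0" for n using w[of n] by linarith+
   show "refocused_second_moment c (%x. eps n * C x) (r0 / eps n) (\<rho>0 / eps n) (\<omega>0 + eps n * \<Omega>) (\<omega>0 - eps n * \<Omega>) (Etr2 (eps n))" for n
    by (rule b(2)[OF e(1)]) (use e(2)[of n] in \<open>simp add: b'_def\<close>)
  qed
 qed
 have K00: "K0 * K0 = (2 * pi) ^ 8" unfolding K0_def by (simp add: power_add[symmetric])
 have P0: "(2 * pi) ^ 8 \<noteq> (0::real)" by simp
 have lim2: "(?E \<longlongrightarrow> cor (1 / (2 * pi) ^ 8) * V) (at_right 0)"
 proof -
  have "cor (1 / (2 * pi) ^ 8) * (cor (K0 * K0) * z) = z" for z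
   unfolding K00 mult.assoc[symmetric] of_real_mult[symmetric] by simp
  with tendsto_mult[OF tendsto_const lim, of "cor (1 / (2 * pi) ^ 8)"] show ?thesis by simp
 qed
 let ?I2 = "LINT ze|lborel. ladder_kernel (r0\<^sup>2) (r0\<^sup>2) y ze * HA ze"
 let ?I3 = "LINT ze|lborel. ladder_kernel (r0\<^sup>2) (\<rho>0\<^sup>2) y ze * HB ze"
 let ?ey = "cor (exp ((norm y)\<^sup>2 / r0\<^sup>2))"
 let ?I5 = "LINT z|lborel. ladder_pair_kernel (r0\<^sup>2) (\<rho>0\<^sup>2) y z * (HB (fst z) * cnj (HB (snd z)))"
 \<comment> \<open>The unscattered term \<open>u\<close> occurs in both ladder means and is removed
   once. In the first ladder both precisions are \<open>r0\<^sup>2\<close>, so its density-density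
   term is a squared modulus.\<close>
 have V: "V = cor (K\<^sup>2 * exp (- (2 * (norm y)\<^sup>2 / r0\<^sup>2))) + cor (2 * K * Re ?I2) + cor (2 * K * Re ?I3)
   + cor ((cmod (?ey * ?I2))\<^sup>2) + ?I5"
 proof -
  have z: "(%_::R2. 0::complex) \<in> borel_measurable borel" and zb: "cmod ((%_::R2. 0) ze) \<le> 0" for ze by simp_all
  have "ladder_mean (r0\<^sup>2) (r0\<^sup>2) y K (%_. 0) = cor (K\<^sup>2 * exp (- (2 * (norm y)\<^sup>2 / r0\<^sup>2)))
   + cor (2 * K * Re (LINT ze|lborel. ladder_kernel (r0\<^sup>2) (r0\<^sup>2) y ze * 0)) + (LINT z|lborel. ladder_pair_kernel (r0\<^sup>2) (r0\<^sup>2) y z * (0 * cnj 0))"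
   unfolding ladder_mean_def by (rule ladder_expectation[OF al al z zb])
  then have V0: "ladder_mean (r0\<^sup>2) (r0\<^sup>2) y K (%_. 0) = cor (K\<^sup>2 * exp (- (2 * (norm y)\<^sup>2 / r0\<^sup>2)))" by simp
  have alg: "(u + a + s) + (u + b + i) - u = u + a + b + s + i" for u a b s i :: complex by simp
  show ?thesis unfolding V_def V0 unfolding ladder_mean_def ladder_expectation[OF al al HAm HAb] ladder_expectation[OF al be HBm HBb]
   ladder_pair_diagonal_integral[OF al HAm HAb] by (rule alg)
 qed
 \<comment> \<open>The first integral of the limit is a Gaussian Fourier transform at
   \<open>2 *\<^sub>R y\<close>; the ladder means produce it in evaluated form.\<close>
 have T1: "(LINT ze|lborel. cor (r0\<^sup>2 / (2 * pi)) * exp (cor (- (r0\<^sup>2 * (norm ze)\<^sup>2 / 2)) + 2 * \<i> * cor (y \<bullet> ze)))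
   = cor (exp (- (2 * (norm y)\<^sup>2 / r0\<^sup>2)))"
 proof -
  have "cor (r0\<^sup>2 / (2 * pi)) * exp (cor (- (r0\<^sup>2 * (norm ze)\<^sup>2 / 2)) + 2 * \<i> * cor (y \<bullet> ze))
   = cor (gaussian (r0\<^sup>2) ze) * iexp ((2 *\<^sub>R y) \<bullet> ze)" for ze
  proof -
   have "2 * \<i> * cor (y \<bullet> ze) = \<i> * cor ((2 *\<^sub>R y) \<bullet> ze)" by simp
   then show ?thesis unfolding gaussian_R2[OF al] by (simp only: exp_split of_real_mult mult.assoc)
  qed
  then have "(LINT ze|lborel. cor (r0\<^sup>2 / (2 * pi)) * exp (cor (- (r0\<^sup>2 * (norm ze)\<^sup>2 / 2)) + 2 * \<i> * cor (y \<bullet> ze)))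
   = exp (- ((norm (2 *\<^sub>R y))\<^sup>2 / (2 * r0\<^sup>2)))" by (simp only: gaussian_fourier(2)[OF al])
  also have "(norm (2 *\<^sub>R y))\<^sup>2 / (2 * r0\<^sup>2) = 2 * (norm y)\<^sup>2 / r0\<^sup>2" by (simp add: power_mult_distrib)
  finally show ?thesis .
 qed
 have sw: "(LINT ze|lborel. ladder_kernel al be y ze * scattered_field L h v (%\<xi> ze. A L \<xi> ze \<Omega>') ze)
  = (LINT (\<xi>, ze)|lborel. ladder_kernel al be y ze * (A L \<xi> ze \<Omega>' * iexp (v \<bullet> \<xi> - L * h * (\<xi> \<bullet> ze))))"
  if "al > 0" "be > 0" "!!ze. (LINT \<xi>|lborel. cmod (A L \<xi> ze \<Omega>')) \<le> B" for al be v \<Omega>' B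
  unfolding scattered_field_def case_prod_beta'
 proof (rule integral_kernel_swap(2)[OF ladder_kernel_integrable[OF that(1,2)], where B=B])
  show "(%(\<xi>, ze). A L \<xi> ze \<Omega>' * iexp (v \<bullet> \<xi> - L * h * (\<xi> \<bullet> ze))) \<in> borel_measurable (borel \<Otimes>\<^sub>M borel)" by measurable
  show "integrable lborel (%\<xi>. A L \<xi> ze \<Omega>' * iexp (v \<bullet> \<xi> - L * h * (\<xi> \<bullet> ze)))" for ze
   by (rule mult_bounded_integrable(1)[OF Ai, where B=1]) auto
  show "(LINT \<xi>|lborel. cmod (A L \<xi> ze \<Omega>' * iexp (v \<bullet> \<xi> - L * h * (\<xi> \<bullet> ze)))) \<le> B" for ze
   using that(3)[of ze] by (simp add: norm_mult)
 qed
 \<comment> \<open>The constants of the general ladder kernel at equal precisions, the case of the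
   second term of the limit.\<close>
 have ck: "r0\<^sup>2 / (4 * pi) = r0\<^sup>2 * r0\<^sup>2 / (2 * pi * (r0\<^sup>2 + r0\<^sup>2))" "r0\<^sup>2 * r0\<^sup>2 * n / (2 * (r0\<^sup>2 + r0\<^sup>2)) = r0\<^sup>2 * n / 4"
  "2 * (norm y)\<^sup>2 / (r0\<^sup>2 + r0\<^sup>2) = (norm y)\<^sup>2 / r0\<^sup>2" "2 * r0\<^sup>2 / (r0\<^sup>2 + r0\<^sup>2) * m = m" for n m
  using r0 by (simp_all add: field_simps)
 have I2: "?I2 = (LINT (\<xi>, ze)|lborel. cor (r0\<^sup>2 / (4 * pi))
      * exp (cor (- (r0\<^sup>2 * (norm ze)\<^sup>2 / 4))
        + \<i> * cor (x \<bullet> \<xi>) + \<i> * cor (y \<bullet> ze)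
        - cor ((norm y)\<^sup>2 / r0\<^sup>2)
        - \<i> * cor (L * c / \<omega>0 * (\<xi> \<bullet> ze)))
      * A L \<xi> ze \<Omega>)"
 proof -
  have "cor (r0\<^sup>2 / (4 * pi)) * exp (cor (- (r0\<^sup>2 * (norm ze)\<^sup>2 / 4))
        + \<i> * cor (x \<bullet> \<xi>) + \<i> * cor (y \<bullet> ze)
        - cor ((norm y)\<^sup>2 / r0\<^sup>2)
        - \<i> * cor (L * c / \<omega>0 * (\<xi> \<bullet> ze))) * A L \<xi> ze \<Omega>
   = ladder_kernel (r0\<^sup>2) (r0\<^sup>2) y ze * (A L \<xi> ze \<Omega> * iexp (x \<bullet> \<xi> - L * h * (\<xi> \<bullet> ze)))" for \<xi> ze
   by (rule ladder_term[OF al al ck(1)]) (unfold ck(2-4) h_def, simp add: algebra_simps)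
  then show ?thesis unfolding HA_def sw[OF al al AB(1)] by (simp only:)
 qed
 have I3: "?I3 = (LINT (\<xi>, ze)|lborel. cor (\<rho>0\<^sup>2 * r0\<^sup>2 / (2 * pi * (\<rho>0\<^sup>2 + r0\<^sup>2)))
      * exp (cor (- (r0\<^sup>2 * \<rho>0\<^sup>2 * (norm ze)\<^sup>2 / (2 * (r0\<^sup>2 + \<rho>0\<^sup>2))))
        + \<i> * cor (2 * \<rho>0\<^sup>2 / (r0\<^sup>2 + \<rho>0\<^sup>2) * (y \<bullet> ze))
        - cor (2 * (norm y)\<^sup>2 / (r0\<^sup>2 + \<rho>0\<^sup>2))
        - \<i> * cor (L * c / \<omega>0 * (\<xi> \<bullet> ze)))
      * A L \<xi> ze 0)"
 proof -
  have k: "\<rho>0\<^sup>2 * r0\<^sup>2 / (2 * pi * (\<rho>0\<^sup>2 + r0\<^sup>2)) = r0\<^sup>2 * \<rho>0\<^sup>2 / (2 * pi * (r0\<^sup>2 + \<rho>0\<^sup>2))" by (simp only: mult.commute add.commute)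
  have "cor (\<rho>0\<^sup>2 * r0\<^sup>2 / (2 * pi * (\<rho>0\<^sup>2 + r0\<^sup>2)))
      * exp (cor (- (r0\<^sup>2 * \<rho>0\<^sup>2 * (norm ze)\<^sup>2 / (2 * (r0\<^sup>2 + \<rho>0\<^sup>2))))
        + \<i> * cor (2 * \<rho>0\<^sup>2 / (r0\<^sup>2 + \<rho>0\<^sup>2) * (y \<bullet> ze))
        - cor (2 * (norm y)\<^sup>2 / (r0\<^sup>2 + \<rho>0\<^sup>2))
        - \<i> * cor (L * c / \<omega>0 * (\<xi> \<bullet> ze)))
      * A L \<xi> ze 0
   = ladder_kernel (r0\<^sup>2) (\<rho>0\<^sup>2) y ze * (A L \<xi> ze 0 * iexp (0 \<bullet> \<xi> - L * h * (\<xi> \<bullet> ze)))" for \<xi> ze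
   by (rule ladder_term[OF al be k]) (unfold h_def, simp)
  then show ?thesis unfolding HB_def sw[OF al be AB(2)] by (simp only:)
 qed
 \<comment> \<open>The integral inside the modulus is that of the second term with the damping in
   \<open>y\<close> removed.\<close>
 have I4: "?ey * ?I2 = (LINT (\<xi>, ze)|lborel. cor (r0\<^sup>2 / (4 * pi))
      * exp (cor (- (r0\<^sup>2 * (norm ze)\<^sup>2 / 4))
        + \<i> * cor (x \<bullet> \<xi>) + \<i> * cor (y \<bullet> ze)
        - \<i> * cor (L * c / \<omega>0 * (\<xi> \<bullet> ze)))
      * A L \<xi> ze \<Omega>)"
 proof -
  have e: "?ey * (k * exp (w - cor ((norm y)\<^sup>2 / r0\<^sup>2) - v) * a) = k * exp (w - v) * a" for k w v a
  proof -
   have "?ey * exp (w - cor ((norm y)\<^sup>2 / r0\<^sup>2) - v) = exp (w - v)"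
    unfolding exp_of_real[symmetric] exp_add[symmetric] by simp
   then show ?thesis unfolding mult.assoc[symmetric] mult.commute[of ?ey k] unfolding mult.assoc[of k ?ey] by (simp only:)
  qed
  show ?thesis unfolding I2 integral_mult_right_zero[symmetric] case_prod_beta' e ..
 qed
 have I5: "?I5 = (LINT (\<xi>a, \<xi>b, zea, zeb)|lborel. cor (r0\<^sup>2 * \<rho>0\<^sup>2 / (4 * pi)\<^sup>2)
      * exp (cor (- ((r0\<^sup>2 + \<rho>0\<^sup>2) / 8 * ((norm zea)\<^sup>2 + (norm zeb)\<^sup>2))
        + (r0\<^sup>2 - \<rho>0\<^sup>2) / 4 * (zea \<bullet> zeb)))
      * exp (\<i> * cor (y \<bullet> (zea - zeb))
        - \<i> * cor (L * c / \<omega>0 * (\<xi>a \<bullet> zea - \<xi>b \<bullet> zeb)))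
      * A L \<xi>a zea 0 * cnj (A L \<xi>b zeb 0))"
 proof -
  let ?b = "%\<xi> ze. A L \<xi> ze 0 * iexp (0 \<bullet> \<xi> - L * h * (\<xi> \<bullet> ze))"
  have s5: "?I5 = (LINT (\<xi>a, \<xi>b, zea, zeb)|lborel. ladder_pair_kernel (r0\<^sup>2) (\<rho>0\<^sup>2) y (zea, zeb) * (?b \<xi>a zea * cnj (?b \<xi>b zeb)))"
   unfolding HB_def scattered_field_def
  proof (rule ladder_pair_integral[OF al be, where B=BB])
   show "(%(\<xi>, ze). ?b \<xi> ze) \<in> borel_measurable (borel \<Otimes>\<^sub>M borel)" by measurable
   show "integrable lborel (%\<xi>. ?b \<xi> ze)" for ze by (rule mult_bounded_integrable(1)[OF Ai, where B=1]) auto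
   show "(LINT \<xi>|lborel. cmod (?b \<xi> ze)) \<le> BB" for ze using AB(2)[of ze] by (simp add: norm_mult)
  qed
  have pk: "ladder_pair_kernel (r0\<^sup>2) (\<rho>0\<^sup>2) y (zea, zeb) * (?b \<xi>a zea * cnj (?b \<xi>b zeb)) = cor (r0\<^sup>2 * \<rho>0\<^sup>2 / (4 * pi)\<^sup>2)
      * exp (cor (- ((r0\<^sup>2 + \<rho>0\<^sup>2) / 8 * ((norm zea)\<^sup>2 + (norm zeb)\<^sup>2))
        + (r0\<^sup>2 - \<rho>0\<^sup>2) / 4 * (zea \<bullet> zeb)))
      * exp (\<i> * cor (y \<bullet> (zea - zeb))
        - \<i> * cor (L * c / \<omega>0 * (\<xi>a \<bullet> zea - \<xi>b \<bullet> zeb)))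
      * A L \<xi>a zea 0 * cnj (A L \<xi>b zeb 0)" for \<xi>a \<xi>b zea zeb
  proof -
   have "\<i> * cor (y \<bullet> (zea - zeb)) - \<i> * cor (L * c / \<omega>0 * (\<xi>a \<bullet> zea - \<xi>b \<bullet> zeb))
    = \<i> * cor (y \<bullet> (zea - zeb) + (0 \<bullet> \<xi>a - L * h * (\<xi>a \<bullet> zea)) + - (0 \<bullet> \<xi>b - L * h * (\<xi>b \<bullet> zeb)))"
    unfolding h_def by (simp add: algebra_simps)
   then have e: "exp (\<i> * cor (y \<bullet> (zea - zeb)) - \<i> * cor (L * c / \<omega>0 * (\<xi>a \<bullet> zea - \<xi>b \<bullet> zeb)))
    = iexp (y \<bullet> (zea - zeb)) * iexp (0 \<bullet> \<xi>a - L * h * (\<xi>a \<bullet> zea)) * cnj (iexp (0 \<bullet> \<xi>b - L * h * (\<xi>b \<bullet> zeb)))"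
    unfolding cnj_iexp iexp_mult by (simp only:)
   show ?thesis unfolding ladder_pair_kernel_eq[OF al be] e complex_cnj_mult by (simp only: mult_ac)
  qed
  show ?thesis unfolding s5 pk ..
 qed
 have sq: "(cmod (1 / (2 * pi) ^ 4 * z))\<^sup>2 = 1 / (2 * pi) ^ 8 * (cmod z)\<^sup>2" for z :: complex
  by (simp add: norm_mult norm_divide norm_power power_mult_distrib power_divide power_mult[symmetric])
 have fin: "cor (K\<^sup>2 / P) * cor e + cor (2 * K / P * R2) + cor (2 * K / P * R3) + cor (1 / P * N) + cor (1 / P) * z
  = cor (1 / P) * (cor (K\<^sup>2 * e) + cor (2 * K * R2) + cor (2 * K * R3) + cor N + z)" for P e R2 R3 N :: real and z
  by (simp add: distrib_left)
 show ?thesis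
  unfolding T1 I2[symmetric] I3[symmetric] I4[symmetric] I5[symmetric] sq K_def[symmetric] fin
  using lim2 unfolding V .
qed

end
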